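(* Let $M$ be a 4-dimensional spacetime manifold, $\Lambda\in\mathbb{R}$, and let $g_{ab}(\lambda)$, $\lambda\ge 0$, be a one-parameter family of smooth Lorentzian metrics on $M$ satisfying assumptions (i)--(iv) listed in the context, with background metric $g^{(0)}_{ab}=g_{ab}(0)$. Then the weak limit $T^{(0)}_{ab}=\operatorname{w-lim}_{\lambda\to0}T_{ab}(\lambda)$ exists, it satisfies the weak energy condition with respect to $g^{(0)}_{ab}$ (i.e. $T^{(0)}_{ab}t^at^b\ge0$ for all $t^a$ timelike with respect to $g^{(0)}_{ab}$), and $$G_{ab}(g^{(0)})+\Lambda g^{(0)}_{ab}=8\pi T^{(0)}_{ab}+8\pi t^{(0)}_{ab},$$ where $t^{(0)}_{ab}$ is given in terms of $\mu_{abcdef}$ by $$8\pi t^{(0)}_{ab}=\tfrac18 g^{(0)}_{ab}\left\{-\mu^{c}{}_{c}{}^{de}{}_{de}-\mu^{c}{}_{c}{}^{d}{}_{d}{}^{e}{}_{e}+2\mu^{cd}{}_{c}{}^{e}{}_{de}\right\}+\tfrac12\mu^{cd}{}_{acbd}-\tfrac12\mu^{c}{}_{ca}{}^{d}{}_{bd}+\tfrac14\mu_{ab}{}^{cd}{}_{cd}-\tfrac12\mu^{c}{}_{(ab)c}{}^{d}{}_{d}+\tfrac34\mu^{c}{}_{cab}{}^{d}{}_{d}-\tfrac12\mu^{cd}{}_{abcd}.$$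
   Context: Signature is $(-,+,+,+)$; $G_{ab}(g)$ is the Einstein tensor of $g$ (conventions of Wald, General Relativity). Round brackets on indices denote symmetrization with weight one. Write $h_{ab}(\lambda)=g_{ab}(\lambda)-g^{(0)}_{ab}$. $\nabla_a$ is the derivative operator of $g^{(0)}_{ab}$; indices are raised and lowered with $g^{(0)}_{ab}$. Fix an arbitrary Riemannian metric $e_{ab}$ on $M$ and let $|t_{a_1\dots a_n}|^2=e^{a_1b_1}\cdots e^{a_nb_n}t_{a_1\dots a_n}t_{b_1\dots b_n}$ (the assumptions do not depend on the choice of $e_{ab}$, nor on the choice of $\lambda$-independent derivative operator). Weak limit: for tensor fields $A_{a_1\dots a_n}(\lambda)$, $\lambda>0$, $\operatorname{w-lim}_{\lambda\to0}A_{a_1\dots a_n}(\lambda)=B_{a_1\dots a_n}$ means $\lim_{\lambda\to0}\int f^{a_1\dots a_n}A_{a_1\dots a_n}(\lambda)=\int f^{a_1\dots a_n}B_{a_1\dots a_n}$ for all smooth compactly supported tensor fields $f^{a_1\dots a_n}$, with the volume element of $g^{(0)}_{ab}$. Assumptions: (i) For all $\lambda>0$, $G_{ab}(g(\lambda))+\Lambda g_{ab}(\lambda)=8\pi T_{ab}(\lambda)$, where $T_{ab}(\lambda)$ satisfies the weak energy condition: $T_{ab}(\lambda)t^at^b\ge0$ for all vectors $t^a$ timelike with respect to $g_{ab}(\lambda)$. (ii) There is a smooth positive function $C_1$ on $M$ with $|h_{ab}(\lambda,x)|\le\lambda C_1(x)$. (iii) There is a smooth positive function $C_2$ on $M$ with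 $|\nabla_ch_{ab}(\lambda,x)|\le C_2(x)$. (iv) There is a smooth tensor field $\mu_{abcdef}$ on $M$ with $\operatorname{w-lim}_{\lambda\to0}[\nabla_ah_{cd}(\lambda)\nabla_bh_{ef}(\lambda)]=\mu_{abcdef}$. *)

theory Defs
  imports "HOL-Analysis.Analysis"
begin

subsection \<open>Smooth functions on open subsets of coordinate space\<close>

definition partial :: "4 \<Rightarrow> (real^4 \<Rightarrow> real) \<Rightarrow> real^4 \<Rightarrow> real" where
  "partial i f x = deriv (\<lambda>t. f (x + t *\<^sub>R axis i 1)) 0"

primrec Ck_on :: "nat \<Rightarrow> (real^4) set \<Rightarrow> (real^4 \<Rightarrow> real) \<Rightarrow> bool" where
  "Ck_on 0 S f \<longleftrightarrow> continuous_on S f"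
| "Ck_on (Suc k) S f \<longleftrightarrow> f differentiable_on S \<and> (\<forall>i. Ck_on k S (partial i f))"

definition smooth_on :: "(real^4) set \<Rightarrow> (real^4 \<Rightarrow> real) \<Rightarrow> bool" where
  "smooth_on S f \<longleftrightarrow> (\<forall>k. Ck_on k S f)"


subsection \<open>Smooth 4-manifolds\<close>

text \<open>
  The manifold is the whole type \<open>'m\<close>; Hausdorff and second countable are imposed by the
  sorts \<open>t2_space\<close> and \<open>second_countable_topology\<close>. The smooth structure is given by an
  arbitrary smooth atlas, which need not be maximal.
\<close>

type_synonym 'm chart = "'m set \<times> ('m \<Rightarrow> real^4)"

abbreviation cdom :: "'m chart \<Rightarrow> 'm set" where "cdom c \<equiv> fst c"
abbreviation cmap :: "'m chart \<Rightarrow> 'm \<Rightarrow> real^4" where "cmap c \<equiv> snd c"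
abbreviation cinv :: "'m chart \<Rightarrow> real^4 \<Rightarrow> 'm" where "cinv c \<equiv> inv_into (cdom c) (cmap c)"

definition is_chart :: "'m::topological_space chart \<Rightarrow> bool" where
  "is_chart c \<longleftrightarrow> open (cdom c) \<and> open (cmap c ` cdom c) \<and> inj_on (cmap c) (cdom c) \<and>
     homeomorphism (cdom c) (cmap c ` cdom c) (cmap c) (cinv c)"

definition smooth_atlas :: "'m::topological_space chart set \<Rightarrow> bool" where
  "smooth_atlas A \<longleftrightarrow> (\<forall>c\<in>A. is_chart c) \<and> (\<Union>c\<in>A. cdom c) = UNIV \<and>
     (\<forall>c\<in>A. \<forall>c'\<in>A. \<forall>i.
        smooth_on (cmap c ` (cdom c \<inter> cdom c')) (\<lambda>x. cmap c' (cinv c x) $ i))"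

definition smooth_in_chart :: "'m chart \<Rightarrow> ('m \<Rightarrow> real) \<Rightarrow> bool" where
  "smooth_in_chart c f \<longleftrightarrow> smooth_on (cmap c ` cdom c) (f \<circ> cinv c)"

definition smooth_function :: "'m chart set \<Rightarrow> ('m \<Rightarrow> real) \<Rightarrow> bool" where
  "smooth_function A f \<longleftrightarrow> (\<forall>c\<in>A. smooth_in_chart c f)"

definition coord_deriv :: "'m chart \<Rightarrow> 4 \<Rightarrow> ('m \<Rightarrow> real) \<Rightarrow> 'm \<Rightarrow> real" where
  "coord_deriv c i f p = partial i (f \<circ> cinv c) (cmap c p)"

text \<open>\<open>jacobian c c' p i j\<close> is \<open>\<partial>x'\<^sup>i/\<partial>x\<^sup>j\<close> at \<open>p\<close>, with \<open>x\<close>, \<open>x'\<close> the coordinates of \<open>c\<close>, \<open>c'\<close>.\<close>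

definition jacobian :: "'m chart \<Rightarrow> 'm chart \<Rightarrow> 'm \<Rightarrow> 4 \<Rightarrow> 4 \<Rightarrow> real" where
  "jacobian c c' p i j = coord_deriv c j (\<lambda>q. cmap c' q $ i) p"


subsection \<open>Tensor fields\<close>

text \<open>
  A tensor field is given by its components: \<open>T c p [a\<^sub>1,\<dots>,a\<^sub>n]\<close> is the component
  with indices \<open>a\<^sub>1,\<dots>,a\<^sub>n\<close> at the point \<open>p\<close> in the chart \<open>c\<close>, subject to the tensor
  transformation law. Only values with \<open>c\<close> in the atlas, \<open>p\<close> in the domain of \<open>c\<close> and
  index lists of the length given by the rank are meaningful. All indices are lower in
  \<open>cov_tensor\<close> and all are upper in \<open>con_tensor\<close>.
\<close>

type_synonym 'm tensor = "'m chart \<Rightarrow> 'm \<Rightarrow> 4 list \<Rightarrow> real"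

definition multi_indices :: "nat \<Rightarrow> 4 list set" where
  "multi_indices n = {as. length as = n}"

definition cov_tensor :: "'m chart set \<Rightarrow> nat \<Rightarrow> 'm tensor \<Rightarrow> bool" where
  "cov_tensor A n T \<longleftrightarrow>
     (\<forall>c\<in>A. \<forall>c'\<in>A. \<forall>p \<in> cdom c \<inter> cdom c'. \<forall>as \<in> multi_indices n.
        T c' p as =
          (\<Sum>bs \<in> multi_indices n. (\<Prod>k<n. jacobian c' c p (bs ! k) (as ! k)) * T c p bs))"

definition con_tensor :: "'m chart set \<Rightarrow> nat \<Rightarrow> 'm tensor \<Rightarrow> bool" where
  "con_tensor A n f \<longleftrightarrow>
     (\<forall>c\<in>A. \<forall>c'\<in>A. \<forall>p \<in> cdom c \<inter> cdom c'. \<forall>as \<in> multi_indices n.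
        f c' p as =
          (\<Sum>bs \<in> multi_indices n. (\<Prod>k<n. jacobian c c' p (as ! k) (bs ! k)) * f c p bs))"

definition smooth_components :: "'m chart set \<Rightarrow> nat \<Rightarrow> 'm tensor \<Rightarrow> bool" where
  "smooth_components A n T \<longleftrightarrow>
     (\<forall>c\<in>A. \<forall>as \<in> multi_indices n. smooth_in_chart c (\<lambda>p. T c p as))"

definition smooth_cov_tensor :: "'m chart set \<Rightarrow> nat \<Rightarrow> 'm tensor \<Rightarrow> bool" where
  "smooth_cov_tensor A n T \<longleftrightarrow> cov_tensor A n T \<and> smooth_components A n T"

definition tensor_support :: "'m::topological_space chart set \<Rightarrow> nat \<Rightarrow> 'm tensor \<Rightarrow> 'm set" where
  "tensor_support A n f =
     closure {p. \<exists>c\<in>A. p \<in> cdom c \<and> (\<exists>as \<in> multi_indices n. f c p as \<noteq> 0)}"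

definition test_tensor :: "'m::topological_space chart set \<Rightarrow> nat \<Rightarrow> 'm tensor \<Rightarrow> bool" where
  "test_tensor A n f \<longleftrightarrow>
     con_tensor A n f \<and> smooth_components A n f \<and> compact (tensor_support A n f)"

text \<open>
  The scalar \<open>f\<^bsup>a\<dots>\<^esup> T\<^bsub>a\<dots>\<^esub>\<close>. By the transformation laws it does not depend on the chart
  in which it is computed.
\<close>

definition pairing :: "'m chart set \<Rightarrow> nat \<Rightarrow> 'm tensor \<Rightarrow> 'm tensor \<Rightarrow> 'm \<Rightarrow> real" where
  "pairing A n f T p =
     (let c = (SOME c. c \<in> A \<and> p \<in> cdom c) in \<Sum>as \<in> multi_indices n. f c p as * T c p as)"

definition bilin :: "'m tensor \<Rightarrow> 'm chart \<Rightarrow> 'm \<Rightarrow> real^4 \<Rightarrow> real^4 \<Rightarrow> real" where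
  "bilin T c p u v = (\<Sum>a\<in>UNIV. \<Sum>b\<in>UNIV. T c p [a, b] * u $ a * v $ b)"


subsection \<open>Metrics\<close>

definition smooth_symmetric :: "'m chart set \<Rightarrow> 'm tensor \<Rightarrow> bool" where
  "smooth_symmetric A g \<longleftrightarrow> smooth_cov_tensor A 2 g \<and>
     (\<forall>c\<in>A. \<forall>p\<in>cdom c. \<forall>a b. g c p [a, b] = g c p [b, a])"

definition riemannian_metric :: "'m chart set \<Rightarrow> 'm tensor \<Rightarrow> bool" where
  "riemannian_metric A e \<longleftrightarrow> smooth_symmetric A e \<and>
     (\<forall>c\<in>A. \<forall>p\<in>cdom c. \<forall>v. v \<noteq> 0 \<longrightarrow> bilin e c p v v > 0)"

text \<open>Signature \<open>(-,+,+,+)\<close>: every tangent space has an orthonormal basis of this type.\<close>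

definition lorentzian_metric :: "'m chart set \<Rightarrow> 'm tensor \<Rightarrow> bool" where
  "lorentzian_metric A g \<longleftrightarrow> smooth_symmetric A g \<and>
     (\<forall>c\<in>A. \<forall>p\<in>cdom c. \<exists>E :: 4 \<Rightarrow> real^4. \<forall>i j.
        bilin g c p (E i) (E j) = (if i \<noteq> j then 0 else if i = 0 then -1 else 1))"

definition metric_matrix :: "'m tensor \<Rightarrow> 'm chart \<Rightarrow> 'm \<Rightarrow> real^4^4" where
  "metric_matrix g c p = (\<chi> a b. g c p [a, b])"

definition inv_metric :: "'m tensor \<Rightarrow> 'm chart \<Rightarrow> 'm \<Rightarrow> 4 \<Rightarrow> 4 \<Rightarrow> real" where
  "inv_metric g c p a b = matrix_inv (metric_matrix g c p) $ a $ b"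

definition tensor_norm :: "'m tensor \<Rightarrow> nat \<Rightarrow> 'm tensor \<Rightarrow> 'm chart \<Rightarrow> 'm \<Rightarrow> real" where
  "tensor_norm e n T c p =
     sqrt (\<Sum>as \<in> multi_indices n. \<Sum>bs \<in> multi_indices n.
             (\<Prod>k<n. inv_metric e c p (as ! k) (bs ! k)) * T c p as * T c p bs)"

text \<open>
  The volume measure, determined by \<open>\<surd>\<bar>det g\<bar> d\<^sup>4x\<close> in every chart; no orientation is needed.
\<close>

definition volume_measure :: "'m::topological_space chart set \<Rightarrow> 'm tensor \<Rightarrow> 'm measure" where
  "volume_measure A g = (THE \<nu>. sets \<nu> = sets borel \<and>
     (\<forall>c\<in>A. \<forall>B\<in>sets borel. B \<subseteq> cdom c \<longrightarrow>
        emeasure \<nu> B =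
          (\<integral>\<^sup>+ x \<in> cmap c ` B. ennreal (sqrt \<bar>det (metric_matrix g c (cinv c x))\<bar>) \<partial>lborel)))"

definition timelike :: "'m tensor \<Rightarrow> 'm chart \<Rightarrow> 'm \<Rightarrow> real^4 \<Rightarrow> bool" where
  "timelike g c p v \<longleftrightarrow> bilin g c p v v < 0"

definition weak_energy_condition :: "'m chart set \<Rightarrow> 'm tensor \<Rightarrow> 'm tensor \<Rightarrow> bool" where
  "weak_energy_condition A g T \<longleftrightarrow>
     (\<forall>c\<in>A. \<forall>p\<in>cdom c. \<forall>v. timelike g c p v \<longrightarrow> bilin T c p v v \<ge> 0)"


subsection \<open>Curvature (conventions of Wald, General Relativity)\<close>

text \<open>\<open>christoffel g c k i j p\<close> is \<open>\<Gamma>\<^sup>k\<^sub>i\<^sub>j\<close>.\<close>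

definition christoffel :: "'m tensor \<Rightarrow> 'm chart \<Rightarrow> 4 \<Rightarrow> 4 \<Rightarrow> 4 \<Rightarrow> 'm \<Rightarrow> real" where
  "christoffel g c k i j p =
     (1/2) * (\<Sum>l\<in>UNIV. inv_metric g c p k l *
       (coord_deriv c i (\<lambda>q. g c q [j, l]) p + coord_deriv c j (\<lambda>q. g c q [i, l]) p
        - coord_deriv c l (\<lambda>q. g c q [i, j]) p))"

text \<open>
  \<open>riemann g c m n r s p\<close> is \<open>R\<^bsub>mnr\<^esub>\<^bsup>s\<^esup>\<close>, where
  \<open>\<nabla>\<^sub>m\<nabla>\<^sub>n\<omega>\<^sub>r - \<nabla>\<^sub>n\<nabla>\<^sub>m\<omega>\<^sub>r = R\<^bsub>mnr\<^esub>\<^bsup>s\<^esup>\<omega>\<^sub>s\<close>; the Ricci tensor is \<open>R\<^bsub>mr\<^esub> = R\<^bsub>mnr\<^esub>\<^bsup>n\<^esup>\<close>.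
\<close>

definition riemann :: "'m tensor \<Rightarrow> 'm chart \<Rightarrow> 4 \<Rightarrow> 4 \<Rightarrow> 4 \<Rightarrow> 4 \<Rightarrow> 'm \<Rightarrow> real" where
  "riemann g c m n r s p =
     coord_deriv c n (christoffel g c s m r) p - coord_deriv c m (christoffel g c s n r) p
     + (\<Sum>k\<in>UNIV. christoffel g c k m r p * christoffel g c s k n p
                - christoffel g c k n r p * christoffel g c s k m p)"

definition ricci :: "'m tensor \<Rightarrow> 'm chart \<Rightarrow> 'm \<Rightarrow> 4 \<Rightarrow> 4 \<Rightarrow> real" where
  "ricci g c p a b = (\<Sum>n\<in>UNIV. riemann g c a n b n p)"

definition scalar_curvature :: "'m tensor \<Rightarrow> 'm chart \<Rightarrow> 'm \<Rightarrow> real" where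
  "scalar_curvature g c p = (\<Sum>a\<in>UNIV. \<Sum>b\<in>UNIV. inv_metric g c p a b * ricci g c p a b)"

definition einstein :: "'m tensor \<Rightarrow> 'm chart \<Rightarrow> 'm \<Rightarrow> 4 \<Rightarrow> 4 \<Rightarrow> real" where
  "einstein g c p a b = ricci g c p a b - (1/2) * scalar_curvature g c p * g c p [a, b]"

text \<open>Levi-Civita derivative of a covariant tensor; the derivative index comes first.\<close>

definition cov_deriv :: "'m tensor \<Rightarrow> 'm tensor \<Rightarrow> 'm tensor" where
  "cov_deriv g T c p as =
     (case as of [] \<Rightarrow> 0
      | i # bs \<Rightarrow> coord_deriv c i (\<lambda>q. T c q bs) p
          - (\<Sum>k<length bs. \<Sum>d\<in>UNIV. christoffel g c d i (bs ! k) p * T c p (bs[k := d])))"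


subsection \<open>Weak limits and the effective stress-energy tensor\<close>

definition weak_limit ::
  "'m::topological_space chart set \<Rightarrow> 'm tensor \<Rightarrow> nat \<Rightarrow> (real \<Rightarrow> 'm tensor) \<Rightarrow> 'm tensor \<Rightarrow> bool" where
  "weak_limit A g0 n T B \<longleftrightarrow>
     (\<forall>f. test_tensor A n f \<longrightarrow>
        ((\<lambda>l. \<integral>p. pairing A n f (T l) p \<partial>volume_measure A g0)
           \<longlongrightarrow> (\<integral>p. pairing A n f B p \<partial>volume_measure A g0)) (at_right 0))"

definition perturbation :: "(real \<Rightarrow> 'm tensor) \<Rightarrow> real \<Rightarrow> 'm tensor" where
  "perturbation g l c p as = g l c p as - g 0 c p as"

text \<open>\<open>\<nabla>\<^sub>a h\<^bsub>cd\<^esub> \<nabla>\<^sub>b h\<^bsub>ef\<^esub>\<close> at the index list \<open>[a, b, c, d, e, f]\<close>.\<close>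

definition grad_product :: "'m tensor \<Rightarrow> 'm tensor \<Rightarrow> 'm tensor" where
  "grad_product g0 h c p as =
     cov_deriv g0 h c p [as ! 0, as ! 2, as ! 3] * cov_deriv g0 h c p [as ! 1, as ! 4, as ! 5]"

text \<open>
  \<open>contract2 g c p F\<close> and \<open>contract3 g c p F\<close> contract two, respectively three, pairs of lower indices:
  \<open>g\<^bsup>cc'\<^esup> g\<^bsup>dd'\<^esup> F\<^bsub>cc'dd'\<^esub>\<close> and \<open>g\<^bsup>cc'\<^esup> g\<^bsup>dd'\<^esup> g\<^bsup>ee'\<^esup> F\<^bsub>cc'dd'ee'\<^esub>\<close>.
\<close>

definition contract2 :: "'m tensor \<Rightarrow> 'm chart \<Rightarrow> 'm \<Rightarrow> (4 \<Rightarrow> 4 \<Rightarrow> 4 \<Rightarrow> 4 \<Rightarrow> real) \<Rightarrow> real" where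
  "contract2 g x p F = (\<Sum>c\<in>UNIV. \<Sum>c'\<in>UNIV. \<Sum>d\<in>UNIV. \<Sum>d'\<in>UNIV.
     inv_metric g x p c c' * inv_metric g x p d d' * F c c' d d')"

definition contract3 ::
  "'m tensor \<Rightarrow> 'm chart \<Rightarrow> 'm \<Rightarrow> (4 \<Rightarrow> 4 \<Rightarrow> 4 \<Rightarrow> 4 \<Rightarrow> 4 \<Rightarrow> 4 \<Rightarrow> real) \<Rightarrow> real" where
  "contract3 g x p F = (\<Sum>c\<in>UNIV. \<Sum>c'\<in>UNIV. \<Sum>d\<in>UNIV. \<Sum>d'\<in>UNIV. \<Sum>e\<in>UNIV. \<Sum>e'\<in>UNIV.
     inv_metric g x p c c' * inv_metric g x p d d' * inv_metric g x p e e' * F c c' d d' e e')"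

text \<open>
  In the formula below primed and unprimed copies of an index are contracted, and the chart is
  called \<open>x\<close>.
\<close>

definition effective_stress :: "'m tensor \<Rightarrow> 'm tensor \<Rightarrow> 'm tensor" where
  "effective_stress g \<mu> x p as = (let a = as ! 0; b = as ! 1; m = \<mu> x p in
     1 / (8 * pi) *
     ((1/8) * g x p [a, b] *
        (- contract3 g x p (\<lambda>c c' d d' e e'. m [c, c', d, e, d', e'])
         - contract3 g x p (\<lambda>c c' d d' e e'. m [c, c', d, d', e, e'])
         + 2 * contract3 g x p (\<lambda>c c' d d' e e'. m [c, d, c', e, d', e']))
      + (1/2) * contract2 g x p (\<lambda>c c' d d'. m [c, d, a, c', b, d'])
      - (1/2) * contract2 g x p (\<lambda>c c' d d'. m [c, c', a, d, b, d'])
      + (1/4) * contract2 g x p (\<lambda>c c' d d'. m [a, b, c, d, c', d'])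
      - (1/2) * contract2 g x p (\<lambda>c c' d d'. (1/2) * (m [c, a, b, c', d, d'] + m [c, b, a, c', d, d']))
      + (3/4) * contract2 g x p (\<lambda>c c' d d'. m [c, c', a, b, d, d'])
      - (1/2) * contract2 g x p (\<lambda>c c' d d'. m [c, d, a, b, c', d'])))"

end

theory Submission
  imports Defs
begin

text \<open>
  Put \<open>h = g(l) - g(0)\<close>. In a chart \<open>h\<close> tends to zero locally uniformly and \<open>\<partial>h\<close> stays bounded. Hence a product of
  \<open>h\<close> with a bounded family tends to zero, derivatives of such products tend to zero weakly, and so
  \<open>h \<partial>\<partial>h'\<close> may be replaced by \<open>-\<partial>h \<partial>h'\<close>; in particular \<open>\<mu>\<close> is symmetric in its first two indices.
  Apply this to \<open>G\<^sub>a\<^sub>b = R\<^sub>a\<^sub>b - (1/2) g\<^sub>a\<^sub>b g\<^sup>c\<^sup>d R\<^sub>c\<^sub>d\<close>: the second derivatives of \<open>h\<close> enter linearly, through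
  derivatives of the Christoffel symbols, whose deviation from the background is a bounded family
  tending to zero weakly. Besides \<open>G(g(0))\<close> only terms quadratic in \<open>\<partial>h\<close> survive, whose weak limits are
  contractions of \<open>\<mu>\<close>; index algebra identifies their sum with \<open>-8 \<pi> t\<close>.

  So the components of \<open>T(l)\<close> converge weakly in every chart to those of
  \<open>T0 = (G(g(0)) + \<Lambda> g(0)) / (8 \<pi>) - t\<close>. Uniqueness of weak limits gives the transformation law of \<open>T0\<close>, a partition
  of unity gives convergence on the manifold, and testing with nonnegative functions supported where a
  fixed coordinate vector is timelike gives the weak energy condition.
\<close>

subsection \<open>Partial derivatives and smooth functions\<close>

text \<open>The obstacle is that weak limits do not respect products. A product can be handled if
  one factor is smooth and independent of \<open>l\<close>, if one factor tends to zero locally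
  uniformly and the other is bounded, or if it is one of the products prescribed by
  \<open>\<mu>\<close>. Second derivatives of the metric are not bounded, so even a null coefficient
  in front of them cannot be dropped. One occurs in the trace term:
  \<open>g\<^sub>a\<^sub>b g\<^sup>c\<^sup>d\<close> is split into its background value and a null
  family \<open>Q\<close>, and \<open>Q\<close> times a derivative of a Christoffel symbol is traded
  for minus \<open>\<partial>Q\<close> times that symbol, which is quadratic in first derivatives.
  The computation uses coordinate derivatives. They are not tensorial, but
  \<open>\<partial>h - \<nabla>h\<close> is a Christoffel symbol times \<open>h\<close>, hence null,
  so in every chart \<open>\<mu>\<close> is also the weak limit of products of coordinate
  derivatives. The price is that the tensor law of the limit must be recovered afterwards. The
  volume measure is a definite description, so it has to be constructed, by gluing charts, before
  any integral over the manifold can be evaluated.\<close>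

lemma partial_eqI:
  assumes "(f has_derivative f') (at x)"
  shows "partial i f x = f' (axis i 1)"
proof -
  have 1: "((\<lambda>t::real. x + t *\<^sub>R axis i 1) has_derivative (\<lambda>t. t *\<^sub>R axis i 1)) (at 0)"
    by (auto intro!: derivative_eq_intros)
  have "((\<lambda>t. f (x + t *\<^sub>R axis i 1)) has_derivative (\<lambda>t. f' (t *\<^sub>R axis i 1))) (at 0)"
    using diff_chain_at[OF 1, of f f'] assms by (simp add: o_def)
  moreover have "(\<lambda>t. f' (t *\<^sub>R axis i 1)) = (*) (f' (axis i 1))"
    using has_derivative_linear[OF assms] by (auto simp: linear_cmul)
  ultimately have "((\<lambda>t. f (x + t *\<^sub>R axis i 1)) has_real_derivative f' (axis i 1)) (at 0)"
    by (simp add: has_field_derivative_def)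
  then show ?thesis
    unfolding partial_def by (rule DERIV_imp_deriv)
qed

lemma has_derivative_partials:
  assumes "f differentiable (at x)"
  shows "(f has_derivative (\<lambda>v. \<Sum>i\<in>UNIV. partial i f x * v $ i)) (at x)"
proof -
  from assms obtain f' where f': "(f has_derivative f') (at x)"
    by (auto simp: differentiable_def)
  have lin: "linear f'" using f' by (rule has_derivative_linear)
  have "f' v = (\<Sum>i\<in>UNIV. partial i f x * v $ i)" for v
  proof -
    have "f' v = f' (\<Sum>i\<in>UNIV. v $ i *\<^sub>R axis i 1)"
      by (simp add: basis_expansion[of v, unfolded scalar_mult_eq_scaleR])
    also have "\<dots> = (\<Sum>i\<in>UNIV. v $ i * f' (axis i 1))"
      using lin by (simp add: linear_sum linear_cmul)
    finally show ?thesis by (simp add: partial_eqI[OF f'] mult.commute)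
  qed
  then have "f' = (\<lambda>v. \<Sum>i\<in>UNIV. partial i f x * v $ i)" by auto
  with f' show ?thesis by simp
qed

lemma partial_has_real_derivative:
  assumes "f differentiable (at (x + t *\<^sub>R axis i 1))"
  shows "((\<lambda>s. f (x + s *\<^sub>R axis i 1)) has_real_derivative partial i f (x + t *\<^sub>R axis i 1)) (at t)"
proof -
  let ?f' = "\<lambda>v. \<Sum>j\<in>UNIV. partial j f (x + t *\<^sub>R axis i 1) * v $ j"
  have 1: "((\<lambda>s::real. x + s *\<^sub>R axis i 1) has_derivative (\<lambda>s. s *\<^sub>R axis i 1)) (at t)"
    by (auto intro!: derivative_eq_intros)
  have "((\<lambda>s. f (x + s *\<^sub>R axis i 1)) has_derivative (\<lambda>s. ?f' (s *\<^sub>R axis i 1))) (at t)"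
    using diff_chain_at[OF 1, of f ?f'] has_derivative_partials[OF assms] by (simp add: o_def)
  moreover have "(\<lambda>s. ?f' (s *\<^sub>R axis i 1)) = (*) (partial i f (x + t *\<^sub>R axis i 1))"
    by (auto simp: axis_def if_distrib cong: if_cong)
  ultimately show ?thesis by (simp add: has_field_derivative_def)
qed

lemma partial_cong_open:
  assumes "open S" "x \<in> S" "\<And>y. y \<in> S \<Longrightarrow> f y = g y"
  shows "partial i f x = partial i g x"
proof -
  have "eventually (\<lambda>t. x + t *\<^sub>R axis i 1 \<in> S) (nhds (0::real))"
  proof -
    have "isCont (\<lambda>t::real. x + t *\<^sub>R axis i 1) 0" by (intro continuous_intros)
    then have "((\<lambda>t::real. x + t *\<^sub>R axis i 1) \<longlongrightarrow> x) (nhds 0)"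
      using tendsto_at_iff_tendsto_nhds[of "\<lambda>t::real. x + t *\<^sub>R axis i 1" 0]
      by (simp add: isCont_def)
    then show ?thesis using assms(1,2) by (rule topological_tendstoD)
  qed
  then have "eventually (\<lambda>t. f (x + t *\<^sub>R axis i 1) = g (x + t *\<^sub>R axis i 1)) (nhds (0::real))"
    by eventually_elim (use assms in auto)
  then show ?thesis unfolding partial_def by (rule deriv_cong_ev) simp
qed

lemma partial_const [simp]: "partial i (\<lambda>x. c) x = 0"
  using partial_eqI[of "\<lambda>x. c" "\<lambda>_. 0"] by auto

lemma partial_component [simp]: "partial i (\<lambda>x. x $ j) x = (if i = j then 1 else 0)"
proof -
  have "((\<lambda>x::real^4. x $ j) has_derivative (\<lambda>v. v $ j)) (at x)"
    by (rule bounded_linear_imp_has_derivative[OF bounded_linear_vec_nth])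
  from partial_eqI[OF this, of i] show ?thesis by (auto simp: axis_def)
qed

lemma partial_add:
  assumes "f differentiable (at x)" "g differentiable (at x)"
  shows "partial i (\<lambda>x. f x + g x) x = partial i f x + partial i g x"
  using partial_eqI[OF has_derivative_add[OF has_derivative_partials has_derivative_partials], of f x g i] assms
  by (simp add: axis_def if_distrib cong: if_cong)


lemma partial_diff:
  assumes "f differentiable (at x)" "g differentiable (at x)"
  shows "partial i (\<lambda>x. f x - g x) x = partial i f x - partial i g x"
  using partial_eqI[OF has_derivative_diff[OF has_derivative_partials has_derivative_partials], of f x g i] assms
  by (simp add: axis_def if_distrib cong: if_cong)

lemma partial_mult:
  assumes "f differentiable (at x)" "g differentiable (at x)"
  shows "partial i (\<lambda>x. f x * g x) x = partial i f x * g x + f x * partial i g x"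
  using partial_eqI[OF has_derivative_mult[OF has_derivative_partials has_derivative_partials], of f x g i] assms
  by (simp add: axis_def if_distrib cong: if_cong)


lemma partial_sum:
  assumes "\<And>k. k \<in> I \<Longrightarrow> f k differentiable (at x)"
  shows "partial i (\<lambda>x. \<Sum>k\<in>I. f k x) x = (\<Sum>k\<in>I. partial i (f k) x)"
  using assms
proof (induction I rule: infinite_finite_induct)
  case (insert k I)
  have "(\<lambda>x. \<Sum>k\<in>I. f k x) differentiable (at x)"
    using insert by (intro differentiable_sum) auto
  then show ?case using insert by (simp add: partial_add)
qed auto

lemma partial_inverse:
  fixes f :: "real^4 \<Rightarrow> real"
  assumes "f differentiable (at x)" "f x \<noteq> 0"
  shows "partial i (\<lambda>x. inverse (f x)) x = - partial i f x * (inverse (f x) * inverse (f x))"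
proof -
  have "((\<lambda>x. inverse (f x)) has_derivative
      (\<lambda>h. - (inverse (f x) * (\<Sum>i\<in>UNIV. partial i f x * h $ i) * inverse (f x)))) (at x)"
    by (rule Deriv.has_derivative_inverse[OF assms(2) has_derivative_partials[OF assms(1)]])
  from partial_eqI[OF this, of i] show ?thesis
    by (simp add: axis_def if_distrib cong: if_cong)
qed

lemma partial_compose_real:
  fixes f :: "real^4 \<Rightarrow> real"
  assumes "f differentiable (at x)" "(g has_real_derivative g') (at (f x))"
  shows "partial i (\<lambda>x. g (f x)) x = g' * partial i f x"
proof -
  have "((\<lambda>x. g (f x)) has_derivative (\<lambda>v. g' * (\<Sum>i\<in>UNIV. partial i f x * v $ i))) (at x)"
    using diff_chain_at[OF has_derivative_partials[OF assms(1)], of g "(*) g'"] assms(2)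
    by (simp add: o_def has_field_derivative_def)
  from partial_eqI[OF this, of i] show ?thesis
    by (simp add: axis_def if_distrib cong: if_cong)
qed

lemma differentiable_vec:
  fixes \<phi> :: "real^4 \<Rightarrow> real^4"
  assumes "\<And>j. (\<lambda>x. \<phi> x $ j) differentiable (at x)"
  shows "(\<phi> has_derivative (\<lambda>v. \<chi> j. \<Sum>i\<in>UNIV. partial i (\<lambda>x. \<phi> x $ j) x * v $ i)) (at x)"
proof -
  have "((\<lambda>x. \<phi> x \<bullet> b) has_derivative
     (\<lambda>v. (\<chi> j. \<Sum>i\<in>UNIV. partial i (\<lambda>x. \<phi> x $ j) x * v $ i) \<bullet> b)) (at x)" if "b \<in> Basis" for b
  proof -
    from that obtain j where b: "b = axis j 1" by (auto simp: Basis_vec_def)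
    show ?thesis using has_derivative_partials[OF assms, of j]
      by (simp add: b inner_axis)
  qed
  then show ?thesis using has_derivative_componentwise_within by blast
qed

lemma partial_compose:
  fixes \<phi> :: "real^4 \<Rightarrow> real^4"
  assumes "\<And>j. (\<lambda>x. \<phi> x $ j) differentiable (at x)" "f differentiable (at (\<phi> x))"
  shows "partial i (\<lambda>x. f (\<phi> x)) x = (\<Sum>j\<in>UNIV. partial j f (\<phi> x) * partial i (\<lambda>x. \<phi> x $ j) x)"
proof -
  from partial_eqI[OF diff_chain_at[OF differentiable_vec[OF assms(1)] has_derivative_partials[OF assms(2)]], of i]
  show ?thesis by (simp add: o_def axis_def if_distrib cong: if_cong)
qed

lemma differentiable_compose_vec:
  fixes \<phi> :: "real^4 \<Rightarrow> real^4" and f :: "real^4 \<Rightarrow> real"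
  assumes "\<And>j. (\<lambda>x. \<phi> x $ j) differentiable (at x)" "f differentiable (at (\<phi> x))"
  shows "(\<lambda>x. f (\<phi> x)) differentiable (at x)"
  using diff_chain_at[OF differentiable_vec[OF assms(1)] has_derivative_partials[OF assms(2)]]
  unfolding differentiable_def o_def by blast

section \<open>Closure properties of \<open>Ck_on\<close> and \<open>smooth_on\<close>\<close>

lemma Ck_on_subset: "Ck_on k S f \<Longrightarrow> T \<subseteq> S \<Longrightarrow> Ck_on k T f"
  by (induction k arbitrary: f) (auto intro: continuous_on_subset differentiable_on_subset)

text \<open>\<open>partial\<close> looks at its function along a line through the point, which may
  leave \<open>S\<close>; agreement on \<open>S\<close> fixes the derivative because
  \<open>S\<close> is open. Openness accompanies most of the rules below for this reason.\<close>

lemma Ck_on_cong: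
  assumes "open S" "\<And>x. x \<in> S \<Longrightarrow> f x = g x" "Ck_on k S f"
  shows "Ck_on k S g"
  using assms(2,3)
proof (induction k arbitrary: f g)
  case 0
  then show ?case using continuous_on_cong[of S S f g] by simp
next
  case (Suc k)
  have "g differentiable_on S"
    unfolding differentiable_on_def
  proof
    fix x assume "x \<in> S"
    then show "g differentiable (at x within S)"
      using Suc.prems differentiable_transform_within[of f x S 1 g] by (auto simp: differentiable_on_def)
  qed
  moreover have "Ck_on k S (partial i g)" for i
  proof (rule Suc.IH[of "partial i f"])
    show "partial i f x = partial i g x" if "x \<in> S" for x
      by (rule partial_cong_open[OF assms(1) that Suc.prems(1)])
  qed (use Suc.prems in simp)
  ultimately show ?case by simp
qed

lemma Ck_on_Suc_D: "Ck_on (Suc k) S f \<Longrightarrow> Ck_on k S f"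
proof (induction k arbitrary: f)
  case 0
  then show ?case by (simp add: differentiable_imp_continuous_on)
next
  case (Suc k)
  then show ?case by (metis Ck_on.simps(2))
qed

lemma Ck_on_const: "Ck_on k S (\<lambda>x. c)"
proof (induction k arbitrary: c)
  case (Suc k)
  have "partial i (\<lambda>x. c) = (\<lambda>x. 0)" for i by auto
  with Suc show ?case by simp
qed simp

lemma Ck_on_component: "Ck_on k S (\<lambda>x. x $ j)"
proof (cases k)
  case (Suc k')
  have "partial i (\<lambda>x. x $ j) = (\<lambda>x. if i = j then 1 else 0)" for i by auto
  moreover have "(\<lambda>x::real^4. x $ j) differentiable_on S"
    unfolding differentiable_on_def
    by (auto intro!: bounded_linear_imp_differentiable bounded_linear_vec_nth)
  ultimately show ?thesis using Suc by (simp add: Ck_on_const)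
qed (auto intro: continuous_intros)

lemma Ck_on_differentiable:
  "open S \<Longrightarrow> Ck_on (Suc k) S f \<Longrightarrow> x \<in> S \<Longrightarrow> f differentiable (at x)"
  by (simp add: differentiable_on_eq_differentiable_at)

lemma Ck_on_add:
  assumes "open S" "Ck_on k S f" "Ck_on k S g"
  shows "Ck_on k S (\<lambda>x. f x + g x)"
  using assms(2,3)
proof (induction k arbitrary: f g)
  case (Suc k)
  have "Ck_on k S (partial i (\<lambda>x. f x + g x))" for i
    by (rule Ck_on_cong[OF assms(1) _ Suc.IH[of "partial i f" "partial i g"]])
       (use Suc.prems assms(1) in \<open>auto simp: partial_add differentiable_on_eq_differentiable_at\<close>)
  with Suc show ?case by simp
qed (simp add: continuous_on_add)

lemma Ck_on_mult:
  assumes "open S" "Ck_on k S f" "Ck_on k S g"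
  shows "Ck_on k S (\<lambda>x. f x * g x)"
  using assms(2,3)
proof (induction k arbitrary: f g)
  case (Suc k)
  note D = Ck_on_Suc_D[OF Suc.prems(1)] Ck_on_Suc_D[OF Suc.prems(2)]
  have "Ck_on k S (partial i (\<lambda>x. f x * g x))" for i
    by (rule Ck_on_cong[OF assms(1) _ Ck_on_add[OF assms(1)
          Suc.IH[of "partial i f" "g", OF _ D(2)] Suc.IH[of "f" "partial i g", OF D(1)]]])
       (use Suc.prems assms(1) in \<open>auto simp: partial_mult differentiable_on_eq_differentiable_at\<close>)
  with Suc show ?case by (simp add: differentiable_on_mult)
qed (simp add: continuous_on_mult)

text \<open>The derivative of \<open>1/f\<close> is a polynomial in the derivative of
  \<open>f\<close> and in \<open>1/f\<close> itself, and the induction already provides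
  \<open>1/f\<close> one order lower.\<close>

lemma Ck_on_inverse:
  assumes "open S" "Ck_on k S f" "\<And>x. x \<in> S \<Longrightarrow> f x \<noteq> 0"
  shows "Ck_on k S (\<lambda>x. inverse (f x))"
  using assms(2)
proof (induction k)
  case (Suc k)
  have inv: "Ck_on k S (\<lambda>x. inverse (f x))" by (rule Suc.IH[OF Ck_on_Suc_D[OF Suc.prems]])
  have "Ck_on k S (partial i (\<lambda>x. inverse (f x)))" for i
    by (rule Ck_on_cong[OF assms(1) _ Ck_on_mult[OF assms(1) Ck_on_mult[OF assms(1) Ck_on_const[of _ _ "-1"], of k "partial i f"]
            Ck_on_mult[OF assms(1) inv inv]]])
       (use Suc.prems assms in \<open>auto simp: partial_inverse differentiable_on_eq_differentiable_at\<close>)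
  moreover have "(\<lambda>x. inverse (f x)) differentiable_on S"
    using Suc.prems assms by (auto simp: differentiable_on_eq_differentiable_at)
  ultimately show ?case by simp
qed (use assms in \<open>auto intro: continuous_on_inverse\<close>)

text \<open>The same bootstrapping: the derivative contains \<open>1 / sqrt f\<close>, which is
  available one order lower by induction and \<open>Ck_on_inverse\<close>.\<close>

lemma Ck_on_sqrt:
  assumes "open S" "Ck_on k S f" "\<And>x. x \<in> S \<Longrightarrow> f x > 0"
  shows "Ck_on k S (\<lambda>x. sqrt (f x))"
  using assms(2)
proof (induction k)
  case (Suc k)
  have "Ck_on k S (\<lambda>x. sqrt (f x))" by (rule Suc.IH[OF Ck_on_Suc_D[OF Suc.prems]])
  then have inv: "Ck_on k S (\<lambda>x. inverse (sqrt (f x)))"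
    by (rule Ck_on_inverse[OF assms(1)]) (use assms(3) in force)
  have d: "f differentiable (at x)" if "x \<in> S" for x
    by (rule Ck_on_differentiable[OF assms(1) Suc.prems that])
  have p: "partial i (\<lambda>x. sqrt (f x)) x = (1/2) * inverse (sqrt (f x)) * partial i f x" if "x \<in> S" for i x
    using partial_compose_real[OF d[OF that], of sqrt "inverse (sqrt (f x)) / 2" i] DERIV_real_sqrt[of "f x"] assms(3)[OF that]
    by simp
  have "Ck_on k S (partial i (\<lambda>x. sqrt (f x)))" for i
    by (rule Ck_on_cong[OF assms(1) p[symmetric] Ck_on_mult[OF assms(1) Ck_on_mult[OF assms(1) Ck_on_const inv]]])
       (use Suc.prems in auto)
  moreover have "(\<lambda>x. sqrt (f x)) differentiable (at x)" if "x \<in> S" for x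
    using has_derivative_real_sqrt[OF assms(3)[OF that] has_derivative_partials[OF d[OF that]]]
    unfolding differentiable_def by blast
  ultimately show ?case using assms(1) by (simp add: differentiable_on_eq_differentiable_at)
qed (auto intro: continuous_intros)

lemma Ck_on_sum:
  assumes "open S" "\<And>j. j \<in> I \<Longrightarrow> Ck_on k S (f j)"
  shows "Ck_on k S (\<lambda>x. \<Sum>j\<in>I. f j x)"
  using assms(2)
  by (induction I rule: infinite_finite_induct) (auto intro: Ck_on_const Ck_on_add[OF assms(1)])

lemma Ck_on_prod:
  assumes "open S" "\<And>j. j \<in> I \<Longrightarrow> Ck_on k S (f j)"
  shows "Ck_on k S (\<lambda>x. \<Prod>j\<in>I. f j x)"
  using assms(2)
  by (induction I rule: infinite_finite_induct) (auto intro: Ck_on_const Ck_on_mult[OF assms(1)])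

lemma Ck_on_compose:
  fixes \<phi> :: "real^4 \<Rightarrow> real^4"
  assumes "open S" "open T" "\<And>j. Ck_on k S (\<lambda>x. \<phi> x $ j)" "\<phi> ` S \<subseteq> T" "Ck_on k T f"
  shows "Ck_on k S (\<lambda>x. f (\<phi> x))"
  using assms(3,5)
proof (induction k arbitrary: f)
  case 0
  then have "continuous_on S (\<lambda>x. \<chi> j. \<phi> x $ j)"
    by (intro continuous_on_vec_lambda) simp
  then have "continuous_on S \<phi>" by simp
  then show ?case using 0 continuous_on_compose2[of T f S \<phi>] assms(4) by simp
next
  case (Suc k)
  have d: "(\<lambda>x. \<phi> x $ j) differentiable (at x)" "f differentiable (at (\<phi> x))" if "x \<in> S" for x j
    using Ck_on_differentiable[OF assms(1) Suc.prems(1) that]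
      Ck_on_differentiable[OF assms(2) Suc.prems(2), of "\<phi> x"] that assms(4) by blast+
  have "Ck_on k S (partial i (\<lambda>x. f (\<phi> x)))" for i
  proof (rule Ck_on_cong[OF assms(1)])
    show "(\<Sum>j\<in>UNIV. partial j f (\<phi> x) * partial i (\<lambda>x. \<phi> x $ j) x) = partial i (\<lambda>x. f (\<phi> x)) x"
      if "x \<in> S" for x by (rule partial_compose[symmetric, OF d[OF that]])
    show "Ck_on k S (\<lambda>x. \<Sum>j\<in>UNIV. partial j f (\<phi> x) * partial i (\<lambda>x. \<phi> x $ j) x)"
      using Suc.prems
      by (intro Ck_on_sum[OF assms(1)] Ck_on_mult[OF assms(1) Suc.IH[OF Ck_on_Suc_D]]) auto
  qed
  moreover have "(\<lambda>x. f (\<phi> x)) differentiable (at x)" if "x \<in> S" for x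
    by (rule differentiable_compose_vec[OF d[OF that]])
  ultimately show ?case using assms(1) by (simp add: differentiable_on_eq_differentiable_at)
qed

lemma Ck_on_local:
  assumes "\<And>x. x \<in> S \<Longrightarrow> \<exists>T. open T \<and> x \<in> T \<and> Ck_on k T f"
  shows "Ck_on k S f"
  using assms
proof (induction k arbitrary: f)
  case 0
  have "continuous (at x within S) f" if xS: "x \<in> S" for x
  proof -
    obtain T where "open T" "x \<in> T" "continuous_on T f" using 0[OF xS] by auto
    then have "isCont f x" using continuous_on_eq_continuous_at by blast
    then show ?thesis by (rule continuous_at_imp_continuous_at_within)
  qed
  then show ?case by (simp add: continuous_on_eq_continuous_within)
next
  case (Suc k)
  have "Ck_on k S (partial i f)" for i
    by (rule Suc.IH) (use Suc.prems in \<open>metis Ck_on.simps(2)\<close>)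
  moreover have "f differentiable_on S"
    using Suc.prems unfolding differentiable_on_def
    by (metis Ck_on_differentiable differentiable_at_withinI)
  ultimately show ?case by simp
qed

named_theorems smooth_rules

lemma smooth_on_subset: "smooth_on S f \<Longrightarrow> T \<subseteq> S \<Longrightarrow> smooth_on T f"
  by (auto simp: smooth_on_def intro: Ck_on_subset)

lemma smooth_on_cong: "open S \<Longrightarrow> (\<And>x. x \<in> S \<Longrightarrow> f x = g x) \<Longrightarrow> smooth_on S f \<Longrightarrow> smooth_on S g"
  by (auto simp: smooth_on_def intro: Ck_on_cong)

lemma smooth_on_const [smooth_rules]: "smooth_on S (\<lambda>x. c)"
  by (simp add: smooth_on_def Ck_on_const)

lemma smooth_on_component [smooth_rules]: "smooth_on S (\<lambda>x. x $ j)"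
  by (simp add: smooth_on_def Ck_on_component)

lemma smooth_on_add [smooth_rules]: "open S \<Longrightarrow> smooth_on S f \<Longrightarrow> smooth_on S g \<Longrightarrow> smooth_on S (\<lambda>x. f x + g x)"
  by (simp add: smooth_on_def Ck_on_add)

lemma smooth_on_mult [smooth_rules]: "open S \<Longrightarrow> smooth_on S f \<Longrightarrow> smooth_on S g \<Longrightarrow> smooth_on S (\<lambda>x. f x * g x)"
  by (simp add: smooth_on_def Ck_on_mult)

lemma smooth_on_uminus [smooth_rules]: "open S \<Longrightarrow> smooth_on S f \<Longrightarrow> smooth_on S (\<lambda>x. - f x)"
  using smooth_on_mult[of S "\<lambda>_. -1" f] by (simp add: smooth_on_const)

lemma smooth_on_diff [smooth_rules]: "open S \<Longrightarrow> smooth_on S f \<Longrightarrow> smooth_on S g \<Longrightarrow> smooth_on S (\<lambda>x. f x - g x)"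
  using smooth_on_add[of S f "\<lambda>x. - g x"] by (simp add: smooth_on_uminus)

lemma smooth_on_inverse: "open S \<Longrightarrow> smooth_on S f \<Longrightarrow> (\<And>x. x \<in> S \<Longrightarrow> f x \<noteq> 0) \<Longrightarrow> smooth_on S (\<lambda>x. inverse (f x))"
  by (simp add: smooth_on_def Ck_on_inverse)

lemma smooth_on_sqrt: "open S \<Longrightarrow> smooth_on S f \<Longrightarrow> (\<And>x. x \<in> S \<Longrightarrow> f x > 0) \<Longrightarrow> smooth_on S (\<lambda>x. sqrt (f x))"
  by (simp add: smooth_on_def Ck_on_sqrt)

lemma smooth_on_sum [smooth_rules]: "open S \<Longrightarrow> (\<And>j. j \<in> I \<Longrightarrow> smooth_on S (f j)) \<Longrightarrow> smooth_on S (\<lambda>x. \<Sum>j\<in>I. f j x)"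
  by (simp add: smooth_on_def Ck_on_sum)

lemma smooth_on_prod [smooth_rules]: "open S \<Longrightarrow> (\<And>j. j \<in> I \<Longrightarrow> smooth_on S (f j)) \<Longrightarrow> smooth_on S (\<lambda>x. \<Prod>j\<in>I. f j x)"
  by (simp add: smooth_on_def Ck_on_prod)

lemma smooth_on_compose:
  fixes \<phi> :: "real^4 \<Rightarrow> real^4"
  shows "open S \<Longrightarrow> open T \<Longrightarrow> (\<And>j. smooth_on S (\<lambda>x. \<phi> x $ j)) \<Longrightarrow> \<phi> ` S \<subseteq> T \<Longrightarrow> smooth_on T f \<Longrightarrow>
    smooth_on S (\<lambda>x. f (\<phi> x))"
  by (simp add: smooth_on_def Ck_on_compose[of S T])

lemma smooth_on_local:
  assumes "\<And>x. x \<in> S \<Longrightarrow> \<exists>T. open T \<and> x \<in> T \<and> smooth_on T f"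
  shows "smooth_on S f"
  unfolding smooth_on_def by (intro allI Ck_on_local) (use assms in \<open>auto simp: smooth_on_def\<close>)

lemma smooth_on_partial [smooth_rules]: "smooth_on S f \<Longrightarrow> smooth_on S (partial i f)"
  unfolding smooth_on_def by (metis Ck_on.simps(2))

lemma smooth_on_continuous: "smooth_on S f \<Longrightarrow> continuous_on S f"
  unfolding smooth_on_def by (metis Ck_on.simps(1))

lemma smooth_on_differentiable: "open S \<Longrightarrow> smooth_on S f \<Longrightarrow> x \<in> S \<Longrightarrow> f differentiable (at x)"
  unfolding smooth_on_def using Ck_on_differentiable by blast

text \<open>The second difference \<open>\<Delta>(s, t)\<close> of \<open>f\<close> over a square is \<open>s t\<close> times a value of either mixed partial
  derivative, by two applications of the mean value theorem.\<close>

lemma second_difference_mvt: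
  fixes f :: "real^4 \<Rightarrow> real"
  assumes "0 < s" and C: "Ck_on 2 S f" "open S"
    and S: "\<And>u v. 0 \<le> u \<Longrightarrow> u \<le> s \<Longrightarrow> 0 \<le> v \<Longrightarrow> v \<le> s \<Longrightarrow> x + u *\<^sub>R axis i 1 + v *\<^sub>R axis j 1 \<in> S"
  shows "\<exists>u v. 0 < u \<and> u < s \<and> 0 < v \<and> v < s \<and>
     f (x + s *\<^sub>R axis i 1 + s *\<^sub>R axis j 1) - f (x + s *\<^sub>R axis i 1) - f (x + s *\<^sub>R axis j 1) + f x
      = s * s * partial j (partial i f) (x + u *\<^sub>R axis i 1 + v *\<^sub>R axis j 1)"
proof -
  have C1: "Ck_on 1 S f" "\<And>i. Ck_on 1 S (partial i f)"
    using C(1) Ck_on_Suc_D[of 1 S f] by (auto simp: numeral_2_eq_2)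
  have df: "f differentiable (at y)" "partial i f differentiable (at y)" if "y \<in> S" for y i
    using C1 C(2) that Ck_on_differentiable[of S 0] by auto
  define \<phi> where "\<phi> u = f (x + u *\<^sub>R axis i 1 + s *\<^sub>R axis j 1) - f (x + u *\<^sub>R axis i 1)" for u
  have d\<phi>: "(\<phi> has_real_derivative (partial i f (x + u *\<^sub>R axis i 1 + s *\<^sub>R axis j 1) - partial i f (x + u *\<^sub>R axis i 1))) (at u)"
    if "0 \<le> u" "u \<le> s" for u
    unfolding \<phi>_def
    using that \<open>0 < s\<close> S[of u s] S[of u 0]
      partial_has_real_derivative[of f "x + s *\<^sub>R axis j 1" u i]
      partial_has_real_derivative[of f "x" u i] df(1)
    by (intro derivative_intros) (auto simp: algebra_simps)
  obtain u where u: "0 < u" "u < s" "\<phi> s - \<phi> 0 = (s - 0) * (partial i f (x + u *\<^sub>R axis i 1 + s *\<^sub>R axis j 1) - partial i f (x + u *\<^sub>R axis i 1))"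
    using MVT2[OF \<open>0 < s\<close> d\<phi>] by auto
  define \<psi> where "\<psi> v = partial i f (x + u *\<^sub>R axis i 1 + v *\<^sub>R axis j 1)" for v
  have d\<psi>: "(\<psi> has_real_derivative (partial j (partial i f) (x + u *\<^sub>R axis i 1 + v *\<^sub>R axis j 1))) (at v)"
    if "0 \<le> v" "v \<le> s" for v
    unfolding \<psi>_def
    using that u S[of u v] df(2)
    by (intro partial_has_real_derivative) auto
  obtain v where v: "0 < v" "v < s" "\<psi> s - \<psi> 0 = (s - 0) * partial j (partial i f) (x + u *\<^sub>R axis i 1 + v *\<^sub>R axis j 1)"
    using MVT2[OF \<open>0 < s\<close> d\<psi>] by auto
  have "\<phi> s - \<phi> 0 = s * (\<psi> s - \<psi> 0)" using u(3) by (simp add: \<psi>_def)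
  then have "\<phi> s - \<phi> 0 = s * s * partial j (partial i f) (x + u *\<^sub>R axis i 1 + v *\<^sub>R axis j 1)"
    using v(3) by simp
  then have "f (x + s *\<^sub>R axis i 1 + s *\<^sub>R axis j 1) - f (x + s *\<^sub>R axis i 1) - f (x + s *\<^sub>R axis j 1) + f x
      = s * s * partial j (partial i f) (x + u *\<^sub>R axis i 1 + v *\<^sub>R axis j 1)"
    by (simp add: \<phi>_def)
  then show ?thesis using u(1,2) v(1,2) by blast
qed

text \<open>\<open>second_difference_mvt\<close>, applied with the two indices in either order,
  expresses the same second difference through each of the mixed derivatives at some point near
  \<open>x\<close>. Continuity of both derivatives then leaves no room for a gap at
  \<open>x\<close>.\<close>

lemma partial_commute:
  fixes f :: "real^4 \<Rightarrow> real"
  assumes C: "Ck_on 2 S f" "open S" and x: "x \<in> S"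
  shows "partial i (partial j f) x = partial j (partial i f) x"
proof (rule ccontr)
  assume ne: "partial i (partial j f) x \<noteq> partial j (partial i f) x"
  \<comment> \<open>Half of the gap: no number lies strictly within \<open>e\<close> of both mixed
    derivatives at \<open>x\<close>.\<close>
  define e where "e = \<bar>partial i (partial j f) x - partial j (partial i f) x\<bar> / 2"
  have e: "e > 0" using ne by (simp add: e_def)
  have cont: "continuous_on S (partial a (partial b f))" for a b
    using C(1) by (simp add: numeral_2_eq_2)
  have "\<exists>d>0. \<forall>y. dist y x < d \<longrightarrow> y \<in> S \<and> \<bar>partial a (partial b f) y - partial a (partial b f) x\<bar> < e" for a b
  proof -
    obtain d1 where "d1 > 0" "\<forall>y\<in>S. dist y x < d1 \<longrightarrow> \<bar>partial a (partial b f) y - partial a (partial b f) x\<bar> < e"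
      using cont[of a b] x e unfolding continuous_on_iff dist_real_def by blast
    moreover obtain d2 where "d2 > 0" "\<forall>y. dist y x < d2 \<longrightarrow> y \<in> S"
      using C(2) x unfolding open_dist by blast
    ultimately show ?thesis by (intro exI[of _ "min d1 d2"]) auto
  qed
  from this[of i j] this[of j i] obtain d1 d2 where
    d1: "d1 > 0" "\<And>y. dist y x < d1 \<Longrightarrow> y \<in> S \<and> \<bar>partial i (partial j f) y - partial i (partial j f) x\<bar> < e" and
    d2: "d2 > 0" "\<And>y. dist y x < d2 \<Longrightarrow> y \<in> S \<and> \<bar>partial j (partial i f) y - partial j (partial i f) x\<bar> < e"
    by blast
  define s where "s = min d1 d2 / 3"
  have s: "s > 0" using d1 d2 by (simp add: s_def)
  have near: "dist (x + u *\<^sub>R axis a 1 + v *\<^sub>R axis b 1) x < min d1 d2"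
    if "0 \<le> u" "u \<le> s" "0 \<le> v" "v \<le> s" for u v and a b :: 4
  proof -
    have "dist (x + u *\<^sub>R axis a 1 + v *\<^sub>R axis b 1) x = norm (u *\<^sub>R axis a 1 + v *\<^sub>R axis b (1::real))"
      by (simp add: dist_norm algebra_simps)
    also have "\<dots> \<le> norm (u *\<^sub>R axis a (1::real)) + norm (v *\<^sub>R axis b (1::real))" by (rule norm_triangle_ineq)
    also have "\<dots> \<le> 2 * s" using that by simp
    also have "\<dots> < min d1 d2" using d1(1) d2(1) by (simp add: s_def min_def)
    finally show ?thesis .
  qed
  obtain u v where uv: "0 < u" "u < s" "0 < v" "v < s" 
     "f (x + s *\<^sub>R axis i 1 + s *\<^sub>R axis j 1) - f (x + s *\<^sub>R axis i 1) - f (x + s *\<^sub>R axis j 1) + f x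
      = s * s * partial j (partial i f) (x + u *\<^sub>R axis i 1 + v *\<^sub>R axis j 1)"
    using second_difference_mvt[OF s C, of x i j] near d1(2) by (metis min_less_iff_conj)
  obtain u' v' where uv': "0 < u'" "u' < s" "0 < v'" "v' < s" 
     "f (x + s *\<^sub>R axis j 1 + s *\<^sub>R axis i 1) - f (x + s *\<^sub>R axis j 1) - f (x + s *\<^sub>R axis i 1) + f x
      = s * s * partial i (partial j f) (x + u' *\<^sub>R axis j 1 + v' *\<^sub>R axis i 1)"
    using second_difference_mvt[OF s C, of x j i] near d1(2) by (metis min_less_iff_conj)
  have "s * s * partial j (partial i f) (x + u *\<^sub>R axis i 1 + v *\<^sub>R axis j 1) =
      s * s * partial i (partial j f) (x + u' *\<^sub>R axis j 1 + v' *\<^sub>R axis i 1)"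
  proof -
    have "x + s *\<^sub>R axis j 1 + s *\<^sub>R axis i 1 = x + s *\<^sub>R axis i 1 + s *\<^sub>R axis j 1" by simp
    from uv'(5)[unfolded this] uv(5) show ?thesis by linarith
  qed
  then have eq: "partial j (partial i f) (x + u *\<^sub>R axis i 1 + v *\<^sub>R axis j 1) = partial i (partial j f) (x + u' *\<^sub>R axis j 1 + v' *\<^sub>R axis i 1)"
    using s by simp
  have "\<bar>partial j (partial i f) (x + u *\<^sub>R axis i 1 + v *\<^sub>R axis j 1) - partial j (partial i f) x\<bar> < e"
    using d2(2) near[of u v i j] uv by auto
  moreover have "\<bar>partial i (partial j f) (x + u' *\<^sub>R axis j 1 + v' *\<^sub>R axis i 1) - partial i (partial j f) x\<bar> < e"
    using d1(2) near[of u' v' j i] uv' by auto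
  moreover have "\<bar>p - q\<bar> \<le> \<bar>a - q\<bar> + \<bar>a - p\<bar>" for p q a :: real by arith
  ultimately show False unfolding eq e_def
    by (metis abs_minus_commute field_sum_of_halves add_strict_mono not_less)
qed

lemma smooth_on_partial_commute:
  "smooth_on S f \<Longrightarrow> open S \<Longrightarrow> x \<in> S \<Longrightarrow> partial i (partial j f) x = partial j (partial i f) x"
  unfolding smooth_on_def using partial_commute by blast

subsection \<open>Test functions on coordinate space\<close>

text \<open>The flat function \<open>exp (-1/t)\<close> together with all its multiples by powers of
  \<open>1/t\<close>: up to linear combinations this family is closed under differentiation, so one
  induction, with \<open>n\<close> arbitrary, proves smoothness.\<close>

definition exp_tail :: "nat \<Rightarrow> real \<Rightarrow> real" where
  "exp_tail n t = (if t \<le> 0 then 0 else exp (- inverse t) * inverse t ^ n)"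

lemma exp_tail_tendsto_0: "(exp_tail n \<longlongrightarrow> 0) (at 0)"
proof -
  have "((\<lambda>t. inverse t ^ n / exp (inverse t)) \<longlongrightarrow> (0::real)) (at_right 0)"
    by (rule filterlim_compose[OF tendsto_power_div_exp_0 filterlim_inverse_at_top_right])
  moreover have "\<forall>\<^sub>F t in at_right (0::real). inverse t ^ n / exp (inverse t) = exp_tail n t"
    by (auto simp: exp_tail_def eventually_at_right_field exp_minus field_simps intro!: exI[of _ 1])
  ultimately have r: "(exp_tail n \<longlongrightarrow> 0) (at_right 0)"
    by (rule Lim_transform_eventually)
  have "\<forall>\<^sub>F t in at_left (0::real). 0 = exp_tail n t"
    by (auto simp: exp_tail_def eventually_at_left_field intro!: exI[of _ "-1"])
  then have "(exp_tail n \<longlongrightarrow> 0) (at_left 0)"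
    by (rule Lim_transform_eventually[OF tendsto_const])
  with r show ?thesis by (simp add: filterlim_split_at)
qed

lemma exp_tail_derivative:
  "(exp_tail n has_real_derivative (exp_tail (n + 2) t - real n * exp_tail (n + 1) t)) (at t)"
proof -
  consider "t > 0" | "t < 0" | "t = 0" by linarith
  then show ?thesis
  proof cases
    case 1
    have "((\<lambda>t. exp (- inverse t) * inverse t ^ n) has_real_derivative
        (exp (- inverse t) * inverse t ^ (n + 2) - real n * (exp (- inverse t) * inverse t ^ (n + 1)))) (at t)"
    proof (rule DERIV_cong[OF DERIV_mult])
      show "((\<lambda>t. exp (- inverse t)) has_real_derivative exp (- inverse t) * (inverse t)\<^sup>2) (at t)"
        using 1 by (auto intro!: derivative_eq_intros simp: power2_eq_square)
      show "((\<lambda>t. inverse t ^ n) has_real_derivative real n * inverse t ^ (n - 1) * - (inverse t)\<^sup>2) (at t)"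
        using 1 by (auto intro!: derivative_eq_intros simp: power2_eq_square)
      show "exp (- inverse t) * (inverse t)\<^sup>2 * inverse t ^ n +
          real n * inverse t ^ (n - 1) * - (inverse t)\<^sup>2 * exp (- inverse t) =
        exp (- inverse t) * inverse t ^ (n + 2) - real n * (exp (- inverse t) * inverse t ^ (n + 1))"
        by (cases n) (simp_all add: algebra_simps power2_eq_square)
    qed
    then show ?thesis
      by (rule has_field_derivative_transform_within_open[of _ _ _ "{0<..}", THEN DERIV_cong])
         (use 1 in \<open>auto simp: exp_tail_def\<close>)
  next
    case 2
    have "((\<lambda>t. 0) has_real_derivative 0) (at t)" by simp
    then show ?thesis
      by (rule has_field_derivative_transform_within_open[of _ _ _ "{..<0}", THEN DERIV_cong])
         (use 2 in \<open>auto simp: exp_tail_def\<close>)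
  next
    case 3
    \<comment> \<open>The difference quotient at 0 is \<open>exp_tail (n + 1)\<close>, which tends
      to 0.\<close>
    have "((\<lambda>h. (exp_tail n (0 + h) - exp_tail n 0) / h) \<longlongrightarrow> 0) (at 0)"
      by (rule Lim_transform_eventually[OF exp_tail_tendsto_0[of "n + 1"]])
         (auto simp: exp_tail_def field_simps eventually_at_filter)
    then show ?thesis using 3 by (simp add: DERIV_def exp_tail_def)
  qed
qed

lemma Ck_on_exp_tail: "smooth_on UNIV q \<Longrightarrow> Ck_on k UNIV (\<lambda>x. exp_tail n (q x))"
proof (induction k arbitrary: n)
  case 0
  have "continuous_on UNIV (exp_tail n)"
    by (rule DERIV_continuous_on) (use exp_tail_derivative in \<open>auto intro: has_field_derivative_at_within\<close>)
  then show ?case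
    using continuous_on_compose2[of UNIV "exp_tail n" UNIV q] smooth_on_continuous[OF 0] by simp
next
  case (Suc k)
  have q: "q differentiable (at x)" for x
    using smooth_on_differentiable[OF open_UNIV Suc.prems] by simp
  have "((\<lambda>x. exp_tail n (q x)) has_derivative (\<lambda>v. (exp_tail (n + 2) (q x) - real n * exp_tail (n + 1) (q x)) *
      (\<Sum>i\<in>UNIV. partial i q x * v $ i))) (at x)" for x
    using diff_chain_at[OF has_derivative_partials[OF q], of "exp_tail n"] exp_tail_derivative[of n "q x"]
    by (simp add: o_def has_field_derivative_def)
  then have "(\<lambda>x. exp_tail n (q x)) differentiable_on UNIV"
    by (auto simp: differentiable_on_def differentiable_def)
  moreover have "Ck_on k UNIV (partial i (\<lambda>x. exp_tail n (q x)))" for i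
  proof -
    have "partial i (\<lambda>x. exp_tail n (q x)) =
        (\<lambda>x. (exp_tail (n + 2) (q x) + (- real n) * exp_tail (n + 1) (q x)) * partial i q x)"
      using partial_compose_real[OF q exp_tail_derivative] by auto
    moreover have "Ck_on k UNIV (partial i q)"
      using smooth_on_partial[OF Suc.prems] by (simp add: smooth_on_def)
    moreover have "Ck_on k UNIV (\<lambda>x. exp_tail m (q x))" for m by (rule Suc.IH[OF Suc.prems])
    ultimately show ?thesis
      by (simp only:) (intro Ck_on_mult Ck_on_add Ck_on_const open_UNIV)
  qed
  ultimately show ?case by simp
qed

text \<open>Test functions are total and smooth on the whole space, so that they can be integrated
  over \<open>lborel\<close> without restriction and moved to a larger open set without
  change.\<close>

definition testf :: "(real^4) set \<Rightarrow> (real^4 \<Rightarrow> real) \<Rightarrow> bool" where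
  "testf U F \<longleftrightarrow> smooth_on UNIV F \<and> (\<exists>K. compact K \<and> K \<subseteq> U \<and> (\<forall>x. x \<notin> K \<longrightarrow> F x = 0))"

lemma testf_mono: "testf U F \<Longrightarrow> U \<subseteq> V \<Longrightarrow> testf V F"
  unfolding testf_def by blast

text \<open>Smoothness is local, and \<open>U\<close> together with the complement of
  \<open>K\<close>, where \<open>F\<close> is zero, covers the space.\<close>

lemma smooth_on_zero_extension:
  assumes "open U" "closed K" "K \<subseteq> U" "smooth_on U F" "\<And>x. x \<notin> K \<Longrightarrow> F x = 0"
  shows "smooth_on UNIV F"
proof (rule smooth_on_local)
  fix x :: "real^4"
  show "\<exists>T. open T \<and> x \<in> T \<and> smooth_on T F"
  proof (cases "x \<in> K")
    case True
    then show ?thesis using assms by blast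
  next
    case False
    have "smooth_on (- K) F"
      by (rule smooth_on_cong[of _ "\<lambda>x. 0"]) (use assms in \<open>auto intro: smooth_on_const\<close>)
    then show ?thesis using False assms(2) by blast
  qed
qed

text \<open>The function is \<open>exp_tail 0\<close> of the squared radius minus the squared
  distance to \<open>p\<close>. That argument is a polynomial in the coordinates, hence smooth, and
  it is positive exactly inside the ball.\<close>

lemma testf_bump:
  assumes "open U" "p \<in> U"
  obtains F where "testf U F" "\<And>x. F x \<ge> 0" "F p > 0"
proof -
  obtain r where r: "r > 0" "cball p r \<subseteq> U" using assms open_contains_cball by blast
  define q where "q x = r\<^sup>2 - (\<Sum>i\<in>UNIV. (x $ i - p $ i) * (x $ i - p $ i))" for x :: "real^4"
  have q: "q x = r\<^sup>2 - (dist x p)\<^sup>2" for x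
    by (simp add: q_def dist_norm norm_vec_def L2_set_def sum_nonneg power2_eq_square)
  have "smooth_on UNIV q"
    unfolding q_def by (intro smooth_rules) auto
  then have "smooth_on UNIV (\<lambda>x. exp_tail 0 (q x))"
    using Ck_on_exp_tail by (simp add: smooth_on_def)
  moreover have "exp_tail 0 (q x) = 0" if "x \<notin> cball p r" for x
    using that r by (auto simp: exp_tail_def q dist_commute power_mono)
  ultimately have "testf U (\<lambda>x. exp_tail 0 (q x))"
    unfolding testf_def using r by (metis compact_cball)
  moreover have "exp_tail 0 (q x) \<ge> 0" for x by (simp add: exp_tail_def)
  moreover have "exp_tail 0 (q p) > 0" using r by (simp add: exp_tail_def q)
  ultimately show ?thesis using that by blast
qed

lemma testf_mult:
  assumes "open U" "testf U F" "smooth_on U \<phi>"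
  shows "testf U (\<lambda>x. F x * \<phi> x)"
proof -
  from assms obtain K where K: "compact K" "K \<subseteq> U" "\<And>x. x \<notin> K \<Longrightarrow> F x = 0" "smooth_on U F"
    by (auto simp: testf_def intro: smooth_on_subset)
  then have "smooth_on UNIV (\<lambda>x. F x * \<phi> x)"
    using assms by (intro smooth_on_zero_extension[of U K] smooth_on_mult compact_imp_closed) auto
  then show ?thesis using K by (auto simp: testf_def)
qed

lemma testf_partial:
  assumes "testf U F"
  shows "testf U (partial i F)"
proof -
  from assms obtain K where K: "compact K" "K \<subseteq> U" "\<And>x. x \<notin> K \<Longrightarrow> F x = 0" "smooth_on UNIV F"
    by (auto simp: testf_def)
  have "partial i F x = 0" if "x \<notin> K" for x
    using partial_cong_open[of "- K" x F "\<lambda>_. 0" i] K that compact_imp_closed[OF K(1)] by auto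
  then show ?thesis using K smooth_on_partial unfolding testf_def by blast
qed

lemma continuous_zero_extension:
  fixes f :: "'a::topological_space \<Rightarrow> real"
  assumes "open U" "closed K" "K \<subseteq> U" "continuous_on U f" "\<And>x. x \<notin> K \<Longrightarrow> f x = 0"
  shows "continuous_on UNIV f"
proof -
  have "continuous_on (U \<union> - K) f"
  proof (rule continuous_on_open_Un)
    show "continuous_on (- K) f"
      using continuous_on_cong[of "- K" "- K" f "\<lambda>_. 0"] assms by auto
  qed (use assms in auto)
  moreover have "U \<union> - K = UNIV" using assms by auto
  ultimately show ?thesis by simp
qed

section \<open>Integration against test functions\<close>

lemma testf_integrable:
  assumes "testf U F" "continuous_on U u"
  shows "integrable lborel (\<lambda>x. F x * u x)"
proof -
  from assms obtain K where K: "compact K" "K \<subseteq> U" "\<And>x. x \<notin> K \<Longrightarrow> F x = 0" "smooth_on UNIV F"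
    by (auto simp: testf_def)
  have "continuous_on K (\<lambda>x. F x * u x)"
    using K assms smooth_on_continuous[OF K(4)]
    by (intro continuous_intros) (auto intro: continuous_on_subset)
  from borel_integrable_compact[OF K(1) this]
  have "integrable lborel (\<lambda>x. indicator K x *\<^sub>R (F x * u x))" .
  moreover have "(\<lambda>x. indicator K x *\<^sub>R (F x * u x)) = (\<lambda>x. F x * u x)"
    using K by (auto simp: indicator_def fun_eq_iff)
  ultimately show ?thesis by simp
qed

text \<open>The integral of \<open>w\<close> is translation invariant, so the integrals of its difference quotients vanish.\<close>

lemma integral_partial_eq_0:
  fixes w :: "real^4 \<Rightarrow> real"
  assumes w: "Ck_on 1 UNIV w" and K: "compact K" "\<And>x. x \<notin> K \<Longrightarrow> w x = 0"
  shows "(\<integral>x. partial i w x \<partial>lborel) = 0"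
proof -
  let ?e = "axis i 1 :: real^4"
  have d: "w differentiable (at x)" for x
    using Ck_on_differentiable[OF open_UNIV, of 0 w x] w by simp
  have cont: "continuous_on UNIV w" using w differentiable_imp_continuous_on by auto
  have contp: "continuous_on UNIV (partial i w)" using w by simp
  have p0: "partial i w x = 0" if "x \<notin> K" for x
    using partial_cong_open[of "- K" x w "\<lambda>_. 0" i] K that compact_imp_closed[OF K(1)] by auto
  obtain B where B: "B \<ge> 0" "\<And>x. \<bar>partial i w x\<bar> \<le> B"
  proof -
    have "bounded (partial i w ` K)"
      using K(1) contp by (meson compact_continuous_image compact_imp_bounded continuous_on_subset subset_UNIV)
    then obtain B where "\<And>x. x \<in> K \<Longrightarrow> \<bar>partial i w x\<bar> \<le> B"
      by (auto simp: bounded_iff)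
    then have "\<And>x. \<bar>partial i w x\<bar> \<le> max B 0" using p0
      by (metis abs_zero max.cobounded2 max.coboundedI1)
    then show ?thesis using that[of "max B 0"] by simp
  qed
  \<comment> \<open>The set swept out when \<open>K\<close> is shifted back by at most 1. Since all
    steps \<open>1 / Suc n\<close> are at most 1, every difference quotient vanishes off
    \<open>K'\<close>, and \<open>B\<close> times its indicator dominates them all.\<close>
  define K' where "K' = (\<lambda>(k, s). k - s *\<^sub>R ?e) ` (K \<times> {0..1})"
  have K': "compact K'" unfolding K'_def
    by (intro compact_continuous_image compact_Times K(1)) (auto intro!: continuous_intros simp: case_prod_beta)
  define q where "q n x = real (Suc n) * (w (x + (1 / real (Suc n)) *\<^sub>R ?e) - w x)" for n x
  have q_bound: "norm (q n x) \<le> B * indicator K' x" for n x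
  proof -
    define s where "s = 1 / real (Suc n)"
    have s: "0 < s" "s \<le> 1" by (auto simp: s_def)
    obtain z where z: "0 < z" "z < s" "w (x + s *\<^sub>R ?e) - w (x + 0 *\<^sub>R ?e) = (s - 0) * partial i w (x + z *\<^sub>R ?e)"
      using MVT2[OF s(1), of "\<lambda>s. w (x + s *\<^sub>R ?e)" "\<lambda>z. partial i w (x + z *\<^sub>R ?e)"]
        partial_has_real_derivative[OF d] by blast
    have qz: "q n x = partial i w (x + z *\<^sub>R ?e)"
      using z(3) by (simp add: q_def s_def)
    show ?thesis
    proof (cases "x \<in> K'")
      case True
      then show ?thesis using B by (simp add: qz)
    next
      case False
      have "x + z *\<^sub>R ?e \<notin> K"
      proof
        assume "x + z *\<^sub>R ?e \<in> K"
        then have "x \<in> K'" unfolding K'_def using z s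
          by (intro image_eqI[of _ _ "(x + z *\<^sub>R ?e, z)"]) auto
        with False show False by simp
      qed
      then show ?thesis using False p0 by (simp add: qz)
    qed
  qed
  have "(\<lambda>n. q n x) \<longlonglongrightarrow> partial i w x" for x
  proof -
    have "((\<lambda>h. (w (x + h *\<^sub>R ?e) - w x) / h) \<longlongrightarrow> partial i w x) (at 0)"
      using partial_has_real_derivative[of w x 0 i] d[of x] by (simp add: DERIV_def)
    moreover have "filterlim (\<lambda>n. 1 / real (Suc n)) (at 0) sequentially"
      unfolding filterlim_at using LIMSEQ_inverse_real_of_nat by (auto simp: inverse_eq_divide simp del: of_nat_Suc)
    ultimately have "(\<lambda>n. (w (x + (1 / real (Suc n)) *\<^sub>R ?e) - w x) / (1 / real (Suc n))) \<longlonglongrightarrow> partial i w x"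
      by (rule filterlim_compose)
    then show ?thesis by (simp add: q_def mult.commute)
  qed
  then have "(\<lambda>n. \<integral>x. q n x \<partial>lborel) \<longlonglongrightarrow> (\<integral>x. partial i w x \<partial>lborel)"
  proof (intro integral_dominated_convergence[where w = "\<lambda>x. B * indicator K' x"])
    show "partial i w \<in> borel_measurable lborel"
      using borel_measurable_continuous_onI[OF contp] by simp
    show "q n \<in> borel_measurable lborel" for n
    proof -
      have "continuous_on UNIV (q n)"
        unfolding q_def by (intro continuous_intros continuous_on_compose2[OF cont]) auto
      then show ?thesis using borel_measurable_continuous_onI by simp
    qed
    show "integrable lborel (\<lambda>x. B * indicator K' x)"
      using borel_integrable_compact[OF K', of "\<lambda>_. B"] by (simp add: mult.commute)
  qed (use q_bound in auto)
  moreover have "(\<integral>x. q n x \<partial>lborel) = 0" for n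
  proof -
    let ?c = "(1 / real (Suc n)) *\<^sub>R ?e"
    have wm: "w \<in> borel_measurable borel" using cont by (rule borel_measurable_continuous_onI)
    have wi: "integrable lborel w"
    proof -
      have "integrable lborel (\<lambda>x. indicator K x *\<^sub>R w x)"
        by (rule borel_integrable_compact[OF K(1) continuous_on_subset[OF cont]]) simp
      moreover have "(\<lambda>x. indicator K x *\<^sub>R w x) = w" using K(2) by (auto simp: indicator_def fun_eq_iff)
      ultimately show ?thesis by simp
    qed
    have tr: "integrable lborel (\<lambda>x. w (?c + x))" "(\<integral>x. w (?c + x) \<partial>lborel) = (\<integral>x. w x \<partial>lborel)"
      using integrable_distr_eq[of "(+) ?c" lborel borel w] integral_distr[of "(+) ?c" lborel borel w]
        lborel_distr_plus[of ?c] wi wm by (simp_all add: measurable_lborel1)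
    show ?thesis
      using tr wi by (simp add: q_def add.commute)
  qed
  ultimately show ?thesis using LIMSEQ_unique[OF tendsto_const, of 0] by simp
qed

text \<open>\<open>u\<close> lives on \<open>U\<close> only, but \<open>F * u\<close> extends by
  zero to a test function, and the integral of its derivative vanishes.\<close>

lemma integral_by_parts:
  assumes "open U" "testf U F" "smooth_on U u"
  shows "(\<integral>x. F x * partial i u x \<partial>lborel) = - (\<integral>x. partial i F x * u x \<partial>lborel)"
proof -
  from assms obtain K where K: "compact K" "K \<subseteq> U" "\<And>x. x \<notin> K \<Longrightarrow> F x = 0" "smooth_on UNIV F"
    by (auto simp: testf_def)
  have pF: "partial i F x = 0" if "x \<notin> K" for x
    using partial_cong_open[of "- K" x F "\<lambda>_. 0" i] K that compact_imp_closed[OF K(1)] by auto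
  have "testf U (\<lambda>x. F x * u x)" by (rule testf_mult[OF assms])
  then have "Ck_on 1 UNIV (\<lambda>x. F x * u x)" by (simp add: testf_def smooth_on_def)
  then have "(\<integral>x. partial i (\<lambda>x. F x * u x) x \<partial>lborel) = 0"
    by (rule integral_partial_eq_0[OF _ K(1)]) (simp add: K)
  moreover have "partial i (\<lambda>x. F x * u x) x = partial i F x * u x + F x * partial i u x" for x
  proof (cases "x \<in> K")
    case True
    then show ?thesis
      using K assms by (intro partial_mult smooth_on_differentiable[of UNIV] smooth_on_differentiable[of U u]) auto
  next
    case False
    then have "partial i (\<lambda>x. F x * u x) x = 0"
      using partial_cong_open[of "- K" x "\<lambda>x. F x * u x" "\<lambda>_. 0" i] K compact_imp_closed[OF K(1)] by auto
    then show ?thesis using False K pF by simp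
  qed
  moreover have "integrable lborel (\<lambda>x. F x * partial i u x)" "integrable lborel (\<lambda>x. partial i F x * u x)"
    using assms by (auto intro!: testf_integrable[of U] testf_partial smooth_on_continuous smooth_on_partial)
  ultimately show ?thesis by simp
qed

text \<open>If \<open>w p\<close> were negative, \<open>w\<close> would stay below
  \<open>w p / 2\<close> near \<open>p\<close>, and a bump supported there would have a negative
  integral against \<open>w\<close>.\<close>

lemma test_integral_nonneg:
  assumes "open U" and w: "continuous_on U w"
    and pos: "\<And>F. testf U F \<Longrightarrow> (\<And>x. F x \<ge> 0) \<Longrightarrow> (\<integral>x. F x * w x \<partial>lborel) \<ge> 0"
    and "p \<in> U"
  shows "w p \<ge> 0"
proof (rule ccontr)
  assume neg: "\<not> w p \<ge> 0"
  define V where "V = {x \<in> U. w x < w p / 2}"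
  have V: "open V" "p \<in> V"
  proof -
    have "V = U \<inter> w -` {..<w p / 2}" by (auto simp: V_def)
    then show "open V" using continuous_open_preimage[OF w \<open>open U\<close> open_lessThan] by simp
  qed (use \<open>p \<in> U\<close> neg in \<open>simp add: V_def\<close>)
  obtain F where F: "testf V F" "\<And>x. F x \<ge> 0" "F p > 0" using testf_bump[OF V] by blast
  have FU: "testf U F" using F(1) by (rule testf_mono) (auto simp: V_def)
  have F0: "F x = 0" if "x \<notin> V" for x using F(1) that by (auto simp: testf_def)
  have contF: "continuous_on UNIV F" using F(1) by (auto simp: testf_def intro: smooth_on_continuous)
  have "0 < (\<integral>x. F x * 1 \<partial>lborel)"
  proof -
    have int: "integrable lborel (\<lambda>x. F x * 1)"
      by (rule testf_integrable[OF F(1)]) simp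
    \<comment> \<open>A nonnegative function with integral zero vanishes almost everywhere; the zero
      set of the continuous \<open>F\<close> is closed, so it would then be everything,
      \<open>p\<close> included.\<close>
    have "(\<integral>x. F x * 1 \<partial>lborel) \<noteq> 0"
    proof
      assume "(\<integral>x. F x * 1 \<partial>lborel) = 0"
      then have "AE x in lborel. F x = 0"
        using integral_nonneg_eq_0_iff_AE[OF int] F(2) by simp
      moreover have "closed {x. F x = 0}"
        using continuous_closed_vimage[of "{0}" F] contF
        by (simp add: vimage_def continuous_on_eq_continuous_at)
      ultimately have "F p = 0" using mem_closed_if_AE_lebesgue[of "{x. F x = 0}" p]
        by (simp add: AE_completion)
      with F(3) show False by simp
    qed
    moreover have "(\<integral>x. F x * 1 \<partial>lborel) \<ge> 0" using F(2) by simp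
    ultimately show ?thesis by linarith
  qed
  then have "(\<integral>x. F x * (w p / 2) \<partial>lborel) < 0" using neg by (simp add: mult_pos_neg)
  moreover have "(\<integral>x. F x * w x \<partial>lborel) \<le> (\<integral>x. F x * (w p / 2) \<partial>lborel)"
  proof (rule integral_mono)
    show "F x * w x \<le> F x * (w p / 2)" for x
      using mult_left_mono[of "w x" "w p / 2" "F x"] F(2)[of x] F0[of x]
      by (cases "x \<in> V") (auto simp: V_def)
  qed (auto intro!: testf_integrable[OF FU] w)
  ultimately show False using pos[OF FU F(2)] by linarith
qed

lemma test_integral_eq_0:
  assumes "open U" "continuous_on U w" "\<And>F. testf U F \<Longrightarrow> (\<integral>x. F x * w x \<partial>lborel) = 0" "p \<in> U"
  shows "w p = 0"
proof -
  have "w p \<ge> 0" by (rule test_integral_nonneg[of U]) (use assms in auto)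
  moreover have "- w p \<ge> 0" by (rule test_integral_nonneg[of U "\<lambda>x. - w x"]) (use assms in \<open>auto intro: continuous_intros\<close>)
  ultimately show ?thesis by simp
qed

subsection \<open>Weak limits of one-parameter families of functions\<close>

text \<open>Only the parameters \<open>l > 0\<close> and the restrictions to \<open>U\<close> matter.\<close>

definition fam :: "(real^4) set \<Rightarrow> (real \<Rightarrow> real^4 \<Rightarrow> real) \<Rightarrow> bool" where
  "fam U u \<longleftrightarrow> (\<forall>l>0. continuous_on U (u l))"

text \<open>Continuity of the family and of the limit is part of the notion, so that all integrals
  against test functions exist and the limit laws carry no integrability conditions.\<close>

definition wlim :: "(real^4) set \<Rightarrow> (real \<Rightarrow> real^4 \<Rightarrow> real) \<Rightarrow> (real^4 \<Rightarrow> real) \<Rightarrow> bool" where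
  "wlim U u v \<longleftrightarrow> fam U u \<and> continuous_on U v \<and>
     (\<forall>F. testf U F \<longrightarrow> ((\<lambda>l. \<integral>x. F x * u l x \<partial>lborel) \<longlongrightarrow> (\<integral>x. F x * v x \<partial>lborel)) (at_right 0))"

definition null_fam :: "(real^4) set \<Rightarrow> (real \<Rightarrow> real^4 \<Rightarrow> real) \<Rightarrow> bool" where
  "null_fam U u \<longleftrightarrow> fam U u \<and>
     (\<forall>K. compact K \<longrightarrow> K \<subseteq> U \<longrightarrow> (\<forall>e>0. \<forall>\<^sub>F l in at_right 0. \<forall>x\<in>K. \<bar>u l x\<bar> \<le> e))"

text \<open>A bound is asked for small parameters only: the inverse metric, for instance, is
  controlled only once \<open>g(l)\<close> is close to the background on \<open>K\<close>.\<close>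

definition bdd_fam :: "(real^4) set \<Rightarrow> (real \<Rightarrow> real^4 \<Rightarrow> real) \<Rightarrow> bool" where
  "bdd_fam U u \<longleftrightarrow> fam U u \<and>
     (\<forall>K. compact K \<longrightarrow> K \<subseteq> U \<longrightarrow> (\<exists>B. \<forall>\<^sub>F l in at_right 0. \<forall>x\<in>K. \<bar>u l x\<bar> \<le> B))"

lemma eventually_at_right_0_pos: "\<forall>\<^sub>F l in at_right (0::real). l > 0"
  by (simp add: eventually_at_right_less)

lemma null_famI:
  assumes "fam U u" "\<And>K e. compact K \<Longrightarrow> K \<subseteq> U \<Longrightarrow> e > 0 \<Longrightarrow> \<forall>\<^sub>F l in at_right 0. \<forall>x\<in>K. \<bar>u l x\<bar> \<le> e"
  shows "null_fam U u"
  using assms by (simp add: null_fam_def)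

lemma null_famD:
  "null_fam U u \<Longrightarrow> compact K \<Longrightarrow> K \<subseteq> U \<Longrightarrow> e > 0 \<Longrightarrow> \<forall>\<^sub>F l in at_right 0. \<forall>x\<in>K. \<bar>u l x\<bar> \<le> e"
  by (simp add: null_fam_def)

lemma bdd_famI:
  assumes "fam U u" "\<And>K. compact K \<Longrightarrow> K \<subseteq> U \<Longrightarrow> \<exists>B. \<forall>\<^sub>F l in at_right 0. \<forall>x\<in>K. \<bar>u l x\<bar> \<le> B"
  shows "bdd_fam U u"
  using assms by (simp add: bdd_fam_def)

lemma bdd_famE:
  assumes "bdd_fam U u" "compact K" "K \<subseteq> U"
  obtains B where "B > 0" "\<forall>\<^sub>F l in at_right 0. \<forall>x\<in>K. \<bar>u l x\<bar> \<le> B"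
proof -
  obtain B where "\<forall>\<^sub>F l in at_right 0. \<forall>x\<in>K. \<bar>u l x\<bar> \<le> B" using assms by (auto simp: bdd_fam_def)
  then have "\<forall>\<^sub>F l in at_right 0. \<forall>x\<in>K. \<bar>u l x\<bar> \<le> max B 1"
    by eventually_elim force
  then show ?thesis using that[of "max B 1"] by simp
qed

section \<open>Algebra of bounded and null families\<close>

lemma fam_add: "fam U u \<Longrightarrow> fam U v \<Longrightarrow> fam U (\<lambda>l x. u l x + v l x)"
  and fam_diff: "fam U u \<Longrightarrow> fam U v \<Longrightarrow> fam U (\<lambda>l x. u l x - v l x)"
  and fam_mult: "fam U u \<Longrightarrow> fam U v \<Longrightarrow> fam U (\<lambda>l x. u l x * v l x)"
  and fam_const: "continuous_on U w \<Longrightarrow> fam U (\<lambda>l. w)"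
  by (auto simp: fam_def intro: continuous_intros)

lemma fam_cong: "(\<And>l x. l > 0 \<Longrightarrow> x \<in> U \<Longrightarrow> u l x = v l x) \<Longrightarrow> fam U u \<Longrightarrow> fam U v"
  unfolding fam_def by (metis continuous_on_cong)

named_theorems fam_rules

lemma bdd_fam_const [fam_rules]: "continuous_on U v \<Longrightarrow> bdd_fam U (\<lambda>l. v)"
proof (rule bdd_famI)
  fix K assume v: "continuous_on U v" and K: "compact K" "K \<subseteq> U"
  then have "bounded (v ` K)"
    by (meson compact_continuous_image compact_imp_bounded continuous_on_subset)
  then obtain B where "\<forall>x\<in>K. \<bar>v x\<bar> \<le> B" by (auto simp: bounded_iff)
  then show "\<exists>B. \<forall>\<^sub>F l in at_right 0. \<forall>x\<in>K. \<bar>v x\<bar> \<le> B"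
    by (intro exI[of _ B]) simp
qed (auto simp: fam_def)

lemma bdd_fam_add [fam_rules]:
  assumes "bdd_fam U u" "bdd_fam U v" shows "bdd_fam U (\<lambda>l x. u l x + v l x)"
proof (rule bdd_famI)
  fix K assume K: "compact K" "K \<subseteq> U"
  obtain B where "\<forall>\<^sub>F l in at_right 0. \<forall>x\<in>K. \<bar>u l x\<bar> \<le> B" by (rule bdd_famE[OF assms(1) K])
  moreover obtain B' where "\<forall>\<^sub>F l in at_right 0. \<forall>x\<in>K. \<bar>v l x\<bar> \<le> B'" by (rule bdd_famE[OF assms(2) K])
  ultimately have "\<forall>\<^sub>F l in at_right 0. \<forall>x\<in>K. \<bar>u l x + v l x\<bar> \<le> B + B'"
    by eventually_elim force
  then show "\<exists>B. \<forall>\<^sub>F l in at_right 0. \<forall>x\<in>K. \<bar>u l x + v l x\<bar> \<le> B" by blast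
qed (use assms in \<open>auto simp: bdd_fam_def fam_add\<close>)

lemma bdd_fam_mult [fam_rules]:
  assumes "bdd_fam U u" "bdd_fam U v" shows "bdd_fam U (\<lambda>l x. u l x * v l x)"
proof (rule bdd_famI)
  fix K assume K: "compact K" "K \<subseteq> U"
  obtain B where B: "B > 0" and eB: "\<forall>\<^sub>F l in at_right 0. \<forall>x\<in>K. \<bar>u l x\<bar> \<le> B" by (rule bdd_famE[OF assms(1) K])
  obtain B' where eB': "\<forall>\<^sub>F l in at_right 0. \<forall>x\<in>K. \<bar>v l x\<bar> \<le> B'" by (rule bdd_famE[OF assms(2) K])
  from eB eB' have "\<forall>\<^sub>F l in at_right 0. \<forall>x\<in>K. \<bar>u l x * v l x\<bar> \<le> B * B'"
    by eventually_elim (use B in \<open>auto simp: abs_mult intro!: mult_mono\<close>)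
  then show "\<exists>B. \<forall>\<^sub>F l in at_right 0. \<forall>x\<in>K. \<bar>u l x * v l x\<bar> \<le> B" by blast
qed (use assms in \<open>auto simp: bdd_fam_def fam_mult\<close>)

lemma bdd_fam_cmult [fam_rules]: "bdd_fam U u \<Longrightarrow> bdd_fam U (\<lambda>l x. c * u l x)"
  by (intro bdd_fam_mult bdd_fam_const continuous_on_const)

lemma bdd_fam_diff [fam_rules]: "bdd_fam U u \<Longrightarrow> bdd_fam U v \<Longrightarrow> bdd_fam U (\<lambda>l x. u l x - v l x)"
  using bdd_fam_add[of U u "\<lambda>l x. -1 * v l x"] bdd_fam_cmult[of U v "-1"] by simp

lemma bdd_fam_sum [fam_rules]: "(\<And>i. i \<in> I \<Longrightarrow> bdd_fam U (u i)) \<Longrightarrow> bdd_fam U (\<lambda>l x. \<Sum>i\<in>I. u i l x)"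
  by (induction I rule: infinite_finite_induct) (auto intro: bdd_fam_const bdd_fam_add)

lemma null_fam_add:
  assumes "null_fam U u" "null_fam U v" shows "null_fam U (\<lambda>l x. u l x + v l x)"
proof (rule null_famI)
  fix K and e :: real assume K: "compact K" "K \<subseteq> U" and "e > 0"
  then have "\<forall>\<^sub>F l in at_right 0. \<forall>x\<in>K. \<bar>u l x\<bar> \<le> e/2" "\<forall>\<^sub>F l in at_right 0. \<forall>x\<in>K. \<bar>v l x\<bar> \<le> e/2"
    using null_famD[OF assms(1) K, of "e/2"] null_famD[OF assms(2) K, of "e/2"] by auto
  then show "\<forall>\<^sub>F l in at_right 0. \<forall>x\<in>K. \<bar>u l x + v l x\<bar> \<le> e"
    by eventually_elim force
qed (use assms in \<open>auto simp: null_fam_def fam_add\<close>)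

lemma null_fam_mult_bdd:
  assumes "null_fam U u" "bdd_fam U v" shows "null_fam U (\<lambda>l x. u l x * v l x)"
proof (rule null_famI)
  fix K and e :: real assume K: "compact K" "K \<subseteq> U" and e: "e > 0"
  obtain B where B: "B > 0" and eB: "\<forall>\<^sub>F l in at_right 0. \<forall>x\<in>K. \<bar>v l x\<bar> \<le> B" by (rule bdd_famE[OF assms(2) K])
  have eu: "\<forall>\<^sub>F l in at_right 0. \<forall>x\<in>K. \<bar>u l x\<bar> \<le> e / B"
    using null_famD[OF assms(1) K, of "e / B"] B e by simp
  from eu eB have "\<forall>\<^sub>F l in at_right 0. \<forall>x\<in>K. \<bar>u l x * v l x\<bar> \<le> (e / B) * B"
    by eventually_elim (use e B in \<open>auto simp: abs_mult simp del: nonzero_eq_divide_eq times_divide_eq_left intro!: mult_mono\<close>)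
  then show "\<forall>\<^sub>F l in at_right 0. \<forall>x\<in>K. \<bar>u l x * v l x\<bar> \<le> e" using B by simp
qed (use assms in \<open>auto simp: null_fam_def bdd_fam_def fam_mult\<close>)

lemma null_fam_bdd_mult: "bdd_fam U v \<Longrightarrow> null_fam U u \<Longrightarrow> null_fam U (\<lambda>l x. v l x * u l x)"
  using null_fam_mult_bdd[of U u v] by (simp add: mult.commute)

lemma null_fam_cmult: "null_fam U u \<Longrightarrow> null_fam U (\<lambda>l x. c * u l x)"
  by (intro null_fam_bdd_mult bdd_fam_const continuous_on_const)

lemma null_fam_diff: "null_fam U u \<Longrightarrow> null_fam U v \<Longrightarrow> null_fam U (\<lambda>l x. u l x - v l x)"
  using null_fam_add[of U u "\<lambda>l x. -1 * v l x"] null_fam_cmult[of U v "-1"] by simp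

lemma null_fam_0: "null_fam U (\<lambda>l x. 0)"
  by (auto simp: null_fam_def fam_def)

lemma null_fam_sum: "(\<And>i. i \<in> I \<Longrightarrow> null_fam U (u i)) \<Longrightarrow> null_fam U (\<lambda>l x. \<Sum>i\<in>I. u i l x)"
  by (induction I rule: infinite_finite_induct) (auto intro: null_fam_0 null_fam_add)

lemma null_fam_imp_bdd: "null_fam U u \<Longrightarrow> bdd_fam U u"
  by (rule bdd_famI, simp add: null_fam_def, rule exI[of _ 1], rule null_famD) auto

lemma null_fam_cong:
  assumes "\<And>l x. l > 0 \<Longrightarrow> x \<in> U \<Longrightarrow> u l x = v l x" "null_fam U u" shows "null_fam U v"
proof (rule null_famI)
  show "fam U v" by (rule fam_cong[OF assms(1)]) (use assms(2) in \<open>auto simp: null_fam_def\<close>)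
  fix K and e :: real assume K: "compact K" "K \<subseteq> U" and "e > 0"
  from null_famD[OF assms(2) this] eventually_at_right_0_pos
  show "\<forall>\<^sub>F l in at_right 0. \<forall>x\<in>K. \<bar>v l x\<bar> \<le> e"
    by eventually_elim (use assms(1) K in fastforce)
qed

lemma bdd_fam_cong:
  assumes "\<And>l x. l > 0 \<Longrightarrow> x \<in> U \<Longrightarrow> u l x = v l x" "bdd_fam U u" shows "bdd_fam U v"
proof (rule bdd_famI)
  show "fam U v" by (rule fam_cong[OF assms(1)]) (use assms(2) in \<open>auto simp: bdd_fam_def\<close>)
  fix K assume K: "compact K" "K \<subseteq> U"
  obtain B where "\<forall>\<^sub>F l in at_right 0. \<forall>x\<in>K. \<bar>u l x\<bar> \<le> B" by (rule bdd_famE[OF assms(2) K])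
  then have "\<forall>\<^sub>F l in at_right 0. \<forall>x\<in>K. \<bar>v l x\<bar> \<le> B"
    using eventually_at_right_0_pos by eventually_elim (use assms(1) K in fastforce)
  then show "\<exists>B. \<forall>\<^sub>F l in at_right 0. \<forall>x\<in>K. \<bar>v l x\<bar> \<le> B" by blast
qed

section \<open>Rules for weak limits\<close>

lemma wlim_cong:
  assumes "\<And>l x. l > 0 \<Longrightarrow> x \<in> U \<Longrightarrow> u l x = u' l x" "\<And>x. x \<in> U \<Longrightarrow> v x = v' x" "wlim U u v"
  shows "wlim U u' v'"
  unfolding wlim_def
proof (intro conjI allI impI)
  show "fam U u'" by (rule fam_cong[OF assms(1)]) (use assms(3) in \<open>auto simp: wlim_def\<close>)
  show "continuous_on U v'"
    using continuous_on_eq[of U v v'] assms(2,3) by (simp add: wlim_def)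
  fix F assume F: "testf U F"
  then have F0: "F x = 0" if "x \<notin> U" for x using that by (auto simp: testf_def)
  have eq: "(\<lambda>x. F x * v x) = (\<lambda>x. F x * v' x)" using F0 assms(2) by (metis mult_zero_left)
  have ev: "\<forall>\<^sub>F l in at_right 0. (\<integral>x. F x * u l x \<partial>lborel) = (\<integral>x. F x * u' l x \<partial>lborel)"
    using eventually_at_right_0_pos
  proof eventually_elim
    case (elim l)
    then have "(\<lambda>x. F x * u l x) = (\<lambda>x. F x * u' l x)" using F0 assms(1) by (metis mult_zero_left)
    then show ?case by simp
  qed
  have "((\<lambda>l. \<integral>x. F x * u l x \<partial>lborel) \<longlongrightarrow> (\<integral>x. F x * v x \<partial>lborel)) (at_right 0)"
    using assms(3) F by (simp add: wlim_def)
  from Lim_transform_eventually[OF this ev]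
  show "((\<lambda>l. \<integral>x. F x * u' l x \<partial>lborel) \<longlongrightarrow> (\<integral>x. F x * v' x \<partial>lborel)) (at_right 0)"
    by (simp add: eq)
qed

lemma wlim_add:
  assumes "wlim U u v" "wlim U u' v'"
  shows "wlim U (\<lambda>l x. u l x + u' l x) (\<lambda>x. v x + v' x)"
  unfolding wlim_def
proof (intro conjI allI impI)
  show "fam U (\<lambda>l x. u l x + u' l x)" "continuous_on U (\<lambda>x. v x + v' x)"
    using assms by (auto simp: wlim_def intro: fam_add continuous_intros)
  fix F assume F: "testf U F"
  have "\<forall>\<^sub>F l in at_right 0. (\<integral>x. F x * u l x \<partial>lborel) + (\<integral>x. F x * u' l x \<partial>lborel) = (\<integral>x. F x * (u l x + u' l x) \<partial>lborel)"
    using eventually_at_right_0_pos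
  proof eventually_elim
    case (elim l)
    then have "integrable lborel (\<lambda>x. F x * u l x)" "integrable lborel (\<lambda>x. F x * u' l x)"
      using assms by (auto intro!: testf_integrable[OF F] simp: wlim_def fam_def)
    then show ?case by (simp add: distrib_left)
  qed
  moreover have "(\<integral>x. F x * (v x + v' x) \<partial>lborel) = (\<integral>x. F x * v x \<partial>lborel) + (\<integral>x. F x * v' x \<partial>lborel)"
    using assms testf_integrable[OF F] by (simp add: wlim_def distrib_left)
  moreover have "((\<lambda>l. (\<integral>x. F x * u l x \<partial>lborel) + (\<integral>x. F x * u' l x \<partial>lborel)) \<longlongrightarrow>
      (\<integral>x. F x * v x \<partial>lborel) + (\<integral>x. F x * v' x \<partial>lborel)) (at_right 0)"
    using assms F by (auto simp: wlim_def intro: tendsto_add)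
  ultimately show "((\<lambda>l. \<integral>x. F x * (u l x + u' l x) \<partial>lborel) \<longlongrightarrow> (\<integral>x. F x * (v x + v' x) \<partial>lborel)) (at_right 0)"
    using Lim_transform_eventually by fastforce
qed

text \<open>The factor is absorbed into the test function, which has to stay smooth.\<close>

lemma wlim_mult_smooth:
  assumes "open U" "smooth_on U \<phi>" "wlim U u v"
  shows "wlim U (\<lambda>l x. \<phi> x * u l x) (\<lambda>x. \<phi> x * v x)"
  unfolding wlim_def
proof (intro conjI allI impI)
  note c = smooth_on_continuous[OF assms(2)]
  show "fam U (\<lambda>l x. \<phi> x * u l x)" "continuous_on U (\<lambda>x. \<phi> x * v x)"
    using assms(3) c by (auto simp: wlim_def intro: fam_mult fam_const continuous_intros)
  fix F assume "testf U F"
  then have "testf U (\<lambda>x. F x * \<phi> x)" by (rule testf_mult[OF assms(1) _ assms(2)])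
  then show "((\<lambda>l. \<integral>x. F x * (\<phi> x * u l x) \<partial>lborel) \<longlongrightarrow> (\<integral>x. F x * (\<phi> x * v x) \<partial>lborel)) (at_right 0)"
    using assms(3) by (simp add: wlim_def mult.assoc[symmetric])
qed

lemma wlim_cmult: "open U \<Longrightarrow> wlim U u v \<Longrightarrow> wlim U (\<lambda>l x. c * u l x) (\<lambda>x. c * v x)"
  by (rule wlim_mult_smooth[OF _ smooth_on_const])

lemma wlim_diff:
  "open U \<Longrightarrow> wlim U u v \<Longrightarrow> wlim U u' v' \<Longrightarrow> wlim U (\<lambda>l x. u l x - u' l x) (\<lambda>x. v x - v' x)"
  using wlim_add[of U u v "\<lambda>l x. -1 * u' l x" "\<lambda>x. -1 * v' x"] wlim_cmult[of U u' v' "-1"] by simp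

lemma wlim_const: "continuous_on U v \<Longrightarrow> wlim U (\<lambda>l. v) v"
  by (simp add: wlim_def fam_def)

lemma wlim_sum: "(\<And>i. i \<in> I \<Longrightarrow> wlim U (u i) (v i)) \<Longrightarrow> wlim U (\<lambda>l x. \<Sum>i\<in>I. u i l x) (\<lambda>x. \<Sum>i\<in>I. v i x)"
  by (induction I rule: infinite_finite_induct) (auto intro: wlim_const wlim_add)

lemma wlim_null:
  assumes "null_fam U u"
  shows "wlim U u (\<lambda>x. 0)"
  unfolding wlim_def
proof (intro conjI allI impI)
  show u: "fam U u" using assms by (simp add: null_fam_def)
  fix F assume F: "testf U F"
  then obtain K where K: "compact K" "K \<subseteq> U" "\<And>x. x \<notin> K \<Longrightarrow> F x = 0" "smooth_on UNIV F"
    by (auto simp: testf_def)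
  have Fi: "integrable lborel (\<lambda>x. \<bar>F x\<bar>)"
    using testf_integrable[OF F, of "\<lambda>_. 1"] by (intro integrable_abs) simp
  \<comment> \<open>The added 1 keeps \<open>B\<close> positive even if \<open>F\<close> is zero, so
    that \<open>e / (2 * B)\<close> is a legitimate tolerance.\<close>
  define B where "B = (\<integral>x. \<bar>F x\<bar> \<partial>lborel) + 1"
  have B: "B > 0" by (simp add: B_def add_nonneg_pos)
  show "((\<lambda>l. \<integral>x. F x * u l x \<partial>lborel) \<longlongrightarrow> (\<integral>x. F x * 0 \<partial>lborel)) (at_right 0)"
    unfolding mult_zero_right lebesgue_integral_const tendsto_iff
  proof (intro allI impI)
    fix e :: real assume e: "e > 0"
    from null_famD[OF assms K(1,2), of "e / (2 * B)"] eventually_at_right_0_pos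
    show "\<forall>\<^sub>F l in at_right 0. dist (\<integral>x. F x * u l x \<partial>lborel) (measure lborel (space lborel) *\<^sub>R 0) < e"
    proof (rule eventually_elim2)
      show "0 < e / (2 * B)" using e B by simp
    next
      fix l :: real assume l: "l > 0" and le: "\<forall>x\<in>K. \<bar>u l x\<bar> \<le> e / (2 * B)"
      have "\<bar>\<integral>x. F x * u l x \<partial>lborel\<bar> \<le> (\<integral>x. \<bar>F x * u l x\<bar> \<partial>lborel)"
        by (rule integral_abs_bound)
      also have "\<dots> \<le> (\<integral>x. \<bar>F x\<bar> * (e / (2 * B)) \<partial>lborel)"
      proof (rule integral_mono)
        show "integrable lborel (\<lambda>x. \<bar>F x * u l x\<bar>)"
          using testf_integrable[OF F] u l by (intro integrable_abs) (simp add: fam_def)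
        show "\<bar>F x * u l x\<bar> \<le> \<bar>F x\<bar> * (e / (2 * B))" for x
          using le K(3)[of x] mult_left_mono[of "\<bar>u l x\<bar>" "e / (2 * B)" "\<bar>F x\<bar>"]
          by (cases "x \<in> K") (auto simp: abs_mult)
      qed (use Fi in simp)
      also have "\<dots> = (B - 1) * (e / (2 * B))" by (simp add: B_def)
      also have "\<dots> < e" using e B by (simp add: field_simps add_pos_pos)
      finally show "dist (\<integral>x. F x * u l x \<partial>lborel) (measure lborel (space lborel) *\<^sub>R 0) < e" by simp
    qed
  qed
qed simp

lemma wlim_add_null:
  "wlim U u v \<Longrightarrow> null_fam U w \<Longrightarrow> wlim U (\<lambda>l x. u l x + w l x) v"
  using wlim_add[of U u v w "\<lambda>x. 0"] wlim_null[of U w] by simp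

lemma wlim_null_cong:
  assumes "wlim U u v" "null_fam U (\<lambda>l x. u' l x - u l x)"
  shows "wlim U u' v"
  using wlim_add_null[OF assms] by simp

text \<open>Integration by parts moves the derivative to the test function, so weak convergence
  passes to derivatives without any bound on them. This is how terms linear in second derivatives of
  the metric are controlled.\<close>

lemma wlim_partial:
  assumes "open U" "\<And>l. l > 0 \<Longrightarrow> smooth_on U (u l)" "smooth_on U v" "wlim U u v"
  shows "wlim U (\<lambda>l x. partial i (u l) x) (partial i v)"
  unfolding wlim_def
proof (intro conjI allI impI)
  show "fam U (\<lambda>l x. partial i (u l) x)" "continuous_on U (partial i v)"
    using assms(2,3) by (auto simp: fam_def intro: smooth_on_continuous smooth_on_partial)
  fix F assume F: "testf U F"
  have "((\<lambda>l. - (\<integral>x. partial i F x * u l x \<partial>lborel)) \<longlongrightarrow> - (\<integral>x. partial i F x * v x \<partial>lborel)) (at_right 0)"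
    using assms(4) testf_partial[OF F] by (auto simp: wlim_def intro: tendsto_minus)
  moreover have "\<forall>\<^sub>F l in at_right 0. - (\<integral>x. partial i F x * u l x \<partial>lborel) = (\<integral>x. F x * partial i (u l) x \<partial>lborel)"
    using eventually_at_right_0_pos
    by eventually_elim (use integral_by_parts[OF assms(1) F] assms(2) in auto)
  ultimately show "((\<lambda>l. \<integral>x. F x * partial i (u l) x \<partial>lborel) \<longlongrightarrow> (\<integral>x. F x * partial i v x \<partial>lborel)) (at_right 0)"
    using Lim_transform_eventually integral_by_parts[OF assms(1) F assms(3)] by fastforce
qed

lemma wlim_partial_null:
  assumes "open U" "\<And>l. l > 0 \<Longrightarrow> smooth_on U (u l)" "null_fam U u"
  shows "wlim U (\<lambda>l x. partial i (u l) x) (\<lambda>x. 0)"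
  using wlim_partial[OF assms(1,2) smooth_on_const wlim_null[OF assms(3)], of i]
  by (rule wlim_cong[rotated 2]) auto

text \<open>The product \<open>u * v\<close> is null, so its derivative tends weakly to zero, and
  the two terms of the product rule have opposite weak limits.\<close>

lemma wlim_parts:
  assumes "open U" "\<And>l. l > 0 \<Longrightarrow> smooth_on U (u l)" "\<And>l. l > 0 \<Longrightarrow> smooth_on U (v l)"
    "null_fam U u" "bdd_fam U v" "wlim U (\<lambda>l x. partial i (u l) x * v l x) w"
  shows "wlim U (\<lambda>l x. u l x * partial i (v l) x) (\<lambda>x. - w x)"
proof -
  have "wlim U (\<lambda>l x. partial i (\<lambda>x. u l x * v l x) x) (\<lambda>x. 0)"
    using assms by (intro wlim_partial_null smooth_on_mult null_fam_mult_bdd) auto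
  from wlim_diff[OF assms(1) this assms(6)]
  show ?thesis
  proof (rule wlim_cong[rotated 2])
    fix l :: real and x assume "l > 0" "x \<in> U"
    then have "u l differentiable (at x)" "v l differentiable (at x)"
      using assms(1-3) smooth_on_differentiable by blast+
    then show "partial i (\<lambda>x. u l x * v l x) x - partial i (u l) x * v l x = u l x * partial i (v l) x"
      by (simp add: partial_mult)
  qed simp
qed

lemma wlim_unique:
  assumes "open U" "wlim U u v" "wlim U u v'" "x \<in> U"
  shows "v x = v' x"
proof -
  have "v x - v' x = 0"
  proof (rule test_integral_eq_0[OF assms(1)])
    show c: "continuous_on U (\<lambda>x. v x - v' x)" using assms by (auto simp: wlim_def intro: continuous_intros)
    fix F assume F: "testf U F"
    have "(\<integral>x. F x * v x \<partial>lborel) = (\<integral>x. F x * v' x \<partial>lborel)"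
      using assms(2,3) F tendsto_unique[OF trivial_limit_at_right_real] unfolding wlim_def by blast
    then show "(\<integral>x. F x * (v x - v' x) \<partial>lborel) = 0"
      using assms testf_integrable[OF F] by (simp add: wlim_def right_diff_distrib)
  qed (rule assms)
  then show ?thesis by simp
qed

subsection \<open>Contractions\<close>

text \<open>These contractions take a bare matrix \<open>p\<close>, so that the index algebra can be
  done at one point, without charts; \<open>contract2\<close> and \<open>contract3\<close> reduce to
  \<open>ct2\<close> and \<open>ct3\<close> with \<open>p\<close> the inverse metric.\<close>

definition ct1 :: "(4 \<Rightarrow> 4 \<Rightarrow> real) \<Rightarrow> (4 \<Rightarrow> 4 \<Rightarrow> real) \<Rightarrow> real" where
  "ct1 p F = (\<Sum>c\<in>UNIV. \<Sum>c'\<in>UNIV. p c c' * F c c')"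

definition ct2 :: "(4 \<Rightarrow> 4 \<Rightarrow> real) \<Rightarrow> (4 \<Rightarrow> 4 \<Rightarrow> 4 \<Rightarrow> 4 \<Rightarrow> real) \<Rightarrow> real" where
  "ct2 p F = (\<Sum>c\<in>UNIV. \<Sum>c'\<in>UNIV. \<Sum>d\<in>UNIV. \<Sum>d'\<in>UNIV. p c c' * p d d' * F c c' d d')"

definition ct3 :: "(4 \<Rightarrow> 4 \<Rightarrow> real) \<Rightarrow> (4 \<Rightarrow> 4 \<Rightarrow> 4 \<Rightarrow> 4 \<Rightarrow> 4 \<Rightarrow> 4 \<Rightarrow> real) \<Rightarrow> real" where
  "ct3 p F = (\<Sum>c\<in>UNIV. \<Sum>c'\<in>UNIV. \<Sum>d\<in>UNIV. \<Sum>d'\<in>UNIV. \<Sum>e\<in>UNIV. \<Sum>e'\<in>UNIV.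
     p c c' * p d d' * p e e' * F c c' d d' e e')"

lemma ct2_nested: "ct2 p F = ct1 p (\<lambda>c c'. ct1 p (F c c'))"
  by (simp add: ct2_def ct1_def sum_distrib_left mult.assoc)

lemma ct3_nested: "ct3 p F = ct1 p (\<lambda>c c'. ct2 p (F c c'))"
  by (simp add: ct3_def ct2_def ct1_def sum_distrib_left mult.assoc)

lemma ct1_add: "ct1 p (\<lambda>c c'. F c c' + G c c') = ct1 p F + ct1 p G"
  and ct1_diff: "ct1 p (\<lambda>c c'. F c c' - G c c') = ct1 p F - ct1 p G"
  and ct1_cmult: "ct1 p (\<lambda>c c'. k * F c c') = k * ct1 p F"
  by (simp_all add: ct1_def sum.distrib sum_subtractf sum_distrib_left algebra_simps)

lemma ct2_add: "ct2 p (\<lambda>c c' d d'. F c c' d d' + G c c' d d') = ct2 p F + ct2 p G"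
  and ct2_diff: "ct2 p (\<lambda>c c' d d'. F c c' d d' - G c c' d d') = ct2 p F - ct2 p G"
  and ct2_cmult: "ct2 p (\<lambda>c c' d d'. k * F c c' d d') = k * ct2 p F"
  by (simp_all add: ct2_nested ct1_add ct1_diff ct1_cmult)

lemma ct3_add: "ct3 p (\<lambda>c c' d d' e e'. F c c' d d' e e' + G c c' d d' e e') = ct3 p F + ct3 p G"
  and ct3_diff: "ct3 p (\<lambda>c c' d d' e e'. F c c' d d' e e' - G c c' d d' e e') = ct3 p F - ct3 p G"
  and ct3_cmult: "ct3 p (\<lambda>c c' d d' e e'. k * F c c' d d' e e') = k * ct3 p F"
  by (simp_all add: ct3_nested ct2_add ct2_diff ct2_cmult ct1_add ct1_diff ct1_cmult)

lemma ct1_swap: "ct1 p (\<lambda>c c'. ct1 p (\<lambda>d d'. F c c' d d')) = ct1 p (\<lambda>d d'. ct1 p (\<lambda>c c'. F c c' d d'))"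
proof -
  have "ct1 p (\<lambda>c c'. ct1 p (\<lambda>d d'. F c c' d d')) =
      (\<Sum>c\<in>UNIV. \<Sum>c'\<in>UNIV. \<Sum>d\<in>UNIV. \<Sum>d'\<in>UNIV. p c c' * (p d d' * F c c' d d'))"
    by (simp add: ct1_def sum_distrib_left)
  also have "\<dots> = (\<Sum>c\<in>UNIV. \<Sum>d\<in>UNIV. \<Sum>c'\<in>UNIV. \<Sum>d'\<in>UNIV. p c c' * (p d d' * F c c' d d'))"
    by (rule sum.cong[OF refl]) (rule sum.swap)
  also have "\<dots> = (\<Sum>d\<in>UNIV. \<Sum>c\<in>UNIV. \<Sum>c'\<in>UNIV. \<Sum>d'\<in>UNIV. p c c' * (p d d' * F c c' d d'))"
    by (rule sum.swap)
  also have "\<dots> = (\<Sum>d\<in>UNIV. \<Sum>c\<in>UNIV. \<Sum>d'\<in>UNIV. \<Sum>c'\<in>UNIV. p c c' * (p d d' * F c c' d d'))"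
    by (rule sum.cong[OF refl], rule sum.cong[OF refl], rule sum.swap)
  also have "\<dots> = (\<Sum>d\<in>UNIV. \<Sum>d'\<in>UNIV. \<Sum>c\<in>UNIV. \<Sum>c'\<in>UNIV. p c c' * (p d d' * F c c' d d'))"
    by (rule sum.cong[OF refl]) (rule sum.swap)
  also have "\<dots> = ct1 p (\<lambda>d d'. ct1 p (\<lambda>c c'. F c c' d d'))"
    by (simp add: ct1_def sum_distrib_left mult.left_commute)
  finally show ?thesis .
qed

lemma ct1_flip:
  assumes "\<And>a b. p a b = p b a"
  shows "ct1 p (\<lambda>c c'. F c' c) = ct1 p F"
proof -
  have "ct1 p (\<lambda>c c'. F c' c) = (\<Sum>c\<in>UNIV. \<Sum>c'\<in>UNIV. p c' c * F c' c)"
    by (simp add: ct1_def assms)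
  also have "\<dots> = ct1 p F" unfolding ct1_def by (rule sum.swap)
  finally show ?thesis .
qed

lemma ct2_swap: "ct2 p (\<lambda>c c' d d'. F d d' c c') = ct2 p F"
  using ct1_swap[of p "\<lambda>c c' d d'. F d d' c c'"] by (simp add: ct2_nested)

lemma ct2_flip:
  assumes "\<And>a b. p a b = p b a"
  shows "ct2 p (\<lambda>c c' d d'. F c' c d d') = ct2 p F" "ct2 p (\<lambda>c c' d d'. F c c' d' d) = ct2 p F"
proof -
  show "ct2 p (\<lambda>c c' d d'. F c' c d d') = ct2 p F"
    unfolding ct2_nested by (rule ct1_flip[where p = p and F = "\<lambda>c c'. ct1 p (F c c')", OF assms])
  have "ct1 p (\<lambda>d d'. F c c' d' d) = ct1 p (F c c')" for c c'
    by (rule ct1_flip[where p = p, OF assms])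
  then show "ct2 p (\<lambda>c c' d d'. F c c' d' d) = ct2 p F"
    by (simp only: ct2_nested)
qed

lemma ct3_swap12: "ct3 p (\<lambda>c c' d d' e e'. F d d' c c' e e') = ct3 p F"
  using ct1_swap[of p "\<lambda>c c' d d'. ct1 p (F d d' c c')"] by (simp add: ct3_nested ct2_nested)

lemma ct3_swap23: "ct3 p (\<lambda>c c' d d' e e'. F c c' e e' d d') = ct3 p F"
proof -
  have "ct2 p (\<lambda>d d' e e'. F c c' e e' d d') = ct2 p (F c c')" for c c' by (rule ct2_swap)
  then show ?thesis by (simp only: ct3_nested)
qed

lemma ct3_flip:
  assumes "\<And>a b. p a b = p b a"
  shows "ct3 p (\<lambda>c c' d d' e e'. F c' c d d' e e') = ct3 p F"
    "ct3 p (\<lambda>c c' d d' e e'. F c c' d' d e e') = ct3 p F"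
    "ct3 p (\<lambda>c c' d d' e e'. F c c' d d' e' e) = ct3 p F"
proof -
  show "ct3 p (\<lambda>c c' d d' e e'. F c' c d d' e e') = ct3 p F"
    unfolding ct3_nested by (rule ct1_flip[where p = p and F = "\<lambda>c c'. ct2 p (F c c')", OF assms])
  have "ct2 p (\<lambda>d d' e e'. F c c' d' d e e') = ct2 p (F c c')"
    "ct2 p (\<lambda>d d' e e'. F c c' d d' e' e) = ct2 p (F c c')" for c c'
    by (rule ct2_flip[where p = p, OF assms])+
  then show "ct3 p (\<lambda>c c' d d' e e'. F c c' d' d e e') = ct3 p F"
    "ct3 p (\<lambda>c c' d d' e e'. F c c' d d' e' e) = ct3 p F"
    by (simp_all only: ct3_nested)
qed

text \<open>Symmetrisation over the relabelings of the dummy indices turns an identity between contractions into an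
  identity between polynomials.\<close>

definition sym2 :: "(4 \<Rightarrow> 4 \<Rightarrow> 4 \<Rightarrow> 4 \<Rightarrow> real) \<Rightarrow> 4 \<Rightarrow> 4 \<Rightarrow> 4 \<Rightarrow> 4 \<Rightarrow> real" where
  "sym2 F c c' d d' = F c c' d d' + F c' c d d' + F c c' d' d + F c' c d' d
     + (F d d' c c' + F d' d c c' + F d d' c' c + F d' d c' c)"

lemma ct2_eqI:
  assumes p: "\<And>a b. p a b = p b a" and eq: "\<And>c c' d d'. sym2 F c c' d d' = sym2 G c c' d d'"
  shows "ct2 p F = ct2 p G"
proof -
  \<comment> \<open>The relabelings that preserve a double contraction with symmetric
    \<open>p\<close> are generated by the two flips within the pairs and the exchange of the pairs;
    there are 8 of them.\<close>
  have sym: "ct2 p (sym2 F) = 8 * ct2 p F" for F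
  proof -
    define F' where "F' c c' d d' = F c c' d d' + F c' c d d' + F c c' d' d + F c' c d' d" for c c' d d'
    have "ct2 p F' = 4 * ct2 p F"
      unfolding F'_def
      using ct2_flip[where p = p, OF p, of F] ct2_flip(1)[where p = p, OF p, of "\<lambda>c c' d d'. F c c' d' d"]
      by (simp add: ct2_add)
    moreover have "ct2 p (\<lambda>c c' d d'. F' d d' c c') = ct2 p F'" by (rule ct2_swap)
    moreover have "sym2 F = (\<lambda>c c' d d'. F' c c' d d' + F' d d' c c')"
      by (simp add: sym2_def F'_def fun_eq_iff)
    ultimately show ?thesis by (simp add: ct2_add)
  qed
  have "sym2 F = sym2 G" using eq by (simp add: fun_eq_iff)
  then show ?thesis using sym[of F] sym[of G] by simp
qed

text \<open>The shape of the products of Christoffel symbols in the Ricci tensor: the upper index of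
  each factor is a lower index of the other, so raising both indices gives a double
  contraction.\<close>

lemma sum_product_ct2:
  "(\<Sum>n\<in>UNIV. \<Sum>k\<in>UNIV. ((1/2) * (\<Sum>m\<in>UNIV. p k m * Y n k m)) * ((1/2) * (\<Sum>m\<in>UNIV. p n m * Z n k m)))
    = (1/4) * ct2 p (\<lambda>k m n m'. Y n k m * Z n k m')"
proof -
  have "(\<Sum>n\<in>UNIV. \<Sum>k\<in>UNIV. ((1/2) * (\<Sum>m\<in>UNIV. p k m * Y n k m)) * ((1/2) * (\<Sum>m\<in>UNIV. p n m * Z n k m)))
    = (1/4) * (\<Sum>n\<in>UNIV. \<Sum>k\<in>UNIV. \<Sum>m\<in>UNIV. \<Sum>m'\<in>UNIV. p k m * p n m' * (Y n k m * Z n k m'))"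
    by (simp add: sum_product sum_distrib_left mult_ac)
  also have "(\<Sum>n\<in>UNIV. \<Sum>k\<in>UNIV. \<Sum>m\<in>UNIV. \<Sum>m'\<in>UNIV. p k m * p n m' * (Y n k m * Z n k m')) =
    (\<Sum>k\<in>UNIV. \<Sum>n\<in>UNIV. \<Sum>m\<in>UNIV. \<Sum>m'\<in>UNIV. p k m * p n m' * (Y n k m * Z n k m'))"
    by (rule sum.swap)
  also have "\<dots> = (\<Sum>k\<in>UNIV. \<Sum>m\<in>UNIV. \<Sum>n\<in>UNIV. \<Sum>m'\<in>UNIV. p k m * p n m' * (Y n k m * Z n k m'))"
    by (rule sum.cong[OF refl]) (rule sum.swap)
  finally show ?thesis by (simp add: ct2_def)
qed

lemma sum_permute:
  fixes Y :: "4 \<Rightarrow> 4 \<Rightarrow> 4 \<Rightarrow> 4 \<Rightarrow> 4 \<Rightarrow> real"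
  shows "(\<Sum>d\<in>UNIV. \<Sum>n\<in>UNIV. \<Sum>e\<in>UNIV. \<Sum>f\<in>UNIV. \<Sum>m\<in>UNIV. Y d n e f m) =
    (\<Sum>e\<in>UNIV. \<Sum>d\<in>UNIV. \<Sum>f\<in>UNIV. \<Sum>n\<in>UNIV. \<Sum>m\<in>UNIV. Y d n e f m)"
proof -
  have "(\<Sum>d\<in>UNIV. \<Sum>n\<in>UNIV. \<Sum>e\<in>UNIV. \<Sum>f\<in>UNIV. \<Sum>m\<in>UNIV. Y d n e f m) =
    (\<Sum>d\<in>UNIV. \<Sum>e\<in>UNIV. \<Sum>n\<in>UNIV. \<Sum>f\<in>UNIV. \<Sum>m\<in>UNIV. Y d n e f m)"
    by (rule sum.cong[OF refl]) (rule sum.swap)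
  also have "\<dots> = (\<Sum>d\<in>UNIV. \<Sum>e\<in>UNIV. \<Sum>f\<in>UNIV. \<Sum>n\<in>UNIV. \<Sum>m\<in>UNIV. Y d n e f m)"
    by (rule sum.cong[OF refl], rule sum.cong[OF refl], rule sum.swap)
  finally show ?thesis by (simp add: sum.swap[of "\<lambda>d e. \<Sum>f\<in>UNIV. \<Sum>n\<in>UNIV. \<Sum>m\<in>UNIV. Y d n e f m"])
qed

subsection \<open>The quadratic part of the Einstein tensor\<close>

text \<open>\<open>D a b c\<close> stands for \<open>\<partial>\<^sub>a h\<^bsub>bc\<^esub>\<close>, \<open>p\<close> and \<open>g\<close> for the inverse background metric and the background metric.
  \<open>qchr\<close>, \<open>qricci\<close> are the leading parts of the difference of the Christoffel symbols and of the products of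
  Christoffel symbols in the Ricci tensor, \<open>qgrad n a b c d\<close> that of the derivative of \<open>g\<^bsub>ab\<^esub> g\<^bsup>cd\<^esup>\<close>.\<close>

definition qchr :: "(4 \<Rightarrow> 4 \<Rightarrow> real) \<Rightarrow> (4 \<Rightarrow> 4 \<Rightarrow> 4 \<Rightarrow> real) \<Rightarrow> 4 \<Rightarrow> 4 \<Rightarrow> 4 \<Rightarrow> real" where
  "qchr p D k i j = (1/2) * (\<Sum>m\<in>UNIV. p k m * (D i j m + D j i m - D m i j))"

definition qricci :: "(4 \<Rightarrow> 4 \<Rightarrow> real) \<Rightarrow> (4 \<Rightarrow> 4 \<Rightarrow> 4 \<Rightarrow> real) \<Rightarrow> 4 \<Rightarrow> 4 \<Rightarrow> real" where
  "qricci p D a b = (\<Sum>n\<in>UNIV. \<Sum>k\<in>UNIV. qchr p D k a b * qchr p D n k n - qchr p D k n b * qchr p D n k a)"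

definition qgrad :: "(4 \<Rightarrow> 4 \<Rightarrow> real) \<Rightarrow> (4 \<Rightarrow> 4 \<Rightarrow> real) \<Rightarrow> (4 \<Rightarrow> 4 \<Rightarrow> 4 \<Rightarrow> real) \<Rightarrow> 4 \<Rightarrow> 4 \<Rightarrow> 4 \<Rightarrow> 4 \<Rightarrow> 4 \<Rightarrow> real" where
  "qgrad g p D n a b c d = D n a b * p c d - g a b * (\<Sum>e\<in>UNIV. \<Sum>f\<in>UNIV. p c e * D n e f * p f d)"

text \<open>What integration by parts leaves of the variation of
  \<open>g\<^sub>a\<^sub>b g\<^sup>c\<^sup>d\<close> times \<open>R\<^sub>c\<^sub>d\<close>: each
  derivative of a Christoffel symbol is replaced by minus the derivative of the coefficient times
  the symbol. The sign of each product is therefore opposite to that of its counterpart in the Ricci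
  tensor.\<close>

definition qparts :: "(4 \<Rightarrow> 4 \<Rightarrow> real) \<Rightarrow> (4 \<Rightarrow> 4 \<Rightarrow> real) \<Rightarrow> (4 \<Rightarrow> 4 \<Rightarrow> 4 \<Rightarrow> real) \<Rightarrow> 4 \<Rightarrow> 4 \<Rightarrow> 4 \<Rightarrow> 4 \<Rightarrow> real" where
  "qparts g p D a b c d = (\<Sum>n\<in>UNIV. qgrad g p D c a b c d * qchr p D n n d - qgrad g p D n a b c d * qchr p D n c d)"

text \<open>In the first trace term the coefficient of the Ricci tensor is frozen at the background;
  its variation is accounted for by \<open>qparts\<close>.\<close>

definition qeinstein :: "(4 \<Rightarrow> 4 \<Rightarrow> real) \<Rightarrow> (4 \<Rightarrow> 4 \<Rightarrow> real) \<Rightarrow> (4 \<Rightarrow> 4 \<Rightarrow> 4 \<Rightarrow> real) \<Rightarrow> 4 \<Rightarrow> 4 \<Rightarrow> real" where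
  "qeinstein g p D a b = qricci p D a b
     - (1/2) * (\<Sum>c\<in>UNIV. \<Sum>d\<in>UNIV. g a b * p c d * qricci p D c d)
     - (1/2) * (\<Sum>c\<in>UNIV. \<Sum>d\<in>UNIV. qparts g p D a b c d)"

context
  fixes p :: "4 \<Rightarrow> 4 \<Rightarrow> real" and D :: "4 \<Rightarrow> 4 \<Rightarrow> 4 \<Rightarrow> real"
  assumes p: "\<And>a b. p a b = p b a" and D: "\<And>a b c. D a b c = D a c b"
begin

text \<open>Expansion of the two products of Christoffel symbols, collected modulo relabeling of
  dummy indices and the symmetry of \<open>D\<close> in its last two. The surviving products are
  kept in the form in which they occur in the formula for the effective stress tensor.\<close>

lemma qricci_eq:
  "qricci p D a b =
     (1/2) * ct2 p (\<lambda>c c' d d'. (1/2) * (D a b c' * D c d d' + D b a c' * D c d d'))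
   - (1/4) * ct2 p (\<lambda>c c' d d'. D c a b * D c' d d')
   - (1/2) * ct2 p (\<lambda>c c' d d'. D d a c' * D c b d')
   + (1/2) * ct2 p (\<lambda>c c' d d'. D c a d * D c' b d')
   - (1/4) * ct2 p (\<lambda>c c' d d'. D a c d * D b c' d')"
proof -
  have "qricci p D a b =
      (1/4) * ct2 p (\<lambda>k m n m'. (D a b m + D b a m - D m a b) * (D k n m' + D n k m' - D m' k n))
    - (1/4) * ct2 p (\<lambda>k m n m'. (D n b m + D b n m - D m n b) * (D k a m' + D a k m' - D m' k a))"
    unfolding qricci_def sum_subtractf qchr_def sum_product_ct2 ..
  also have "\<dots> = ct2 p (\<lambda>k m n m'. (1/4) * ((D a b m + D b a m - D m a b) * (D k n m' + D n k m' - D m' k n))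
      - (1/4) * ((D n b m + D b n m - D m n b) * (D k a m' + D a k m' - D m' k a)))"
    by (simp only: ct2_diff ct2_cmult)
  also have "\<dots> = ct2 p (\<lambda>c c' d d'. (1/2) * ((1/2) * (D a b c' * D c d d' + D b a c' * D c d d'))
      - (1/4) * (D c a b * D c' d d') - (1/2) * (D d a c' * D c b d') + (1/2) * (D c a d * D c' b d')
      - (1/4) * (D a c d * D b c' d'))"
  proof (rule ct2_eqI[where p = p, OF p])
    show "sym2 (\<lambda>k m n m'. (1/4) * ((D a b m + D b a m - D m a b) * (D k n m' + D n k m' - D m' k n))
      - (1/4) * ((D n b m + D b n m - D m n b) * (D k a m' + D a k m' - D m' k a))) c c' d d' =
     sym2 (\<lambda>c c' d d'. (1/2) * ((1/2) * (D a b c' * D c d d' + D b a c' * D c d d'))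
      - (1/4) * (D c a b * D c' d d') - (1/2) * (D d a c' * D c b d') + (1/2) * (D c a d * D c' b d')
      - (1/4) * (D a c d * D b c' d')) c c' d d'" for c c' d d'
      \<comment> \<open>Each listed instance sorts the last two indices of \<open>D\<close> into a
        fixed order; afterwards the identity is one between polynomials in commuting reals.\<close>
      unfolding sym2_def D[of _ c b] D[of _ c' b] D[of _ d b] D[of _ d' b] D[of _ c a] D[of _ c' a] D[of _ d a] D[of _ d' a]
        D[of _ b a] D[of _ c' c] D[of _ d c] D[of _ d' c] D[of _ d c'] D[of _ d' c'] D[of _ d' d] by (simp add: algebra_simps)
  qed
  also have "\<dots> = (1/2) * ct2 p (\<lambda>c c' d d'. (1/2) * (D a b c' * D c d d' + D b a c' * D c d d'))
   - (1/4) * ct2 p (\<lambda>c c' d d'. D c a b * D c' d d')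
   - (1/2) * ct2 p (\<lambda>c c' d d'. D d a c' * D c b d')
   + (1/2) * ct2 p (\<lambda>c c' d d'. D c a d * D c' b d')
   - (1/4) * ct2 p (\<lambda>c c' d d'. D a c d * D b c' d')"
    by (simp only: ct2_diff ct2_add ct2_cmult)
  finally show ?thesis .
qed

text \<open>Under the trace the terms \<open>D c a d * D c' b d'\<close> and
  \<open>D a c d * D b c' d'\<close> both become the full square of \<open>D\<close>, and their
  coefficients 1/2 and -1/4 add up to 1/4. The two halves of the symmetrised term also
  coincide.\<close>

lemma ct1_qricci:
  "ct1 p (qricci p D) =
     (1/2) * ct3 p (\<lambda>c c' d d' e e'. D c c' d' * D d e e')
   - (1/4) * ct3 p (\<lambda>c c' d d' e e'. D c d d' * D c' e e')
   - (1/2) * ct3 p (\<lambda>c c' d d' e e'. D d c' e * D c d' e')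
   + (1/4) * ct3 p (\<lambda>c c' d d' e e'. D c d e * D c' d' e')"
proof -
  have "ct1 p (qricci p D) = 
     (1/4) * (ct3 p (\<lambda>a b c c' d d'. D a b c' * D c d d') + ct3 p (\<lambda>a b c c' d d'. D b a c' * D c d d'))
   - (1/4) * ct3 p (\<lambda>a b c c' d d'. D c a b * D c' d d')
   - (1/2) * ct3 p (\<lambda>a b c c' d d'. D d a c' * D c b d')
   + (1/2) * ct3 p (\<lambda>a b c c' d d'. D c a d * D c' b d')
   - (1/4) * ct3 p (\<lambda>a b c c' d d'. D a c d * D b c' d')"
    unfolding qricci_eq[abs_def]
    by (simp only: ct1_add ct1_diff ct1_cmult ct2_add ct2_cmult ct3_nested)
  moreover have "ct3 p (\<lambda>a b c c' d d'. D b a c' * D c d d') = ct3 p (\<lambda>c c' d d' e e'. D c c' d' * D d e e')"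
    using ct3_flip(1)[where p = p, OF p, of "\<lambda>c c' d d' e e'. D c c' d' * D d e e'"] by simp
  moreover have "ct3 p (\<lambda>a b c c' d d'. D c a b * D c' d d') = ct3 p (\<lambda>c c' d d' e e'. D c d d' * D c' e e')"
    using ct3_swap12[of p "\<lambda>c c' d d' e e'. D c d d' * D c' e e'"] by simp
  moreover have "ct3 p (\<lambda>a b c c' d d'. D d a c' * D c b d') = ct3 p (\<lambda>c c' d d' e e'. D d c' e * D c d' e')"
  proof -
    have "ct3 p (\<lambda>a b c c' d d'. D d a c' * D c b d') = ct3 p (\<lambda>c c' a b d d'. D d a c' * D c b d')"
      using ct3_swap12[of p "\<lambda>c c' a b d d'. D d a c' * D c b d'"] by simp
    also have "\<dots> = ct3 p (\<lambda>c c' d d' a b. D d a c' * D c b d')"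
      using ct3_swap23[of p "\<lambda>c c' d d' a b. D d a c' * D c b d'"] by simp
    finally show ?thesis using D by simp
  qed
  moreover have "ct3 p (\<lambda>a b c c' d d'. D c a d * D c' b d') = ct3 p (\<lambda>c c' d d' e e'. D c d e * D c' d' e')"
    using ct3_swap12[of p "\<lambda>c c' d d' e e'. D c d e * D c' d' e'"] by simp
  ultimately show ?thesis by simp
qed

text \<open>By the product rule \<open>qgrad\<close> has a part that differentiates
  \<open>g\<^sub>a\<^sub>b\<close> and a part that differentiates the inverse metric. Each meets the
  two kinds of Christoffel terms: the former gives \<open>T1\<close> and \<open>T3\<close>, the
  latter \<open>T2\<close> and \<open>T4\<close>.\<close>

lemma sum_qparts:
  "(\<Sum>c\<in>UNIV. \<Sum>d\<in>UNIV. qparts g p D a b c d) =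
     ct2 p (\<lambda>c c' d d'. D c a b * D c' d d') - ct2 p (\<lambda>c c' d d'. D c a b * D d c' d')
   + g a b * (ct3 p (\<lambda>c c' d d' e e'. D d c' e * D c d' e') - (1/2) * ct3 p (\<lambda>c c' d d' e e'. D c d e * D c' d' e')
     - (1/2) * ct3 p (\<lambda>c c' d d' e e'. D c c' d' * D d e e'))"
proof -
  let ?X = "\<lambda>m i j. D i j m + D j i m - D m i j"
  have T1: "(\<Sum>c\<in>UNIV. \<Sum>d\<in>UNIV. \<Sum>n\<in>UNIV. D n a b * p c d * qchr p D n c d) =
      ct2 p (\<lambda>c c' d d'. D c a b * D d c' d') - (1/2) * ct2 p (\<lambda>c c' d d'. D c a b * D c' d d')"
  proof -
    have "(\<Sum>c\<in>UNIV. \<Sum>d\<in>UNIV. \<Sum>n\<in>UNIV. D n a b * p c d * qchr p D n c d) =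
        (\<Sum>c\<in>UNIV. \<Sum>d\<in>UNIV. \<Sum>n\<in>UNIV. \<Sum>m\<in>UNIV. p c d * p n m * ((1/2) * (D n a b * ?X m c d)))"
      by (simp add: qchr_def sum_distrib_left mult_ac)
    also have "\<dots> = ct2 p (\<lambda>c d n m. (1/2) * (D n a b * ?X m c d))" by (simp add: ct2_def)
    also have "\<dots> = ct2 p (\<lambda>c c' d d'. D c a b * D d c' d' - (1/2) * (D c a b * D c' d d'))"
    proof (rule ct2_eqI[where p = p, OF p])
      show "sym2 (\<lambda>c d n m. (1/2) * (D n a b * ?X m c d)) c c' d d' =
        sym2 (\<lambda>c c' d d'. D c a b * D d c' d' - (1/2) * (D c a b * D c' d d')) c c' d d'" for c c' d d'
        unfolding sym2_def D[of _ c' c] D[of _ d c] D[of _ d' c] D[of _ d c'] D[of _ d' c'] D[of _ d' d]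
        by (simp add: algebra_simps)
    qed
    finally show ?thesis by (simp only: ct2_diff ct2_cmult)
  qed
  \<comment> \<open>In a contracted Christoffel symbol two of the three derivatives cancel under the
    flip of \<open>n\<close> and \<open>m\<close>; the derivative of the trace remains.\<close>
  have T3: "(\<Sum>c\<in>UNIV. \<Sum>d\<in>UNIV. \<Sum>n\<in>UNIV. D c a b * p c d * qchr p D n n d) =
      (1/2) * ct2 p (\<lambda>c c' d d'. D c a b * D c' d d')"
  proof -
    have "(\<Sum>c\<in>UNIV. \<Sum>d\<in>UNIV. \<Sum>n\<in>UNIV. D c a b * p c d * qchr p D n n d) =
        (\<Sum>c\<in>UNIV. \<Sum>d\<in>UNIV. \<Sum>n\<in>UNIV. \<Sum>m\<in>UNIV. p c d * p n m * ((1/2) * (D c a b * ?X m n d)))"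
      by (simp add: qchr_def sum_distrib_left mult_ac)
    also have "\<dots> = ct2 p (\<lambda>c d n m. (1/2) * (D c a b * ?X m n d))" by (simp add: ct2_def)
    also have "\<dots> = ct2 p (\<lambda>c c' d d'. (1/2) * (D c a b * D c' d d'))"
    proof (rule ct2_eqI[where p = p, OF p])
      show "sym2 (\<lambda>c d n m. (1/2) * (D c a b * ?X m n d)) c c' d d' =
        sym2 (\<lambda>c c' d d'. (1/2) * (D c a b * D c' d d')) c c' d d'" for c c' d d'
        unfolding sym2_def D[of _ c' c] D[of _ d c] D[of _ d' c] D[of _ d c'] D[of _ d' c'] D[of _ d' d]
        by (simp add: algebra_simps)
    qed
    finally show ?thesis by (simp only: ct2_cmult)
  qed
  have T2: "(\<Sum>c\<in>UNIV. \<Sum>d\<in>UNIV. \<Sum>n\<in>UNIV. (\<Sum>e\<in>UNIV. \<Sum>f\<in>UNIV. p c e * D n e f * p f d) * qchr p D n c d) =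
      ct3 p (\<lambda>c c' d d' e e'. D d c' e * D c d' e') - (1/2) * ct3 p (\<lambda>c c' d d' e e'. D c d e * D c' d' e')"
  proof -
    have "(\<Sum>c\<in>UNIV. \<Sum>d\<in>UNIV. \<Sum>n\<in>UNIV. (\<Sum>e\<in>UNIV. \<Sum>f\<in>UNIV. p c e * D n e f * p f d) * qchr p D n c d) =
        (\<Sum>c\<in>UNIV. \<Sum>d\<in>UNIV. \<Sum>n\<in>UNIV. \<Sum>e\<in>UNIV. \<Sum>f\<in>UNIV. \<Sum>m\<in>UNIV. p c e * p d f * p n m * ((1/2) * (D n e f * ?X m c d)))"
      unfolding qchr_def sum_distrib_right
      by (simp add: sum_distrib_left sum_divide_distrib p[of _ d for d] mult_ac)
    also have "\<dots> = (\<Sum>c\<in>UNIV. \<Sum>e\<in>UNIV. \<Sum>d\<in>UNIV. \<Sum>f\<in>UNIV. \<Sum>n\<in>UNIV. \<Sum>m\<in>UNIV. p c e * p d f * p n m * ((1/2) * (D n e f * ?X m c d)))"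
    proof (rule sum.cong[OF refl])
      fix c :: 4
      show "(\<Sum>d\<in>UNIV. \<Sum>n\<in>UNIV. \<Sum>e\<in>UNIV. \<Sum>f\<in>UNIV. \<Sum>m\<in>UNIV. p c e * p d f * p n m * ((1/2) * (D n e f * ?X m c d)))
        = (\<Sum>e\<in>UNIV. \<Sum>d\<in>UNIV. \<Sum>f\<in>UNIV. \<Sum>n\<in>UNIV. \<Sum>m\<in>UNIV. p c e * p d f * p n m * ((1/2) * (D n e f * ?X m c d)))"
        by (rule sum_permute)
    qed
    also have "\<dots> = ct3 p (\<lambda>c e d f n m. (1/2) * (D n e f * ?X m c d))" by (simp only: ct3_def)
    also have "\<dots> = (1/2) * ct3 p (\<lambda>c e d f n m. D n e f * D c d m) + (1/2) * ct3 p (\<lambda>c e d f n m. D n e f * D d c m)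
        - (1/2) * ct3 p (\<lambda>c e d f n m. D n e f * D m c d)"
      by (simp only: ct3_add[symmetric] ct3_diff[symmetric] ct3_cmult[symmetric]) (simp add: algebra_simps)
    also have "ct3 p (\<lambda>c e d f n m. D n e f * D d c m) = ct3 p (\<lambda>c e d f n m. D n e f * D c d m)"
      using ct3_swap12[of p "\<lambda>c e d f n m. D n e f * D c d m"] D by simp
    also have "ct3 p (\<lambda>c e d f n m. D n e f * D m c d) = ct3 p (\<lambda>c c' d d' e e'. D c d e * D c' d' e')"
    proof -
      have "ct3 p (\<lambda>c e d f n m. D n e f * D m c d) = ct3 p (\<lambda>e c f d n m. D n e f * D m c d)"
        using ct3_flip(1)[where p = p, OF p, of "\<lambda>e c d f n m. D n e f * D m c d"] ct3_flip(2)[where p = p, OF p, of "\<lambda>e c f d n m. D n e f * D m c d"] by simp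
      also have "\<dots> = ct3 p (\<lambda>e c n m f d. D n e f * D m c d)"
        using ct3_swap23[of p "\<lambda>e c n m f d. D n e f * D m c d"] by simp
      also have "\<dots> = ct3 p (\<lambda>n m e c f d. D n e f * D m c d)"
        using ct3_swap12[of p "\<lambda>n m e c f d. D n e f * D m c d"] by simp
      finally show ?thesis .
    qed
    also have "ct3 p (\<lambda>c e d f n m. D n e f * D c d m) = ct3 p (\<lambda>c c' d d' e e'. D d c' e * D c d' e')"
    proof -
      have "ct3 p (\<lambda>c e d f n m. D n e f * D c d m) = ct3 p (\<lambda>c e n m d f. D n e f * D c d m)"
        using ct3_swap23[of p "\<lambda>c e n m d f. D n e f * D c d m"] by simp
      also have "\<dots> = ct3 p (\<lambda>c e n m f d. D n e f * D c d m)"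
        using ct3_flip(3)[where p = p, OF p, of "\<lambda>c e n m f d. D n e f * D c d m"] by simp
      finally show ?thesis using D by simp
    qed
    finally show ?thesis by simp
  qed
  have T4: "(\<Sum>c\<in>UNIV. \<Sum>d\<in>UNIV. \<Sum>n\<in>UNIV. (\<Sum>e\<in>UNIV. \<Sum>f\<in>UNIV. p c e * D c e f * p f d) * qchr p D n n d) =
      (1/2) * ct3 p (\<lambda>c c' d d' e e'. D c c' d' * D d e e')"
  proof -
    have "(\<Sum>c\<in>UNIV. \<Sum>d\<in>UNIV. \<Sum>n\<in>UNIV. (\<Sum>e\<in>UNIV. \<Sum>f\<in>UNIV. p c e * D c e f * p f d) * qchr p D n n d) =
        (\<Sum>c\<in>UNIV. \<Sum>d\<in>UNIV. \<Sum>n\<in>UNIV. \<Sum>e\<in>UNIV. \<Sum>f\<in>UNIV. \<Sum>m\<in>UNIV. p c e * p d f * p n m * ((1/2) * (D c e f * ?X m n d)))"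
      unfolding qchr_def sum_distrib_right
      by (simp add: sum_distrib_left sum_divide_distrib p[of _ d for d] mult_ac)
    also have "\<dots> = (\<Sum>c\<in>UNIV. \<Sum>e\<in>UNIV. \<Sum>d\<in>UNIV. \<Sum>f\<in>UNIV. \<Sum>n\<in>UNIV. \<Sum>m\<in>UNIV. p c e * p d f * p n m * ((1/2) * (D c e f * ?X m n d)))"
    proof (rule sum.cong[OF refl])
      fix c :: 4
      show "(\<Sum>d\<in>UNIV. \<Sum>n\<in>UNIV. \<Sum>e\<in>UNIV. \<Sum>f\<in>UNIV. \<Sum>m\<in>UNIV. p c e * p d f * p n m * ((1/2) * (D c e f * ?X m n d)))
        = (\<Sum>e\<in>UNIV. \<Sum>d\<in>UNIV. \<Sum>f\<in>UNIV. \<Sum>n\<in>UNIV. \<Sum>m\<in>UNIV. p c e * p d f * p n m * ((1/2) * (D c e f * ?X m n d)))"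
        by (rule sum_permute)
    qed
    also have "\<dots> = ct3 p (\<lambda>c e d f n m. (1/2) * (D c e f * ?X m n d))" by (simp only: ct3_def)
    also have "\<dots> = (1/2) * ct3 p (\<lambda>c e d f n m. D c e f * D n d m) + (1/2) * ct3 p (\<lambda>c e d f n m. D c e f * D d n m)
        - (1/2) * ct3 p (\<lambda>c e d f n m. D c e f * D m n d)"
      by (simp only: ct3_add[symmetric] ct3_diff[symmetric] ct3_cmult[symmetric]) (simp add: algebra_simps)
    also have "ct3 p (\<lambda>c e d f n m. D c e f * D m n d) = ct3 p (\<lambda>c e d f n m. D c e f * D n d m)"
      using ct3_flip(3)[where p = p, OF p, of "\<lambda>c e d f n m. D c e f * D n d m"] D by simp
    finally show ?thesis by simp
  qed
  have "(\<Sum>c\<in>UNIV. \<Sum>d\<in>UNIV. qparts g p D a b c d) =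
     (\<Sum>c\<in>UNIV. \<Sum>d\<in>UNIV. \<Sum>n\<in>UNIV. D c a b * p c d * qchr p D n n d)
   - (\<Sum>c\<in>UNIV. \<Sum>d\<in>UNIV. \<Sum>n\<in>UNIV. D n a b * p c d * qchr p D n c d)
   + g a b * (\<Sum>c\<in>UNIV. \<Sum>d\<in>UNIV. \<Sum>n\<in>UNIV. (\<Sum>e\<in>UNIV. \<Sum>f\<in>UNIV. p c e * D n e f * p f d) * qchr p D n c d)
   - g a b * (\<Sum>c\<in>UNIV. \<Sum>d\<in>UNIV. \<Sum>n\<in>UNIV. (\<Sum>e\<in>UNIV. \<Sum>f\<in>UNIV. p c e * D c e f * p f d) * qchr p D n n d)"
  proof -
    have "qparts g p D a b c d = (\<Sum>n\<in>UNIV. D c a b * p c d * qchr p D n n d)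
     - (\<Sum>n\<in>UNIV. D n a b * p c d * qchr p D n c d)
     + g a b * (\<Sum>n\<in>UNIV. (\<Sum>e\<in>UNIV. \<Sum>f\<in>UNIV. p c e * D n e f * p f d) * qchr p D n c d)
     - g a b * (\<Sum>n\<in>UNIV. (\<Sum>e\<in>UNIV. \<Sum>f\<in>UNIV. p c e * D c e f * p f d) * qchr p D n n d)" for c d
    proof -
      have "qparts g p D a b c d = (\<Sum>n\<in>UNIV. D c a b * p c d * qchr p D n n d - D n a b * p c d * qchr p D n c d
        + g a b * ((\<Sum>e\<in>UNIV. \<Sum>f\<in>UNIV. p c e * D n e f * p f d) * qchr p D n c d)
        - g a b * ((\<Sum>e\<in>UNIV. \<Sum>f\<in>UNIV. p c e * D c e f * p f d) * qchr p D n n d))"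
        unfolding qparts_def qgrad_def by (rule sum.cong[OF refl]) algebra
      then show ?thesis by (simp only: sum.distrib sum_subtractf sum_distrib_left)
    qed
    then show ?thesis by (simp only: sum.distrib sum_subtractf sum_distrib_left)
  qed
  then show ?thesis unfolding T1 T2 T3 T4 by (simp add: algebra_simps)
qed

text \<open>The contraction \<open>D c c' d' * D d e e'\<close> cancels between the trace of
  \<open>qricci\<close> and \<open>qparts\<close>, which is why the braces of the formula contain
  only three terms. The coefficient 3/4 is 1/4 from \<open>qricci\<close> plus 1/2 from
  \<open>qparts\<close>.\<close>

lemma qeinstein_eq:
  "qeinstein g p D a b = - ((1/8) * g a b *
       (- ct3 p (\<lambda>c c' d d' e e'. D c d e * D c' d' e') - ct3 p (\<lambda>c c' d d' e e'. D c d d' * D c' e e')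
        + 2 * ct3 p (\<lambda>c c' d d' e e'. D d c' e * D c d' e'))
     + (1/2) * ct2 p (\<lambda>c c' d d'. D d a c' * D c b d')
     - (1/2) * ct2 p (\<lambda>c c' d d'. D c a d * D c' b d')
     + (1/4) * ct2 p (\<lambda>c c' d d'. D a c d * D b c' d')
     - (1/2) * ct2 p (\<lambda>c c' d d'. (1/2) * (D a b c' * D c d d' + D b a c' * D c d d'))
     + (3/4) * ct2 p (\<lambda>c c' d d'. D c a b * D c' d d')
     - (1/2) * ct2 p (\<lambda>c c' d d'. D c a b * D d c' d'))"
proof -
  have "(\<Sum>c\<in>UNIV. \<Sum>d\<in>UNIV. g a b * p c d * qricci p D c d) = g a b * ct1 p (qricci p D)"
    by (simp add: ct1_def sum_distrib_left mult.assoc)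
  then show ?thesis
    unfolding qeinstein_def sum_qparts ct1_qricci by (simp add: qricci_eq algebra_simps)
qed

end

subsection \<open>Weak limit of the Einstein tensor in a coordinate domain\<close>

text \<open>Equality up to a weakly vanishing error. It compares families before either of them is
  known to converge, and it is preserved by sums and smooth fixed factors.\<close>

definition weq :: "(real^4) set \<Rightarrow> (real \<Rightarrow> real^4 \<Rightarrow> real) \<Rightarrow> (real \<Rightarrow> real^4 \<Rightarrow> real) \<Rightarrow> bool" where
  "weq U u v \<longleftrightarrow> wlim U (\<lambda>l x. u l x - v l x) (\<lambda>x. 0)"

lemma weq_cong:
  assumes "weq U u v" "\<And>l x. l > 0 \<Longrightarrow> x \<in> U \<Longrightarrow> u l x = u' l x" "\<And>l x. l > 0 \<Longrightarrow> x \<in> U \<Longrightarrow> v l x = v' l x"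
  shows "weq U u' v'"
  using assms(1) unfolding weq_def by (rule wlim_cong[rotated 2]) (use assms(2,3) in auto)

lemma weq_add: "weq U u v \<Longrightarrow> weq U u' v' \<Longrightarrow> weq U (\<lambda>l x. u l x + u' l x) (\<lambda>l x. v l x + v' l x)"
  unfolding weq_def by (drule (1) wlim_add) (simp add: algebra_simps)

lemma weq_diff: "open U \<Longrightarrow> weq U u v \<Longrightarrow> weq U u' v' \<Longrightarrow> weq U (\<lambda>l x. u l x - u' l x) (\<lambda>l x. v l x - v' l x)"
  unfolding weq_def by (drule (2) wlim_diff) (simp add: algebra_simps)

lemma weq_sum: "(\<And>i. i \<in> I \<Longrightarrow> weq U (u i) (v i)) \<Longrightarrow> weq U (\<lambda>l x. \<Sum>i\<in>I. u i l x) (\<lambda>l x. \<Sum>i\<in>I. v i l x)"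
  unfolding weq_def using wlim_sum[of I U "\<lambda>i l x. u i l x - v i l x" "\<lambda>i x. 0"] by (simp add: sum_subtractf)

lemma weq_smooth_mult: "open U \<Longrightarrow> smooth_on U \<phi> \<Longrightarrow> weq U u v \<Longrightarrow> weq U (\<lambda>l x. \<phi> x * u l x) (\<lambda>l x. \<phi> x * v l x)"
  unfolding weq_def by (drule (2) wlim_mult_smooth) (simp add: algebra_simps)

lemma weq_null: "null_fam U (\<lambda>l x. u l x - v l x) \<Longrightarrow> weq U u v"
  unfolding weq_def by (rule wlim_null)

lemma weq_wlim: "weq U u v \<Longrightarrow> wlim U v w \<Longrightarrow> wlim U u w"
  unfolding weq_def by (drule (1) wlim_add) simp

text \<open>The cross terms vanish weakly because they pair a weakly vanishing family with a fixed function.\<close>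

lemma weq_mult:
  assumes U: "open U" and u0: "smooth_on U u0" and v0: "smooth_on U v0"
    and u: "null_fam U (\<lambda>l x. u l x - (u0 x + u' l x))" and v: "null_fam U (\<lambda>l x. v l x - (v0 x + v' l x))"
    and bdd: "bdd_fam U u'" "bdd_fam U v'" and lim: "wlim U u' (\<lambda>x. 0)" "wlim U v' (\<lambda>x. 0)"
  shows "weq U (\<lambda>l x. u l x * v l x) (\<lambda>l x. u0 x * v0 x + u' l x * v' l x)"
proof -
  have bu: "bdd_fam U (\<lambda>l x. u0 x + u' l x)"
    using bdd by (intro bdd_fam_add bdd_fam_const smooth_on_continuous u0)
  have bv: "bdd_fam U v"
  proof -
    from bdd_fam_add[OF null_fam_imp_bdd[OF v] bdd_fam_add[OF bdd_fam_const[OF smooth_on_continuous[OF v0]] bdd(2)]]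
    show ?thesis by simp
  qed
  have "null_fam U (\<lambda>l x. (u l x - (u0 x + u' l x)) * v l x + (u0 x + u' l x) * (v l x - (v0 x + v' l x)))"
    by (intro null_fam_add null_fam_mult_bdd[OF u bv] null_fam_bdd_mult[OF bu v])
  from wlim_null[OF this]
  have "wlim U (\<lambda>l x. ((u l x - (u0 x + u' l x)) * v l x + (u0 x + u' l x) * (v l x - (v0 x + v' l x)))
      + (u0 x * v' l x + v0 x * u' l x)) (\<lambda>x. 0 + (u0 x * 0 + v0 x * 0))"
    by (intro wlim_add wlim_mult_smooth U u0 v0 lim)
  then show ?thesis unfolding weq_def
    by (rule wlim_cong[rotated 2]) (simp_all add: algebra_simps)
qed

section \<open>Perturbation of inverse matrices\<close>

lemma delta_mult: "(if P then 1 else 0) * (x::real) = (if P then x else 0)"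
  and mult_delta: "(x::real) * (if P then 1 else 0) = (if P then x else 0)"
  by simp_all

text \<open>The resolvent identity: \<open>B A B'\<close> equals \<open>B'\<close>, and
  \<open>B A' B'\<close> equals \<open>B\<close>.\<close>

lemma inverse_difference:
  fixes A A' B B' :: "4 \<Rightarrow> 4 \<Rightarrow> real"
  assumes A: "\<And>a c. (\<Sum>b\<in>UNIV. B a b * A b c) = (if a = c then 1 else 0)"
    and A': "\<And>a c. (\<Sum>b\<in>UNIV. A' a b * B' b c) = (if a = c then 1 else 0)"
  shows "B a c - B' a c = - (\<Sum>b\<in>UNIV. \<Sum>d\<in>UNIV. B a b * (A b d - A' b d) * B' d c)"
proof -
  have "(\<Sum>b\<in>UNIV. \<Sum>d\<in>UNIV. B a b * A b d * B' d c) = (\<Sum>d\<in>UNIV. \<Sum>b\<in>UNIV. B a b * A b d * B' d c)"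
    by (rule sum.swap)
  also have "\<dots> = (\<Sum>d\<in>UNIV. (\<Sum>b\<in>UNIV. B a b * A b d) * B' d c)" by (simp add: sum_distrib_right)
  also have "\<dots> = B' a c" by (simp add: A delta_mult)
  finally have 1: "(\<Sum>b\<in>UNIV. \<Sum>d\<in>UNIV. B a b * A b d * B' d c) = B' a c" .
  have "(\<Sum>b\<in>UNIV. \<Sum>d\<in>UNIV. B a b * A' b d * B' d c) = (\<Sum>b\<in>UNIV. B a b * (\<Sum>d\<in>UNIV. A' b d * B' d c))"
    by (simp add: sum_distrib_left mult.assoc)
  also have "\<dots> = B a c" by (simp add: A' mult_delta)
  finally have 2: "(\<Sum>b\<in>UNIV. \<Sum>d\<in>UNIV. B a b * A' b d * B' d c) = B a c" .
  have "(\<Sum>b\<in>UNIV. \<Sum>d\<in>UNIV. B a b * (A b d - A' b d) * B' d c) = B' a c - B a c"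
    unfolding 1[symmetric] 2[symmetric] by (simp add: algebra_simps sum_subtractf)
  then show ?thesis by simp
qed

text \<open>With \<open>N\<close>, \<open>N'\<close> and \<open>H\<close> the entry sums of
  \<open>B\<close>, \<open>B'\<close> and \<open>A - A'\<close>, the resolvent identity gives
  \<open>N \<le> N' + N * (H * N')\<close>. As \<open>H * N'\<close> is at most 1/2, the last term
  is absorbed on the left.\<close>

lemma inverse_bound:
  fixes A A' B B' :: "4 \<Rightarrow> 4 \<Rightarrow> real"
  assumes A: "\<And>a c. (\<Sum>b\<in>UNIV. B a b * A b c) = (if a = c then 1 else 0)"
    and A': "\<And>a c. (\<Sum>b\<in>UNIV. A' a b * B' b c) = (if a = c then 1 else 0)"
    and small: "(\<Sum>b\<in>UNIV. \<Sum>d\<in>UNIV. \<bar>A b d - A' b d\<bar>) * (\<Sum>d\<in>UNIV. \<Sum>c\<in>UNIV. \<bar>B' d c\<bar>) \<le> 1/2"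
  shows "\<bar>B a c\<bar> \<le> 2 * (\<Sum>d\<in>UNIV. \<Sum>c\<in>UNIV. \<bar>B' d c\<bar>)"
proof -
  define N where "N = (\<Sum>a\<in>UNIV. \<Sum>c\<in>UNIV. \<bar>B a c\<bar>)"
  define N' where "N' = (\<Sum>a\<in>UNIV. \<Sum>c\<in>UNIV. \<bar>B' a c\<bar>)"
  define H where "H = (\<Sum>a\<in>UNIV. \<Sum>c\<in>UNIV. \<bar>A a c - A' a c\<bar>)"
  have pos: "N \<ge> 0" "N' \<ge> 0" "H \<ge> 0" by (auto simp: N_def N'_def H_def intro: sum_nonneg)
  have el: "\<bar>X a c\<bar> \<le> (\<Sum>a\<in>UNIV. \<Sum>c\<in>UNIV. \<bar>X a c\<bar>)" for X :: "4 \<Rightarrow> 4 \<Rightarrow> real" and a c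
  proof -
    have "\<bar>X a c\<bar> \<le> (\<Sum>c\<in>UNIV. \<bar>X a c\<bar>)" by (rule member_le_sum) auto
    also have "\<dots> \<le> (\<Sum>a\<in>UNIV. \<Sum>c\<in>UNIV. \<bar>X a c\<bar>)" by (rule member_le_sum) (auto intro: sum_nonneg)
    finally show ?thesis .
  qed
  have "\<bar>B a c\<bar> \<le> \<bar>B' a c\<bar> + (\<Sum>b\<in>UNIV. \<Sum>d\<in>UNIV. \<bar>B a b\<bar> * \<bar>A b d - A' b d\<bar> * \<bar>B' d c\<bar>)" for a c
  proof -
    have "\<bar>B a c\<bar> \<le> \<bar>B' a c\<bar> + \<bar>\<Sum>b\<in>UNIV. \<Sum>d\<in>UNIV. B a b * (A b d - A' b d) * B' d c\<bar>"
      using inverse_difference[OF A A', of a c] by linarith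
    also have "\<bar>\<Sum>b\<in>UNIV. \<Sum>d\<in>UNIV. B a b * (A b d - A' b d) * B' d c\<bar>
        \<le> (\<Sum>b\<in>UNIV. \<Sum>d\<in>UNIV. \<bar>B a b * (A b d - A' b d) * B' d c\<bar>)"
      by (rule order_trans[OF sum_abs]) (intro sum_mono sum_abs)
    finally show ?thesis by (simp add: abs_mult)
  qed
  then have "N \<le> (\<Sum>a\<in>UNIV. \<Sum>c\<in>UNIV. \<bar>B' a c\<bar> + (\<Sum>b\<in>UNIV. \<Sum>d\<in>UNIV. \<bar>B a b\<bar> * \<bar>A b d - A' b d\<bar> * \<bar>B' d c\<bar>))"
    unfolding N_def by (intro sum_mono)
  also have "\<dots> = N' + (\<Sum>a\<in>UNIV. \<Sum>c\<in>UNIV. \<Sum>b\<in>UNIV. \<Sum>d\<in>UNIV. \<bar>B a b\<bar> * \<bar>A b d - A' b d\<bar> * \<bar>B' d c\<bar>)"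
    by (simp add: sum.distrib N'_def)
  also have "\<dots> \<le> N' + N * (H * N')"
  proof -
    have "\<bar>B a b\<bar> * \<bar>A b d - A' b d\<bar> * \<bar>B' d c\<bar> \<le> \<bar>B a b\<bar> * (\<bar>A b d - A' b d\<bar> * (\<Sum>d\<in>UNIV. \<bar>B' d c\<bar>))" for a b c d
      unfolding mult.assoc by (intro mult_left_mono member_le_sum) auto
    then have "(\<Sum>a\<in>UNIV. \<Sum>c\<in>UNIV. \<Sum>b\<in>UNIV. \<Sum>d\<in>UNIV. \<bar>B a b\<bar> * \<bar>A b d - A' b d\<bar> * \<bar>B' d c\<bar>)
      \<le> (\<Sum>a\<in>UNIV. \<Sum>c\<in>UNIV. \<Sum>b\<in>UNIV. \<Sum>d\<in>UNIV. \<bar>B a b\<bar> * (\<bar>A b d - A' b d\<bar> * (\<Sum>d\<in>UNIV. \<bar>B' d c\<bar>)))"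
      by (intro sum_mono)
    also have "\<dots> = (\<Sum>a\<in>UNIV. \<Sum>c\<in>UNIV. \<Sum>b\<in>UNIV. \<bar>B a b\<bar> * ((\<Sum>d\<in>UNIV. \<bar>A b d - A' b d\<bar>) * (\<Sum>d\<in>UNIV. \<bar>B' d c\<bar>)))"
      by (simp only: sum_distrib_left[symmetric] sum_distrib_right[symmetric])
    also have "\<dots> \<le> (\<Sum>a\<in>UNIV. \<Sum>c\<in>UNIV. \<Sum>b\<in>UNIV. \<bar>B a b\<bar> * (H * (\<Sum>d\<in>UNIV. \<bar>B' d c\<bar>)))"
      unfolding H_def by (intro sum_mono mult_left_mono mult_right_mono member_le_sum sum_nonneg) auto
    also have "\<dots> = (\<Sum>a\<in>UNIV. \<Sum>b\<in>UNIV. \<Sum>c\<in>UNIV. \<bar>B a b\<bar> * (H * (\<Sum>d\<in>UNIV. \<bar>B' d c\<bar>)))"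
      by (rule sum.cong[OF refl], rule sum.swap)
    also have "\<dots> = N * (H * (\<Sum>c\<in>UNIV. \<Sum>d\<in>UNIV. \<bar>B' d c\<bar>))"
      by (simp only: N_def sum_distrib_left[symmetric] sum_distrib_right[symmetric])
    also have "(\<Sum>c\<in>UNIV. \<Sum>d\<in>UNIV. \<bar>B' d c\<bar>) = N'" unfolding N'_def by (rule sum.swap)
    finally show ?thesis by simp
  qed
  also have "N * (H * N') \<le> N * (1/2)"
    using small pos by (intro mult_left_mono) (simp_all add: H_def N'_def)
  finally have "N \<le> 2 * N'" by simp
  moreover have "\<bar>B a c\<bar> \<le> N" using el[of B a c] by (simp add: N_def)
  ultimately show ?thesis by (simp add: N'_def)
qed

text \<open>Here and in \<open>metric_family\<close> the letter \<open>h\<close> stands for the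
  inverse metric, not for the perturbation. As a separate argument it makes the curvature a
  polynomial in \<open>g\<close>, \<open>h\<close> and their derivatives.\<close>

definition lchr :: "(4 \<Rightarrow> 4 \<Rightarrow> real^4 \<Rightarrow> real) \<Rightarrow> (4 \<Rightarrow> 4 \<Rightarrow> real^4 \<Rightarrow> real) \<Rightarrow> 4 \<Rightarrow> 4 \<Rightarrow> 4 \<Rightarrow> real^4 \<Rightarrow> real" where
  "lchr g h k i j x = (1/2) * (\<Sum>m\<in>UNIV. h k m x *
     (partial i (g j m) x + partial j (g i m) x - partial m (g i j) x))"

definition lricci :: "(4 \<Rightarrow> 4 \<Rightarrow> real^4 \<Rightarrow> real) \<Rightarrow> (4 \<Rightarrow> 4 \<Rightarrow> real^4 \<Rightarrow> real) \<Rightarrow> 4 \<Rightarrow> 4 \<Rightarrow> real^4 \<Rightarrow> real" where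
  "lricci g h a b x = (\<Sum>n\<in>UNIV. partial n (lchr g h n a b) x - partial a (lchr g h n n b) x
     + (\<Sum>k\<in>UNIV. lchr g h k a b x * lchr g h n k n x - lchr g h k n b x * lchr g h n k a x))"

definition leinstein :: "(4 \<Rightarrow> 4 \<Rightarrow> real^4 \<Rightarrow> real) \<Rightarrow> (4 \<Rightarrow> 4 \<Rightarrow> real^4 \<Rightarrow> real) \<Rightarrow> 4 \<Rightarrow> 4 \<Rightarrow> real^4 \<Rightarrow> real" where
  "leinstein g h a b x = lricci g h a b x - (1/2) * (\<Sum>c\<in>UNIV. \<Sum>d\<in>UNIV. h c d x * lricci g h c d x) * g a b x"

lemma smooth_lchr: "open U \<Longrightarrow> (\<And>a b. smooth_on U (g a b)) \<Longrightarrow> (\<And>a b. smooth_on U (h a b)) \<Longrightarrow> smooth_on U (lchr g h k i j)"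
  unfolding lchr_def[abs_def] by (intro smooth_rules) auto

lemma smooth_lricci: "open U \<Longrightarrow> (\<And>a b. smooth_on U (g a b)) \<Longrightarrow> (\<And>a b. smooth_on U (h a b)) \<Longrightarrow> smooth_on U (lricci g h a b)"
  unfolding lricci_def[abs_def] by (intro smooth_rules smooth_lchr) auto

lemma smooth_leinstein: "open U \<Longrightarrow> (\<And>a b. smooth_on U (g a b)) \<Longrightarrow> (\<And>a b. smooth_on U (h a b)) \<Longrightarrow> smooth_on U (leinstein g h a b)"
  unfolding leinstein_def[abs_def] by (intro smooth_rules smooth_lricci) auto

text \<open>The form that the assumptions on the metrics take in one coordinate domain, with
  coordinate derivatives in place of covariant ones; matter does not enter.\<close>

locale metric_family =
  fixes U :: "(real^4) set" and g h :: "real \<Rightarrow> 4 \<Rightarrow> 4 \<Rightarrow> real^4 \<Rightarrow> real"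
    and mu :: "4 \<Rightarrow> 4 \<Rightarrow> 4 \<Rightarrow> 4 \<Rightarrow> 4 \<Rightarrow> 4 \<Rightarrow> real^4 \<Rightarrow> real"
  assumes U: "open U"
    and smooth_g: "\<And>l a b. l \<ge> 0 \<Longrightarrow> smooth_on U (g l a b)"
    and smooth_h: "\<And>l a b. l \<ge> 0 \<Longrightarrow> smooth_on U (h l a b)"
    and sym_g: "\<And>l a b x. l \<ge> 0 \<Longrightarrow> x \<in> U \<Longrightarrow> g l a b x = g l b a x"
    and sym_h: "\<And>l a b x. l \<ge> 0 \<Longrightarrow> x \<in> U \<Longrightarrow> h l a b x = h l b a x"
    and inv: "\<And>l a c x. l \<ge> 0 \<Longrightarrow> x \<in> U \<Longrightarrow> (\<Sum>b\<in>UNIV. g l a b x * h l b c x) = (if a = c then 1 else 0)"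
    and null_pert: "\<And>a b. null_fam U (\<lambda>l x. g l a b x - g 0 a b x)"
    and bdd_dpert: "\<And>a b c. bdd_fam U (\<lambda>l x. partial a (g l b c) x - partial a (g 0 b c) x)"
    and mu_lim: "\<And>a b c d e f. wlim U (\<lambda>l x. (partial a (g l c d) x - partial a (g 0 c d) x) *
        (partial b (g l e f) x - partial b (g 0 e f) x)) (mu a b c d e f)"
begin

definition D :: "real \<Rightarrow> 4 \<Rightarrow> 4 \<Rightarrow> 4 \<Rightarrow> real^4 \<Rightarrow> real" where
  "D l a b c x = partial a (g l b c) x - partial a (g 0 b c) x"

lemma smooth_D: "l \<ge> 0 \<Longrightarrow> smooth_on U (D l a b c)"
  unfolding D_def[abs_def] by (intro smooth_rules smooth_g U) auto

lemma bdd_D: "bdd_fam U (\<lambda>l x. D l a b c x)"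
  unfolding D_def by (rule bdd_dpert)

lemma sym_D: "l \<ge> 0 \<Longrightarrow> x \<in> U \<Longrightarrow> D l a b c x = D l a c b x"
  unfolding D_def using partial_cong_open[OF U, of x "g l b c" "g l c b" a] partial_cong_open[OF U, of x "g 0 b c" "g 0 c b" a] sym_g
  by (metis order_refl)

lemma partial_pert: "l \<ge> 0 \<Longrightarrow> x \<in> U \<Longrightarrow> partial a (\<lambda>x. g l b c x - g 0 b c x) x = D l a b c x"
  unfolding D_def by (rule partial_diff) (auto intro: smooth_on_differentiable[OF U smooth_g])

lemma wlim_D: "wlim U (\<lambda>l x. D l a b c x) (\<lambda>x. 0)"
proof -
  have "wlim U (\<lambda>l x. partial a (\<lambda>x. g l b c x - g 0 b c x) x) (\<lambda>x. 0)"
    using null_pert by (intro wlim_partial_null U smooth_on_diff smooth_g) auto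
  then show ?thesis by (rule wlim_cong[rotated 2]) (auto simp: partial_pert)
qed

lemma wlim_DD: "wlim U (\<lambda>l x. D l a c d x * D l b e f x) (mu a b c d e f)"
  using mu_lim by (simp add: D_def)

text \<open>\<open>\<partial>\<^sub>a h \<partial>\<^sub>b h' - \<partial>\<^sub>b h \<partial>\<^sub>a h' = \<partial>\<^sub>a (h \<partial>\<^sub>b h') - \<partial>\<^sub>b (h \<partial>\<^sub>a h')\<close>, and \<open>h\<close> tends to zero uniformly.\<close>

lemma mu_swap: assumes x: "x \<in> U" shows "mu a b c d e f x = mu b a c d e f x"
proof (rule wlim_unique[OF U wlim_DD _ x])
  define k where "k l x = g l c d x - g 0 c d x" for l x
  have sk: "smooth_on U (k l)" if "l \<ge> 0" for l
    unfolding k_def[abs_def] using that by (intro smooth_rules smooth_g U) auto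
  have nk: "null_fam U k" unfolding k_def[abs_def] by (rule null_pert)
  have pk: "partial i (k l) x = D l i c d x" if "l \<ge> 0" "x \<in> U" for i l x
    unfolding k_def[abs_def] by (rule partial_pert[OF that])
  have 1: "wlim U (\<lambda>l x. k l x * partial i (D l j e f) x) (\<lambda>x. - mu i j c d e f x)" for i j
  proof (rule wlim_parts[OF U _ _ nk bdd_D])
    show "wlim U (\<lambda>l x. partial i (k l) x * D l j e f x) (mu i j c d e f)"
      by (rule wlim_cong[OF _ _ wlim_DD]) (auto simp: pk)
  qed (use sk smooth_D in auto)
  have "partial b (D l a e f) x = partial a (D l b e f) x" if "l > 0" "x \<in> U" for l x
  proof -
    have "partial i (D l j e f) x = partial i (partial j (\<lambda>x. g l e f x - g 0 e f x)) x" for i j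
      by (rule partial_cong_open[OF U that(2)]) (use that in \<open>simp add: partial_pert\<close>)
    moreover have "partial b (partial a (\<lambda>x. g l e f x - g 0 e f x)) x = partial a (partial b (\<lambda>x. g l e f x - g 0 e f x)) x"
      using that by (intro smooth_on_partial_commute[OF _ U] smooth_on_diff smooth_g U) auto
    ultimately show ?thesis by simp
  qed
  then have "wlim U (\<lambda>l x. k l x * partial b (D l a e f) x) (\<lambda>x. - mu a b c d e f x)"
    by (intro wlim_cong[OF _ _ 1[of a b]]) auto
  then have "- mu b a c d e f x = - mu a b c d e f x" if "x \<in> U" for x
    using wlim_unique[OF U 1[of b a]] that by blast
  then show "wlim U (\<lambda>l x. D l a c d x * D l b e f x) (mu b a c d e f)"
    by (intro wlim_cong[OF _ _ wlim_DD[of a c d b e f]]) auto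
qed

lemma inv': "l \<ge> 0 \<Longrightarrow> x \<in> U \<Longrightarrow> (\<Sum>b\<in>UNIV. h l a b x * g l b c x) = (if a = c then 1 else 0)"
  using inv[of l x c a] sym_g sym_h by (simp add: mult.commute)

lemma h_difference: "l \<ge> 0 \<Longrightarrow> x \<in> U \<Longrightarrow>
   h l a c x - h 0 a c x = - (\<Sum>b\<in>UNIV. \<Sum>d\<in>UNIV. h l a b x * (g l b d x - g 0 b d x) * h 0 d c x)"
  by (rule inverse_difference) (use inv' inv in auto)

text \<open>\<open>inverse_bound\<close>, applied at each point of \<open>K\<close> with the
  background as reference, as soon as \<open>g l\<close> is close enough to it uniformly on
  \<open>K\<close>.\<close>

lemma bdd_h: "bdd_fam U (\<lambda>l x. h l a b x)"
proof (rule bdd_famI)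
  show "fam U (\<lambda>l x. h l a b x)" using smooth_h by (auto simp: fam_def intro: smooth_on_continuous)
  fix K assume K: "compact K" "K \<subseteq> U"
  define N where "N x = (\<Sum>d\<in>UNIV. \<Sum>c\<in>UNIV. \<bar>h 0 d c x\<bar>)" for x
  have "continuous_on K (h 0 d c)" for d c
    using continuous_on_subset[OF smooth_on_continuous[OF smooth_h] K(2)] by simp
  then have "continuous_on K N" unfolding N_def by (intro continuous_intros)
  then have "bounded (N ` K)" using K(1) compact_continuous_image compact_imp_bounded by blast
  then obtain B0 where "\<And>x. x \<in> K \<Longrightarrow> \<bar>N x\<bar> \<le> B0" by (auto simp: bounded_iff)
  then have B: "N x \<le> max B0 1" if "x \<in> K" for x using that by (meson abs_le_D1 le_max_iff_disj)
  define B where "B = max B0 1"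
  have Bp: "B > 0" by (simp add: B_def)
  have "null_fam U (\<lambda>l x. \<Sum>b\<in>UNIV. \<Sum>d\<in>UNIV. \<bar>g l b d x - g 0 b d x\<bar>)"
  proof (intro null_fam_sum)
    show "null_fam U (\<lambda>l x. \<bar>g l b d x - g 0 b d x\<bar>)" for b d
      using null_pert[of b d] by (auto simp: null_fam_def fam_def intro: continuous_intros)
  qed
  \<comment> \<open>Since \<open>B\<close> bounds the entry sum of the background inverse on
    \<open>K\<close>, the tolerance \<open>1 / (2 * B)\<close> yields the product bound 1/2 that
    \<open>inverse_bound\<close> requires.\<close>
  then have "\<forall>\<^sub>F l in at_right 0. \<forall>x\<in>K. \<bar>\<Sum>b\<in>UNIV. \<Sum>d\<in>UNIV. \<bar>g l b d x - g 0 b d x\<bar>\<bar> \<le> 1 / (2 * B)"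
    using null_famD[OF _ K, of _ "1 / (2 * B)"] Bp by simp
  with eventually_at_right_0_pos
  have "\<forall>\<^sub>F l in at_right 0. \<forall>x\<in>K. \<bar>h l a b x\<bar> \<le> 2 * B"
  proof eventually_elim
    case (elim l)
    show ?case
    proof
      fix x assume x: "x \<in> K"
      have Nx: "N x \<le> B" using B[OF x] by (simp add: B_def)
      have N0: "N x \<ge> 0" by (auto simp: N_def intro: sum_nonneg)
      have "(\<Sum>b\<in>UNIV. \<Sum>d\<in>UNIV. \<bar>g l b d x - g 0 b d x\<bar>) \<le> 1 / (2 * B)" using elim x by fastforce
      then have "(\<Sum>b\<in>UNIV. \<Sum>d\<in>UNIV. \<bar>g l b d x - g 0 b d x\<bar>) * N x \<le> 1 / (2 * B) * B"
        using Nx N0 Bp by (intro mult_mono) auto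
      then have "(\<Sum>b\<in>UNIV. \<Sum>d\<in>UNIV. \<bar>g l b d x - g 0 b d x\<bar>) * N x \<le> 1/2" using Bp by simp
      then have "\<bar>h l a b x\<bar> \<le> 2 * N x"
        unfolding N_def using elim(1) subsetD[OF K(2) x]
        by (intro inverse_bound[of "\<lambda>a b. h l a b x" "\<lambda>a b. g l a b x" "\<lambda>a b. g 0 a b x"])
           (simp_all add: inv inv')
      then show "\<bar>h l a b x\<bar> \<le> 2 * B" using Nx by simp
    qed
  qed
  then show "\<exists>B. \<forall>\<^sub>F l in at_right 0. \<forall>x\<in>K. \<bar>h l a b x\<bar> \<le> B" by blast
qed

lemma cont0: "continuous_on U (g 0 a b)" "continuous_on U (h 0 a b)" "continuous_on U (partial i (g 0 a b))"
  using smooth_g[of 0] smooth_h[of 0] by (auto intro: smooth_on_continuous smooth_on_partial)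

lemma null_h: "null_fam U (\<lambda>l x. h l a c x - h 0 a c x)"
proof -
  have "null_fam U (\<lambda>l x. -1 * (\<Sum>b\<in>UNIV. \<Sum>d\<in>UNIV. h l a b x * (g l b d x - g 0 b d x) * h 0 d c x))"
    by (intro null_fam_cmult null_fam_sum null_fam_mult_bdd null_fam_bdd_mult bdd_h null_pert bdd_fam_const cont0)
  then show ?thesis by (rule null_fam_cong[rotated]) (simp add: h_difference)
qed


lemma bdd_dg: "bdd_fam U (\<lambda>l x. partial i (g l a b) x)"
  using bdd_fam_add[OF bdd_dpert bdd_fam_const[OF cont0(3)], of i a b i a b] by simp

text \<open>Differentiate the identity \<open>g * h = 1\<close> of matrices and multiply from the
  left by \<open>h\<close>.\<close>

lemma partial_h:
  assumes "l \<ge> 0" "x \<in> U"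
  shows "partial i (h l a c) x = - (\<Sum>b\<in>UNIV. \<Sum>d\<in>UNIV. h l a b x * partial i (g l b d) x * h l d c x)"
proof -
  have dg: "g l a b differentiable (at x)" and dh: "h l a b differentiable (at x)" for a b
    using assms smooth_on_differentiable[OF U] smooth_g smooth_h by blast+
  have dgh: "(\<lambda>x. g l d b x * h l b c x) differentiable (at x)" for d b
    by (intro differentiable_mult dg dh)
  have "(\<Sum>b\<in>UNIV. partial i (g l d b) x * h l b c x) + (\<Sum>b\<in>UNIV. g l d b x * partial i (h l b c) x) = 0" for d
  proof -
    have "0 = partial i (\<lambda>x. \<Sum>b\<in>UNIV. g l d b x * h l b c x) x"
      using partial_cong_open[OF U assms(2), of "\<lambda>x. \<Sum>b\<in>UNIV. g l d b x * h l b c x" "\<lambda>x. if d = c then 1 else 0" i]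
        inv[OF assms(1)] by simp
    also have "\<dots> = (\<Sum>b\<in>UNIV. partial i (g l d b) x * h l b c x + g l d b x * partial i (h l b c) x)"
      by (simp add: partial_sum[OF dgh] partial_mult[OF dg dh])
    finally show ?thesis by (simp add: sum.distrib)
  qed
  then have eq: "(\<Sum>b\<in>UNIV. g l d b x * partial i (h l b c) x) = - (\<Sum>b\<in>UNIV. partial i (g l d b) x * h l b c x)" for d
    by (simp add: eq_neg_iff_add_eq_0 add.commute)
  have "(\<Sum>d\<in>UNIV. h l a d x * (\<Sum>b\<in>UNIV. g l d b x * partial i (h l b c) x)) =
      - (\<Sum>d\<in>UNIV. h l a d x * (\<Sum>b\<in>UNIV. partial i (g l d b) x * h l b c x))"
    by (simp only: eq mult_minus_right sum_negf)
  moreover have "(\<Sum>d\<in>UNIV. h l a d x * (\<Sum>b\<in>UNIV. g l d b x * partial i (h l b c) x)) = partial i (h l a c) x"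
  proof -
    have "(\<Sum>d\<in>UNIV. h l a d x * (\<Sum>b\<in>UNIV. g l d b x * partial i (h l b c) x)) =
      (\<Sum>d\<in>UNIV. \<Sum>b\<in>UNIV. h l a d x * g l d b x * partial i (h l b c) x)"
      by (simp add: sum_distrib_left mult.assoc)
    also have "\<dots> = (\<Sum>b\<in>UNIV. (\<Sum>d\<in>UNIV. h l a d x * g l d b x) * partial i (h l b c) x)"
      by (subst sum.swap) (simp add: sum_distrib_right)
    also have "\<dots> = partial i (h l a c) x" by (simp add: inv'[OF assms] delta_mult)
    finally show ?thesis .
  qed
  ultimately show ?thesis by (simp add: sum_distrib_left mult.assoc)
qed


section \<open>Christoffel symbols, Ricci tensor and Einstein tensor up to weakly vanishing
  terms\<close>

abbreviation G where "G l k i j \<equiv> lchr (g l) (h l) k i j"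
abbreviation p0 where "p0 x \<equiv> (\<lambda>a b. h 0 a b x)"
abbreviation g0 where "g0 x \<equiv> (\<lambda>a b. g 0 a b x)"
abbreviation DD where "DD l x \<equiv> (\<lambda>a b c. D l a b c x)"

lemma smooth_G: "l \<ge> 0 \<Longrightarrow> smooth_on U (G l k i j)"
  using smooth_g smooth_h U by (intro smooth_lchr) auto

lemma smooth0: "smooth_on U (g 0 a b)" "smooth_on U (h 0 a b)" "smooth_on U (G 0 k i j)"
  using smooth_g[of 0] smooth_h[of 0] smooth_G[of 0] by auto

lemma bdd_qchr: "bdd_fam U (\<lambda>l x. qchr (p0 x) (DD l x) k i j)"
  unfolding qchr_def by (intro fam_rules bdd_D cont0)

lemma wlim_qchr: "wlim U (\<lambda>l x. qchr (p0 x) (DD l x) k i j) (\<lambda>x. 0)"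
proof -
  have "wlim U (\<lambda>l x. (1/2) * (\<Sum>m\<in>UNIV. h 0 k m x * (D l i j m x + D l j i m x - D l m i j x)))
     (\<lambda>x. (1/2) * (\<Sum>m\<in>UNIV. h 0 k m x * (0 + 0 - 0)))"
    by (intro wlim_cmult wlim_sum wlim_mult_smooth wlim_add wlim_diff wlim_D U smooth0)
  then show ?thesis by (simp add: qchr_def)
qed

text \<open>The error is \<open>h l - h 0\<close>, which is null, times first derivatives of
  \<open>g l\<close>, which are bounded. What is left of the deviation is linear in \<open>D\<close>
  with background coefficients.\<close>

lemma null_G: "null_fam U (\<lambda>l x. G l k i j x - (G 0 k i j x + qchr (p0 x) (DD l x) k i j))"
proof -
  have "null_fam U (\<lambda>l x. (1/2) * (\<Sum>m\<in>UNIV. (h l k m x - h 0 k m x) *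
     (partial i (g l j m) x + partial j (g l i m) x - partial m (g l i j) x)))"
    by (intro null_fam_cmult null_fam_sum null_fam_mult_bdd null_h bdd_fam_add bdd_fam_diff bdd_dg)
  then show ?thesis
    by (rule null_fam_cong[rotated]) (simp add: lchr_def qchr_def D_def algebra_simps sum.distrib sum_subtractf)
qed

lemma bdd_G: "bdd_fam U (\<lambda>l x. G l k i j x)"
  unfolding lchr_def by (intro fam_rules bdd_h bdd_dg)

lemma wlim_G: "wlim U (\<lambda>l x. G l k i j x) (G 0 k i j)"
proof -
  have "wlim U (\<lambda>l x. G 0 k i j x + qchr (p0 x) (DD l x) k i j) (\<lambda>x. G 0 k i j x + 0)"
    by (intro wlim_add wlim_qchr wlim_const smooth_on_continuous smooth0)
  from wlim_null_cong[OF this null_G] show ?thesis by simp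
qed

text \<open>The derivatives of Christoffel symbols carry the second derivatives of the metric.
  Entering linearly, they converge to their background value together with the symbols.\<close>

lemma weq_dG: "weq U (\<lambda>l x. partial n (G l k i j) x) (\<lambda>l x. partial n (G 0 k i j) x)"
proof -
  have "wlim U (\<lambda>l x. partial n (G l k i j) x) (partial n (G 0 k i j))"
    by (rule wlim_partial[OF U _ smooth0(3) wlim_G]) (simp add: smooth_G)
  from wlim_diff[OF U this wlim_const[of U "partial n (G 0 k i j)"]]
  show ?thesis by (simp add: weq_def smooth_on_continuous smooth_on_partial smooth0)
qed

lemma weq_GG: "weq U (\<lambda>l x. G l k i j x * G l n i' j' x)
   (\<lambda>l x. G 0 k i j x * G 0 n i' j' x + qchr (p0 x) (DD l x) k i j * qchr (p0 x) (DD l x) n i' j')"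
  by (rule weq_mult[OF U smooth0(3) smooth0(3) null_G null_G bdd_qchr bdd_qchr wlim_qchr wlim_qchr])

abbreviation Ric where "Ric l a b x \<equiv> lricci (g l) (h l) a b x"

lemma weq_Ric: "weq U (\<lambda>l x. Ric l a b x) (\<lambda>l x. Ric 0 a b x + qricci (p0 x) (DD l x) a b)"
proof -
  let ?q = "\<lambda>l x. qchr (p0 x) (DD l x)"
  have "weq U (\<lambda>l x. \<Sum>n\<in>UNIV. partial n (G l n a b) x - partial a (G l n n b) x
     + (\<Sum>k\<in>UNIV. G l k a b x * G l n k n x - G l k n b x * G l n k a x))
    (\<lambda>l x. \<Sum>n\<in>UNIV. partial n (G 0 n a b) x - partial a (G 0 n n b) x
     + (\<Sum>k\<in>UNIV. (G 0 k a b x * G 0 n k n x + ?q l x k a b * ?q l x n k n)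
         - (G 0 k n b x * G 0 n k a x + ?q l x k n b * ?q l x n k a)))"
    by (intro weq_sum weq_add weq_diff weq_dG weq_GG U)
  then show ?thesis
    by (rule weq_cong) (simp_all add: lricci_def qricci_def sum.distrib sum_subtractf algebra_simps)
qed

text \<open>The deviation of the coefficient of \<open>Ric l c d\<close> in the trace term of the
  Einstein tensor. It is null, but it multiplies second derivatives that are not bounded.\<close>

definition Q :: "4 \<Rightarrow> 4 \<Rightarrow> 4 \<Rightarrow> 4 \<Rightarrow> real \<Rightarrow> real^4 \<Rightarrow> real" where
  "Q a b c d l x = g l a b x * h l c d x - g 0 a b x * h 0 c d x"

lemma null_Q: "null_fam U (Q a b c d)"
proof -
  have "null_fam U (\<lambda>l x. (g l a b x - g 0 a b x) * h l c d x + g 0 a b x * (h l c d x - h 0 c d x))"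
    by (intro null_fam_add null_fam_mult_bdd null_fam_bdd_mult null_pert null_h bdd_h bdd_fam_const cont0)
  then show ?thesis by (rule null_fam_cong[rotated]) (simp add: Q_def algebra_simps)
qed

lemma smooth_Q: "l \<ge> 0 \<Longrightarrow> smooth_on U (Q a b c d l)"
  unfolding Q_def[abs_def] using smooth0 by (intro smooth_rules U smooth_g smooth_h) auto

text \<open>The product rule and \<open>partial_h\<close> express the derivative through
  \<open>g\<close>, \<open>h\<close> and first derivatives; replacing undifferentiated factors by
  background ones costs null terms. The summand 0 supplies the fixed part expected by
  \<open>weq_mult\<close>.\<close>

lemma null_dQ: "null_fam U (\<lambda>l x. partial n (Q a b c d l) x - (0 + qgrad (g0 x) (p0 x) (DD l x) n a b c d))"
proof -
  let ?s = "\<lambda>u v w :: real^4 \<Rightarrow> 4 \<Rightarrow> 4 \<Rightarrow> real. \<lambda>x. \<Sum>e\<in>UNIV. \<Sum>f\<in>UNIV. u x c e * v x e f * w x f d"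
  let ?h = "\<lambda>l x e f. h l e f x" and ?d = "\<lambda>l x e f. partial n (g l e f) x" and ?k = "\<lambda>l x e f. h l e f x - h 0 e f x"
  have dQ: "partial n (Q a b c d l) x = partial n (g l a b) x * h l c d x - g l a b x * ?s (?h l) (?d l) (?h l) x
      - (partial n (g 0 a b) x * h 0 c d x - g 0 a b x * ?s (?h 0) (?d 0) (?h 0) x)" if "l \<ge> 0" "x \<in> U" for l x
  proof -
    have d: "g l a b differentiable (at x)" "h l c d differentiable (at x)" if "l \<ge> 0" for l a b c d
      using smooth_on_differentiable[OF U] smooth_g smooth_h that \<open>x \<in> U\<close> by blast+
    show ?thesis unfolding Q_def[abs_def] using that
      by (simp add: partial_diff partial_mult d partial_h)
  qed
  have n1: "null_fam U (\<lambda>l x. ?k l x e f)" for e f by (rule null_h)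
  have "null_fam U (\<lambda>l x. partial n (g l a b) x * (h l c d x - h 0 c d x)
     - ((g l a b x - g 0 a b x) * ?s (?h l) (?d l) (?h l) x
       + g 0 a b x * (?s (?k l) (?d l) (?h l) x + ?s (?h 0) (?d l) (?k l) x)))"
    by (intro null_fam_diff null_fam_add null_fam_sum null_pert null_h
        null_fam_bdd_mult[OF bdd_dg] null_fam_mult_bdd[OF null_pert] null_fam_bdd_mult[OF bdd_fam_const[OF cont0(1)]]
        null_fam_mult_bdd[OF null_fam_mult_bdd[OF null_h]] null_fam_bdd_mult[OF bdd_fam_mult[OF bdd_fam_const[OF cont0(2)]]]
        bdd_fam_sum bdd_fam_mult bdd_h bdd_dg)
  then show ?thesis
  proof (rule null_fam_cong[rotated])
    fix l :: real and x assume l: "l > 0" and x: "x \<in> U"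
    \<comment> \<open>Telescoping: the two factors of the inverse metric are replaced by the
      background one after the other.\<close>
    have "?s (?k l) (?d l) (?h l) x + ?s (?h 0) (?d l) (?k l) x = ?s (?h l) (?d l) (?h l) x - ?s (?h 0) (?d l) (?h 0) x"
      by (simp add: algebra_simps sum.distrib sum_subtractf)
    moreover have "(\<Sum>e\<in>UNIV. \<Sum>f\<in>UNIV. p0 x c e * DD l x n e f * p0 x f d) = ?s (?h 0) (?d l) (?h 0) x - ?s (?h 0) (?d 0) (?h 0) x"
      by (simp add: D_def algebra_simps sum_subtractf)
    ultimately show "partial n (g l a b) x * (h l c d x - h 0 c d x)
     - ((g l a b x - g 0 a b x) * ?s (?h l) (?d l) (?h l) x
       + g 0 a b x * (?s (?k l) (?d l) (?h l) x + ?s (?h 0) (?d l) (?k l) x)) =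
      partial n (Q a b c d l) x - (0 + qgrad (g0 x) (p0 x) (DD l x) n a b c d)"
      using l x by (simp only: dQ[OF less_imp_le] qgrad_def) (simp add: D_def algebra_simps)
  qed
qed

lemma bdd_qgrad: "bdd_fam U (\<lambda>l x. qgrad (g0 x) (p0 x) (DD l x) n a b c d)"
  unfolding qgrad_def by (intro fam_rules bdd_D cont0)

lemma wlim_qgrad: "wlim U (\<lambda>l x. qgrad (g0 x) (p0 x) (DD l x) n a b c d) (\<lambda>x. 0)"
proof -
  have "wlim U (\<lambda>l x. h 0 c d x * D l n a b x - g 0 a b x * (\<Sum>e\<in>UNIV. \<Sum>f\<in>UNIV. (h 0 c e x * h 0 f d x) * D l n e f x))
     (\<lambda>x. h 0 c d x * 0 - g 0 a b x * (\<Sum>e\<in>UNIV. \<Sum>f\<in>UNIV. (h 0 c e x * h 0 f d x) * 0))"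
    by (intro wlim_sum wlim_mult_smooth wlim_diff wlim_D U smooth0 smooth_on_mult)
  then show ?thesis by (simp add: qgrad_def mult_ac)
qed


text \<open>\<open>Q\<close> is null and the Christoffel symbols are bounded, so the derivative of
  their product vanishes weakly. Hence \<open>Q\<close> times the derivative of the symbol may be
  replaced by minus the derivative of \<open>Q\<close> times the symbol, and \<open>weq_mult\<close>
  evaluates that product; the background symbol drops out because the fixed part of the derivative
  of \<open>Q\<close> is zero.\<close>

lemma weq_Q_dG: "weq U (\<lambda>l x. Q a b c d l x * partial n (G l k i j) x)
   (\<lambda>l x. - (qgrad (g0 x) (p0 x) (DD l x) n a b c d * qchr (p0 x) (DD l x) k i j))"
proof -
  have w: "weq U (\<lambda>l x. partial n (Q a b c d l) x * G l k i j x)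
      (\<lambda>l x. 0 * G 0 k i j x + qgrad (g0 x) (p0 x) (DD l x) n a b c d * qchr (p0 x) (DD l x) k i j)"
    by (rule weq_mult[OF U smooth_on_const smooth0(3) null_dQ null_G bdd_qgrad bdd_qchr wlim_qgrad wlim_qchr])
  have "wlim U (\<lambda>l x. partial n (\<lambda>x. Q a b c d l x * G l k i j x) x) (\<lambda>x. 0)"
    by (intro wlim_partial_null U smooth_on_mult smooth_Q smooth_G null_fam_mult_bdd null_Q bdd_G) auto
  from wlim_diff[OF U this w[unfolded weq_def]]
  show ?thesis unfolding weq_def
  proof (rule wlim_cong[rotated 2])
    fix l :: real and x assume "l > 0" "x \<in> U"
    then have "Q a b c d l differentiable (at x)" "G l k i j differentiable (at x)"
      using smooth_on_differentiable[OF U] smooth_Q smooth_G by (meson less_imp_le)+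
    then show "partial n (\<lambda>x. Q a b c d l x * G l k i j x) x - (partial n (Q a b c d l) x * G l k i j x -
         (0 * G 0 k i j x + qgrad (g0 x) (p0 x) (DD l x) n a b c d * qchr (p0 x) (DD l x) k i j)) =
      Q a b c d l x * partial n (G l k i j) x - - (qgrad (g0 x) (p0 x) (DD l x) n a b c d * qchr (p0 x) (DD l x) k i j)"
      by (simp add: partial_mult)
  qed simp
qed

text \<open>The products of Christoffel symbols in the Ricci tensor are bounded, so \<open>Q\<close>
  times them is null; only the two derivative terms contribute.\<close>

lemma weq_Q_Ric: "weq U (\<lambda>l x. Q a b c d l x * Ric l c d x) (\<lambda>l x. qparts (g0 x) (p0 x) (DD l x) a b c d)"
proof -
  have "weq U (\<lambda>l x. Q a b c d l x * (\<Sum>n\<in>UNIV. \<Sum>k\<in>UNIV. G l k c d x * G l n k n x - G l k n d x * G l n k c x)) (\<lambda>l x. 0)"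
    by (rule weq_null) (auto intro!: null_fam_mult_bdd null_Q fam_rules bdd_G)
  then have "weq U (\<lambda>l x. (\<Sum>n\<in>UNIV. Q a b c d l x * partial n (G l n c d) x - Q a b c d l x * partial c (G l n n d) x)
      + Q a b c d l x * (\<Sum>n\<in>UNIV. \<Sum>k\<in>UNIV. G l k c d x * G l n k n x - G l k n d x * G l n k c x))
    (\<lambda>l x. (\<Sum>n\<in>UNIV. - (qgrad (g0 x) (p0 x) (DD l x) n a b c d * qchr (p0 x) (DD l x) n c d)
         - - (qgrad (g0 x) (p0 x) (DD l x) c a b c d * qchr (p0 x) (DD l x) n n d)) + 0)"
    by (intro weq_add weq_sum weq_diff weq_Q_dG U)
  then show ?thesis
  proof (rule weq_cong)
    fix l :: real and x
    show "(\<Sum>n\<in>UNIV. Q a b c d l x * partial n (G l n c d) x - Q a b c d l x * partial c (G l n n d) x)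
      + Q a b c d l x * (\<Sum>n\<in>UNIV. \<Sum>k\<in>UNIV. G l k c d x * G l n k n x - G l k n d x * G l n k c x) = Q a b c d l x * Ric l c d x"
      unfolding lricci_def sum.distrib sum_subtractf by (simp add: sum_distrib_left algebra_simps)
  qed (simp add: qparts_def algebra_simps)
qed

abbreviation Ein where "Ein l a b x \<equiv> leinstein (g l) (h l) a b x"

lemma weq_Ein: "weq U (\<lambda>l x. Ein l a b x) (\<lambda>l x. Ein 0 a b x + qeinstein (g0 x) (p0 x) (DD l x) a b)"
proof -
  have "weq U (\<lambda>l x. Ric l a b x - (1/2) * (\<Sum>c\<in>UNIV. \<Sum>d\<in>UNIV. (g 0 a b x * h 0 c d x) * Ric l c d x)
       - (1/2) * (\<Sum>c\<in>UNIV. \<Sum>d\<in>UNIV. Q a b c d l x * Ric l c d x))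
     (\<lambda>l x. (Ric 0 a b x + qricci (p0 x) (DD l x) a b)
       - (1/2) * (\<Sum>c\<in>UNIV. \<Sum>d\<in>UNIV. (g 0 a b x * h 0 c d x) * (Ric 0 c d x + qricci (p0 x) (DD l x) c d))
       - (1/2) * (\<Sum>c\<in>UNIV. \<Sum>d\<in>UNIV. qparts (g0 x) (p0 x) (DD l x) a b c d))"
    by (intro weq_diff weq_sum weq_smooth_mult weq_Ric weq_Q_Ric U smooth_on_const smooth_on_mult smooth0)
  then show ?thesis
  proof (rule weq_cong)
    fix l :: real and x
    show "Ric l a b x - (1/2) * (\<Sum>c\<in>UNIV. \<Sum>d\<in>UNIV. (g 0 a b x * h 0 c d x) * Ric l c d x)
       - (1/2) * (\<Sum>c\<in>UNIV. \<Sum>d\<in>UNIV. Q a b c d l x * Ric l c d x) = Ein l a b x"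
      by (simp add: leinstein_def Q_def algebra_simps sum_subtractf sum_distrib_left)
    show "(Ric 0 a b x + qricci (p0 x) (DD l x) a b)
       - (1/2) * (\<Sum>c\<in>UNIV. \<Sum>d\<in>UNIV. (g 0 a b x * h 0 c d x) * (Ric 0 c d x + qricci (p0 x) (DD l x) c d))
       - (1/2) * (\<Sum>c\<in>UNIV. \<Sum>d\<in>UNIV. qparts (g0 x) (p0 x) (DD l x) a b c d) =
      Ein 0 a b x + qeinstein (g0 x) (p0 x) (DD l x) a b"
      by (simp add: leinstein_def qeinstein_def algebra_simps sum.distrib sum_distrib_left)
  qed
qed

text \<open>Equals \<open>8 * pi\<close> times \<open>effective_stress\<close> in a chart, written
  with bare functions of the coordinates.\<close>

definition leff :: "4 \<Rightarrow> 4 \<Rightarrow> real^4 \<Rightarrow> real" where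
  "leff a b x = (let m = (\<lambda>a b c d e f. mu a b c d e f x); p = p0 x in
     (1/8) * g 0 a b x *
        (- ct3 p (\<lambda>c c' d d' e e'. m c c' d e d' e') - ct3 p (\<lambda>c c' d d' e e'. m c c' d d' e e')
         + 2 * ct3 p (\<lambda>c c' d d' e e'. m c d c' e d' e'))
      + (1/2) * ct2 p (\<lambda>c c' d d'. m c d a c' b d')
      - (1/2) * ct2 p (\<lambda>c c' d d'. m c c' a d b d')
      + (1/4) * ct2 p (\<lambda>c c' d d'. m a b c d c' d')
      - (1/2) * ct2 p (\<lambda>c c' d d'. (1/2) * (m c a b c' d d' + m c b a c' d d'))
      + (3/4) * ct2 p (\<lambda>c c' d d'. m c c' a b d d')
      - (1/2) * ct2 p (\<lambda>c c' d d'. m c d a b c' d'))"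

lemma wlim_ct2:
  assumes "\<And>c c' d d'. wlim U (\<lambda>l x. F l x c c' d d') (\<lambda>x. F' x c c' d d')"
  shows "wlim U (\<lambda>l x. ct2 (p0 x) (F l x)) (\<lambda>x. ct2 (p0 x) (F' x))"
  unfolding ct2_def by (intro wlim_sum wlim_mult_smooth smooth_on_mult smooth0 U assms)

lemma wlim_ct3:
  assumes "\<And>c c' d d' e e'. wlim U (\<lambda>l x. F l x c c' d d' e e') (\<lambda>x. F' x c c' d d' e e')"
  shows "wlim U (\<lambda>l x. ct3 (p0 x) (F l x)) (\<lambda>x. ct3 (p0 x) (F' x))"
  unfolding ct3_def by (intro wlim_sum wlim_mult_smooth smooth_on_mult smooth0 U assms)

lemma wlim_qeinstein: "wlim U (\<lambda>l x. qeinstein (g0 x) (p0 x) (DD l x) a b) (\<lambda>x. - leff a b x)"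
proof -
  \<comment> \<open>In some terms of the formula the two derivative indices stand in the order
    opposite to the one produced by the expansion; \<open>mu_swap\<close> covers these.\<close>
  have DD': "wlim U (\<lambda>l x. D l i c d x * D l j e f x) (\<lambda>x. mu j i c d e f x)" for i j c d e f
    by (rule wlim_cong[OF _ _ wlim_DD[of i c d j e f]]) (auto intro: mu_swap)
  have "wlim U (\<lambda>l x. -1 * (g 0 a b x * ((1/8) *
       ((-1) * ct3 (p0 x) (\<lambda>c c' d d' e e'. D l c d e x * D l c' d' e' x) - ct3 (p0 x) (\<lambda>c c' d d' e e'. D l c d d' x * D l c' e e' x)
        + 2 * ct3 (p0 x) (\<lambda>c c' d d' e e'. D l d c' e x * D l c d' e' x)))
     + (1/2) * ct2 (p0 x) (\<lambda>c c' d d'. D l d a c' x * D l c b d' x)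
     - (1/2) * ct2 (p0 x) (\<lambda>c c' d d'. D l c a d x * D l c' b d' x)
     + (1/4) * ct2 (p0 x) (\<lambda>c c' d d'. D l a c d x * D l b c' d' x)
     - (1/2) * ct2 (p0 x) (\<lambda>c c' d d'. (1/2) * (D l a b c' x * D l c d d' x + D l b a c' x * D l c d d' x))
     + (3/4) * ct2 (p0 x) (\<lambda>c c' d d'. D l c a b x * D l c' d d' x)
     - (1/2) * ct2 (p0 x) (\<lambda>c c' d d'. D l c a b x * D l d c' d' x)))
    (\<lambda>x. -1 * (g 0 a b x * ((1/8) *
        ((-1) * ct3 (p0 x) (\<lambda>c c' d d' e e'. mu c c' d e d' e' x) - ct3 (p0 x) (\<lambda>c c' d d' e e'. mu c c' d d' e e' x)
         + 2 * ct3 (p0 x) (\<lambda>c c' d d' e e'. mu c d c' e d' e' x)))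
      + (1/2) * ct2 (p0 x) (\<lambda>c c' d d'. mu c d a c' b d' x)
      - (1/2) * ct2 (p0 x) (\<lambda>c c' d d'. mu c c' a d b d' x)
      + (1/4) * ct2 (p0 x) (\<lambda>c c' d d'. mu a b c d c' d' x)
      - (1/2) * ct2 (p0 x) (\<lambda>c c' d d'. (1/2) * (mu c a b c' d d' x + mu c b a c' d d' x))
      + (3/4) * ct2 (p0 x) (\<lambda>c c' d d'. mu c c' a b d d' x)
      - (1/2) * ct2 (p0 x) (\<lambda>c c' d d'. mu c d a b c' d' x)))"
    by (intro wlim_cmult wlim_mult_smooth wlim_add wlim_diff U smooth0 wlim_ct2 wlim_ct3; (rule wlim_DD | rule DD'))
  then show ?thesis
  proof (rule wlim_cong[rotated 2])
    fix l :: real and x assume "l > 0" "x \<in> U"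
    then have "qeinstein (g0 x) (p0 x) (DD l x) a b = - ((1/8) * g0 x a b *
       (- ct3 (p0 x) (\<lambda>c c' d d' e e'. DD l x c d e * DD l x c' d' e') - ct3 (p0 x) (\<lambda>c c' d d' e e'. DD l x c d d' * DD l x c' e e')
        + 2 * ct3 (p0 x) (\<lambda>c c' d d' e e'. DD l x d c' e * DD l x c d' e'))
     + (1/2) * ct2 (p0 x) (\<lambda>c c' d d'. DD l x d a c' * DD l x c b d')
     - (1/2) * ct2 (p0 x) (\<lambda>c c' d d'. DD l x c a d * DD l x c' b d')
     + (1/4) * ct2 (p0 x) (\<lambda>c c' d d'. DD l x a c d * DD l x b c' d')
     - (1/2) * ct2 (p0 x) (\<lambda>c c' d d'. (1/2) * (DD l x a b c' * DD l x c d d' + DD l x b a c' * DD l x c d d'))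
     + (3/4) * ct2 (p0 x) (\<lambda>c c' d d'. DD l x c a b * DD l x c' d d')
     - (1/2) * ct2 (p0 x) (\<lambda>c c' d d'. DD l x c a b * DD l x d c' d'))"
      by (intro qeinstein_eq) (auto intro: sym_h sym_D)
    then show "-1 * (g 0 a b x * ((1/8) *
       ((-1) * ct3 (p0 x) (\<lambda>c c' d d' e e'. D l c d e x * D l c' d' e' x) - ct3 (p0 x) (\<lambda>c c' d d' e e'. D l c d d' x * D l c' e e' x)
        + 2 * ct3 (p0 x) (\<lambda>c c' d d' e e'. D l d c' e x * D l c d' e' x)))
     + (1/2) * ct2 (p0 x) (\<lambda>c c' d d'. D l d a c' x * D l c b d' x)
     - (1/2) * ct2 (p0 x) (\<lambda>c c' d d'. D l c a d x * D l c' b d' x)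
     + (1/4) * ct2 (p0 x) (\<lambda>c c' d d'. D l a c d x * D l b c' d' x)
     - (1/2) * ct2 (p0 x) (\<lambda>c c' d d'. (1/2) * (D l a b c' x * D l c d d' x + D l b a c' x * D l c d d' x))
     + (3/4) * ct2 (p0 x) (\<lambda>c c' d d'. D l c a b x * D l c' d d' x)
     - (1/2) * ct2 (p0 x) (\<lambda>c c' d d'. D l c a b x * D l d c' d' x))
     = qeinstein (g0 x) (p0 x) (DD l x) a b"
      by (simp only:) (simp add: mult_ac)
  next
    fix x assume "x \<in> U"
    show "-1 * (g 0 a b x * ((1/8) *
        ((-1) * ct3 (p0 x) (\<lambda>c c' d d' e e'. mu c c' d e d' e' x) - ct3 (p0 x) (\<lambda>c c' d d' e e'. mu c c' d d' e e' x)
         + 2 * ct3 (p0 x) (\<lambda>c c' d d' e e'. mu c d c' e d' e' x)))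
      + (1/2) * ct2 (p0 x) (\<lambda>c c' d d'. mu c d a c' b d' x)
      - (1/2) * ct2 (p0 x) (\<lambda>c c' d d'. mu c c' a d b d' x)
      + (1/4) * ct2 (p0 x) (\<lambda>c c' d d'. mu a b c d c' d' x)
      - (1/2) * ct2 (p0 x) (\<lambda>c c' d d'. (1/2) * (mu c a b c' d d' x + mu c b a c' d d' x))
      + (3/4) * ct2 (p0 x) (\<lambda>c c' d d'. mu c c' a b d d' x)
      - (1/2) * ct2 (p0 x) (\<lambda>c c' d d'. mu c d a b c' d' x)) = - leff a b x"
      unfolding leff_def Let_def by simp
  qed
qed

theorem wlim_Ein: "wlim U (\<lambda>l x. Ein l a b x) (\<lambda>x. Ein 0 a b x - leff a b x)"
proof -
  have "wlim U (\<lambda>l x. Ein 0 a b x + qeinstein (g0 x) (p0 x) (DD l x) a b) (\<lambda>x. Ein 0 a b x + - leff a b x)"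
    using smooth_g[of 0] smooth_h[of 0]
    by (intro wlim_add wlim_qeinstein wlim_const smooth_on_continuous smooth_leinstein U) auto
  from weq_wlim[OF weq_Ein this] show ?thesis by simp
qed

end

subsection \<open>Charts and changes of coordinates\<close>

abbreviation cran :: "'m chart \<Rightarrow> (real^4) set" where "cran c \<equiv> cmap c ` cdom c"

definition overlap :: "'m chart \<Rightarrow> 'm chart \<Rightarrow> (real^4) set" where
  "overlap c c' = cmap c ` (cdom c \<inter> cdom c')"

section \<open>Sums over index lists\<close>

lemma multi_indices_0: "multi_indices 0 = {[]}"
  by (auto simp: multi_indices_def)

lemma sum_multi_indices_Suc:
  "(\<Sum>as\<in>multi_indices (Suc n). F as) = (\<Sum>a\<in>UNIV. \<Sum>as\<in>multi_indices n. F (a # as))"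
proof -
  have "multi_indices (Suc n) = (\<lambda>(a, as). a # as) ` (UNIV \<times> multi_indices n)"
    by (auto simp: multi_indices_def length_Suc_conv image_iff)
  then have "(\<Sum>as\<in>multi_indices (Suc n). F as) = (\<Sum>(a, as)\<in>UNIV \<times> multi_indices n. F (a # as))"
    by (simp add: sum.reindex inj_on_def case_prod_beta)
  then show ?thesis by (simp add: sum.cartesian_product)
qed

lemma finite_multi_indices: "finite (multi_indices n)"
  using finite_lists_length_eq[of "UNIV :: 4 set" n] by (simp add: multi_indices_def)

lemma sum_prod_multi_indices:
  fixes f :: "nat \<Rightarrow> 4 \<Rightarrow> real"
  shows "(\<Sum>as\<in>multi_indices n. \<Prod>k<n. f k (as ! k)) = (\<Prod>k<n. \<Sum>b\<in>UNIV. f k b)"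
proof (induction n arbitrary: f)
  case (Suc n)
  have "(\<Sum>as\<in>multi_indices (Suc n). \<Prod>k<Suc n. f k (as ! k)) =
      (\<Sum>a\<in>UNIV. \<Sum>as\<in>multi_indices n. f 0 a * (\<Prod>k<n. f (Suc k) (as ! k)))"
    by (simp add: sum_multi_indices_Suc prod.lessThan_Suc_shift del: prod.lessThan_Suc)
  also have "\<dots> = (\<Sum>a\<in>UNIV. f 0 a * (\<Prod>k<n. \<Sum>b\<in>UNIV. f (Suc k) b))"
    by (simp only: sum_distrib_left[symmetric] Suc.IH[of "\<lambda>k. f (Suc k)"])
  also have "\<dots> = (\<Prod>k<Suc n. \<Sum>b\<in>UNIV. f k b)"
    by (simp add: prod.lessThan_Suc_shift sum_distrib_right[symmetric] del: prod.lessThan_Suc)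
  finally show ?case .
qed (simp add: multi_indices_0)

lemma prod_delta_multi_indices:
  assumes "as \<in> multi_indices n" "bs \<in> multi_indices n"
  shows "(\<Prod>k<n. if as ! k = bs ! k then 1 else 0) = (if as = bs then 1 else (0::real))"
proof (cases "as = bs")
  case False
  then obtain k where "k < n" "as ! k \<noteq> bs ! k"
    using assms by (auto simp: multi_indices_def list_eq_iff_nth_eq)
  then show ?thesis using False by (auto intro!: prod_zero)
qed simp

locale manifold =
  fixes A :: "'m::{t2_space, second_countable_topology} chart set"
  assumes atlas: "smooth_atlas A"
begin

lemma open_cdom: "c \<in> A \<Longrightarrow> open (cdom c)"
  and open_cran: "c \<in> A \<Longrightarrow> open (cran c)"
  and inj_cmap: "c \<in> A \<Longrightarrow> inj_on (cmap c) (cdom c)"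
  and homeo: "c \<in> A \<Longrightarrow> homeomorphism (cdom c) (cran c) (cmap c) (cinv c)"
  using atlas by (auto simp: smooth_atlas_def is_chart_def)

lemma cinv_cmap: "c \<in> A \<Longrightarrow> p \<in> cdom c \<Longrightarrow> cinv c (cmap c p) = p"
  by (simp add: inj_cmap)

lemma cmap_cinv: "x \<in> cran c \<Longrightarrow> cmap c (cinv c x) = x"
  by (simp add: f_inv_into_f)

lemma cinv_in: "x \<in> cran c \<Longrightarrow> cinv c x \<in> cdom c"
  by (simp add: inv_into_into)

lemma continuous_cmap: "c \<in> A \<Longrightarrow> continuous_on (cdom c) (cmap c)"
  and continuous_cinv: "c \<in> A \<Longrightarrow> continuous_on (cran c) (cinv c)"
  using homeo by (auto simp: homeomorphism_def)

lemma chart_at: obtains c where "c \<in> A" "p \<in> cdom c"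
proof -
  have "(\<Union>c\<in>A. cdom c) = UNIV" using atlas by (simp add: smooth_atlas_def)
  then have "p \<in> (\<Union>c\<in>A. cdom c)" by simp
  then show ?thesis using that by blast
qed

lemma open_cmap_image:
  assumes "c \<in> A" "open V"
  shows "open (cmap c ` (cdom c \<inter> V))"
proof -
  have "cmap c ` (cdom c \<inter> V) = cran c \<inter> cinv c -` V"
    using cinv_cmap[OF assms(1)] cmap_cinv cinv_in by (auto simp: image_iff)
  then show ?thesis
    using continuous_open_preimage[OF continuous_cinv[OF assms(1)] open_cran[OF assms(1)] assms(2)] by simp
qed

lemma open_overlap: "c \<in> A \<Longrightarrow> c' \<in> A \<Longrightarrow> open (overlap c c')"
  unfolding overlap_def by (intro open_cmap_image open_cdom)

lemma overlap_sub: "overlap c c' \<subseteq> cran c"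
  by (auto simp: overlap_def)

lemma overlap_iff: "c \<in> A \<Longrightarrow> x \<in> overlap c c' \<longleftrightarrow> x \<in> cran c \<and> cinv c x \<in> cdom c'"
  by (auto simp: overlap_def cinv_cmap cmap_cinv cinv_in intro!: image_eqI[of _ _ "cinv c x"])

lemma cmap_overlap: "p \<in> cdom c \<Longrightarrow> p \<in> cdom c' \<Longrightarrow> cmap c p \<in> overlap c c'"
  by (auto simp: overlap_def)

lemma smooth_transition: "c \<in> A \<Longrightarrow> c' \<in> A \<Longrightarrow> smooth_on (overlap c c') (\<lambda>x. cmap c' (cinv c x) $ i)"
  using atlas by (auto simp: smooth_atlas_def overlap_def)

lemma transition_image: "c \<in> A \<Longrightarrow> (\<lambda>x. cmap c' (cinv c x)) ` overlap c c' \<subseteq> overlap c' c"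
  by (auto simp: overlap_iff overlap_def cinv_cmap)

lemma smooth_change_chart:
  assumes c: "c \<in> A" "c' \<in> A" and f: "smooth_on (overlap c' c) (\<lambda>x. f (cinv c' x))"
  shows "smooth_on (overlap c c') (\<lambda>x. f (cinv c x))"
proof (rule smooth_on_cong[OF open_overlap[OF c]])
  show "smooth_on (overlap c c') (\<lambda>x. f (cinv c' (cmap c' (cinv c x))))"
    by (rule smooth_on_compose[OF open_overlap[OF c] open_overlap[OF c(2,1)] smooth_transition[OF c] transition_image[OF c(1)] f])
qed (auto simp: overlap_iff c cinv_cmap)

lemma coord_deriv_cinv: "x \<in> cran c \<Longrightarrow> coord_deriv c i f (cinv c x) = partial i (\<lambda>x. f (cinv c x)) x"
  by (simp add: coord_deriv_def cmap_cinv o_def)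

lemma jacobian_cinv: "x \<in> cran c \<Longrightarrow> jacobian c c' (cinv c x) i j = partial j (\<lambda>x. cmap c' (cinv c x) $ i) x"
  by (simp add: jacobian_def coord_deriv_cinv)

lemma smooth_jacobian:
  assumes "c \<in> A" "c' \<in> A"
  shows "smooth_on (overlap c c') (\<lambda>x. jacobian c c' (cinv c x) i j)"
  by (rule smooth_on_cong[OF open_overlap[OF assms] _ smooth_on_partial[OF smooth_transition[OF assms]]])
     (simp add: jacobian_cinv subsetD[OF overlap_sub])

lemma coord_deriv_chain:
  assumes c: "c \<in> A" "c' \<in> A" and p: "p \<in> cdom c" "p \<in> cdom c'"
    and f: "(\<lambda>x. f (cinv c' x)) differentiable (at (cmap c' p))"
  shows "coord_deriv c i f p = (\<Sum>j\<in>UNIV. coord_deriv c' j f p * jacobian c c' p j i)"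
proof -
  let ?x = "cmap c p"
  have x: "?x \<in> overlap c c'" using p by (rule cmap_overlap)
  have "coord_deriv c i f p = partial i (\<lambda>x. f (cinv c x)) ?x" by (simp add: coord_deriv_def o_def)
  also have "\<dots> = partial i (\<lambda>x. f (cinv c' (cmap c' (cinv c x)))) ?x"
    by (rule partial_cong_open[OF open_overlap[OF c] x]) (simp add: overlap_iff c cinv_cmap)
  also have "\<dots> = (\<Sum>j\<in>UNIV. partial j (\<lambda>x. f (cinv c' x)) (cmap c' (cinv c ?x)) * partial i (\<lambda>x. cmap c' (cinv c x) $ j) ?x)"
    by (rule partial_compose[where f = "\<lambda>x. f (cinv c' x)"])
       (use f p c x in \<open>auto simp: cinv_cmap intro: smooth_on_differentiable[OF open_overlap[OF c] smooth_transition[OF c]]\<close>)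
  finally show ?thesis using p c by (simp add: cinv_cmap jacobian_def coord_deriv_def o_def)
qed

text \<open>The chain rule for the coordinate functions of \<open>c''\<close>, read in the chart
  \<open>c'\<close>.\<close>

lemma jacobian_cocycle:
  assumes "c \<in> A" "c' \<in> A" "c'' \<in> A" "p \<in> cdom c" "p \<in> cdom c'" "p \<in> cdom c''"
  shows "(\<Sum>j\<in>UNIV. jacobian c' c'' p i j * jacobian c c' p j k) = jacobian c c'' p i k"
  unfolding jacobian_def[of c c''] jacobian_def[of c' c'']
  by (rule coord_deriv_chain[symmetric])
     (use assms smooth_on_differentiable[OF open_overlap smooth_transition cmap_overlap] in auto)

lemma jacobian_self:
  assumes "c \<in> A" "p \<in> cdom c"
  shows "jacobian c c p i j = (if i = j then 1 else 0)"
proof -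
  have "jacobian c c p i j = partial j (\<lambda>x. cmap c (cinv c x) $ i) (cmap c p)"
    by (simp add: jacobian_def coord_deriv_def o_def)
  also have "\<dots> = partial j (\<lambda>x. x $ i) (cmap c p)"
    by (rule partial_cong_open[OF open_cran[OF assms(1)]]) (use assms in \<open>auto simp: cmap_cinv\<close>)
  finally show ?thesis by auto
qed

lemma jacobian_inverse:
  assumes "c \<in> A" "c' \<in> A" "p \<in> cdom c" "p \<in> cdom c'"
  shows "(\<Sum>j\<in>UNIV. jacobian c' c p i j * jacobian c c' p j k) = (if i = k then 1 else 0)"
  using jacobian_cocycle[OF assms(1,2,1,3,4,3)] jacobian_self[OF assms(1,3)] by simp

lemma jacobian_prod_cocycle:
  assumes "c \<in> A" "c' \<in> A" "c'' \<in> A" "p \<in> cdom c" "p \<in> cdom c'" "p \<in> cdom c''"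
  shows "(\<Sum>bs\<in>multi_indices n. (\<Prod>k<n. jacobian c' c'' p (as ! k) (bs ! k)) * (\<Prod>k<n. jacobian c c' p (bs ! k) (ds ! k)))
    = (\<Prod>k<n. jacobian c c'' p (as ! k) (ds ! k))"
  using sum_prod_multi_indices[where n = n and f = "\<lambda>k b. jacobian c' c'' p (as ! k) b * jacobian c c' p b (ds ! k)"]
  by (simp add: jacobian_cocycle[OF assms] prod.distrib)

text \<open>The Jacobian factors in the contravariant and the covariant law are inverse to each
  other, so the chart chosen by \<open>SOME\<close> in \<open>pairing\<close> can be replaced by any
  other.\<close>

lemma pairing_in_chart:
  assumes f: "con_tensor A n f" and T: "cov_tensor A n T" and c: "c \<in> A" "p \<in> cdom c"
  shows "pairing A n f T p = (\<Sum>as\<in>multi_indices n. f c p as * T c p as)"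
proof -
  define c0 where "c0 = (SOME c. c \<in> A \<and> p \<in> cdom c)"
  have c0: "c0 \<in> A" "p \<in> cdom c0"
    using someI[of "\<lambda>c. c \<in> A \<and> p \<in> cdom c" c] c by (auto simp: c0_def)
  let ?I = "multi_indices n"
  have "(\<Sum>as\<in>?I. f c p as * T c p as) = (\<Sum>as\<in>?I. (\<Sum>bs\<in>?I. (\<Prod>k<n. jacobian c0 c p (as ! k) (bs ! k)) * f c0 p bs) *
     (\<Sum>ds\<in>?I. (\<Prod>k<n. jacobian c c0 p (ds ! k) (as ! k)) * T c0 p ds))"
    using f T c c0 unfolding con_tensor_def cov_tensor_def by (intro sum.cong refl arg_cong2[of _ _ _ _ "(*)"]) blast+
  also have "\<dots> = (\<Sum>as\<in>?I. \<Sum>bs\<in>?I. \<Sum>ds\<in>?I. f c0 p bs * T c0 p ds *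
     ((\<Prod>k<n. jacobian c c0 p (ds ! k) (as ! k)) * (\<Prod>k<n. jacobian c0 c p (as ! k) (bs ! k))))"
    unfolding sum_product by (simp add: mult_ac)
  also have "\<dots> = (\<Sum>bs\<in>?I. \<Sum>as\<in>?I. \<Sum>ds\<in>?I. f c0 p bs * T c0 p ds *
     ((\<Prod>k<n. jacobian c c0 p (ds ! k) (as ! k)) * (\<Prod>k<n. jacobian c0 c p (as ! k) (bs ! k))))"
    by (rule sum.swap)
  also have "\<dots> = (\<Sum>bs\<in>?I. \<Sum>ds\<in>?I. \<Sum>as\<in>?I. f c0 p bs * T c0 p ds *
     ((\<Prod>k<n. jacobian c c0 p (ds ! k) (as ! k)) * (\<Prod>k<n. jacobian c0 c p (as ! k) (bs ! k))))"
    by (rule sum.cong[OF refl], rule sum.swap)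
  also have "\<dots> = (\<Sum>bs\<in>?I. \<Sum>ds\<in>?I. f c0 p bs * T c0 p ds * (\<Prod>k<n. jacobian c0 c0 p (ds ! k) (bs ! k)))"
    by (simp add: sum_distrib_left[symmetric] jacobian_prod_cocycle[OF c0(1) c(1) c0(1) c0(2) c(2) c0(2)])
  also have "\<dots> = (\<Sum>bs\<in>?I. \<Sum>ds\<in>?I. if ds = bs then f c0 p bs * T c0 p ds else 0)"
    by (intro sum.cong refl) (simp add: jacobian_self[OF c0] prod_delta_multi_indices)
  also have "\<dots> = (\<Sum>bs\<in>?I. f c0 p bs * T c0 p bs)"
    by (simp add: finite_multi_indices)
  finally show ?thesis by (simp add: pairing_def c0_def Let_def)
qed

lemma pairing_eq_0:
  assumes "\<And>c as. c \<in> A \<Longrightarrow> p \<in> cdom c \<Longrightarrow> f c p as = 0"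
  shows "pairing A n f T p = 0"
proof -
  obtain c where "c \<in> A" "p \<in> cdom c" by (rule chart_at)
  then have "(SOME c. c \<in> A \<and> p \<in> cdom c) \<in> A" "p \<in> cdom (SOME c. c \<in> A \<and> p \<in> cdom c)"
    using someI[of "\<lambda>c. c \<in> A \<and> p \<in> cdom c" c] by auto
  then show ?thesis using assms by (simp add: pairing_def Let_def)
qed

subsection \<open>Test tensors supported in a chart\<close>

text \<open>In the chart \<open>c\<close> the tensor \<open>chart_tensor n c as F\<close> has the single nonzero component \<open>F\<close>, at the index
  list \<open>as\<close>; the Jacobian factors extend it to the other charts.\<close>

definition scalar :: "'m chart \<Rightarrow> (real^4 \<Rightarrow> real) \<Rightarrow> 'm \<Rightarrow> real" where
  "scalar c F p = (if p \<in> cdom c then F (cmap c p) else 0)"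

definition chart_tensor :: "nat \<Rightarrow> 'm chart \<Rightarrow> 4 list \<Rightarrow> (real^4 \<Rightarrow> real) \<Rightarrow> 'm tensor" where
  "chart_tensor n c as F c' p bs = (\<Prod>k<n. jacobian c c' p (bs ! k) (as ! k)) * scalar c F p"

lemma con_chart_tensor:
  assumes "c \<in> A"
  shows "con_tensor A n (chart_tensor n c as F)"
  unfolding con_tensor_def
proof (intro ballI)
  fix c1 c2 p bs assume "c1 \<in> A" "c2 \<in> A" "p \<in> cdom c1 \<inter> cdom c2" "bs \<in> multi_indices n"
  then show "chart_tensor n c as F c2 p bs =
     (\<Sum>ds\<in>multi_indices n. (\<Prod>k<n. jacobian c1 c2 p (bs ! k) (ds ! k)) * chart_tensor n c as F c1 p ds)"
    using jacobian_prod_cocycle[OF assms, where c' = c1 and c'' = c2 and p = p and n = n and as = bs and ds = as]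
    by (cases "p \<in> cdom c") (simp_all add: chart_tensor_def mult.assoc[symmetric] sum_distrib_right[symmetric] scalar_def)
qed

text \<open>The Hausdorff property enters here: the compact image is closed in the manifold, so what
  is supported in it can be extended by zero outside the chart.\<close>

lemma compact_chart_support:
  assumes c: "c \<in> A" and K: "compact K" "K \<subseteq> cran c"
  shows "compact (cinv c ` K)" "closed (cinv c ` K)" "cinv c ` K \<subseteq> cdom c"
proof -
  show "compact (cinv c ` K)"
    by (rule compact_continuous_image[OF continuous_on_subset[OF continuous_cinv[OF c] K(2)] K(1)])
  then show "closed (cinv c ` K)" by (rule compact_imp_closed)
  show "cinv c ` K \<subseteq> cdom c" by (rule image_subsetI) (rule cinv_in[OF subsetD[OF K(2)]])
qed

lemma scalar_0:
  assumes "c \<in> A" "\<And>x. x \<notin> K \<Longrightarrow> F x = 0" "p \<notin> cinv c ` K"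
  shows "scalar c F p = 0"
proof (cases "p \<in> cdom c")
  case True
  have "cmap c p \<notin> K"
  proof
    assume "cmap c p \<in> K"
    then have "cinv c (cmap c p) \<in> cinv c ` K" by (rule imageI)
    with assms(3) show False using cinv_cmap[OF assms(1) True] by simp
  qed
  then show ?thesis by (simp add: scalar_def assms(2))
qed (simp add: scalar_def)

text \<open>A point of the second chart lies either in the first chart, where smoothness is
  transported by the coordinate change, or in the open complement of the closed support, where
  \<open>f\<close> is zero.\<close>

lemma smooth_on_supported:
  assumes c: "c \<in> A" "c' \<in> A" and K: "compact K" "K \<subseteq> cran c"
    and 0: "\<And>p. p \<notin> cinv c ` K \<Longrightarrow> f p = 0"
    and f: "smooth_on (overlap c c') (\<lambda>x. f (cinv c x))"
  shows "smooth_on (cran c') (\<lambda>x. f (cinv c' x))"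
proof (rule smooth_on_local)
  note KM = compact_chart_support[OF c(1) K]
  fix x assume x: "x \<in> cran c'"
  show "\<exists>T. open T \<and> x \<in> T \<and> smooth_on T (\<lambda>x. f (cinv c' x))"
  proof (cases "cinv c' x \<in> cdom c")
    case True
    then have "x \<in> overlap c' c" using x c by (simp add: overlap_iff)
    then show ?thesis using smooth_change_chart[OF c(2,1) f] open_overlap[OF c(2,1)] by blast
  next
    case False
    let ?V = "cmap c' ` (cdom c' \<inter> - (cinv c ` K))"
    have V: "open ?V" by (rule open_cmap_image[OF c(2)]) (use KM in auto)
    have "smooth_on ?V (\<lambda>x. f (cinv c' x))"
      by (rule smooth_on_cong[OF V _ smooth_on_const[of _ 0]]) (auto simp: cinv_cmap c 0)
    moreover have "x \<in> ?V" using False x KM(3) cmap_cinv[OF x] cinv_in[OF x]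
      by (intro image_eqI[of _ _ "cinv c' x"]) auto
    ultimately show ?thesis using V by blast
  qed
qed

lemma smooth_scalar:
  assumes c: "c \<in> A" "c' \<in> A" and F: "testf (cran c) F"
  shows "smooth_on (cran c') (\<lambda>x. scalar c F (cinv c' x))"
proof -
  obtain K where K: "compact K" "K \<subseteq> cran c" "\<And>x. x \<notin> K \<Longrightarrow> F x = 0" "smooth_on UNIV F"
    using F by (auto simp: testf_def)
  have sm: "smooth_on (overlap c c') (\<lambda>x. scalar c F (cinv c x))"
    by (rule smooth_on_cong[OF open_overlap[OF c] _ smooth_on_subset[OF K(4)]])
       (auto simp: scalar_def overlap_iff c cmap_cinv cinv_in)
  have "scalar c F p = 0" if "p \<notin> cinv c ` K" for p
    by (rule scalar_0[where K = K and F = F, OF c(1) K(3) that])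
  then show ?thesis by (rule smooth_on_supported[where f = "scalar c F", OF c K(1,2) _ sm])
qed

lemma test_chart_tensor:
  assumes c: "c \<in> A" and F: "testf (cran c) F"
  shows "test_tensor A n (chart_tensor n c as F)"
proof -
  obtain K where K: "compact K" "K \<subseteq> cran c" "\<And>x. x \<notin> K \<Longrightarrow> F x = 0" "smooth_on UNIV F"
    using F by (auto simp: testf_def)
  note KM = compact_chart_support[OF c K(1,2)]
  have "smooth_components A n (chart_tensor n c as F)"
    unfolding smooth_components_def smooth_in_chart_def o_def
  proof (intro ballI)
    fix c' bs assume c': "c' \<in> A"
    show "smooth_on (cran c') (\<lambda>x. chart_tensor n c as F c' (cinv c' x) bs)"
    proof (rule smooth_on_supported[OF c c' K(1,2)])
      show "chart_tensor n c as F c' p bs = 0" if "p \<notin> cinv c ` K" for p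
        using scalar_0[where K = K and F = F, OF c K(3) that] by (simp add: chart_tensor_def)
      show "smooth_on (overlap c c') (\<lambda>x. chart_tensor n c as F c' (cinv c x) bs)"
        unfolding chart_tensor_def
        by (intro smooth_rules smooth_jacobian open_overlap c c' smooth_on_subset[OF smooth_scalar[OF c c F] overlap_sub])
    qed
  qed
  moreover have "compact (tensor_support A n (chart_tensor n c as F))"
  proof -
    have "{p. \<exists>c'\<in>A. p \<in> cdom c' \<and> (\<exists>bs \<in> multi_indices n. chart_tensor n c as F c' p bs \<noteq> 0)} \<subseteq> cinv c ` K"
      using scalar_0[where K = K and F = F, OF c K(3)] by (auto simp: chart_tensor_def)
    then have "tensor_support A n (chart_tensor n c as F) \<subseteq> cinv c ` K"
      unfolding tensor_support_def using KM(2) by (rule closure_minimal)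
    then show ?thesis
      using closed_Int_compact[of "tensor_support A n (chart_tensor n c as F)", OF _ KM(1)]
      by (simp add: tensor_support_def inf.absorb1)
  qed
  ultimately show ?thesis using con_chart_tensor[OF c] by (simp add: test_tensor_def)
qed

lemma pairing_chart_tensor:
  assumes c: "c \<in> A" and T: "cov_tensor A n T" and as: "as \<in> multi_indices n"
  shows "pairing A n (chart_tensor n c as F) T p = scalar c F p * T c p as"
proof (cases "p \<in> cdom c")
  case True
  have "pairing A n (chart_tensor n c as F) T p = (\<Sum>bs\<in>multi_indices n. chart_tensor n c as F c p bs * T c p bs)"
    by (rule pairing_in_chart[OF con_chart_tensor[OF c] T c True])
  also have "\<dots> = (\<Sum>bs\<in>multi_indices n. if bs = as then scalar c F p * T c p bs else 0)"
    by (intro sum.cong refl) (simp add: chart_tensor_def jacobian_self[OF c True] prod_delta_multi_indices as)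
  finally show ?thesis using as by (simp add: finite_multi_indices)
next
  case False
  then show ?thesis by (simp add: pairing_eq_0 chart_tensor_def scalar_def)
qed

end

subsection \<open>Metrics and covariant derivatives in charts\<close>

lemma matrix_inv_left_right:
  "invertible M \<Longrightarrow> M ** matrix_inv M = mat 1 \<and> matrix_inv M ** M = mat 1"
  unfolding matrix_inv_def invertible_def by (rule someI_ex)

lemma invertible_metric_matrix:
  assumes "det (metric_matrix g c p) \<noteq> 0"
  shows "(\<Sum>b\<in>UNIV. g c p [a, b] * inv_metric g c p b d) = (if a = d then 1 else 0)"
    "(\<Sum>b\<in>UNIV. inv_metric g c p a b * g c p [b, d]) = (if a = d then 1 else 0)"
proof -
  let ?M = "metric_matrix g c p"
  have inv: "invertible ?M" using assms by (simp add: invertible_det_nz)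
  then have "?M ** matrix_inv ?M = mat 1" "matrix_inv ?M ** ?M = mat 1"
    by (simp_all add: matrix_inv_left_right)
  then have "(?M ** matrix_inv ?M) $ a $ d = mat 1 $ a $ d" "(matrix_inv ?M ** ?M) $ a $ d = mat 1 $ a $ d" by simp_all
  then show "(\<Sum>b\<in>UNIV. g c p [a, b] * inv_metric g c p b d) = (if a = d then 1 else 0)"
    "(\<Sum>b\<in>UNIV. inv_metric g c p a b * g c p [b, d]) = (if a = d then 1 else 0)"
    by (simp_all add: matrix_matrix_mult_def mat_def inv_metric_def metric_matrix_def)
qed

lemma inv_metric_unique:
  assumes "det (metric_matrix g c p) \<noteq> 0" and X: "\<And>a d. (\<Sum>b\<in>UNIV. g c p [a, b] * X b d) = (if a = d then 1 else 0)"
  shows "X a d = inv_metric g c p a d"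
proof -
  have "X a d = (\<Sum>b\<in>UNIV. (\<Sum>e\<in>UNIV. inv_metric g c p a e * g c p [e, b]) * X b d)"
    by (simp add: invertible_metric_matrix(2)[OF assms(1)] delta_mult)
  also have "\<dots> = (\<Sum>b\<in>UNIV. \<Sum>e\<in>UNIV. inv_metric g c p a e * (g c p [e, b] * X b d))"
    by (simp add: sum_distrib_right mult.assoc)
  also have "\<dots> = (\<Sum>e\<in>UNIV. inv_metric g c p a e * (\<Sum>b\<in>UNIV. g c p [e, b] * X b d))"
    by (subst sum.swap) (simp add: sum_distrib_left)
  also have "\<dots> = inv_metric g c p a d" by (simp add: X mult_delta)
  finally show ?thesis .
qed

lemma inv_metric_sym:
  assumes "det (metric_matrix g c p) \<noteq> 0" "\<And>a b. g c p [a, b] = g c p [b, a]"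
  shows "inv_metric g c p a b = inv_metric g c p b a"
proof -
  have "(\<Sum>b\<in>UNIV. g c p [a, b] * inv_metric g c p d b) = (if a = d then 1 else 0)" for a d
  proof -
    have "(\<Sum>b\<in>UNIV. g c p [a, b] * inv_metric g c p d b) = (\<Sum>b\<in>UNIV. inv_metric g c p d b * g c p [b, a])"
      by (rule sum.cong[OF refl]) (metis assms(2) mult.commute)
    then show ?thesis using invertible_metric_matrix(2)[OF assms(1), of d a] by auto
  qed
  from inv_metric_unique[OF assms(1) this] show ?thesis by simp
qed

text \<open>In the orthonormal basis the matrix is diagonal with determinant -1, and a change of
  basis multiplies the determinant by a square. The strict sign makes the metric invertible and the
  volume density smooth.\<close>

lemma det_lorentzian:
  fixes E :: "4 \<Rightarrow> real^4"
  assumes "\<forall>i j. bilin g c p (E i) (E j) = (if i \<noteq> j then 0 else if i = 0 then -1 else 1)"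
  shows "det (metric_matrix g c p) < 0"
proof -
  let ?M = "metric_matrix g c p"
  define P where "P = (\<chi> i j. E i $ j)"
  have "(P ** ?M ** transpose P) $ i $ j = bilin g c p (E i) (E j)" for i j
  proof -
    have "(P ** ?M ** transpose P) $ i $ j = (\<Sum>b\<in>UNIV. \<Sum>a\<in>UNIV. E i $ a * g c p [a, b] * E j $ b)"
      by (simp add: matrix_matrix_mult_def transpose_def P_def metric_matrix_def sum_distrib_right)
    also have "\<dots> = (\<Sum>a\<in>UNIV. \<Sum>b\<in>UNIV. E i $ a * g c p [a, b] * E j $ b)" by (rule sum.swap)
    finally show ?thesis by (simp add: bilin_def mult_ac)
  qed
  then have "P ** ?M ** transpose P = (\<chi> i j. if i \<noteq> j then 0 else if i = 0 then -1 else 1)"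
    using assms by (simp add: vec_eq_iff)
  then have "det P * det ?M * det P = det (\<chi> i j::4. if i \<noteq> j then 0 else if i = 0 then -1 else (1::real))"
    by (metis det_mul det_transpose)
  also have "\<dots> = (\<Prod>i\<in>UNIV. if i = (0::4) then -1 else 1)"
    by (subst det_diagonal) simp_all
  also have "\<dots> = -1" by simp
  finally have "(det P)\<^sup>2 * det ?M = -1" by (simp add: power2_eq_square mult_ac)
  then show ?thesis by (smt (verit) mult_nonneg_nonneg zero_le_power2)
qed

lemma smooth_on_det:
  assumes "open S" "\<And>i j. smooth_on S (\<lambda>x. M x $ i $ j)"
  shows "smooth_on S (\<lambda>x. det (M x :: real^4^4))"
  unfolding det_def by (intro smooth_on_sum smooth_on_mult smooth_on_const smooth_on_prod assms)

text \<open>Cramer's rule: every entry of the inverse is a quotient of determinants, hence of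
  polynomials in the entries.\<close>

lemma smooth_on_matrix_inv:
  assumes S: "open S" and M: "\<And>i j. smooth_on S (\<lambda>x. M x $ i $ j)" and nz: "\<And>x. x \<in> S \<Longrightarrow> det (M x :: real^4^4) \<noteq> 0"
  shows "smooth_on S (\<lambda>x. matrix_inv (M x) $ a $ b)"
proof (rule smooth_on_cong[OF S])
  let ?N = "\<lambda>x. (\<chi> i j. if j = a then axis b 1 $ i else M x $ i $ j) :: real^4^4"
  have "smooth_on S (\<lambda>x. ?N x $ i $ j)" for i j
    by (cases "j = a") (simp_all add: smooth_on_const M)
  then have dN: "smooth_on S (\<lambda>x. det (?N x))" by (rule smooth_on_det[OF S, of ?N])
  show "smooth_on S (\<lambda>x. det (?N x) * inverse (det (M x)))"
    by (rule smooth_on_mult[OF S dN smooth_on_inverse[OF S smooth_on_det[OF S M] nz]])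
  fix x assume x: "x \<in> S"
  have "M x *v (matrix_inv (M x) *v axis b 1) = axis b 1"
    using nz[OF x] by (simp add: matrix_vector_mul_assoc matrix_inv_left_right invertible_det_nz)
  then have "matrix_inv (M x) *v axis b 1 = (\<chi> k. det (\<chi> i j. if j = k then axis b 1 $ i else M x $ i $ j) / det (M x))"
    using cramer[OF nz[OF x]] by blast
  moreover have "(matrix_inv (M x) *v axis b 1) $ a = matrix_inv (M x) $ a $ b"
    by (simp add: matrix_vector_mult_def axis_def if_distrib cong: if_cong)
  ultimately show "det (?N x) * inverse (det (M x)) = matrix_inv (M x) $ a $ b"
    by (metis (no_types, lifting) divide_inverse vec_lambda_beta)
qed

context manifold
begin

lemma smooth_component_cov:
  "smooth_cov_tensor A n T \<Longrightarrow> c \<in> A \<Longrightarrow> length as = n \<Longrightarrow> smooth_on (cran c) (\<lambda>x. T c (cinv c x) as)"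
  by (auto simp: smooth_cov_tensor_def smooth_components_def smooth_in_chart_def multi_indices_def o_def)

lemma lorentzian_smooth: "lorentzian_metric A g \<Longrightarrow> smooth_cov_tensor A 2 g"
  by (simp add: lorentzian_metric_def smooth_symmetric_def)

lemma lorentzian_sym: "lorentzian_metric A g \<Longrightarrow> c \<in> A \<Longrightarrow> p \<in> cdom c \<Longrightarrow> g c p [a, b] = g c p [b, a]"
  by (simp add: lorentzian_metric_def smooth_symmetric_def)

lemma lorentzian_det: "lorentzian_metric A g \<Longrightarrow> c \<in> A \<Longrightarrow> p \<in> cdom c \<Longrightarrow> det (metric_matrix g c p) < 0"
proof -
  assume "lorentzian_metric A g" "c \<in> A" "p \<in> cdom c"
  then obtain E :: "4 \<Rightarrow> real^4" where "\<forall>i j. bilin g c p (E i) (E j) = (if i \<noteq> j then 0 else if i = 0 then -1 else 1)"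
    unfolding lorentzian_metric_def by blast
  then show ?thesis by (rule det_lorentzian)
qed

lemma smooth_inv_metric:
  assumes "smooth_cov_tensor A 2 g" "c \<in> A" "\<And>p. p \<in> cdom c \<Longrightarrow> det (metric_matrix g c p) \<noteq> 0"
  shows "smooth_on (cran c) (\<lambda>x. inv_metric g c (cinv c x) a b)"
  unfolding inv_metric_def
  by (intro smooth_on_matrix_inv open_cran assms)
     (simp_all add: metric_matrix_def cinv_in smooth_component_cov[OF assms(1,2)])

lemma christoffel_cinv:
  assumes "x \<in> cran c"
  shows "christoffel g c k i j (cinv c x) =
    lchr (\<lambda>a b x. g c (cinv c x) [a, b]) (\<lambda>a b x. inv_metric g c (cinv c x) a b) k i j x"
  using assms by (simp add: christoffel_def lchr_def coord_deriv_cinv)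

lemma ricci_cinv:
  assumes c: "c \<in> A" and x: "x \<in> cran c"
  shows "ricci g c (cinv c x) a b =
    lricci (\<lambda>a b x. g c (cinv c x) [a, b]) (\<lambda>a b x. inv_metric g c (cinv c x) a b) a b x"
proof -
  have "coord_deriv c n (christoffel g c k i j) (cinv c x) =
      partial n (lchr (\<lambda>a b x. g c (cinv c x) [a, b]) (\<lambda>a b x. inv_metric g c (cinv c x) a b) k i j) x" for n k i j
    unfolding coord_deriv_cinv[OF x] by (rule partial_cong_open[OF open_cran[OF c] x]) (rule christoffel_cinv)
  then show ?thesis using x
    by (simp add: ricci_def riemann_def lricci_def christoffel_cinv)
qed

lemma einstein_cinv:
  assumes "c \<in> A" "x \<in> cran c"
  shows "einstein g c (cinv c x) a b =
    leinstein (\<lambda>a b x. g c (cinv c x) [a, b]) (\<lambda>a b x. inv_metric g c (cinv c x) a b) a b x"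
  using assms by (simp add: einstein_def scalar_curvature_def leinstein_def ricci_cinv)

lemma sum_MI2: "(\<Sum>as\<in>multi_indices 2. F as) = (\<Sum>a\<in>UNIV. \<Sum>b\<in>UNIV. F [a, b])"
  by (simp add: numeral_2_eq_2 sum_multi_indices_Suc multi_indices_0)


lemma cov_tensor_2:
  assumes "cov_tensor A 2 T" "c \<in> A" "c' \<in> A" "p \<in> cdom c" "p \<in> cdom c'"
  shows "T c' p [i, j] = (\<Sum>a\<in>UNIV. \<Sum>b\<in>UNIV. jacobian c' c p a i * jacobian c' c p b j * T c p [a, b])"
proof -
  have "[i, j] \<in> multi_indices 2" by (simp add: multi_indices_def)
  then have "T c' p [i, j] = (\<Sum>bs\<in>multi_indices 2. (\<Prod>k<2. jacobian c' c p (bs ! k) ([i, j] ! k)) * T c p bs)"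
    using assms unfolding cov_tensor_def by blast
  then show ?thesis by (simp only: sum_MI2) (simp add: numeral_2_eq_2 mult_ac)
qed

lemma coord_deriv_cov_tensor_2:
  assumes T: "smooth_cov_tensor A 2 T" and c: "c \<in> A" "c' \<in> A" and p: "p \<in> cdom c" "p \<in> cdom c'"
  shows "coord_deriv c' i (\<lambda>q. T c' q [j, k]) p =
      (\<Sum>a\<in>UNIV. \<Sum>b\<in>UNIV. coord_deriv c' i (\<lambda>q. jacobian c' c q a j) p * jacobian c' c p b k * T c p [a, b])
    + (\<Sum>a\<in>UNIV. \<Sum>b\<in>UNIV. jacobian c' c p a j * coord_deriv c' i (\<lambda>q. jacobian c' c q b k) p * T c p [a, b])
    + (\<Sum>a\<in>UNIV. \<Sum>b\<in>UNIV. \<Sum>d\<in>UNIV. jacobian c' c p d i * jacobian c' c p a j * jacobian c' c p b k * coord_deriv c d (\<lambda>q. T c q [a, b]) p)"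
proof -
  let ?x = "cmap c' p" and ?W = "overlap c' c"
  let ?J = "\<lambda>a j x. jacobian c' c (cinv c' x) a j"
  let ?T = "\<lambda>a b x. T c (cinv c' x) [a, b]"
  have W: "open ?W" "?x \<in> ?W" using open_overlap[OF c(2,1)] cmap_overlap[OF p(2,1)] by auto
  have ip: "cinv c' ?x = p" using cinv_cmap[OF c(2) p(2)] .
  have J: "?J a j differentiable (at ?x)" for a j
    by (rule smooth_on_differentiable[OF W(1) smooth_jacobian[OF c(2,1)] W(2)])
  have Tc: "smooth_on (cran c) (\<lambda>x. T c (cinv c x) [a, b])" for a b
    by (rule smooth_component_cov[OF T c(1)]) simp
  have T': "?T a b differentiable (at ?x)" for a b
    by (rule smooth_on_differentiable[OF W(1) smooth_change_chart[OF c(2,1) smooth_on_subset[OF Tc overlap_sub]] W(2)])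
  have cT: "cov_tensor A 2 T" using T by (simp add: smooth_cov_tensor_def)
  have "coord_deriv c' i (\<lambda>q. T c' q [j, k]) p = partial i (\<lambda>x. T c' (cinv c' x) [j, k]) ?x"
    by (simp add: coord_deriv_def o_def)
  also have "\<dots> = partial i (\<lambda>x. \<Sum>a\<in>UNIV. \<Sum>b\<in>UNIV. ?J a j x * ?J b k x * ?T a b x) ?x"
    by (rule partial_cong_open[OF W]) (use cov_tensor_2[OF cT c] c in \<open>auto simp: overlap_iff cinv_in\<close>)
  also have "\<dots> = (\<Sum>a\<in>UNIV. \<Sum>b\<in>UNIV. (partial i (?J a j) ?x * ?J b k ?x + ?J a j ?x * partial i (?J b k) ?x) * ?T a b ?x
       + ?J a j ?x * ?J b k ?x * partial i (?T a b) ?x)"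
    by (simp add: partial_sum partial_mult differentiable_sum differentiable_mult J T')
  also have "\<dots> = (\<Sum>a\<in>UNIV. \<Sum>b\<in>UNIV. (coord_deriv c' i (\<lambda>q. jacobian c' c q a j) p * jacobian c' c p b k
       + jacobian c' c p a j * coord_deriv c' i (\<lambda>q. jacobian c' c q b k) p) * T c p [a, b]
       + jacobian c' c p a j * jacobian c' c p b k * (\<Sum>d\<in>UNIV. coord_deriv c d (\<lambda>q. T c q [a, b]) p * jacobian c' c p d i))"
  proof -
    have "partial i (?T a b) ?x = (\<Sum>d\<in>UNIV. coord_deriv c d (\<lambda>q. T c q [a, b]) p * jacobian c' c p d i)" for a b
      using coord_deriv_chain[OF c(2,1) p(2,1), of "\<lambda>q. T c q [a, b]" i]
        smooth_on_differentiable[OF open_cran[OF c(1)] Tc, of "cmap c p" a b] p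
      by (simp add: coord_deriv_def o_def)
    then show ?thesis by (simp add: ip coord_deriv_def o_def)
  qed
  finally show ?thesis by (simp add: sum.distrib algebra_simps sum_distrib_left)
qed

end

text \<open>The inhomogeneous transformation law of the Christoffel symbols at one point: \<open>J\<close> is the Jacobian matrix of the
  old coordinates with respect to the new ones, \<open>H\<close> its derivative.\<close>

lemma christoffel_transformation_algebra:
  fixes J :: "4 \<Rightarrow> 4 \<Rightarrow> real" and H :: "4 \<Rightarrow> 4 \<Rightarrow> 4 \<Rightarrow> real"
  assumes H: "\<And>a i j. H a i j = H a j i"
    and J: "\<And>a b. (\<Sum>l\<in>UNIV. J a l * J' l b) = (if a = b then 1 else 0)"
    and gsym: "\<And>a b. g a b = g b a"
    and gi: "\<And>a b. (\<Sum>m\<in>UNIV. gi a m * g m b) = (if a = b then 1 else 0)"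
    and gi': "\<And>a b. (\<Sum>m\<in>UNIV. g' a m * gi' m b) = (if a = b then 1 else 0)" and gisym': "\<And>a b. gi' a b = gi' b a"
    and g': "\<And>i j. g' i j = (\<Sum>a\<in>UNIV. \<Sum>b\<in>UNIV. J a i * J b j * g a b)"
    and dg': "\<And>i j k. dg' i j k = (\<Sum>a\<in>UNIV. \<Sum>b\<in>UNIV. H a i j * J b k * g a b) + (\<Sum>a\<in>UNIV. \<Sum>b\<in>UNIV. J a j * H b i k * g a b)
       + (\<Sum>a\<in>UNIV. \<Sum>b\<in>UNIV. \<Sum>d\<in>UNIV. J d i * J a j * J b k * dg d a b)"
  shows "(\<Sum>k\<in>UNIV. J a k * ((1/2) * (\<Sum>l\<in>UNIV. gi' k l * (dg' i j l + dg' j i l - dg' l i j)))) =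
     H a i j + (\<Sum>b\<in>UNIV. \<Sum>d\<in>UNIV. ((1/2) * (\<Sum>m\<in>UNIV. gi a m * (dg b d m + dg d b m - dg m b d))) * J b i * J d j)"
proof -
  define L where "L m b d = (1/2) * (dg b d m + dg d b m - dg m b d)" for m b d
  define L' where "L' l i j = (1/2) * (dg' i j l + dg' j i l - dg' l i j)" for l i j
  define k where "k i j l = (\<Sum>a\<in>UNIV. \<Sum>b\<in>UNIV. H a i j * J b l * g a b)" for i j l
  define S where "S i j l = (\<Sum>a\<in>UNIV. \<Sum>b\<in>UNIV. \<Sum>d\<in>UNIV. J d i * J a j * J b l * dg d a b)" for i j l
  have k2: "(\<Sum>a\<in>UNIV. \<Sum>b\<in>UNIV. J a j * H b i l * g a b) = k i l j" for i j l
    unfolding k_def by (subst sum.swap) (simp add: gsym mult_ac)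
  have dk: "dg' i j l = k i j l + k i l j + S i j l" for i j l
    unfolding dg' k2 by (simp add: k_def S_def)
  have ks: "k i j l = k j i l" for i j l unfolding k_def using H by simp
  \<comment> \<open>Of the six terms with second derivatives of the coordinates, four cancel in
    pairs by the symmetry of \<open>H\<close>, and the other two are equal.\<close>
  have L'_eq: "L' l i j = k i j l + (1/2) * (S i j l + S j i l - S l i j)" for i j l
    unfolding L'_def dk ks[of j i] ks[of l i] ks[of l j] by (simp add: field_simps)
  have S1: "S i j l = (\<Sum>m\<in>UNIV. \<Sum>b\<in>UNIV. \<Sum>d\<in>UNIV. J m l * (J b i * J d j * dg b d m))" for i j l
  proof -
    have "S i j l = (\<Sum>d\<in>UNIV. \<Sum>m\<in>UNIV. \<Sum>b\<in>UNIV. J m l * (J b i * J d j * dg b d m))"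
      by (simp add: S_def mult_ac)
    also have "\<dots> = (\<Sum>m\<in>UNIV. \<Sum>d\<in>UNIV. \<Sum>b\<in>UNIV. J m l * (J b i * J d j * dg b d m))" by (rule sum.swap)
    also have "\<dots> = (\<Sum>m\<in>UNIV. \<Sum>b\<in>UNIV. \<Sum>d\<in>UNIV. J m l * (J b i * J d j * dg b d m))"
      by (rule sum.cong[OF refl], rule sum.swap)
    finally show ?thesis .
  qed
  have S2: "S j i l = (\<Sum>m\<in>UNIV. \<Sum>b\<in>UNIV. \<Sum>d\<in>UNIV. J m l * (J b i * J d j * dg d b m))" for i j l
  proof -
    have "S j i l = (\<Sum>b\<in>UNIV. \<Sum>m\<in>UNIV. \<Sum>d\<in>UNIV. J m l * (J b i * J d j * dg d b m))"
      by (simp add: S_def mult_ac)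
    also have "\<dots> = (\<Sum>m\<in>UNIV. \<Sum>b\<in>UNIV. \<Sum>d\<in>UNIV. J m l * (J b i * J d j * dg d b m))" by (rule sum.swap)
    finally show ?thesis .
  qed
  have S3: "S l i j = (\<Sum>m\<in>UNIV. \<Sum>b\<in>UNIV. \<Sum>d\<in>UNIV. J m l * (J b i * J d j * dg m b d))" for i j l
  proof -
    have "S l i j = (\<Sum>b\<in>UNIV. \<Sum>d\<in>UNIV. \<Sum>m\<in>UNIV. J m l * (J b i * J d j * dg m b d))"
      by (simp add: S_def mult_ac)
    also have "\<dots> = (\<Sum>b\<in>UNIV. \<Sum>m\<in>UNIV. \<Sum>d\<in>UNIV. J m l * (J b i * J d j * dg m b d))"
      by (rule sum.cong[OF refl], rule sum.swap)
    also have "\<dots> = (\<Sum>m\<in>UNIV. \<Sum>b\<in>UNIV. \<Sum>d\<in>UNIV. J m l * (J b i * J d j * dg m b d))" by (rule sum.swap)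
    finally show ?thesis .
  qed
  \<comment> \<open>\<open>R\<close> is the right-hand side of the claim with its index lowered by
    \<open>g\<close>; raised by \<open>gi\<close> it becomes \<open>X\<close>.\<close>
  define R where "R m = (\<Sum>b\<in>UNIV. \<Sum>d\<in>UNIV. J b i * J d j * L m b d) + (\<Sum>a\<in>UNIV. g m a * H a i j)" for m
  have L'R: "L' l i j = (\<Sum>m\<in>UNIV. J m l * R m)" for l
  proof -
    have "(1/2) * (S i j l + S j i l - S l i j) = (\<Sum>m\<in>UNIV. J m l * (\<Sum>b\<in>UNIV. \<Sum>d\<in>UNIV. J b i * J d j * L m b d))"
      unfolding S1[of i j l] S2[of j i l] S3[of l i j] L_def
      by (simp add: sum_distrib_left sum.distrib[symmetric] sum_subtractf[symmetric] algebra_simps sum_divide_distrib add_divide_distrib diff_divide_distrib)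
    moreover have "k i j l = (\<Sum>m\<in>UNIV. J m l * (\<Sum>a\<in>UNIV. g m a * H a i j))"
      unfolding k_def by (subst sum.swap) (simp add: sum_distrib_left gsym mult_ac)
    ultimately show ?thesis unfolding L'_eq R_def by (simp add: sum.distrib distrib_left)
  qed
  define X where "X a = (\<Sum>m\<in>UNIV. gi a m * R m)" for a
  define V where "V k = (\<Sum>l\<in>UNIV. gi' k l * L' l i j)" for k
  have gX: "(\<Sum>a\<in>UNIV. g b a * X a) = R b" for b
  proof -
    have gg: "(\<Sum>a\<in>UNIV. g b a * gi a m) = (if b = m then 1 else 0)" for m
    proof -
      have "(\<chi> a b. gi a b) ** (\<chi> a b. g a b) = (mat 1 :: real^4^4)"
        by (simp add: matrix_matrix_mult_def mat_def vec_eq_iff gi)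
      then have "(\<chi> a b. g a b) ** (\<chi> a b. gi a b) = (mat 1 :: real^4^4)"
        by (simp add: matrix_left_right_inverse)
      then show ?thesis by (simp add: matrix_matrix_mult_def mat_def vec_eq_iff)
    qed
    have "(\<Sum>a\<in>UNIV. g b a * X a) = (\<Sum>a\<in>UNIV. \<Sum>m\<in>UNIV. g b a * gi a m * R m)"
      by (simp add: X_def sum_distrib_left mult.assoc)
    also have "\<dots> = (\<Sum>m\<in>UNIV. (\<Sum>a\<in>UNIV. g b a * gi a m) * R m)"
      by (subst sum.swap) (simp add: sum_distrib_right)
    also have "\<dots> = R b" by (simp add: gg delta_mult)
    finally show ?thesis .
  qed
  \<comment> \<open>\<open>Z\<close> is \<open>X\<close> in the new coordinates. It solves
    \<open>g' Z = L'\<close>, and so does \<open>V\<close>, which is \<open>L'\<close> raised by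
    \<open>gi'\<close>; invertibility identifies the two.\<close>
  define Z where "Z l = (\<Sum>a\<in>UNIV. J' l a * X a)" for l
  have XZ: "X a = (\<Sum>l\<in>UNIV. J a l * Z l)" for a
  proof -
    have "(\<Sum>l\<in>UNIV. J a l * Z l) = (\<Sum>l\<in>UNIV. \<Sum>b\<in>UNIV. J a l * J' l b * X b)"
      by (simp add: Z_def sum_distrib_left mult.assoc)
    also have "\<dots> = (\<Sum>b\<in>UNIV. (\<Sum>l\<in>UNIV. J a l * J' l b) * X b)"
      by (subst sum.swap) (simp add: sum_distrib_right)
    also have "\<dots> = X a" by (simp add: J delta_mult)
    finally show ?thesis by simp
  qed
  have "(\<Sum>m\<in>UNIV. g' l m * Z m) = L' l i j" for l
  proof -
    have "(\<Sum>m\<in>UNIV. g' l m * Z m) = (\<Sum>m\<in>UNIV. \<Sum>a\<in>UNIV. \<Sum>b\<in>UNIV. J a l * (g a b * (J b m * Z m)))"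
      by (simp add: g' sum_distrib_right sum_distrib_left mult_ac)
    also have "\<dots> = (\<Sum>a\<in>UNIV. \<Sum>m\<in>UNIV. \<Sum>b\<in>UNIV. J a l * (g a b * (J b m * Z m)))" by (rule sum.swap)
    also have "\<dots> = (\<Sum>a\<in>UNIV. \<Sum>b\<in>UNIV. \<Sum>m\<in>UNIV. J a l * (g a b * (J b m * Z m)))"
      by (rule sum.cong[OF refl], rule sum.swap)
    also have "\<dots> = (\<Sum>a\<in>UNIV. J a l * R a)" by (simp add: sum_distrib_left[symmetric] XZ[symmetric] gX)
    finally show ?thesis by (simp add: L'R)
  qed
  moreover have "(\<Sum>l\<in>UNIV. gi' k l * (\<Sum>m\<in>UNIV. g' l m * Z m)) = Z k" for k
  proof -
    have gg: "(\<Sum>l\<in>UNIV. gi' k l * g' l m) = (if k = m then 1 else 0)" for m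
    proof -
      have "(\<chi> a b. g' a b) ** (\<chi> a b. gi' a b) = (mat 1 :: real^4^4)"
        by (simp add: matrix_matrix_mult_def mat_def vec_eq_iff gi')
      then have "(\<chi> a b. gi' a b) ** (\<chi> a b. g' a b) = (mat 1 :: real^4^4)"
        by (simp add: matrix_left_right_inverse)
      then show ?thesis by (simp add: matrix_matrix_mult_def mat_def vec_eq_iff)
    qed
    have "(\<Sum>l\<in>UNIV. gi' k l * (\<Sum>m\<in>UNIV. g' l m * Z m)) = (\<Sum>l\<in>UNIV. \<Sum>m\<in>UNIV. gi' k l * g' l m * Z m)"
      by (simp add: sum_distrib_left mult.assoc)
    also have "\<dots> = (\<Sum>m\<in>UNIV. (\<Sum>l\<in>UNIV. gi' k l * g' l m) * Z m)"
      by (subst sum.swap) (simp add: sum_distrib_right)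
    also have "\<dots> = Z k" by (simp add: gg delta_mult)
    finally show ?thesis .
  qed
  ultimately have VZ: "V k = Z k" for k by (simp add: V_def)
  have "(\<Sum>k\<in>UNIV. J a k * ((1/2) * (\<Sum>l\<in>UNIV. gi' k l * (dg' i j l + dg' j i l - dg' l i j)))) = (\<Sum>k\<in>UNIV. J a k * V k)"
    by (simp add: V_def L'_def sum_distrib_left mult_ac sum_divide_distrib)
  also have "\<dots> = X a" by (simp add: VZ XZ)
  also have "\<dots> = (\<Sum>m\<in>UNIV. gi a m * (\<Sum>b\<in>UNIV. \<Sum>d\<in>UNIV. J b i * J d j * L m b d)) + (\<Sum>m\<in>UNIV. \<Sum>b\<in>UNIV. gi a m * g m b * H b i j)"
    by (simp add: X_def R_def distrib_left sum.distrib sum_distrib_left mult.assoc)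
  also have "(\<Sum>m\<in>UNIV. \<Sum>b\<in>UNIV. gi a m * g m b * H b i j) = (\<Sum>b\<in>UNIV. (\<Sum>m\<in>UNIV. gi a m * g m b) * H b i j)"
    by (subst sum.swap) (simp add: sum_distrib_right)
  also have "\<dots> = H a i j" by (simp add: gi delta_mult)
  also have "(\<Sum>m\<in>UNIV. gi a m * (\<Sum>b\<in>UNIV. \<Sum>d\<in>UNIV. J b i * J d j * L m b d)) =
      (\<Sum>b\<in>UNIV. \<Sum>d\<in>UNIV. (\<Sum>m\<in>UNIV. gi a m * L m b d) * J b i * J d j)"
  proof -
    have "(\<Sum>m\<in>UNIV. gi a m * (\<Sum>b\<in>UNIV. \<Sum>d\<in>UNIV. J b i * J d j * L m b d)) =
      (\<Sum>m\<in>UNIV. \<Sum>b\<in>UNIV. \<Sum>d\<in>UNIV. gi a m * L m b d * J b i * J d j)"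
      by (simp add: sum_distrib_left mult_ac)
    also have "\<dots> = (\<Sum>b\<in>UNIV. \<Sum>m\<in>UNIV. \<Sum>d\<in>UNIV. gi a m * L m b d * J b i * J d j)" by (rule sum.swap)
    also have "\<dots> = (\<Sum>b\<in>UNIV. \<Sum>d\<in>UNIV. \<Sum>m\<in>UNIV. gi a m * L m b d * J b i * J d j)"
      by (rule sum.cong[OF refl], rule sum.swap)
    finally show ?thesis by (simp add: sum_distrib_right)
  qed
  finally show ?thesis by (simp add: L_def sum_distrib_left mult_ac sum_divide_distrib)
qed

context manifold
begin

text \<open>The matrix \<open>H\<close> of the algebraic lemma consists of the second derivatives of
  the transition map and is symmetric because partial derivatives commute.\<close>

lemma christoffel_transformation:
  assumes g: "smooth_cov_tensor A 2 g" and sym: "\<And>c p a b. c \<in> A \<Longrightarrow> p \<in> cdom c \<Longrightarrow> g c p [a, b] = g c p [b, a]"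
    and nz: "\<And>c p. c \<in> A \<Longrightarrow> p \<in> cdom c \<Longrightarrow> det (metric_matrix g c p) \<noteq> 0"
    and c: "c \<in> A" "c' \<in> A" and p: "p \<in> cdom c" "p \<in> cdom c'"
  shows "(\<Sum>k\<in>UNIV. jacobian c' c p a k * christoffel g c' k i j p) =
     coord_deriv c' i (\<lambda>q. jacobian c' c q a j) p
     + (\<Sum>b\<in>UNIV. \<Sum>d\<in>UNIV. christoffel g c a b d p * jacobian c' c p b i * jacobian c' c p d j)"
  unfolding christoffel_def
proof (rule christoffel_transformation_algebra[where J' = "jacobian c c' p" and g = "\<lambda>a b. g c p [a, b]" and g' = "\<lambda>a b. g c' p [a, b]"])
  show "coord_deriv c' i (\<lambda>q. jacobian c' c q a j) p = coord_deriv c' j (\<lambda>q. jacobian c' c q a i) p" for a i j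
  proof -
    let ?W = "overlap c' c" and ?t = "\<lambda>x. cmap c (cinv c' x) $ a"
    have x: "cmap c' p \<in> ?W" by (rule cmap_overlap[OF p(2,1)])
    have "coord_deriv c' i (\<lambda>q. jacobian c' c q a j) p = partial i (partial j ?t) (cmap c' p)" for i j
      unfolding coord_deriv_def o_def
      by (rule partial_cong_open[OF open_overlap[OF c(2,1)] x]) (simp add: jacobian_cinv subsetD[OF overlap_sub])
    then show ?thesis
      using smooth_on_partial_commute[OF smooth_transition[OF c(2,1)] open_overlap[OF c(2,1)] x] by simp
  qed
  show "(\<Sum>l\<in>UNIV. jacobian c' c p a l * jacobian c c' p l b) = (if a = b then 1 else 0)" for a b
    by (rule jacobian_inverse[OF c p])
  show "g c' p [i, j] = (\<Sum>a\<in>UNIV. \<Sum>b\<in>UNIV. jacobian c' c p a i * jacobian c' c p b j * g c p [a, b])" for i j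
    by (rule cov_tensor_2[OF _ c p]) (use g in \<open>simp add: smooth_cov_tensor_def\<close>)
qed (use sym[OF c(1) p(1)] invertible_metric_matrix[OF nz[OF c(1) p(1)]] invertible_metric_matrix[OF nz[OF c(2) p(2)]]
       inv_metric_sym[OF nz[OF c(2) p(2)] sym[OF c(2) p(2)]] in \<open>blast intro: coord_deriv_cov_tensor_2[OF g c p]\<close>)+

lemma cov_deriv_2: "cov_deriv g T c p [i, j, k] = coord_deriv c i (\<lambda>q. T c q [j, k]) p
   - (\<Sum>d\<in>UNIV. christoffel g c d i j p * T c p [d, k]) - (\<Sum>d\<in>UNIV. christoffel g c d i k p * T c p [j, d])"
  by (simp add: cov_deriv_def lessThan_Suc numeral_2_eq_2)

text \<open>The second derivatives of the transition map in the derivative of the components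
  (\<open>3\<close>) cancel against those in the Christoffel terms (\<open>1\<close> and
  \<open>2\<close>). The tensor law makes the pairing of \<open>grad_product\<close> with a test
  tensor independent of the chart, so that the assumption on \<open>\<mu>\<close> can be read in any
  chart.\<close>

lemma cov_deriv_tensor:
  assumes g: "smooth_cov_tensor A 2 g" and sym: "\<And>c p a b. c \<in> A \<Longrightarrow> p \<in> cdom c \<Longrightarrow> g c p [a, b] = g c p [b, a]"
    and nz: "\<And>c p. c \<in> A \<Longrightarrow> p \<in> cdom c \<Longrightarrow> det (metric_matrix g c p) \<noteq> 0"
    and T: "smooth_cov_tensor A 2 T"
    and c: "c \<in> A" "c' \<in> A" and p: "p \<in> cdom c" "p \<in> cdom c'"
  shows "cov_deriv g T c' p [i, j, k] = (\<Sum>d\<in>UNIV. \<Sum>a\<in>UNIV. \<Sum>b\<in>UNIV.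
     jacobian c' c p d i * jacobian c' c p a j * jacobian c' c p b k * cov_deriv g T c p [d, a, b])"
proof -
  define J where "J = jacobian c' c p"
  define H where "H a i j = coord_deriv c' i (\<lambda>q. jacobian c' c q a j) p" for a i j
  define C where "C a b d = christoffel g c a b d p" for a b d
  define C' where "C' a b d = christoffel g c' a b d p" for a b d
  define t where "t a b = T c p [a, b]" for a b
  define t' where "t' a b = T c' p [a, b]" for a b
  define dt where "dt d a b = coord_deriv c d (\<lambda>q. T c q [a, b]) p" for d a b
  have tr: "(\<Sum>k\<in>UNIV. J a k * C' k i j) = H a i j + (\<Sum>b\<in>UNIV. \<Sum>d\<in>UNIV. C a b d * J b i * J d j)" for a i j
    unfolding J_def C'_def H_def C_def by (rule christoffel_transformation[OF g sym nz c p])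
  have t': "t' m k = (\<Sum>a\<in>UNIV. \<Sum>b\<in>UNIV. J a m * J b k * t a b)" for m k
    unfolding t'_def J_def t_def using T by (intro cov_tensor_2[OF _ c p]) (simp add: smooth_cov_tensor_def)
  have 1: "(\<Sum>m\<in>UNIV. C' m i j * t' m k) = (\<Sum>a\<in>UNIV. \<Sum>b\<in>UNIV. H a i j * J b k * t a b)
     + (\<Sum>d\<in>UNIV. \<Sum>a\<in>UNIV. \<Sum>b\<in>UNIV. J d i * J a j * J b k * (\<Sum>m\<in>UNIV. C m d a * t m b))"
  proof -
    have "(\<Sum>m\<in>UNIV. C' m i j * t' m k) = (\<Sum>m\<in>UNIV. \<Sum>a\<in>UNIV. \<Sum>b\<in>UNIV. J a m * C' m i j * (J b k * t a b))"
      unfolding t' by (simp add: sum_distrib_left mult_ac)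
    also have "\<dots> = (\<Sum>a\<in>UNIV. \<Sum>m\<in>UNIV. \<Sum>b\<in>UNIV. J a m * C' m i j * (J b k * t a b))" by (rule sum.swap)
    also have "\<dots> = (\<Sum>a\<in>UNIV. \<Sum>b\<in>UNIV. \<Sum>m\<in>UNIV. J a m * C' m i j * (J b k * t a b))"
      by (rule sum.cong[OF refl], rule sum.swap)
    also have "\<dots> = (\<Sum>a\<in>UNIV. \<Sum>b\<in>UNIV. (H a i j + (\<Sum>e\<in>UNIV. \<Sum>d\<in>UNIV. C a e d * J e i * J d j)) * (J b k * t a b))"
      by (simp add: sum_distrib_right[symmetric] tr)
    also have "\<dots> = (\<Sum>a\<in>UNIV. \<Sum>b\<in>UNIV. H a i j * J b k * t a b)
      + (\<Sum>a\<in>UNIV. \<Sum>b\<in>UNIV. \<Sum>e\<in>UNIV. \<Sum>d\<in>UNIV. J e i * J d j * J b k * (C a e d * t a b))"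
      by (simp add: distrib_left distrib_right sum.distrib sum_distrib_left sum_distrib_right mult_ac)
    also have "(\<Sum>a\<in>UNIV. \<Sum>b\<in>UNIV. \<Sum>e\<in>UNIV. \<Sum>d\<in>UNIV. J e i * J d j * J b k * (C a e d * t a b))
      = (\<Sum>b\<in>UNIV. \<Sum>a\<in>UNIV. \<Sum>e\<in>UNIV. \<Sum>d\<in>UNIV. J e i * J d j * J b k * (C a e d * t a b))" by (rule sum.swap)
    also have "\<dots> = (\<Sum>b\<in>UNIV. \<Sum>e\<in>UNIV. \<Sum>a\<in>UNIV. \<Sum>d\<in>UNIV. J e i * J d j * J b k * (C a e d * t a b))"
      by (rule sum.cong[OF refl], rule sum.swap)
    also have "\<dots> = (\<Sum>e\<in>UNIV. \<Sum>b\<in>UNIV. \<Sum>a\<in>UNIV. \<Sum>d\<in>UNIV. J e i * J d j * J b k * (C a e d * t a b))" by (rule sum.swap)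
    also have "\<dots> = (\<Sum>e\<in>UNIV. \<Sum>b\<in>UNIV. \<Sum>d\<in>UNIV. \<Sum>a\<in>UNIV. J e i * J d j * J b k * (C a e d * t a b))"
      by (rule sum.cong[OF refl], rule sum.cong[OF refl], rule sum.swap)
    also have "\<dots> = (\<Sum>e\<in>UNIV. \<Sum>d\<in>UNIV. \<Sum>b\<in>UNIV. \<Sum>a\<in>UNIV. J e i * J d j * J b k * (C a e d * t a b))"
      by (rule sum.cong[OF refl], rule sum.swap)
    finally show ?thesis by (simp add: sum_distrib_left)
  qed
  have 2: "(\<Sum>m\<in>UNIV. C' m i k * t' j m) = (\<Sum>a\<in>UNIV. \<Sum>b\<in>UNIV. J a j * H b i k * t a b)
     + (\<Sum>d\<in>UNIV. \<Sum>a\<in>UNIV. \<Sum>b\<in>UNIV. J d i * J a j * J b k * (\<Sum>m\<in>UNIV. C m d b * t a m))"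
  proof -
    have "(\<Sum>m\<in>UNIV. C' m i k * t' j m) = (\<Sum>m\<in>UNIV. \<Sum>a\<in>UNIV. \<Sum>b\<in>UNIV. J b m * C' m i k * (J a j * t a b))"
      unfolding t' by (simp add: sum_distrib_left mult_ac)
    also have "\<dots> = (\<Sum>a\<in>UNIV. \<Sum>m\<in>UNIV. \<Sum>b\<in>UNIV. J b m * C' m i k * (J a j * t a b))" by (rule sum.swap)
    also have "\<dots> = (\<Sum>a\<in>UNIV. \<Sum>b\<in>UNIV. \<Sum>m\<in>UNIV. J b m * C' m i k * (J a j * t a b))"
      by (rule sum.cong[OF refl], rule sum.swap)
    also have "\<dots> = (\<Sum>a\<in>UNIV. \<Sum>b\<in>UNIV. (H b i k + (\<Sum>e\<in>UNIV. \<Sum>d\<in>UNIV. C b e d * J e i * J d k)) * (J a j * t a b))"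
      by (simp add: sum_distrib_right[symmetric] tr)
    also have "\<dots> = (\<Sum>a\<in>UNIV. \<Sum>b\<in>UNIV. J a j * H b i k * t a b)
      + (\<Sum>a\<in>UNIV. \<Sum>b\<in>UNIV. \<Sum>e\<in>UNIV. \<Sum>d\<in>UNIV. J e i * J a j * J d k * (C b e d * t a b))"
      by (simp add: distrib_left distrib_right sum.distrib sum_distrib_left sum_distrib_right mult_ac)
    also have "(\<Sum>a\<in>UNIV. \<Sum>b\<in>UNIV. \<Sum>e\<in>UNIV. \<Sum>d\<in>UNIV. J e i * J a j * J d k * (C b e d * t a b))
      = (\<Sum>a\<in>UNIV. \<Sum>e\<in>UNIV. \<Sum>b\<in>UNIV. \<Sum>d\<in>UNIV. J e i * J a j * J d k * (C b e d * t a b))"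
      by (rule sum.cong[OF refl], rule sum.swap)
    also have "\<dots> = (\<Sum>e\<in>UNIV. \<Sum>a\<in>UNIV. \<Sum>b\<in>UNIV. \<Sum>d\<in>UNIV. J e i * J a j * J d k * (C b e d * t a b))" by (rule sum.swap)
    also have "\<dots> = (\<Sum>e\<in>UNIV. \<Sum>a\<in>UNIV. \<Sum>d\<in>UNIV. \<Sum>b\<in>UNIV. J e i * J a j * J d k * (C b e d * t a b))"
      by (rule sum.cong[OF refl], rule sum.cong[OF refl], rule sum.swap)
    finally show ?thesis by (simp add: sum_distrib_left)
  qed
  have 3: "coord_deriv c' i (\<lambda>q. T c' q [j, k]) p =
      (\<Sum>a\<in>UNIV. \<Sum>b\<in>UNIV. H a i j * J b k * t a b) + (\<Sum>a\<in>UNIV. \<Sum>b\<in>UNIV. J a j * H b i k * t a b)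
    + (\<Sum>d\<in>UNIV. \<Sum>a\<in>UNIV. \<Sum>b\<in>UNIV. J d i * J a j * J b k * dt d a b)"
  proof -
    have "(\<Sum>a\<in>UNIV. \<Sum>b\<in>UNIV. \<Sum>d\<in>UNIV. J d i * J a j * J b k * dt d a b) =
      (\<Sum>a\<in>UNIV. \<Sum>d\<in>UNIV. \<Sum>b\<in>UNIV. J d i * J a j * J b k * dt d a b)" by (rule sum.cong[OF refl], rule sum.swap)
    also have "\<dots> = (\<Sum>d\<in>UNIV. \<Sum>a\<in>UNIV. \<Sum>b\<in>UNIV. J d i * J a j * J b k * dt d a b)" by (rule sum.swap)
    finally show ?thesis
      using coord_deriv_cov_tensor_2[OF T c p, of i j k] by (simp add: J_def H_def t_def dt_def)
  qed
  have "cov_deriv g T c' p [i, j, k] = coord_deriv c' i (\<lambda>q. T c' q [j, k]) p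
     - (\<Sum>m\<in>UNIV. C' m i j * t' m k) - (\<Sum>m\<in>UNIV. C' m i k * t' j m)"
    by (simp add: cov_deriv_2 C'_def t'_def)
  also have "\<dots> = (\<Sum>d\<in>UNIV. \<Sum>a\<in>UNIV. \<Sum>b\<in>UNIV. J d i * J a j * J b k *
      (dt d a b - (\<Sum>m\<in>UNIV. C m d a * t m b) - (\<Sum>m\<in>UNIV. C m d b * t a m)))"
    unfolding 1 2 3 by (simp only: right_diff_distrib sum_subtractf)
  finally show ?thesis by (simp only: cov_deriv_2 C_def t_def dt_def J_def)
qed

lemma sum_MI6: "(\<Sum>as\<in>multi_indices 6. F as) = (\<Sum>a\<in>UNIV. \<Sum>b\<in>UNIV. \<Sum>c\<in>UNIV. \<Sum>d\<in>UNIV. \<Sum>e\<in>UNIV. \<Sum>f\<in>UNIV. F [a, b, c, d, e, f])"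
proof -
  have "(6::nat) = Suc (Suc (Suc (Suc (Suc (Suc 0)))))" by simp
  then show ?thesis by (simp only: sum_multi_indices_Suc) (simp add: multi_indices_0)
qed

lemma multi_index_6:
  assumes "as \<in> multi_indices 6"
  obtains a b c d e f where "as = [a, b, c, d, e, f]"
  using assms by (auto simp: multi_indices_def length_Suc_conv eval_nat_numeral)

lemma grad_product_tensor:
  assumes g: "smooth_cov_tensor A 2 g" and sym: "\<And>c p a b. c \<in> A \<Longrightarrow> p \<in> cdom c \<Longrightarrow> g c p [a, b] = g c p [b, a]"
    and nz: "\<And>c p. c \<in> A \<Longrightarrow> p \<in> cdom c \<Longrightarrow> det (metric_matrix g c p) \<noteq> 0"
    and T: "smooth_cov_tensor A 2 T"
  shows "cov_tensor A 6 (grad_product g T)"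
  unfolding cov_tensor_def
proof (intro ballI)
  fix c c' p as assume c: "c \<in> A" "c' \<in> A" and p: "p \<in> cdom c \<inter> cdom c'" and as6: "as \<in> multi_indices 6"
  obtain i j k l m n where as: "as = [i, j, k, l, m, n]" by (rule multi_index_6[OF as6])
  define J where "J = jacobian c' c p"
  define X where "X a d e = J a i * J d k * J e l * cov_deriv g T c p [a, d, e]" for a d e
  define Y where "Y b d e = J b j * J d m * J e n * cov_deriv g T c p [b, d, e]" for b d e
  have "grad_product g T c' p as = cov_deriv g T c' p [i, k, l] * cov_deriv g T c' p [j, m, n]"
    by (simp add: grad_product_def as eval_nat_numeral)
  also have "\<dots> = (\<Sum>a\<in>UNIV. \<Sum>d\<in>UNIV. \<Sum>e\<in>UNIV. X a d e) * (\<Sum>b\<in>UNIV. \<Sum>d\<in>UNIV. \<Sum>e\<in>UNIV. Y b d e)"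
    using p by (simp only: X_def Y_def J_def cov_deriv_tensor[OF g sym nz T c] Int_iff)
  also have "\<dots> = (\<Sum>a\<in>UNIV. \<Sum>b\<in>UNIV. \<Sum>d\<in>UNIV. \<Sum>e\<in>UNIV. \<Sum>d'\<in>UNIV. \<Sum>e'\<in>UNIV. X a d e * Y b d' e')"
    unfolding sum_product[of "\<lambda>a. \<Sum>d\<in>UNIV. \<Sum>e\<in>UNIV. X a d e" UNIV]
    by (simp only: sum_distrib_left[symmetric] sum_distrib_right[symmetric])
  also have "\<dots> = (\<Sum>bs\<in>multi_indices 6. (\<Prod>k<6. J (bs ! k) (as ! k)) * grad_product g T c p bs)"
    unfolding sum_MI6 by (simp add: grad_product_def as eval_nat_numeral X_def Y_def mult_ac)
  finally show "grad_product g T c' p as = (\<Sum>bs\<in>multi_indices 6. (\<Prod>k<6. jacobian c' c p (bs ! k) (as ! k)) * grad_product g T c p bs)"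
    by (simp only: J_def)
qed

end

subsection \<open>The volume measure\<close>

lemma borel_measurable_extension:
  fixes f :: "'a::topological_space \<Rightarrow> 'b::topological_space"
  assumes "open U" "continuous_on U f"
  shows "(\<lambda>x. if x \<in> U then f x else a) \<in> borel_measurable borel"
proof (rule borel_measurableI)
  fix S :: "'b set" assume "open S"
  then have "open (U \<inter> f -` S)" using assms by (intro continuous_open_preimage)
  moreover have "(\<lambda>x. if x \<in> U then f x else a) -` S \<inter> space borel = (U \<inter> f -` S) \<union> (if a \<in> S then - U else {})"
    by (auto split: if_splits)
  ultimately show "(\<lambda>x. if x \<in> U then f x else a) -` S \<inter> space borel \<in> sets borel"
    using assms(1) by auto
qed

text \<open>The change of variables for gauge integrals compares finite values only. The infinite
  case follows because its equivalence would turn a finite measure of the image into a finite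
  integral.\<close>

lemma emeasure_image:
  fixes \<phi> :: "real^4 \<Rightarrow> real^4"
  assumes B: "B \<in> sets borel" and \<phi>B: "\<phi> ` B \<in> sets borel"
    and d: "\<And>x. x \<in> B \<Longrightarrow> (\<phi> has_derivative \<phi>' x) (at x)" and inj: "inj_on \<phi> B"
    and m: "(\<lambda>x. \<bar>det (matrix (\<phi>' x))\<bar> * indicator B x) \<in> borel_measurable borel"
  shows "emeasure lborel (\<phi> ` B) = (\<integral>\<^sup>+x. ennreal (\<bar>det (matrix (\<phi>' x))\<bar> * indicator B x) \<partial>lborel)"
proof -
  let ?f = "\<lambda>x. \<bar>det (matrix (\<phi>' x))\<bar> * indicator B x"
  have iff: "\<phi> ` B \<in> lmeasurable \<and> measure lebesgue (\<phi> ` B) = r \<longleftrightarrow> ((\<lambda>x. \<bar>det (matrix (\<phi>' x))\<bar>) has_integral r) B" for r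
    by (rule has_measure_differentiable_image)
       (use B inj d in \<open>auto intro: has_derivative_at_withinI\<close>)
  have r: "(?f has_integral r) UNIV \<longleftrightarrow> ((\<lambda>x. \<bar>det (matrix (\<phi>' x))\<bar>) has_integral r) B" for r
  proof -
    have "?f = (\<lambda>x. if x \<in> B then \<bar>det (matrix (\<phi>' x))\<bar> else 0)" by (auto simp: indicator_def)
    then show ?thesis by (simp only: has_integral_restrict_UNIV)
  qed
  have eq: "emeasure lebesgue (\<phi> ` B) = emeasure lborel (\<phi> ` B)" using \<phi>B by simp
  show ?thesis
  proof (cases "(\<integral>\<^sup>+x. ennreal (?f x) \<partial>lborel) < \<infinity>")
    case True
    then obtain r where r0: "r \<ge> 0" "(\<integral>\<^sup>+x. ennreal (?f x) \<partial>lborel) = ennreal r"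
      by (cases "\<integral>\<^sup>+x. ennreal (?f x) \<partial>lborel" rule: ennreal_cases) auto
    then have "(?f has_integral r) UNIV"
      by (intro nn_integral_has_integral m) auto
    then have "\<phi> ` B \<in> lmeasurable" "measure lebesgue (\<phi> ` B) = r" using iff r by blast+
    then show ?thesis using r0 eq emeasure_eq_measure2[of "\<phi> ` B" lebesgue] by simp
  next
    case False
    have "emeasure lborel (\<phi> ` B) = \<infinity>"
    proof (rule ccontr)
      assume "emeasure lborel (\<phi> ` B) \<noteq> \<infinity>"
      then have "\<phi> ` B \<in> lmeasurable"
        using \<phi>B eq by (intro fmeasurableI) (auto simp: top.not_eq_extremum)
      then have "(?f has_integral measure lebesgue (\<phi> ` B)) UNIV" using iff r by blast
      then have "(\<integral>\<^sup>+x. ennreal (?f x) \<partial>lborel) = ennreal (measure lebesgue (\<phi> ` B))"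
        by (intro nn_integral_has_integral_lborel m) auto
      then show False using False by simp
    qed
    then show ?thesis using False by (simp add: top.not_eq_extremum[symmetric])
  qed
qed

definition vol :: "'m tensor \<Rightarrow> 'm chart \<Rightarrow> real^4 \<Rightarrow> real" where
  "vol g c x = sqrt \<bar>det (metric_matrix g c (cinv c x))\<bar>"

text \<open>The push-forward of the volume density under the inverse chart. The map has to be total,
  but its arbitrary value outside the range carries density zero.\<close>

definition chart_measure :: "'m::topological_space tensor \<Rightarrow> 'm chart \<Rightarrow> 'm measure" where
  "chart_measure g c = distr (density lborel (\<lambda>x. ennreal (if x \<in> cran c then vol g c x else 0))) borel
     (\<lambda>x. if x \<in> cran c then cinv c x else undefined)"

locale manifold_metric = manifold A for A :: "'m::{t2_space, second_countable_topology} chart set" +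
  fixes g :: "'m tensor"
  assumes g: "smooth_cov_tensor A 2 g"
begin

lemma continuous_vol: assumes "c \<in> A" shows "continuous_on (cran c) (vol g c)"
proof -
  have "smooth_on (cran c) (\<lambda>x. det (metric_matrix g c (cinv c x)))"
    by (intro smooth_on_det open_cran assms) (simp add: metric_matrix_def smooth_component_cov[OF g assms])
  then show ?thesis unfolding vol_def by (intro continuous_intros smooth_on_continuous)
qed

lemma cinv_measurable: "c \<in> A \<Longrightarrow> (\<lambda>x. if x \<in> cran c then cinv c x else undefined) \<in> borel_measurable borel"
  by (rule borel_measurable_extension[OF open_cran continuous_cinv])

lemma vol_measurable: "c \<in> A \<Longrightarrow> (\<lambda>x. if x \<in> cran c then vol g c x else 0) \<in> borel_measurable borel"
  by (rule borel_measurable_extension[OF open_cran continuous_vol])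

lemma sets_chart_measure: "sets (chart_measure g c) = sets borel"
  by (simp add: chart_measure_def)

lemma mem_image_chart:
  assumes "c \<in> A"
  shows "x \<in> cmap c ` (B \<inter> cdom c) \<longleftrightarrow> x \<in> cran c \<and> cinv c x \<in> B"
proof
  assume "x \<in> cmap c ` (B \<inter> cdom c)"
  then show "x \<in> cran c \<and> cinv c x \<in> B" using cinv_cmap[OF assms] by auto
next
  assume "x \<in> cran c \<and> cinv c x \<in> B"
  then show "x \<in> cmap c ` (B \<inter> cdom c)"
    using cmap_cinv[of x c] cinv_in[of x c] by (intro image_eqI[of _ _ "cinv c x"]) simp_all
qed

lemma image_borel:
  assumes c: "c \<in> A" and B: "B \<in> sets borel"
  shows "cmap c ` (B \<inter> cdom c) \<in> sets borel"
proof -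
  have "cmap c ` (B \<inter> cdom c) = cran c \<inter> ((\<lambda>x. if x \<in> cran c then cinv c x else undefined) -` B \<inter> space borel)"
    unfolding set_eq_iff mem_image_chart[OF c] by (simp split: if_split)
  then show ?thesis using measurable_sets[OF cinv_measurable[OF c] B] open_cran[OF c] by auto
qed

lemma emeasure_chart_measure:
  assumes c: "c \<in> A" and B: "B \<in> sets borel"
  shows "emeasure (chart_measure g c) B =
     (\<integral>\<^sup>+x. ennreal (if x \<in> cran c then vol g c x else 0) * indicator (cmap c ` (B \<inter> cdom c)) x \<partial>lborel)"
proof -
  let ?\<psi> = "\<lambda>x. if x \<in> cran c then cinv c x else undefined"
  have "emeasure (chart_measure g c) B =
     (\<integral>\<^sup>+x. ennreal (if x \<in> cran c then vol g c x else 0) * indicator (?\<psi> -` B \<inter> space lborel) x \<partial>lborel)"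
    unfolding chart_measure_def
    using measurable_sets[OF cinv_measurable[OF c] B] cinv_measurable[OF c] vol_measurable[OF c] B
    by (subst emeasure_distr) (auto simp: emeasure_density)
  also have "\<dots> = (\<integral>\<^sup>+x. ennreal (if x \<in> cran c then vol g c x else 0) * indicator (cmap c ` (B \<inter> cdom c)) x \<partial>lborel)"
  proof (rule nn_integral_cong)
    fix x :: "real^4"
    have "x \<in> cran c \<Longrightarrow> cinv c x \<in> B \<longleftrightarrow> x \<in> cmap c ` (B \<inter> cdom c)"
      by (simp only: mem_image_chart[OF c]) simp
    then show "ennreal (if x \<in> cran c then vol g c x else 0) * indicator (?\<psi> -` B \<inter> space lborel) x =
       ennreal (if x \<in> cran c then vol g c x else 0) * indicator (cmap c ` (B \<inter> cdom c)) x"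
      by (auto simp: indicator_def)
  qed
  finally show ?thesis .
qed

lemma emeasure_chart_measure_sub:
  assumes c: "c \<in> A" and B: "B \<in> sets borel" "B \<subseteq> cdom c"
  shows "emeasure (chart_measure g c) B =
     (\<integral>\<^sup>+ x \<in> cmap c ` B. ennreal (sqrt \<bar>det (metric_matrix g c (cinv c x))\<bar>) \<partial>lborel)"
proof -
  have "B \<inter> cdom c = B" using B by auto
  then show ?thesis unfolding emeasure_chart_measure[OF c B(1)]
    by (intro nn_integral_cong) (use B(2) in \<open>auto simp: indicator_def vol_def\<close>)
qed

lemma vol_transform:
  assumes c: "c \<in> A" "c' \<in> A" and x: "x \<in> overlap c c'"
  shows "vol g c x = \<bar>det (\<chi> j i. jacobian c c' (cinv c x) j i)\<bar> * vol g c' (cmap c' (cinv c x))"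
proof -
  let ?p = "cinv c x"
  let ?J = "(\<chi> j i. jacobian c c' ?p j i) :: real^4^4"
  have p: "?p \<in> cdom c" "?p \<in> cdom c'" using x c by (auto simp: overlap_iff cinv_in)
  have ip: "cinv c' (cmap c' ?p) = ?p" by (rule cinv_cmap[OF c(2) p(2)])
  have "metric_matrix g c ?p = transpose ?J ** metric_matrix g c' ?p ** ?J"
  proof -
    have "(transpose ?J ** metric_matrix g c' ?p ** ?J) $ i $ j = metric_matrix g c ?p $ i $ j" for i j
    proof -
      have "(transpose ?J ** metric_matrix g c' ?p ** ?J) $ i $ j =
        (\<Sum>b\<in>UNIV. \<Sum>a\<in>UNIV. jacobian c c' ?p a i * jacobian c c' ?p b j * g c' ?p [a, b])"
        by (simp add: matrix_matrix_mult_def transpose_def metric_matrix_def sum_distrib_right sum_distrib_left mult_ac)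
      also have "\<dots> = (\<Sum>a\<in>UNIV. \<Sum>b\<in>UNIV. jacobian c c' ?p a i * jacobian c c' ?p b j * g c' ?p [a, b])"
        by (rule sum.swap)
      also have "\<dots> = g c ?p [i, j]"
        by (rule cov_tensor_2[symmetric, OF _ c(2,1) p(2,1)]) (use g in \<open>simp add: smooth_cov_tensor_def\<close>)
      finally show ?thesis by (simp add: metric_matrix_def)
    qed
    then show ?thesis by (simp add: vec_eq_iff)
  qed
  then have "det (metric_matrix g c ?p) = (det ?J)\<^sup>2 * det (metric_matrix g c' ?p)"
    by (simp only: det_mul det_transpose) (simp add: power2_eq_square)
  then show ?thesis by (simp add: vol_def ip abs_mult real_sqrt_mult)
qed

text \<open>The Jacobian determinant from the change of variables is compensated by the one in
  \<open>vol_transform\<close>.\<close>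

lemma chart_measure_compatible:
  assumes c: "c \<in> A" "c' \<in> A" and B: "B \<in> sets borel" "B \<subseteq> cdom c" "B \<subseteq> cdom c'"
  shows "emeasure (chart_measure g c) B = emeasure (chart_measure g c') B"
proof -
  define W where "W = overlap c c'"
  define W' where "W' = overlap c' c"
  define \<tau> where "\<tau> x = (if x \<in> W then cmap c' (cinv c x) else 0)" for x
  define d where "d x = (if x \<in> W then \<bar>det (\<chi> j i. jacobian c c' (cinv c x) j i)\<bar> else 0)" for x
  have W: "open W" "open W'" unfolding W_def W'_def using open_overlap c by auto
  have tr_cont: "continuous_on W (\<lambda>x. cmap c' (cinv c x))"
    using continuous_on_vec_lambda[of W "\<lambda>j x. cmap c' (cinv c x) $ j"] smooth_on_continuous[OF smooth_transition[OF c]]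
    by (simp add: W_def)
  have \<tau>m: "\<tau> \<in> borel_measurable borel"
    unfolding \<tau>_def by (rule borel_measurable_extension[OF W(1) tr_cont])
  have dm: "d \<in> borel_measurable borel"
    unfolding d_def
  proof (rule borel_measurable_extension[OF W(1)])
    have "smooth_on W (\<lambda>x. det (\<chi> j i. jacobian c c' (cinv c x) j i))"
      unfolding W_def by (intro smooth_on_det open_overlap c) (simp add: smooth_jacobian c)
    then show "continuous_on W (\<lambda>x. \<bar>det (\<chi> j i. jacobian c c' (cinv c x) j i)\<bar>)"
      by (intro continuous_intros smooth_on_continuous)
  qed
  have \<tau>W: "\<tau> x \<in> W'" "cinv c' (\<tau> x) = cinv c x" if "x \<in> W" for x
    using that transition_image[OF c(1), of c'] c by (auto simp: \<tau>_def W_def W'_def overlap_iff cinv_cmap)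
  have inj: "inj_on \<tau> W"
  proof (rule inj_onI)
    fix x y assume "x \<in> W" "y \<in> W" "\<tau> x = \<tau> y"
    then have eq: "cinv c x = cinv c y" using \<tau>W(2)[of x] \<tau>W(2)[of y] by simp
    have xy: "x \<in> cran c" "y \<in> cran c"
      using \<open>x \<in> W\<close> \<open>y \<in> W\<close> by (simp_all add: W_def overlap_iff c)
    have "x = cmap c (cinv c x)" by (rule cmap_cinv[OF xy(1), symmetric])
    also have "\<dots> = y" unfolding eq by (rule cmap_cinv[OF xy(2)])
    finally show "x = y" .
  qed
  \<comment> \<open>The change of variables as an identity between measures: \<open>\<tau>\<close>
    carries \<open>d\<close> times Lebesgue measure on \<open>W\<close> to Lebesgue measure on
    \<open>W'\<close>. In this form it can be applied to integrals of arbitrary nonnegative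
    measurable functions.\<close>
  have eq: "density lborel (indicator W') = distr (density lborel (\<lambda>x. ennreal (d x))) borel \<tau>"
  proof (rule measure_eqI)
    fix S assume "S \<in> sets (density lborel (indicator W'))"
    then have S: "S \<in> sets borel" by simp
    define B' where "B' = W \<inter> (\<tau> -` (S \<inter> W') \<inter> space borel)"
    have B': "B' \<in> sets borel" unfolding B'_def
      by (intro sets.Int measurable_sets[OF \<tau>m]) (use W S in auto)
    have im: "\<tau> ` B' = S \<inter> W'"
    proof
      show "S \<inter> W' \<subseteq> \<tau> ` B'"
      proof
        fix y assume y: "y \<in> S \<inter> W'"
        then have y2: "y \<in> cran c'" "cinv c' y \<in> cdom c" by (auto simp: W'_def overlap_iff c)
        let ?x = "cmap c (cinv c' y)"
        have x: "?x \<in> W" unfolding W_def by (rule cmap_overlap) (use y2 cinv_in[OF y2(1)] in simp_all)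
        have "\<tau> ?x = y" using x y2 by (simp add: \<tau>_def cinv_cmap c cmap_cinv)
        then show "y \<in> \<tau> ` B'" using x y by (intro image_eqI[of _ _ ?x]) (auto simp: B'_def)
      qed
    qed (auto simp: B'_def)
    have der: "(\<tau> has_derivative (\<lambda>v. \<chi> j. \<Sum>i\<in>UNIV. jacobian c c' (cinv c x) j i * v $ i)) (at x)" if "x \<in> B'" for x
    proof -
      have x: "x \<in> W" using that by (simp add: B'_def)
      have "((\<lambda>x. cmap c' (cinv c x)) has_derivative (\<lambda>v. \<chi> j. \<Sum>i\<in>UNIV. partial i (\<lambda>x. cmap c' (cinv c x) $ j) x * v $ i)) (at x)"
        by (rule differentiable_vec) (use x in \<open>auto simp: W_def intro: smooth_on_differentiable[OF open_overlap[OF c] smooth_transition[OF c]]\<close>)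
      then have "((\<lambda>x. cmap c' (cinv c x)) has_derivative (\<lambda>v. \<chi> j. \<Sum>i\<in>UNIV. jacobian c c' (cinv c x) j i * v $ i)) (at x)"
        using jacobian_cinv[of x c] x subsetD[OF overlap_sub, of x c c'] by (simp add: W_def)
      then show ?thesis
        by (rule has_derivative_transform_within_open[OF _ W(1) x]) (simp add: \<tau>_def)
    qed
    have mat: "matrix (\<lambda>v. \<chi> j. \<Sum>i\<in>UNIV. jacobian c c' (cinv c x) j i * v $ i) = (\<chi> j i. jacobian c c' (cinv c x) j i)" for x
      by (simp add: matrix_def vec_eq_iff axis_def mult_delta)
    have dB: "\<bar>det (matrix (\<lambda>v. \<chi> j. \<Sum>i\<in>UNIV. jacobian c c' (cinv c x) j i * v $ i))\<bar> * indicator B' x = d x * indicator B' x" for x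
      unfolding mat by (auto simp: d_def B'_def indicator_def)
    have "emeasure (density lborel (indicator W')) S = emeasure lborel (S \<inter> W')"
    proof -
      have "indicator W' x * indicator S x = (indicator (S \<inter> W') x :: ennreal)" for x by (auto simp: indicator_def)
      then show ?thesis using S W by (simp add: emeasure_density)
    qed
    also have "\<dots> = (\<integral>\<^sup>+x. ennreal (d x * indicator B' x) \<partial>lborel)"
      using emeasure_image[OF B' _ der, unfolded dB] im S W inj_on_subset[OF inj, of B'] B' dm by (auto simp: B'_def)
    also have "\<dots> = (\<integral>\<^sup>+x. ennreal (d x) * indicator (\<tau> -` S \<inter> space borel) x \<partial>lborel)"
      by (rule nn_integral_cong) (use \<tau>W in \<open>auto simp: B'_def d_def indicator_def\<close>)
    also have "\<dots> = emeasure (distr (density lborel (\<lambda>x. ennreal (d x))) borel \<tau>) S"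
      using S \<tau>m dm measurable_sets[OF \<tau>m S] by (subst emeasure_distr) (auto simp: emeasure_density)
    finally show "emeasure (density lborel (indicator W')) S = emeasure (distr (density lborel (\<lambda>x. ennreal (d x))) borel \<tau>) S" .
  qed simp
  let ?v' = "\<lambda>y. if y \<in> cran c' then vol g c' y else 0"
  define u where "u y = ennreal (?v' y) * indicator (cmap c' ` (B \<inter> cdom c')) y" for y
  have um: "u \<in> borel_measurable borel"
    unfolding u_def using vol_measurable[OF c(2)] image_borel[OF c(2) B(1)] by measurable
  have "emeasure (chart_measure g c') B = (\<integral>\<^sup>+y. u y \<partial>lborel)"
    by (simp add: emeasure_chart_measure[OF c(2) B(1)] u_def)
  also have "\<dots> = (\<integral>\<^sup>+y. indicator W' y * u y \<partial>lborel)"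
  proof (rule nn_integral_cong)
    have "y \<in> W'" if "y \<in> cmap c' ` (B \<inter> cdom c')" for y using that B by (auto simp: W'_def overlap_def)
    then show "u y = indicator W' y * u y" for y by (auto simp: u_def indicator_def)
  qed
  also have "\<dots> = (\<integral>\<^sup>+y. u y \<partial>density lborel (indicator W'))"
    using um W by (subst nn_integral_density) auto
  also have "\<dots> = (\<integral>\<^sup>+x. ennreal (d x) * u (\<tau> x) \<partial>lborel)"
  proof -
    have "(\<lambda>x. u (\<tau> x)) \<in> borel_measurable borel" using measurable_compose[OF \<tau>m um] .
    then show ?thesis unfolding eq using um \<tau>m dm
      by (subst nn_integral_distr) (auto simp: nn_integral_density)
  qed
  also have "\<dots> = (\<integral>\<^sup>+x. ennreal (if x \<in> cran c then vol g c x else 0) * indicator (cmap c ` (B \<inter> cdom c)) x \<partial>lborel)"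
  proof (rule nn_integral_cong)
    fix x :: "real^4"
    show "ennreal (d x) * u (\<tau> x) = ennreal (if x \<in> cran c then vol g c x else 0) * indicator (cmap c ` (B \<inter> cdom c)) x"
    proof (cases "x \<in> W")
      case True
      have xc: "x \<in> cran c" "cinv c x \<in> cdom c'" using True by (auto simp: W_def overlap_iff c)
      have "\<tau> x \<in> cran c'" using \<tau>W(1)[OF True] overlap_sub unfolding W'_def by blast
      moreover have "\<tau> x \<in> cmap c' ` (B \<inter> cdom c') \<longleftrightarrow> cinv c x \<in> B"
        using \<tau>W(2)[OF True] calculation by (simp only: mem_image_chart[OF c(2)]) simp
      moreover have "x \<in> cmap c ` (B \<inter> cdom c) \<longleftrightarrow> cinv c x \<in> B"
        using xc(1) by (simp only: mem_image_chart[OF c(1)]) simp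
      moreover have "ennreal (d x) * ennreal (vol g c' (\<tau> x)) = ennreal (vol g c x)"
        using vol_transform[OF c, of x] True by (simp add: d_def \<tau>_def W_def ennreal_mult[symmetric] vol_def)
      ultimately show ?thesis using xc by (simp add: u_def indicator_def)
    next
      case False
      then have "x \<notin> cmap c ` (B \<inter> cdom c)" using B by (auto simp: W_def overlap_def)
      then show ?thesis using False by (simp add: d_def)
    qed
  qed
  also have "\<dots> = emeasure (chart_measure g c) B"
    by (simp add: emeasure_chart_measure[OF c(1) B(1)])
  finally show ?thesis by simp
qed

text \<open>Second countability enters here, through the Lindelof property; countably many charts
  are needed because measures are only countably additive.\<close>

lemma countable_charts: obtains ch :: "nat \<Rightarrow> 'm chart" where "range ch \<subseteq> A" "(\<Union>n. cdom (ch n)) = UNIV"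
proof -
  have "\<And>S. S \<in> cdom ` A \<Longrightarrow> open S" using open_cdom by auto
  then obtain F where F: "F \<subseteq> cdom ` A" "countable F" "\<Union>F = \<Union>(cdom ` A)" by (rule Lindelof)
  have U: "\<Union>F = UNIV" using F(3) atlas by (simp add: smooth_atlas_def)
  then have "F \<noteq> {}" by auto
  have "\<forall>n. \<exists>c\<in>A. cdom c = from_nat_into F n" using F(1) from_nat_into[OF \<open>F \<noteq> {}\<close>] by blast
  then obtain ch where ch: "\<And>n. ch n \<in> A" "\<And>n. cdom (ch n) = from_nat_into F n" by metis
  have "(\<Union>n. cdom (ch n)) = \<Union>F" using range_from_nat_into[OF \<open>F \<noteq> {}\<close> F(2)] by (simp add: ch(2))
  then show ?thesis using that[of ch] ch(1) U by auto
qed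

definition is_volume :: "'m measure \<Rightarrow> bool" where
  "is_volume \<nu> \<longleftrightarrow> sets \<nu> = sets borel \<and> (\<forall>c\<in>A. \<forall>B\<in>sets borel. B \<subseteq> cdom c \<longrightarrow>
        emeasure \<nu> B = (\<integral>\<^sup>+ x \<in> cmap c ` B. ennreal (sqrt \<bar>det (metric_matrix g c (cinv c x))\<bar>) \<partial>lborel))"

lemma is_volume_iff: "is_volume \<nu> \<longleftrightarrow> sets \<nu> = sets borel \<and> (\<forall>c\<in>A. \<forall>B\<in>sets borel. B \<subseteq> cdom c \<longrightarrow>
        emeasure \<nu> B = emeasure (chart_measure g c) B)"
  unfolding is_volume_def using emeasure_chart_measure_sub by auto

text \<open>The manifold is cut into disjoint Borel pieces, each inside one chart. Adding the chart
  measures of the pieces gives a measure that does not depend on the chart by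
  \<open>chart_measure_compatible\<close>; conversely, the values on the pieces determine a
  measure.\<close>

lemma ex1_volume: "\<exists>!\<nu>. is_volume \<nu>"
proof -
  obtain ch :: "nat \<Rightarrow> 'm chart" where ch: "\<And>n. ch n \<in> A" "(\<Union>n. cdom (ch n)) = UNIV"
    using countable_charts by (metis UNIV_I image_subset_iff)
  define P where "P = disjointed (\<lambda>n. cdom (ch n))"
  have P: "disjoint_family P" "(\<Union>n. P n) = UNIV" "\<And>n. P n \<subseteq> cdom (ch n)" "\<And>n. P n \<in> sets borel"
  proof -
    show "disjoint_family P" "(\<Union>n. P n) = UNIV"
      using ch(2) by (simp_all only: P_def disjoint_family_disjointed UN_disjointed_eq)
    show "P n \<subseteq> cdom (ch n)" for n unfolding P_def by (rule disjointed_subset)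
    have "cdom (ch n) \<in> sets borel" for n using open_cdom[OF ch(1)] by simp
    then have "range (\<lambda>n. cdom (ch n)) \<subseteq> sets borel" by blast
    then show "P n \<in> sets borel" for n unfolding P_def using sets.range_disjointed_sets by blast
  qed
  have decomp: "emeasure M B = (\<Sum>n. emeasure M (B \<inter> P n))" if "sets M = sets borel" "B \<in> sets borel" for M B
  proof -
    have "(\<Sum>n. emeasure M (B \<inter> P n)) = emeasure M (\<Union>n. B \<inter> P n)"
      using that P by (intro suminf_emeasure) (auto simp: disjoint_family_on_def)
    also have "(\<Union>n. B \<inter> P n) = B" using P(2) by auto
    finally show ?thesis by simp
  qed
  \<comment> \<open>The sum over the pieces is written as an integral over the counting measure, so
    that countable additivity is an exchange of sum and integral.\<close>
  define \<mu> where "\<mu> B = (\<integral>\<^sup>+n. emeasure (chart_measure g (ch n)) (B \<inter> P n) \<partial>count_space UNIV)" for B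
  define \<nu> where "\<nu> = measure_of UNIV (sets borel) \<mu>"
  have sets_\<nu>: "sets \<nu> = sets borel" unfolding \<nu>_def using sets.sigma_sets_eq[of "borel :: 'm measure"] by (simp add: sets_measure_of_conv)
  have em: "emeasure \<nu> B = \<mu> B" if B: "B \<in> sets borel" for B
    unfolding \<nu>_def
  proof (rule emeasure_measure_of_sigma)
    show "sigma_algebra UNIV (sets (borel :: 'm measure))" using sets.sigma_algebra_axioms[of "borel :: 'm measure"] by simp
    show "positive (sets borel) \<mu>" by (simp add: positive_def \<mu>_def)
    show "countably_additive (sets borel) \<mu>"
    proof (rule countably_additiveI)
      fix S :: "nat \<Rightarrow> 'm set" assume S: "range S \<subseteq> sets borel" "disjoint_family S"
      have "(\<Sum>i. emeasure (chart_measure g (ch n)) (S i \<inter> P n)) = emeasure (chart_measure g (ch n)) ((\<Union>i. S i) \<inter> P n)" for n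
      proof -
        have "(\<Sum>i. emeasure (chart_measure g (ch n)) (S i \<inter> P n)) = emeasure (chart_measure g (ch n)) (\<Union>i. S i \<inter> P n)"
          using S P(4) by (intro suminf_emeasure) (auto simp: disjoint_family_on_def sets_chart_measure)
        then show ?thesis by simp
      qed
      then show "(\<Sum>i. \<mu> (S i)) = \<mu> (\<Union>i. S i)"
        unfolding \<mu>_def by (subst nn_integral_suminf[symmetric]) auto
    qed
  qed (rule B)
  have "is_volume \<nu>"
    unfolding is_volume_iff
  proof (intro conjI ballI impI sets_\<nu>)
    fix c B assume c: "c \<in> A" and B: "B \<in> sets borel" "B \<subseteq> cdom c"
    have "emeasure \<nu> B = (\<Sum>n. emeasure (chart_measure g (ch n)) (B \<inter> P n))"
      using em[OF B(1)] by (simp add: \<mu>_def nn_integral_count_space_nat)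
    also have "\<dots> = (\<Sum>n. emeasure (chart_measure g c) (B \<inter> P n))"
      by (intro suminf_cong chart_measure_compatible c ch) (use B P in auto)
    also have "\<dots> = emeasure (chart_measure g c) B"
      using decomp[OF sets_chart_measure B(1)] by simp
    finally show "emeasure \<nu> B = emeasure (chart_measure g c) B" .
  qed
  moreover have "\<nu>' = \<nu>" if "is_volume \<nu>'" for \<nu>'
  proof (rule measure_eqI)
    show "sets \<nu>' = sets \<nu>" using that sets_\<nu> by (simp add: is_volume_iff)
    fix B assume "B \<in> sets \<nu>'"
    then have B: "B \<in> sets borel" using that by (simp add: is_volume_iff)
    have "emeasure M (B \<inter> P n) = emeasure (chart_measure g (ch n)) (B \<inter> P n)" if "is_volume M" for M n
      using that B P ch(1) unfolding is_volume_iff by (metis inf.coboundedI2 sets.Int)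
    then show "emeasure \<nu>' B = emeasure \<nu> B"
      using decomp[of \<nu>' B] decomp[of \<nu> B] that \<open>is_volume \<nu>\<close> B by (simp add: is_volume_iff)
  qed
  ultimately show ?thesis by blast
qed

lemma volume_measure: "is_volume (volume_measure A g)"
  using theI'[OF ex1_volume] by (simp add: volume_measure_def is_volume_def)

lemma sets_volume: "sets (volume_measure A g) = sets borel"
  using volume_measure by (simp add: is_volume_iff)

lemma density_volume:
  assumes c: "c \<in> A"
  shows "density (volume_measure A g) (indicator (cdom c)) = chart_measure g c"
proof (rule measure_eqI)
  show "sets (density (volume_measure A g) (indicator (cdom c))) = sets (chart_measure g c)"
    by (simp add: sets_volume sets_chart_measure)
  fix B assume "B \<in> sets (density (volume_measure A g) (indicator (cdom c)))"
  then have B: "B \<in> sets borel" by (simp add: sets_volume)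
  have dc: "cdom c \<in> sets borel" using open_cdom[OF c] by simp
  have "emeasure (density (volume_measure A g) (indicator (cdom c))) B = emeasure (volume_measure A g) (B \<inter> cdom c)"
  proof -
    have "indicator (cdom c) x * indicator B x = (indicator (B \<inter> cdom c) x :: ennreal)" for x by (auto simp: indicator_def)
    then show ?thesis using B dc by (simp add: emeasure_density sets_volume measurable_cong_sets[OF sets_volume refl])
  qed
  also have "\<dots> = emeasure (chart_measure g c) (B \<inter> cdom c)"
    using volume_measure c B dc by (simp add: is_volume_iff)
  also have "\<dots> = emeasure (chart_measure g c) B"
    using B dc by (simp add: emeasure_chart_measure[OF c])
  finally show "emeasure (density (volume_measure A g) (indicator (cdom c))) B = emeasure (chart_measure g c) B" .
qed

lemma scalar_measurable:
  assumes c: "c \<in> A" and u: "continuous_on (cran c) u"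
  shows "scalar c u \<in> borel_measurable borel"
proof -
  have "continuous_on (cdom c) (\<lambda>p. u (cmap c p))"
    by (rule continuous_on_compose2[OF u continuous_cmap[OF c]]) simp
  then show ?thesis
    unfolding scalar_def[abs_def] by (rule borel_measurable_extension[OF open_cdom[OF c]])
qed

lemma integral_scalar:
  assumes c: "c \<in> A" and u: "continuous_on (cran c) u"
  shows "(\<integral>p. scalar c u p \<partial>volume_measure A g) = (\<integral>x. (if x \<in> cran c then vol g c x * u x else 0) \<partial>lborel)" (is ?eq)
    and "integrable (volume_measure A g) (scalar c u) \<longleftrightarrow> integrable lborel (\<lambda>x. if x \<in> cran c then vol g c x * u x else 0)" (is ?int)
proof -
  let ?V = "volume_measure A g"
  let ?\<psi> = "\<lambda>x. if x \<in> cran c then cinv c x else undefined" and ?v = "\<lambda>x. if x \<in> cran c then vol g c x else 0"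
  have m: "scalar c u \<in> borel_measurable borel" by (rule scalar_measurable[OF assms])
  have mV: "scalar c u \<in> borel_measurable ?V" using m by (simp add: measurable_cong_sets[OF sets_volume refl])
  have dc: "cdom c \<in> sets ?V" using open_cdom[OF c] by (simp add: sets_volume)
  have ind: "(\<lambda>p. indicator (cdom c) p *\<^sub>R scalar c u p) = scalar c u" by (auto simp: scalar_def indicator_def fun_eq_iff)
  have \<psi>: "?\<psi> \<in> borel_measurable (density lborel (\<lambda>x. ennreal (?v x)))" using cinv_measurable[OF c] by simp
  have v: "?v \<in> borel_measurable lborel" using vol_measurable[OF c] by simp
  have v0: "AE x in lborel. 0 \<le> ?v x" by (simp add: vol_def)
  have m2: "(\<lambda>x. scalar c u (?\<psi> x)) \<in> borel_measurable lborel"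
    using measurable_compose[OF cinv_measurable[OF c] m] by simp
  have fin: "(\<lambda>x. ?v x *\<^sub>R scalar c u (?\<psi> x)) = (\<lambda>x. if x \<in> cran c then vol g c x * u x else 0)"
    by (auto simp: scalar_def cinv_in cmap_cinv fun_eq_iff)
  have dens: "density ?V (\<lambda>p. ennreal (indicator (cdom c) p)) = chart_measure g c"
    using density_volume[OF c] by (simp add: ennreal_indicator)
  have indm: "indicator (cdom c) \<in> borel_measurable ?V" using dc by simp
  show ?eq
  proof -
    have "(\<integral>p. scalar c u p \<partial>?V) = (\<integral>p. scalar c u p \<partial>chart_measure g c)"
      unfolding dens[symmetric] using integral_density[OF mV indm] ind by simp
    also have "\<dots> = (\<integral>x. ?v x *\<^sub>R scalar c u (?\<psi> x) \<partial>lborel)"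
      unfolding chart_measure_def integral_distr[OF \<psi> m] by (rule integral_density[OF m2 v v0])
    finally show ?thesis by (simp only: fin)
  qed
  show ?int
  proof -
    have "integrable ?V (scalar c u) \<longleftrightarrow> integrable (chart_measure g c) (scalar c u)"
      unfolding dens[symmetric] using integrable_density[OF mV indm] ind by simp
    also have "\<dots> \<longleftrightarrow> integrable lborel (\<lambda>x. ?v x *\<^sub>R scalar c u (?\<psi> x))"
      unfolding chart_measure_def integrable_distr_eq[OF \<psi> m] by (rule integrable_density[OF m2 v v0])
    finally show ?thesis by (simp only: fin)
  qed
qed

end

subsection \<open>Pointwise tensor norms\<close>

text \<open>Completion of the square, one index at a time: \<open>B'\<close> is the Schur complement
  of the diagonal entry at \<open>j\<close>, and it is again positive definite.\<close>

lemma positive_definite_factor: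
  fixes B :: "'a \<Rightarrow> 'a \<Rightarrow> real"
  assumes "finite I" and sym: "\<And>a b. B a b = B b a"
    and pos: "\<And>x. \<exists>a\<in>I. x a \<noteq> 0 \<Longrightarrow> (\<Sum>a\<in>I. \<Sum>b\<in>I. B a b * x a * x b) > 0"
  shows "\<exists>S. \<forall>a\<in>I. \<forall>b\<in>I. B a b = (\<Sum>i\<in>I. S i a * S i b)"
  using assms
proof (induction I arbitrary: B rule: finite_induct)
  case (insert j I)
  define \<beta> where "\<beta> = B j j"
  have \<beta>: "\<beta> > 0"
    using insert.prems(2)[of "\<lambda>a. if a = j then 1 else 0"] insert.hyps
    by (simp add: \<beta>_def mult_delta if_distrib[of "\<lambda>u. _ * u"] sum.delta' cong: if_cong)
  define B' where "B' a b = B a b - B j a * B j b / \<beta>" for a b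
  have "\<exists>S. \<forall>a\<in>I. \<forall>b\<in>I. B' a b = (\<Sum>i\<in>I. S i a * S i b)"
  proof (rule insert.IH)
    show "B' a b = B' b a" for a b unfolding B'_def using insert.prems(1) by (simp add: mult.commute)
    fix x :: "'a \<Rightarrow> real" assume x: "\<exists>a\<in>I. x a \<noteq> 0"
    define s where "s = (\<Sum>a\<in>I. B j a * x a)"
    \<comment> \<open>The entry at \<open>j\<close> is the one that minimises the form; with it the
      form of \<open>B\<close> at \<open>y\<close> equals the form of \<open>B'\<close> at
      \<open>x\<close>.\<close>
    define y where "y a = (if a = j then - s / \<beta> else x a)" for a
    have yI: "y a = x a" if "a \<in> I" for a using that insert.hyps by (auto simp: y_def)
    have "0 < (\<Sum>a\<in>insert j I. \<Sum>b\<in>insert j I. B a b * y a * y b)"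
      using x yI by (intro insert.prems(2)) auto
    also have "\<dots> = \<beta> * y j * y j + (\<Sum>b\<in>I. B j b * y j * x b) + ((\<Sum>a\<in>I. B a j * x a * y j) + (\<Sum>a\<in>I. \<Sum>b\<in>I. B a b * x a * x b))"
      using insert.hyps by (simp add: yI sum.distrib \<beta>_def)
    also have "(\<Sum>b\<in>I. B j b * y j * x b) = y j * s" by (simp add: s_def sum_distrib_left mult_ac)
    also have "(\<Sum>a\<in>I. B a j * x a * y j) = y j * s" using insert.prems(1)[of _ j] by (simp add: s_def sum_distrib_left mult_ac)
    also have "\<beta> * y j * y j + y j * s + (y j * s + (\<Sum>a\<in>I. \<Sum>b\<in>I. B a b * x a * x b)) =
        (\<Sum>a\<in>I. \<Sum>b\<in>I. B a b * x a * x b) - s * s / \<beta>"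
      using \<beta> by (simp add: y_def field_simps)
    also have "s * s / \<beta> = (\<Sum>a\<in>I. \<Sum>b\<in>I. B j a * B j b / \<beta> * x a * x b)"
      by (simp add: s_def sum_product sum_divide_distrib mult_ac)
    finally show "0 < (\<Sum>a\<in>I. \<Sum>b\<in>I. B' a b * x a * x b)"
      by (simp add: B'_def sum_subtractf[symmetric] left_diff_distrib)
  qed
  then obtain S where S: "\<And>a b. a \<in> I \<Longrightarrow> b \<in> I \<Longrightarrow> B' a b = (\<Sum>i\<in>I. S i a * S i b)" by blast
  \<comment> \<open>Row \<open>j\<close> is the completed square; the remaining rows do not involve
    the variable \<open>j\<close>.\<close>
  define S' where "S' i a = (if i = j then B j a / sqrt \<beta> else if a = j then 0 else S i a)" for i a
  have sq: "sqrt \<beta> * sqrt \<beta> = \<beta>" using \<beta> by simp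
  have "B a b = (\<Sum>i\<in>insert j I. S' i a * S' i b)" if "a \<in> insert j I" "b \<in> insert j I" for a b
  proof -
    have "(\<Sum>i\<in>insert j I. S' i a * S' i b) = B j a * B j b / \<beta> + (\<Sum>i\<in>I. S' i a * S' i b)"
      using insert.hyps sq by (simp add: S'_def)
    also have "(\<Sum>i\<in>I. S' i a * S' i b) = (if a = j \<or> b = j then 0 else B' a b)"
    proof -
      have "S' i a = (if a = j then 0 else S i a)" if "i \<in> I" for i a
        using that insert.hyps by (auto simp: S'_def)
      then show ?thesis using that S by auto
    qed
    finally show ?thesis
      using \<beta> insert.prems(1)[of a j] by (auto simp: B'_def \<beta>_def)
  qed
  then show ?case by blast
qed simp

text \<open>The frame in which \<open>e\<close> is the identity turns the norm into a sum of squares; \<open>R\<close> is the inverse frame.\<close>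

lemma tensor_component_bound:
  fixes e T :: "'m tensor"
  assumes sym: "\<And>a b. e c p [a, b] = e c p [b, a]" and pos: "\<And>v. v \<noteq> 0 \<Longrightarrow> bilin e c p v v > 0"
    and as: "as \<in> multi_indices n"
  shows "\<bar>T c p as\<bar> \<le> sqrt (\<Prod>k<n. e c p [as ! k, as ! k]) * tensor_norm e n T c p"
proof -
  let ?I = "multi_indices n" and ?e = "\<lambda>a b. e c p [a, b]" and ?B = "inv_metric e c p"
  have nz: "det (metric_matrix e c p) \<noteq> 0"
  proof
    assume "det (metric_matrix e c p) = 0"
    then obtain v where v: "v \<noteq> 0" "metric_matrix e c p *v v = 0"
      using invertible_det_nz matrix_left_invertible_ker invertible_left_inverse by metis
    then have "(\<Sum>b\<in>UNIV. ?e a b * v $ b) = 0" for a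
      by (simp add: matrix_vector_mult_def metric_matrix_def vec_eq_iff)
    then have "bilin e c p v v = 0"
      by (simp add: bilin_def mult.assoc mult.left_commute[of "?e _ _"] sum_distrib_left[symmetric])
    with pos[OF v(1)] show False by simp
  qed
  note inv = invertible_metric_matrix[OF nz]
  have Bsym: "?B a b = ?B b a" for a b by (rule inv_metric_sym[OF nz sym])
  have Bpos: "(\<Sum>a\<in>UNIV. \<Sum>b\<in>UNIV. ?B a b * x a * x b) > 0" if x: "\<exists>a\<in>UNIV. x a \<noteq> 0" for x
  proof -
    \<comment> \<open>Raising the index of \<open>x\<close> turns the form of the inverse metric at
      \<open>x\<close> into the form of \<open>e\<close> at \<open>v\<close>.\<close>
    define v where "v = (\<chi> a. \<Sum>b\<in>UNIV. ?B a b * x b)"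
    have ev: "(\<Sum>b\<in>UNIV. ?e a b * v $ b) = x a" for a
    proof -
      have "(\<Sum>b\<in>UNIV. ?e a b * v $ b) = (\<Sum>b\<in>UNIV. \<Sum>d\<in>UNIV. ?e a b * ?B b d * x d)"
        by (simp add: v_def sum_distrib_left mult.assoc)
      also have "\<dots> = (\<Sum>d\<in>UNIV. (\<Sum>b\<in>UNIV. ?e a b * ?B b d) * x d)"
        by (subst sum.swap) (simp add: sum_distrib_right)
      also have "\<dots> = x a" by (simp add: inv delta_mult)
      finally show ?thesis .
    qed
    have "v \<noteq> 0" using x ev by auto
    then have "0 < bilin e c p v v" by (rule pos)
    also have "\<dots> = (\<Sum>a\<in>UNIV. v $ a * x a)"
      by (simp add: bilin_def ev[symmetric] sum_distrib_left mult_ac)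
    also have "\<dots> = (\<Sum>a\<in>UNIV. \<Sum>b\<in>UNIV. ?B a b * x a * x b)"
      by (simp add: v_def sum_distrib_left sum_distrib_right mult_ac)
    finally show ?thesis .
  qed
  have "\<exists>S :: 4 \<Rightarrow> 4 \<Rightarrow> real. \<forall>a\<in>UNIV. \<forall>b\<in>UNIV. ?B a b = (\<Sum>i\<in>UNIV. S i a * S i b)"
  proof (rule positive_definite_factor)
    show "?B a b = ?B b a" for a b by (rule Bsym)
    show "(\<Sum>a\<in>UNIV. \<Sum>b\<in>UNIV. ?B a b * x a * x b) > 0" if "\<exists>a\<in>UNIV. x a \<noteq> 0" for x by (rule Bpos[OF that])
  qed simp
  then obtain S :: "4 \<Rightarrow> 4 \<Rightarrow> real" where S: "\<And>a b. ?B a b = (\<Sum>i\<in>UNIV. S i a * S i b)" by blast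
  define U where "U is = (\<Sum>as\<in>?I. (\<Prod>k<n. S (is ! k) (as ! k)) * T c p as)" for "is" :: "4 list"
  define R where "R a i = (\<Sum>b\<in>UNIV. ?e a b * S i b)" for a i
  have RS: "(\<Sum>i\<in>UNIV. R a i * S i d) = (if a = d then 1 else 0)" for a d
  proof -
    have "(\<Sum>i\<in>UNIV. R a i * S i d) = (\<Sum>i\<in>UNIV. \<Sum>b\<in>UNIV. ?e a b * (S i b * S i d))"
      by (simp add: R_def sum_distrib_right mult.assoc)
    also have "\<dots> = (\<Sum>b\<in>UNIV. ?e a b * ?B b d)"
      by (subst sum.swap) (simp add: S sum_distrib_left)
    finally show ?thesis by (simp add: inv)
  qed
  \<comment> \<open>The rows of the inverse frame have the diagonal entries of \<open>e\<close> as
    squared lengths; their products give the constant of the bound through the Cauchy-Schwarz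
    inequality.\<close>
  have RR: "(\<Sum>i\<in>UNIV. R a i * R a i) = ?e a a" for a
  proof -
    have "(\<Sum>i\<in>UNIV. R a i * R a i) = (\<Sum>i\<in>UNIV. \<Sum>d\<in>UNIV. R a i * S i d * ?e a d)"
      by (subst (2) R_def) (simp add: sum_distrib_left mult_ac)
    also have "\<dots> = (\<Sum>d\<in>UNIV. (\<Sum>i\<in>UNIV. R a i * S i d) * ?e a d)"
      by (subst sum.swap) (simp add: sum_distrib_right)
    finally show ?thesis by (simp add: RS delta_mult)
  qed
  have norm: "tensor_norm e n T c p = sqrt (\<Sum>is\<in>?I. (U is)\<^sup>2)"
  proof -
    have "(\<Sum>is\<in>?I. (U is)\<^sup>2) = (\<Sum>is\<in>?I. \<Sum>as\<in>?I. \<Sum>bs\<in>?I. (\<Prod>k<n. S (is ! k) (as ! k) * S (is ! k) (bs ! k)) * T c p as * T c p bs)"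
      unfolding U_def power2_eq_square sum_product prod.distrib by (simp add: mult_ac)
    also have "\<dots> = (\<Sum>as\<in>?I. \<Sum>is\<in>?I. \<Sum>bs\<in>?I. (\<Prod>k<n. S (is ! k) (as ! k) * S (is ! k) (bs ! k)) * T c p as * T c p bs)"
      by (rule sum.swap)
    also have "\<dots> = (\<Sum>as\<in>?I. \<Sum>bs\<in>?I. \<Sum>is\<in>?I. (\<Prod>k<n. S (is ! k) (as ! k) * S (is ! k) (bs ! k)) * T c p as * T c p bs)"
      by (rule sum.cong[OF refl], rule sum.swap)
    also have "\<dots> = (\<Sum>as\<in>?I. \<Sum>bs\<in>?I. (\<Prod>k<n. ?B (as ! k) (bs ! k)) * T c p as * T c p bs)"
      by (simp add: sum_distrib_right[symmetric] S sum_prod_multi_indices[where n = n and f = "\<lambda>k i. S i (_ ! k) * S i (_ ! k)"])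
    finally show ?thesis by (simp add: tensor_norm_def)
  qed
  have TU: "T c p as = (\<Sum>is\<in>?I. (\<Prod>k<n. R (as ! k) (is ! k)) * U is)"
  proof -
    have "(\<Sum>is\<in>?I. (\<Prod>k<n. R (as ! k) (is ! k)) * U is) =
      (\<Sum>is\<in>?I. \<Sum>bs\<in>?I. (\<Prod>k<n. R (as ! k) (is ! k) * S (is ! k) (bs ! k)) * T c p bs)"
      by (simp add: U_def sum_distrib_left prod.distrib mult.assoc)
    also have "\<dots> = (\<Sum>bs\<in>?I. \<Sum>is\<in>?I. (\<Prod>k<n. R (as ! k) (is ! k) * S (is ! k) (bs ! k)) * T c p bs)"
      by (rule sum.swap)
    also have "\<dots> = (\<Sum>bs\<in>?I. if as = bs then T c p bs else 0)"
      by (rule sum.cong[OF refl])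
         (simp add: sum_distrib_right[symmetric] RS sum_prod_multi_indices[where n = n and f = "\<lambda>k i. R (as ! k) i * S i (_ ! k)"]
           prod_delta_multi_indices as)
    finally show ?thesis using as by (simp add: finite_multi_indices)
  qed
  have "(T c p as)\<^sup>2 \<le> (\<Sum>is\<in>?I. (\<Prod>k<n. R (as ! k) (is ! k))\<^sup>2) * (\<Sum>is\<in>?I. (U is)\<^sup>2)"
    unfolding TU by (rule Cauchy_Schwarz_ineq_sum)
  also have "(\<Sum>is\<in>?I. (\<Prod>k<n. R (as ! k) (is ! k))\<^sup>2) = (\<Prod>k<n. ?e (as ! k) (as ! k))"
    using sum_prod_multi_indices[where n = n and f = "\<lambda>k i. R (as ! k) i * R (as ! k) i"]
    by (simp add: RR power2_eq_square prod.distrib)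
  finally have "sqrt ((T c p as)\<^sup>2) \<le> sqrt ((\<Prod>k<n. ?e (as ! k) (as ! k)) * (\<Sum>is\<in>?I. (U is)\<^sup>2))"
    by (rule real_sqrt_le_mono)
  then show ?thesis by (simp add: norm real_sqrt_mult)
qed

section \<open>Null and bounded families from pointwise estimates\<close>

lemma null_fam_linear_bound:
  assumes "fam U u" "continuous_on U F" "\<And>l x. l > 0 \<Longrightarrow> x \<in> U \<Longrightarrow> \<bar>u l x\<bar> \<le> l * F x"
  shows "null_fam U u"
proof (rule null_famI[OF assms(1)])
  fix K and e :: real assume K: "compact K" "K \<subseteq> U" and e: "e > 0"
  have "bounded (F ` K)"
    using K assms(2) by (meson compact_continuous_image compact_imp_bounded continuous_on_subset)
  then obtain B0 where B0: "\<And>x. x \<in> K \<Longrightarrow> \<bar>F x\<bar> \<le> B0" by (auto simp: bounded_iff)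
  define B where "B = max B0 1"
  have B: "B > 0" "\<And>x. x \<in> K \<Longrightarrow> F x \<le> B" using B0 by (auto simp: B_def intro: order_trans[OF abs_ge_self] max.coboundedI1)
  have "\<forall>\<^sub>F l in at_right (0::real). l < e / B"
    using B e by (auto simp: eventually_at_right_field intro!: exI[of _ "e / B"])
  with eventually_at_right_0_pos show "\<forall>\<^sub>F l in at_right 0. \<forall>x\<in>K. \<bar>u l x\<bar> \<le> e"
  proof eventually_elim
    case (elim l)
    show ?case
    proof
      fix x assume x: "x \<in> K"
      have "\<bar>u l x\<bar> \<le> l * F x" using assms(3) elim x K by blast
      also have "\<dots> \<le> l * B" using B(2)[OF x] elim by (intro mult_left_mono) auto
      also have "\<dots> \<le> e" using elim B(1) by (simp add: pos_less_divide_eq less_imp_le)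
      finally show "\<bar>u l x\<bar> \<le> e" .
    qed
  qed
qed

lemma bdd_fam_bound:
  assumes "fam U u" "continuous_on U F" "\<And>l x. l > 0 \<Longrightarrow> x \<in> U \<Longrightarrow> \<bar>u l x\<bar> \<le> F x"
  shows "bdd_fam U u"
proof (rule bdd_famI[OF assms(1)])
  fix K assume K: "compact K" "K \<subseteq> U"
  have "bounded (F ` K)"
    using K assms(2) by (meson compact_continuous_image compact_imp_bounded continuous_on_subset)
  then obtain B where B: "\<And>x. x \<in> K \<Longrightarrow> \<bar>F x\<bar> \<le> B" by (auto simp: bounded_iff)
  have "\<forall>\<^sub>F l in at_right 0. \<forall>x\<in>K. \<bar>u l x\<bar> \<le> B"
    using eventually_at_right_0_pos
  proof eventually_elim
    case (elim l)
    show ?case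
    proof
      fix x assume x: "x \<in> K"
      have "\<bar>u l x\<bar> \<le> F x" using assms(3)[OF elim] x K(2) by blast
      also have "\<dots> \<le> B" using B[OF x] by linarith
      finally show "\<bar>u l x\<bar> \<le> B" .
    qed
  qed
  then show "\<exists>B. \<forall>\<^sub>F l in at_right 0. \<forall>x\<in>K. \<bar>u l x\<bar> \<le> B" by blast
qed

subsection \<open>Weak limits on the manifold and in charts\<close>

context manifold_metric
begin

lemma integral_scalar_test:
  assumes c: "c \<in> A" and F: "testf (cran c) F" and u: "continuous_on (cran c) u"
  shows "(\<integral>p. scalar c (\<lambda>x. F x * u x) p \<partial>volume_measure A g) = (\<integral>x. F x * (vol g c x * u x) \<partial>lborel)"
    and "integrable (volume_measure A g) (scalar c (\<lambda>x. F x * u x))"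
proof -
  have F0: "F x = 0" if "x \<notin> cran c" for x using F that by (auto simp: testf_def)
  have Fc: "continuous_on (cran c) F"
    using F by (auto simp: testf_def intro: continuous_on_subset[OF smooth_on_continuous])
  have eq: "(\<lambda>x. if x \<in> cran c then vol g c x * (F x * u x) else 0) = (\<lambda>x. F x * (vol g c x * u x))"
    using F0 by (auto simp: fun_eq_iff)
  have Fu: "continuous_on (cran c) (\<lambda>x. F x * u x)" using Fc u by (intro continuous_intros)
  show "(\<integral>p. scalar c (\<lambda>x. F x * u x) p \<partial>volume_measure A g) = (\<integral>x. F x * (vol g c x * u x) \<partial>lborel)"
    using integral_scalar(1)[OF c Fu] by (simp only: eq)
  have "integrable lborel (\<lambda>x. F x * (vol g c x * u x))"
    by (rule testf_integrable[OF F]) (intro continuous_intros continuous_vol c u)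
  then show "integrable (volume_measure A g) (scalar c (\<lambda>x. F x * u x))"
    using integral_scalar(2)[OF c Fu] by (simp only: eq)
qed

lemma testf_pullback:
  assumes c: "c \<in> A" and \<psi>: "smooth_on (cran c) (\<lambda>x. \<psi> (cinv c x))"
    and K: "compact K" "K \<subseteq> cdom c" "\<And>p. p \<notin> K \<Longrightarrow> \<psi> p = 0"
  shows "testf (cran c) (\<lambda>x. if x \<in> cran c then \<psi> (cinv c x) else 0)"
proof -
  have cK: "compact (cmap c ` K)"
    by (rule compact_continuous_image[OF continuous_on_subset[OF continuous_cmap[OF c] K(2)] K(1)])
  have KU: "cmap c ` K \<subseteq> cran c" using K(2) by blast
  have 0: "(if x \<in> cran c then \<psi> (cinv c x) else 0) = 0" if "x \<notin> cmap c ` K" for x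
    using that K(3)[of "cinv c x"] cmap_cinv[of x c] by (metis imageI)
  have "smooth_on (cran c) (\<lambda>x. if x \<in> cran c then \<psi> (cinv c x) else 0)"
    by (rule smooth_on_cong[OF open_cran[OF c] _ \<psi>]) simp
  then have "smooth_on UNIV (\<lambda>x. if x \<in> cran c then \<psi> (cinv c x) else 0)"
    by (rule smooth_on_zero_extension[OF open_cran[OF c] compact_imp_closed[OF cK] KU]) (rule 0)
  then show ?thesis unfolding testf_def using cK KU 0 by blast
qed

lemma scalar_pullback:
  assumes c: "c \<in> A" and K: "K \<subseteq> cdom c" "\<And>p. p \<notin> K \<Longrightarrow> \<psi> p = 0"
  shows "scalar c (\<lambda>x. (if x \<in> cran c then \<psi> (cinv c x) else 0) * u (cinv c x)) p = \<psi> p * u p"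
  using K cinv_cmap[OF c, of p] by (cases "p \<in> cdom c") (auto simp: scalar_def)

end

locale lorentzian_manifold = manifold A for A :: "'m::{t2_space, second_countable_topology} chart set" +
  fixes g :: "'m tensor"
  assumes lor: "lorentzian_metric A g"

sublocale lorentzian_manifold \<subseteq> manifold_metric
  by unfold_locales (rule lorentzian_smooth[OF lor])

context lorentzian_manifold
begin

lemma vol_pos: "c \<in> A \<Longrightarrow> x \<in> cran c \<Longrightarrow> vol g c x > 0"
  using lorentzian_det[OF lor, of c "cinv c x"] cinv_in[of x c] by (simp add: vol_def)

lemma smooth_vol:
  assumes "c \<in> A" shows "smooth_on (cran c) (vol g c)"
proof -
  have d: "det (metric_matrix g c (cinv c x)) < 0" if "x \<in> cran c" for x
    by (rule lorentzian_det[OF lor assms cinv_in[OF that]])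
  have sd: "smooth_on (cran c) (\<lambda>x. det (metric_matrix g c (cinv c x)))"
    by (intro smooth_on_det open_cran assms) (simp add: metric_matrix_def smooth_component_cov[OF g assms])
  have "smooth_on (cran c) (\<lambda>x. sqrt (- det (metric_matrix g c (cinv c x))))"
    by (rule smooth_on_sqrt[OF open_cran[OF assms] smooth_on_uminus[OF open_cran[OF assms] sd]]) (use d in force)
  then show ?thesis
    by (rule smooth_on_cong[OF open_cran[OF assms], rotated]) (use d in \<open>force simp: vol_def\<close>)
qed

text \<open>Testing with a tensor whose single nonzero component in the chart \<open>c\<close> is at
  \<open>as\<close> isolates that component of the family.\<close>

lemma weak_limit_imp_wlim:
  assumes lim: "weak_limit A g n T B" and T: "\<And>l. l > 0 \<Longrightarrow> cov_tensor A n (T l)" and B: "cov_tensor A n B"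
    and c: "c \<in> A" and as: "as \<in> multi_indices n"
    and Tc: "\<And>l. l > 0 \<Longrightarrow> continuous_on (cran c) (\<lambda>x. T l c (cinv c x) as)" and Bc: "continuous_on (cran c) (\<lambda>x. B c (cinv c x) as)"
  shows "wlim (cran c) (\<lambda>l x. T l c (cinv c x) as) (\<lambda>x. B c (cinv c x) as)"
  unfolding wlim_def
proof (intro conjI allI impI)
  show "fam (cran c) (\<lambda>l x. T l c (cinv c x) as)" using Tc by (simp add: fam_def)
  show "continuous_on (cran c) (\<lambda>x. B c (cinv c x) as)" by (rule Bc)
  fix F assume F: "testf (cran c) F"
  \<comment> \<open>Division by the volume density, smooth and positive for a Lorentzian metric,
    turns the integral over the manifold into the plain coordinate integral against
    \<open>F\<close>.\<close>
  define F' where "F' x = F x * inverse (vol g c x)" for x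
  have F': "testf (cran c) F'"
    unfolding F'_def
    by (rule testf_mult[OF open_cran[OF c] F smooth_on_inverse[OF open_cran[OF c] smooth_vol[OF c]]])
       (use vol_pos[OF c] in force)
  have F0: "F x = 0" if "x \<notin> cran c" for x using F that by (auto simp: testf_def)
  have int: "(\<integral>p. pairing A n (chart_tensor n c as F') S p \<partial>volume_measure A g) = (\<integral>x. F x * S c (cinv c x) as \<partial>lborel)"
    if S: "cov_tensor A n S" "continuous_on (cran c) (\<lambda>x. S c (cinv c x) as)" for S
  proof -
    have "pairing A n (chart_tensor n c as F') S p = scalar c (\<lambda>x. F' x * S c (cinv c x) as) p" for p
      by (simp add: pairing_chart_tensor[OF c S(1) as] scalar_def cinv_cmap[OF c])
    then have "(\<integral>p. pairing A n (chart_tensor n c as F') S p \<partial>volume_measure A g) = (\<integral>x. F' x * (vol g c x * S c (cinv c x) as) \<partial>lborel)"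
      using integral_scalar_test(1)[OF c F' S(2)] by simp
    also have "(\<lambda>x. F' x * (vol g c x * S c (cinv c x) as)) = (\<lambda>x. F x * S c (cinv c x) as)"
    proof
      fix x
      show "F' x * (vol g c x * S c (cinv c x) as) = F x * S c (cinv c x) as"
        using vol_pos[OF c, of x] F0[of x] by (cases "x \<in> cran c") (simp_all add: F'_def)
    qed
    finally show ?thesis .
  qed
  have "((\<lambda>l. \<integral>p. pairing A n (chart_tensor n c as F') (T l) p \<partial>volume_measure A g) \<longlongrightarrow>
      (\<integral>p. pairing A n (chart_tensor n c as F') B p \<partial>volume_measure A g)) (at_right 0)"
    using lim test_chart_tensor[OF c F', of n as] by (simp add: weak_limit_def)
  moreover have "\<forall>\<^sub>F l in at_right 0. (\<integral>p. pairing A n (chart_tensor n c as F') (T l) p \<partial>volume_measure A g) = (\<integral>x. F x * T l c (cinv c x) as \<partial>lborel)"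
    using eventually_at_right_0_pos by eventually_elim (rule int[OF T Tc])
  ultimately show "((\<lambda>l. \<integral>x. F x * T l c (cinv c x) as \<partial>lborel) \<longlongrightarrow> (\<integral>x. F x * B c (cinv c x) as \<partial>lborel)) (at_right 0)"
    unfolding int[OF B Bc] by (rule Lim_transform_eventually)
qed

end

text \<open>Convergence of components, separately in every chart. The tensor law of
  \<open>T0\<close>, which \<open>pairing\<close> needs in order to be independent of the chart, is
  derived from it.\<close>

locale chart_convergence = lorentzian_manifold A g for A :: "'m::{t2_space, second_countable_topology} chart set" and g +
  fixes T :: "real \<Rightarrow> 'm tensor" and T0 :: "'m tensor"
  assumes T: "\<And>l. l > 0 \<Longrightarrow> cov_tensor A 2 (T l)"
    and conv: "\<And>c a b. c \<in> A \<Longrightarrow> wlim (cran c) (\<lambda>l x. T l c (cinv c x) [a, b]) (\<lambda>x. T0 c (cinv c x) [a, b])"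
begin

lemma cont_T: "c \<in> A \<Longrightarrow> l > 0 \<Longrightarrow> continuous_on (cran c) (\<lambda>x. T l c (cinv c x) [a, b])"
  and cont_T0: "c \<in> A \<Longrightarrow> continuous_on (cran c) (\<lambda>x. T0 c (cinv c x) [a, b])"
  using conv[of c a b] by (auto simp: wlim_def fam_def)

text \<open>A factor with compact support in one chart reduces the integral to coordinates, and the
  smooth volume density is absorbed by \<open>wlim_mult_smooth\<close>.\<close>

lemma volume_convergence:
  assumes c: "c \<in> A" and \<psi>: "smooth_on (cran c) (\<lambda>x. \<psi> (cinv c x))"
    and K: "compact K" "K \<subseteq> cdom c" "\<And>p. p \<notin> K \<Longrightarrow> \<psi> p = 0"
  shows "((\<lambda>l. \<integral>p. \<psi> p * T l c p [a, b] \<partial>volume_measure A g) \<longlongrightarrow> (\<integral>p. \<psi> p * T0 c p [a, b] \<partial>volume_measure A g)) (at_right 0)"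
    and "l > 0 \<Longrightarrow> integrable (volume_measure A g) (\<lambda>p. \<psi> p * T l c p [a, b])"
    and "integrable (volume_measure A g) (\<lambda>p. \<psi> p * T0 c p [a, b])"
proof -
  let ?F = "\<lambda>x. if x \<in> cran c then \<psi> (cinv c x) else 0"
  have F: "testf (cran c) ?F" by (rule testf_pullback[where c = c and K = K and \<psi> = \<psi>, OF c \<psi> K])
  have sc: "(\<lambda>p. \<psi> p * u p) = scalar c (\<lambda>x. ?F x * u (cinv c x))" for u
    using scalar_pullback[where c = c and K = K and \<psi> = \<psi> and u = u, OF c K(2,3)] by (simp add: fun_eq_iff)
  have int: "(\<integral>p. \<psi> p * S c p [a, b] \<partial>volume_measure A g) = (\<integral>x. ?F x * (vol g c x * S c (cinv c x) [a, b]) \<partial>lborel)"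
    "integrable (volume_measure A g) (\<lambda>p. \<psi> p * S c p [a, b])"
    if "continuous_on (cran c) (\<lambda>x. S c (cinv c x) [a, b])" for S
    using integral_scalar_test[OF c F that] by (simp_all only: sc)
  show "l > 0 \<Longrightarrow> integrable (volume_measure A g) (\<lambda>p. \<psi> p * T l c p [a, b])" by (rule int(2)[where S = "T l", OF cont_T[OF c]])
  show "integrable (volume_measure A g) (\<lambda>p. \<psi> p * T0 c p [a, b])" by (rule int(2)[where S = T0, OF cont_T0[OF c]])
  have "wlim (cran c) (\<lambda>l x. vol g c x * T l c (cinv c x) [a, b]) (\<lambda>x. vol g c x * T0 c (cinv c x) [a, b])"
    by (rule wlim_mult_smooth[OF open_cran[OF c] smooth_vol[OF c] conv[OF c]])
  then have "((\<lambda>l. \<integral>x. ?F x * (vol g c x * T l c (cinv c x) [a, b]) \<partial>lborel) \<longlongrightarrow>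
      (\<integral>x. ?F x * (vol g c x * T0 c (cinv c x) [a, b]) \<partial>lborel)) (at_right 0)"
    using F by (simp add: wlim_def)
  moreover have "\<forall>\<^sub>F l in at_right 0. (\<integral>x. ?F x * (vol g c x * T l c (cinv c x) [a, b]) \<partial>lborel) = (\<integral>p. \<psi> p * T l c p [a, b] \<partial>volume_measure A g)"
    using eventually_at_right_0_pos by eventually_elim (rule int(1)[where S = "T _", OF cont_T[OF c], symmetric])
  ultimately show "((\<lambda>l. \<integral>p. \<psi> p * T l c p [a, b] \<partial>volume_measure A g) \<longlongrightarrow> (\<integral>p. \<psi> p * T0 c p [a, b] \<partial>volume_measure A g)) (at_right 0)"
    unfolding int(1)[where S = T0, OF cont_T0[OF c]] by (rule Lim_transform_eventually)
qed

text \<open>The transformation law passes to the limit because weak limits are unique.\<close>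

lemma cov_T0: "cov_tensor A 2 T0"
  unfolding cov_tensor_def
proof (intro ballI)
  fix c c' p as assume c: "c \<in> A" "c' \<in> A" and p: "p \<in> cdom c \<inter> cdom c'" and as2: "as \<in> multi_indices 2"
  obtain i j where as: "as = [i, j]"
    using as2 by (auto simp: multi_indices_def length_Suc_conv numeral_2_eq_2)
  let ?W = "overlap c' c"
  let ?J = "\<lambda>a b q. jacobian c' c q a i * jacobian c' c q b j"
  \<comment> \<open>The defect of the transformation law; it is continuous, so it vanishes once all
    its test integrals over the overlap do.\<close>
  define w where "w x = T0 c' (cinv c' x) [i, j] - (\<Sum>a\<in>UNIV. \<Sum>b\<in>UNIV. ?J a b (cinv c' x) * T0 c (cinv c' x) [a, b])" for x
  have W: "open ?W" by (rule open_overlap[OF c(2,1)])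
  have sJ: "smooth_on ?W (\<lambda>x. ?J a b (cinv c' x))" for a b
    by (intro smooth_on_mult W smooth_jacobian c)
  have cT0: "continuous_on ?W (\<lambda>x. T0 c (cinv c' x) [a, b])" for a b
  proof -
    have "continuous_on ?W (\<lambda>x. cmap c (cinv c' x))"
      using continuous_on_vec_lambda[of ?W "\<lambda>j x. cmap c (cinv c' x) $ j"] smooth_on_continuous[OF smooth_transition[OF c(2,1)]]
      by simp
    from continuous_on_compose2[OF cont_T0[OF c(1), of a b] this]
    have "continuous_on ?W (\<lambda>x. T0 c (cinv c (cmap c (cinv c' x))) [a, b])"
      using transition_image[OF c(2), of c] overlap_sub[of c c'] by blast
    then show ?thesis
      by (rule continuous_on_eq) (simp add: overlap_iff c cinv_cmap)
  qed
  have cw: "continuous_on ?W w"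
    unfolding w_def
    by (intro continuous_on_diff continuous_on_sum continuous_on_mult[OF smooth_on_continuous[OF sJ] cT0]
        continuous_on_subset[OF cont_T0[OF c(2)] overlap_sub])
  have "vol g c' (cmap c' p) * w (cmap c' p) = 0"
  proof (rule test_integral_eq_0[OF W])
    show "continuous_on ?W (\<lambda>x. vol g c' x * w x)"
      by (intro continuous_intros cw continuous_on_subset[OF continuous_vol[OF c(2)] overlap_sub])
    show "cmap c' p \<in> ?W" using p by (intro cmap_overlap) auto
    fix F assume F: "testf ?W F"
    then obtain K where K: "compact K" "K \<subseteq> ?W" "\<And>x. x \<notin> K \<Longrightarrow> F x = 0" "smooth_on UNIV F"
      by (auto simp: testf_def)
    have F': "testf (cran c') F" by (rule testf_mono[OF F overlap_sub])
    have Kc': "K \<subseteq> cran c'" using K(2) overlap_sub by blast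
    let ?K = "cinv c' ` K"
    note KM = compact_chart_support[OF c(2) K(1) Kc']
    have Kc: "?K \<subseteq> cdom c" using K(2) by (auto simp: overlap_iff c)
    define \<psi> where "\<psi> = scalar c' F"
    have \<psi>0: "\<psi> q = 0" if "q \<notin> ?K" for q
      unfolding \<psi>_def by (rule scalar_0[where K = K and F = F, OF c(2) K(3) that])
    have s\<psi>: "smooth_on (cran c') (\<lambda>x. \<psi> (cinv c' x))"
      unfolding \<psi>_def by (rule smooth_scalar[OF c(2,2) F'])
    have s\<psi>J: "smooth_on (cran c) (\<lambda>x. (\<lambda>q. \<psi> q * ?J a b q) (cinv c x))" for a b
      by (rule smooth_on_supported[OF c(2,1) K(1) Kc', where f = "\<lambda>q. \<psi> q * ?J a b q"])
         (auto simp: \<psi>0 intro!: smooth_on_mult[OF W smooth_on_subset[OF s\<psi> overlap_sub] sJ])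
    note v' = volume_convergence[OF c(2) s\<psi> KM(1,3) \<psi>0]
    note v = volume_convergence[OF c(1) s\<psi>J KM(1) Kc]
    have v0: "\<psi> q * ?J a b q = 0" if "q \<notin> ?K" for q a b using \<psi>0[OF that] by simp
    \<comment> \<open>The defect integrated over the manifold, for an arbitrary family
      \<open>S\<close> of components. Its summands converge separately, because
      \<open>\<psi>\<close> and its products with the Jacobian factors are smooth with compact
      support in either chart, and it is zero for each tensor \<open>T l\<close>.\<close>
    let ?d = "\<lambda>S. (\<integral>q. \<psi> q * S c' q [i, j] \<partial>volume_measure A g) - (\<Sum>a\<in>UNIV. \<Sum>b\<in>UNIV. \<integral>q. \<psi> q * ?J a b q * S c q [a, b] \<partial>volume_measure A g)"
    have "((\<lambda>l. ?d (T l)) \<longlongrightarrow> ?d T0) (at_right 0)"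
      by (intro tendsto_diff tendsto_sum v'(1) v(1) v0)
    moreover have "\<forall>\<^sub>F l in at_right 0. ?d (T l) = 0"
      using eventually_at_right_0_pos
    proof eventually_elim
      case (elim l)
      have "?d (T l) = (\<integral>q. \<psi> q * T l c' q [i, j] - (\<Sum>a\<in>UNIV. \<Sum>b\<in>UNIV. \<psi> q * ?J a b q * T l c q [a, b]) \<partial>volume_measure A g)"
        using v'(2)[OF _ elim] v(2)[OF v0 elim] by (simp add: Bochner_Integration.integral_diff Bochner_Integration.integral_sum Bochner_Integration.integrable_sum)
      also have "(\<lambda>q. \<psi> q * T l c' q [i, j] - (\<Sum>a\<in>UNIV. \<Sum>b\<in>UNIV. \<psi> q * ?J a b q * T l c q [a, b])) = (\<lambda>q. 0)"
      proof
        fix q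
        show "\<psi> q * T l c' q [i, j] - (\<Sum>a\<in>UNIV. \<Sum>b\<in>UNIV. \<psi> q * ?J a b q * T l c q [a, b]) = 0"
        proof (cases "q \<in> ?K")
          case True
          then have "q \<in> cdom c" "q \<in> cdom c'" using Kc KM(3) by auto
          from cov_tensor_2[OF T[OF elim] c this, of i j] show ?thesis
            by (simp add: sum_distrib_left mult.assoc)
        qed (simp add: \<psi>0)
      qed
      finally show ?case by simp
    qed
    ultimately have "?d T0 = 0"
      using tendsto_unique[OF trivial_limit_at_right_real _ tendsto_eventually] by blast
    moreover have "?d T0 = (\<integral>x. F x * (vol g c' x * w x) \<partial>lborel)"
    proof -
      have "?d T0 = (\<integral>q. \<psi> q * T0 c' q [i, j] - (\<Sum>a\<in>UNIV. \<Sum>b\<in>UNIV. \<psi> q * ?J a b q * T0 c q [a, b]) \<partial>volume_measure A g)"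
        using v'(3) v(3)[OF v0] by (simp add: Bochner_Integration.integral_diff Bochner_Integration.integral_sum Bochner_Integration.integrable_sum)
      also have "(\<lambda>q. \<psi> q * T0 c' q [i, j] - (\<Sum>a\<in>UNIV. \<Sum>b\<in>UNIV. \<psi> q * ?J a b q * T0 c q [a, b])) = scalar c' (\<lambda>x. F x * w x)"
      proof
        fix q
        show "\<psi> q * T0 c' q [i, j] - (\<Sum>a\<in>UNIV. \<Sum>b\<in>UNIV. \<psi> q * ?J a b q * T0 c q [a, b]) = scalar c' (\<lambda>x. F x * w x) q"
          by (cases "q \<in> cdom c'")
             (simp_all add: \<psi>_def scalar_def w_def cinv_cmap[OF c(2)] right_diff_distrib sum_distrib_left mult.assoc)
      qed
      also have "(\<integral>q. scalar c' (\<lambda>x. F x * w x) q \<partial>volume_measure A g) = (\<integral>x. F x * (vol g c' x * w x) \<partial>lborel)"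
      proof -
        have Fw: "continuous_on UNIV (\<lambda>x. F x * w x)"
          by (rule continuous_zero_extension[OF W compact_imp_closed[OF K(1)] K(2)])
             (use K cw smooth_on_continuous[OF smooth_on_subset[OF K(4)]] in \<open>auto intro!: continuous_intros\<close>)
        have "(\<integral>q. scalar c' (\<lambda>x. F x * w x) q \<partial>volume_measure A g) =
           (\<integral>x. (if x \<in> cran c' then vol g c' x * (F x * w x) else 0) \<partial>lborel)"
          by (rule integral_scalar(1)[OF c(2) continuous_on_subset[OF Fw]]) simp
        also have "(\<lambda>x. if x \<in> cran c' then vol g c' x * (F x * w x) else 0) = (\<lambda>x. F x * (vol g c' x * w x))"
          using K(3) Kc' by (auto simp: fun_eq_iff)
        finally show ?thesis .
      qed
      finally show ?thesis .
    qed
    ultimately show "(\<integral>x. F x * (vol g c' x * w x) \<partial>lborel) = 0" by simp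
  qed
  then have "w (cmap c' p) = 0" using vol_pos[OF c(2), of "cmap c' p"] p by auto
  then have "T0 c' p [i, j] = (\<Sum>a\<in>UNIV. \<Sum>b\<in>UNIV. ?J a b p * T0 c p [a, b])"
    using p by (simp add: w_def cinv_cmap[OF c(2)])
  moreover have "(\<Sum>bs\<in>multi_indices 2. (\<Prod>k<2. jacobian c' c p (bs ! k) (as ! k)) * T0 c p bs) = (\<Sum>a\<in>UNIV. \<Sum>b\<in>UNIV. ?J a b p * T0 c p [a, b])"
    unfolding sum_MI2 as by (simp add: numeral_2_eq_2)
  ultimately show "T0 c' p as = (\<Sum>bs\<in>multi_indices 2. (\<Prod>k<2. jacobian c' c p (bs ! k) (as ! k)) * T0 c p bs)"
    by (simp add: as)
qed

end

context chart_convergence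
begin

text \<open>A partition of unity subordinate to finitely many charts covering the support of the test tensor.\<close>

lemma weak_limit_T0: "weak_limit A g 2 T T0"
  unfolding weak_limit_def
proof (intro allI impI)
  fix f assume f: "test_tensor A 2 f"
  then have con: "con_tensor A 2 f" and sm: "smooth_components A 2 f" and cpt: "compact (tensor_support A 2 f)"
    by (auto simp: test_tensor_def)
  let ?K = "tensor_support A 2 f" and ?V = "volume_measure A g"
  have clK: "closed ?K" by (simp add: tensor_support_def)
  have f0: "f c q [a, b] = 0" if "q \<notin> ?K" "c \<in> A" "q \<in> cdom c" for c q a b
  proof (rule ccontr)
    assume "f c q [a, b] \<noteq> 0"
    moreover have "[a, b] \<in> multi_indices 2" by (simp add: multi_indices_def)
    ultimately have "\<exists>as\<in>multi_indices 2. f c q as \<noteq> 0" by (rule bexI)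
    then have "\<exists>c\<in>A. q \<in> cdom c \<and> (\<exists>as\<in>multi_indices 2. f c q as \<noteq> 0)"
      by (intro bexI[OF _ that(2)] conjI[OF that(3)])
    then have "q \<in> ?K" unfolding tensor_support_def by (intro subsetD[OF closure_subset] CollectI)
    with that(1) show False by simp
  qed
  have "\<forall>p. \<exists>c F. c \<in> A \<and> p \<in> cdom c \<and> testf (cran c) F \<and> (\<forall>x. F x \<ge> 0) \<and> F (cmap c p) > 0"
  proof
    fix p
    obtain c where c: "c \<in> A" "p \<in> cdom c" by (rule chart_at)
    obtain F where "testf (cran c) F" "\<And>x. F x \<ge> 0" "F (cmap c p) > 0"
      using testf_bump[OF open_cran[OF c(1)], of "cmap c p"] c(2) by blast
    with c show "\<exists>c F. c \<in> A \<and> p \<in> cdom c \<and> testf (cran c) F \<and> (\<forall>x. F x \<ge> 0) \<and> F (cmap c p) > 0" by blast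
  qed
  then obtain ch Fn where ch: "\<And>p. ch p \<in> A" "\<And>p. p \<in> cdom (ch p)" and Fn: "\<And>p. testf (cran (ch p)) (Fn p)"
    "\<And>p x. Fn p x \<ge> 0" "\<And>p. Fn p (cmap (ch p) p) > 0" by metis
  define b where "b p = scalar (ch p) (Fn p)" for p
  have b0: "b p q \<ge> 0" for p q using Fn(2) by (simp add: b_def scalar_def)
  have sb: "smooth_on (cran c) (\<lambda>x. b p (cinv c x))" if "c \<in> A" for p c
    unfolding b_def by (rule smooth_scalar[OF ch(1) that Fn(1)])
  define V where "V p = cdom (ch p) \<inter> (\<lambda>q. Fn p (cmap (ch p) q)) -` {0<..}" for p
  have V: "open (V p)" "p \<in> V p" for p
  proof -
    have "continuous_on (cdom (ch p)) (\<lambda>q. Fn p (cmap (ch p) q))"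
      using Fn(1)[of p] continuous_on_compose2[OF smooth_on_continuous continuous_cmap[OF ch(1)], of UNIV "Fn p" p]
      by (auto simp: testf_def)
    then show "open (V p)" unfolding V_def by (rule continuous_open_preimage[OF _ open_cdom[OF ch(1)] open_greaterThan])
    show "p \<in> V p" using ch(2) Fn(3) by (simp add: V_def)
  qed
  have bV: "b p q > 0" if "q \<in> V p" for p q using that by (simp add: V_def b_def scalar_def)
  obtain P where P: "finite P" "?K \<subseteq> (\<Union>p\<in>P. V p)"
    using compactE_image[OF cpt, of ?K V] V by (metis UN_I subsetI)
  define S where "S q = (\<Sum>p\<in>P. b p q)" for q
  have Spos: "S q > 0" if "q \<in> ?K" for q
  proof -
    from that P obtain p where "p \<in> P" "q \<in> V p" by blast
    then show ?thesis unfolding S_def using P(1) b0 bV by (intro sum_pos2[of P p]) auto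
  qed
  have sS: "smooth_on (cran c) (\<lambda>x. S (cinv c x))" if "c \<in> A" for c
    unfolding S_def by (intro smooth_on_sum open_cran that sb)
  \<comment> \<open>The component of \<open>f\<close> cut down to the chart \<open>ch p\<close> by
    the normalised bump \<open>b p / S\<close>. Where \<open>S\<close> may vanish, off the support
    of \<open>f\<close>, the product is zero, so the value of \<open>inverse 0\<close> is
    harmless.\<close>
  define \<psi> where "\<psi> p i j q = b p q * (inverse (S q) * f (ch p) q [i, j])" for p i j q
  have s\<psi>: "smooth_on (cran (ch p)) (\<lambda>x. \<psi> p i j (cinv (ch p) x))" for p i j
  proof (rule smooth_on_local)
    let ?c = "ch p"
    fix x assume x: "x \<in> cran ?c"
    show "\<exists>T. open T \<and> x \<in> T \<and> smooth_on T (\<lambda>x. \<psi> p i j (cinv ?c x))"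
    proof (cases "cinv ?c x \<in> ?K")
      case True
      let ?W = "cran ?c \<inter> (\<lambda>x. S (cinv ?c x)) -` {0<..}"
      have W: "open ?W"
        by (rule continuous_open_preimage[OF smooth_on_continuous[OF sS[OF ch(1)]] open_cran[OF ch(1)] open_greaterThan])
      have fs: "smooth_on (cran ?c) (\<lambda>x. f ?c (cinv ?c x) [i, j])"
        using sm ch(1) by (auto simp: smooth_components_def smooth_in_chart_def multi_indices_def o_def)
      have "smooth_on ?W (\<lambda>x. \<psi> p i j (cinv ?c x))"
        unfolding \<psi>_def
        by (intro smooth_on_mult[OF W] smooth_on_inverse[OF W] smooth_on_subset[OF sb[OF ch(1)]] smooth_on_subset[OF sS[OF ch(1)]]
            smooth_on_subset[OF fs]) auto
      then show ?thesis using W x Spos[OF True] by blast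
    next
      case False
      let ?W = "cmap ?c ` (cdom ?c \<inter> - ?K)"
      have W: "open ?W" using clK by (intro open_cmap_image ch) auto
      have "smooth_on ?W (\<lambda>x. \<psi> p i j (cinv ?c x))"
        by (rule smooth_on_cong[OF W _ smooth_on_const[of _ 0]]) (auto simp: \<psi>_def cinv_cmap ch(1) f0)
      moreover have "x \<in> ?W" using False x cmap_cinv[OF x] cinv_in[OF x]
        by (intro image_eqI[of _ _ "cinv ?c x"]) auto
      ultimately show ?thesis using W by blast
    qed
  qed
  have "\<exists>Kp. compact Kp \<and> Kp \<subseteq> cdom (ch p) \<and> (\<forall>q. q \<notin> Kp \<longrightarrow> b p q = 0)" for p
  proof -
    obtain Kx where Kx: "compact Kx" "Kx \<subseteq> cran (ch p)" "\<And>x. x \<notin> Kx \<Longrightarrow> Fn p x = 0"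
      using Fn(1)[of p] by (auto simp: testf_def)
    have "b p q = 0" if "q \<notin> cinv (ch p) ` Kx" for q
      unfolding b_def by (rule scalar_0[where K = Kx and F = "Fn p", OF ch(1) Kx(3) that])
    then show ?thesis using compact_chart_support[OF ch(1) Kx(1,2)] by blast
  qed
  then obtain Kp where Kp: "\<And>p. compact (Kp p)" "\<And>p. Kp p \<subseteq> cdom (ch p)" "\<And>p q. q \<notin> Kp p \<Longrightarrow> b p q = 0" by metis
  have \<psi>0: "\<psi> p i j q = 0" if "q \<notin> Kp p" for p i j q using Kp(3)[OF that] by (simp add: \<psi>_def)
  note vc = volume_convergence[where \<psi> = "\<psi> p i j" and K = "Kp p" and c = "ch p" for p i j, OF ch(1) s\<psi> Kp(1,2) \<psi>0]
  have pair: "pairing A 2 f X q = (\<Sum>p\<in>P. \<Sum>i\<in>UNIV. \<Sum>j\<in>UNIV. \<psi> p i j q * X (ch p) q [i, j])"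
    if X: "cov_tensor A 2 X" for X q
  proof -
    have part: "(\<Sum>i\<in>UNIV. \<Sum>j\<in>UNIV. \<psi> p i j q * X (ch p) q [i, j]) = b p q * inverse (S q) * pairing A 2 f X q" for p
    proof (cases "b p q = 0")
      case False
      then have q: "q \<in> cdom (ch p)" by (auto simp: b_def scalar_def split: if_splits)
      have "pairing A 2 f X q = (\<Sum>i\<in>UNIV. \<Sum>j\<in>UNIV. f (ch p) q [i, j] * X (ch p) q [i, j])"
        unfolding pairing_in_chart[OF con X ch(1) q] by (rule sum_MI2)
      then show ?thesis by (simp add: \<psi>_def sum_distrib_left mult.assoc)
    qed (simp add: \<psi>_def)
    show ?thesis
    proof (cases "q \<in> ?K")
      case True
      have "(\<Sum>p\<in>P. b p q * inverse (S q) * pairing A 2 f X q) = S q * inverse (S q) * pairing A 2 f X q"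
        by (simp add: S_def sum_distrib_right)
      then show ?thesis using Spos[OF True] by (simp add: part)
    next
      case False
      obtain c where c: "c \<in> A" "q \<in> cdom c" by (rule chart_at)
      have "pairing A 2 f X q = 0"
        unfolding pairing_in_chart[OF con X c] sum_MI2 using f0[OF False c] by simp
      then show ?thesis by (simp add: part)
    qed
  qed
  have int: "(\<integral>q. pairing A 2 f X q \<partial>?V) = (\<Sum>p\<in>P. \<Sum>i\<in>UNIV. \<Sum>j\<in>UNIV. \<integral>q. \<psi> p i j q * X (ch p) q [i, j] \<partial>?V)"
    if X: "cov_tensor A 2 X" and i: "\<And>p i j. integrable ?V (\<lambda>q. \<psi> p i j q * X (ch p) q [i, j])" for X
    unfolding pair[OF X] using i by (simp add: Bochner_Integration.integral_sum Bochner_Integration.integrable_sum)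
  have lim: "((\<lambda>l. \<Sum>p\<in>P. \<Sum>i\<in>UNIV. \<Sum>j\<in>UNIV. \<integral>q. \<psi> p i j q * T l (ch p) q [i, j] \<partial>?V) \<longlongrightarrow>
      (\<Sum>p\<in>P. \<Sum>i\<in>UNIV. \<Sum>j\<in>UNIV. \<integral>q. \<psi> p i j q * T0 (ch p) q [i, j] \<partial>?V)) (at_right 0)"
    by (intro tendsto_sum vc(1))
  have ev: "\<forall>\<^sub>F l in at_right 0. (\<Sum>p\<in>P. \<Sum>i\<in>UNIV. \<Sum>j\<in>UNIV. \<integral>q. \<psi> p i j q * T l (ch p) q [i, j] \<partial>?V) = (\<integral>q. pairing A 2 f (T l) q \<partial>?V)"
    using eventually_at_right_0_pos by eventually_elim (rule int[OF T vc(2), symmetric])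
  have int0: "(\<integral>q. pairing A 2 f T0 q \<partial>?V) = (\<Sum>p\<in>P. \<Sum>i\<in>UNIV. \<Sum>j\<in>UNIV. \<integral>q. \<psi> p i j q * T0 (ch p) q [i, j] \<partial>?V)"
    by (rule int[OF cov_T0 vc(3)])
  show "((\<lambda>l. \<integral>q. pairing A 2 f (T l) q \<partial>?V) \<longlongrightarrow> (\<integral>q. pairing A 2 f T0 q \<partial>?V)) (at_right 0)"
    unfolding int0 by (rule Lim_transform_eventually[OF lim ev])
qed

text \<open>On the compact support of the test function the background value of the form at
  \<open>v\<close> is bounded away from zero, so uniform convergence makes \<open>v\<close> timelike
  for all nearby metrics at once. The integrals are then nonnegative, and so is their limit.\<close>

lemma weak_energy_T0:
  assumes wec: "\<And>l. l > 0 \<Longrightarrow> weak_energy_condition A (G l) (T l)"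
    and null: "\<And>c a b. c \<in> A \<Longrightarrow> null_fam (cran c) (\<lambda>l x. G l c (cinv c x) [a, b] - g c (cinv c x) [a, b])"
  shows "weak_energy_condition A g T0"
  unfolding weak_energy_condition_def
proof (intro ballI allI impI)
  fix c p v assume c: "c \<in> A" and p: "p \<in> cdom c" and tl: "timelike g c p v"
  let ?q = "\<lambda>X x. bilin X c (cinv c x) v v"
  have contg: "continuous_on (cran c) (?q g)"
    unfolding bilin_def
    by (intro continuous_intros smooth_on_continuous smooth_component_cov[OF lorentzian_smooth[OF lor] c]) simp
  have wT: "wlim (cran c) (\<lambda>l. ?q (T l)) (?q T0)"
  proof -
    have "wlim (cran c) (\<lambda>l x. \<Sum>a\<in>UNIV. \<Sum>b\<in>UNIV. (v $ a * v $ b) * T l c (cinv c x) [a, b])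
       (\<lambda>x. \<Sum>a\<in>UNIV. \<Sum>b\<in>UNIV. (v $ a * v $ b) * T0 c (cinv c x) [a, b])"
      by (intro wlim_sum wlim_cmult open_cran conv c)
    then show ?thesis by (simp add: bilin_def mult_ac)
  qed
  have nG: "null_fam (cran c) (\<lambda>l x. ?q (G l) x - ?q g x)"
  proof -
    have "null_fam (cran c) (\<lambda>l x. \<Sum>a\<in>UNIV. \<Sum>b\<in>UNIV. (v $ a * v $ b) * (G l c (cinv c x) [a, b] - g c (cinv c x) [a, b]))"
      by (intro null_fam_sum null_fam_cmult null c)
    then show ?thesis
      by (rule null_fam_cong[rotated]) (simp add: bilin_def algebra_simps sum_subtractf)
  qed
  define V where "V = cran c \<inter> ?q g -` {..<0}"
  have V: "open V" unfolding V_def by (rule continuous_open_preimage[OF contg open_cran[OF c] open_lessThan])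
  have pV: "cmap c p \<in> V" using p tl by (simp add: V_def timelike_def cinv_cmap[OF c])
  have VU: "V \<subseteq> cran c" by (auto simp: V_def)
  have "?q T0 (cmap c p) \<ge> 0"
  proof (rule test_integral_nonneg[OF V _ _ pV])
    show "continuous_on V (?q T0)" using wT VU by (auto simp: wlim_def intro: continuous_on_subset)
    fix F assume F: "testf V F" and F0: "\<And>x. F x \<ge> 0"
    obtain K where K: "compact K" "K \<subseteq> V" "\<And>x. x \<notin> K \<Longrightarrow> F x = 0" using F by (auto simp: testf_def)
    have KU: "K \<subseteq> cran c" using K(2) VU by blast
    \<comment> \<open>Minus the maximum of the form over \<open>K\<close>; for empty
      \<open>K\<close> any positive number serves. A deviation of at most \<open>d / 2\<close>
      preserves the sign.\<close>
    obtain d where d: "d > 0" "\<And>x. x \<in> K \<Longrightarrow> ?q g x \<le> - d"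
    proof (cases "K = {}")
      case False
      obtain x0 where x0: "x0 \<in> K" "\<And>x. x \<in> K \<Longrightarrow> ?q g x \<le> ?q g x0"
        using continuous_attains_sup[OF K(1) False continuous_on_subset[OF contg KU]] by blast
      have "?q g x0 < 0" using x0(1) K(2) by (auto simp: V_def)
      then show ?thesis using x0(2) that[of "- ?q g x0"] by simp
    qed (use that[of 1] in simp)
    have "\<forall>\<^sub>F l in at_right 0. \<forall>x\<in>K. \<bar>?q (G l) x - ?q g x\<bar> \<le> d / 2"
      by (rule null_famD[OF nG K(1) KU]) (use d(1) in simp)
    with eventually_at_right_0_pos have ev: "\<forall>\<^sub>F l in at_right 0. (\<integral>x. F x * ?q (T l) x \<partial>lborel) \<ge> 0"
    proof eventually_elim
      case (elim l)
      have "F x * ?q (T l) x \<ge> 0" for x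
      proof (cases "x \<in> K")
        case True
        have "\<bar>?q (G l) x - ?q g x\<bar> \<le> d / 2" using elim(2) True by blast
        then have "?q (G l) x < 0" using d(1) d(2)[OF True] by linarith
        then have "?q (T l) x \<ge> 0"
          using wec[OF elim(1)] c True KU cinv_in[of x c] by (auto simp: weak_energy_condition_def timelike_def)
        then show ?thesis using F0[of x] by simp
      qed (simp add: K(3))
      then show ?case by (intro integral_nonneg_AE) simp
    qed
    have "((\<lambda>l. \<integral>x. F x * ?q (T l) x \<partial>lborel) \<longlongrightarrow> (\<integral>x. F x * ?q T0 x \<partial>lborel)) (at_right 0)"
      using wT testf_mono[OF F VU] by (simp add: wlim_def)
    then show "(\<integral>x. F x * ?q T0 x \<partial>lborel) \<ge> 0"
      using ev trivial_limit_at_right_real by (rule tendsto_lowerbound)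
  qed
  then show "bilin T0 c p v v \<ge> 0" by (simp add: cinv_cmap[OF c p])
qed

end

subsection \<open>Sequences of metrics with small amplitude and bounded gradient\<close>

lemma contract2_eq_ct2: "contract2 g c p F = ct2 (\<lambda>a b. inv_metric g c p a b) F"
  by (simp add: contract2_def ct2_def)

lemma contract3_eq_ct3: "contract3 g c p F = ct3 (\<lambda>a b. inv_metric g c p a b) F"
  by (simp add: contract3_def ct3_def)

locale metric_sequence = manifold A for A :: "'m::{t2_space, second_countable_topology} chart set" +
  fixes g :: "real \<Rightarrow> 'm tensor" and e \<mu> :: "'m tensor" and C1 C2 :: "'m \<Rightarrow> real"
  assumes e: "riemannian_metric A e"
    and lorentzian: "\<And>l. l \<ge> 0 \<Longrightarrow> lorentzian_metric A (g l)"
    and C1: "smooth_function A C1"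
    and h_bound: "\<And>l c p. l > 0 \<Longrightarrow> c \<in> A \<Longrightarrow> p \<in> cdom c \<Longrightarrow> tensor_norm e 2 (perturbation g l) c p \<le> l * C1 p"
    and C2: "smooth_function A C2"
    and grad_h_bound: "\<And>l c p. l > 0 \<Longrightarrow> c \<in> A \<Longrightarrow> p \<in> cdom c \<Longrightarrow>
          tensor_norm e 3 (cov_deriv (g 0) (perturbation g l)) c p \<le> C2 p"
    and \<mu>: "smooth_cov_tensor A 6 \<mu>"
    and \<mu>_limit: "weak_limit A (g 0) 6 (\<lambda>l. grad_product (g 0) (perturbation g l)) \<mu>"
begin

sublocale lorentzian_manifold A "g 0"
  by unfold_locales (simp add: lorentzian)

section \<open>The assumptions of the theorem in the components of one chart\<close>

abbreviation gc where "gc c l a b x \<equiv> g l c (cinv c x) [a, b]"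
abbreviation hc where "hc c l a b x \<equiv> inv_metric (g l) c (cinv c x) a b"

lemma smooth_gc: "l \<ge> 0 \<Longrightarrow> c \<in> A \<Longrightarrow> smooth_on (cran c) (gc c l a b)"
  by (rule smooth_component_cov[OF lorentzian_smooth[OF lorentzian]]) simp_all

lemma det_g: "l \<ge> 0 \<Longrightarrow> c \<in> A \<Longrightarrow> p \<in> cdom c \<Longrightarrow> det (metric_matrix (g l) c p) \<noteq> 0"
proof -
  assume "l \<ge> 0" "c \<in> A" "p \<in> cdom c"
  from lorentzian_det[OF lorentzian[OF this(1)] this(2,3)] show ?thesis by simp
qed

lemma smooth_hc: "l \<ge> 0 \<Longrightarrow> c \<in> A \<Longrightarrow> smooth_on (cran c) (hc c l a b)"
  by (rule smooth_inv_metric[OF lorentzian_smooth[OF lorentzian]]) (simp_all add: det_g)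

lemma sym_gc: "l \<ge> 0 \<Longrightarrow> c \<in> A \<Longrightarrow> x \<in> cran c \<Longrightarrow> gc c l a b x = gc c l b a x"
proof -
  assume l: "l \<ge> 0" and c: "c \<in> A" and x: "x \<in> cran c"
  show ?thesis by (rule lorentzian_sym[OF lorentzian[OF l] c cinv_in[OF x]])
qed

lemma component_bound:
  assumes "c \<in> A" "x \<in> cran c" "as \<in> multi_indices n"
  shows "\<bar>T c (cinv c x) as\<bar> \<le> sqrt (\<Prod>k<n. e c (cinv c x) [as ! k, as ! k]) * tensor_norm e n T c (cinv c x)"
proof (rule tensor_component_bound[OF _ _ assms(3)])
  have p: "cinv c x \<in> cdom c" by (rule cinv_in[OF assms(2)])
  show "e c (cinv c x) [a, b] = e c (cinv c x) [b, a]" for a b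
    using e p assms(1) unfolding riemannian_metric_def smooth_symmetric_def by blast
  show "bilin e c (cinv c x) v v > 0" if "v \<noteq> 0" for v
    using e p assms(1) that unfolding riemannian_metric_def by blast
qed

lemma continuous_frame:
  assumes "c \<in> A" shows "continuous_on (cran c) (\<lambda>x. sqrt (\<Prod>k<n. e c (cinv c x) [as ! k, as ! k]))"
proof -
  have e2: "smooth_cov_tensor A 2 e" using e by (simp add: riemannian_metric_def smooth_symmetric_def)
  have "continuous_on (cran c) (\<lambda>x. e c (cinv c x) [i, i])" for i
    by (intro smooth_on_continuous smooth_component_cov[OF e2 assms]) simp
  then show ?thesis by (intro continuous_intros)
qed

lemma continuous_function: "smooth_function A C \<Longrightarrow> c \<in> A \<Longrightarrow> continuous_on (cran c) (\<lambda>x. C (cinv c x))"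
  by (auto simp: smooth_function_def smooth_in_chart_def o_def intro: smooth_on_continuous)

lemma frame_nonneg: "c \<in> A \<Longrightarrow> x \<in> cran c \<Longrightarrow> sqrt (\<Prod>k<n. e c (cinv c x) [as ! k, as ! k]) \<ge> 0"
proof -
  assume c: "c \<in> A" and x: "x \<in> cran c"
  have "e c (cinv c x) [i, i] \<ge> 0" for i
  proof -
    have "bilin e c (cinv c x) (axis i 1) (axis i 1) > 0"
      using e c cinv_in[OF x] by (simp add: riemannian_metric_def)
    moreover have "bilin e c (cinv c x) (axis i 1) (axis i 1) = e c (cinv c x) [i, i]"
      by (simp add: bilin_def axis_def mult_delta)
    ultimately show ?thesis by simp
  qed
  then show ?thesis by (simp add: prod_nonneg)
qed

lemma null_h: assumes c: "c \<in> A" shows "null_fam (cran c) (\<lambda>l x. gc c l a b x - gc c 0 a b x)"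
proof (rule null_fam_linear_bound)
  show "fam (cran c) (\<lambda>l x. gc c l a b x - gc c 0 a b x)"
    unfolding fam_def by (intro allI impI continuous_on_diff smooth_on_continuous smooth_gc c) simp_all
  let ?E = "\<lambda>x. sqrt (\<Prod>k<2. e c (cinv c x) [[a, b] ! k, [a, b] ! k])"
  show "continuous_on (cran c) (\<lambda>x. ?E x * C1 (cinv c x))"
    by (intro continuous_on_mult continuous_frame continuous_function c C1)
  fix l :: real and x assume l: "l > 0" and x: "x \<in> cran c"
  have "\<bar>gc c l a b x - gc c 0 a b x\<bar> = \<bar>perturbation g l c (cinv c x) [a, b]\<bar>" by (simp add: perturbation_def)
  also have "\<dots> \<le> ?E x * tensor_norm e 2 (perturbation g l) c (cinv c x)"
    by (rule component_bound[OF c x]) (simp add: multi_indices_def)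
  also have "\<dots> \<le> ?E x * (l * C1 (cinv c x))"
    by (intro mult_left_mono h_bound l c cinv_in x frame_nonneg)
  finally show "\<bar>gc c l a b x - gc c 0 a b x\<bar> \<le> l * (?E x * C1 (cinv c x))" by (simp add: mult_ac)
qed

lemma smooth_perturbation: "l > 0 \<Longrightarrow> smooth_cov_tensor A 2 (perturbation g l)"
proof -
  assume l: "l > 0"
  have g: "smooth_cov_tensor A 2 (g l)" "smooth_cov_tensor A 2 (g 0)"
    using lorentzian_smooth[OF lorentzian] l by auto
  have "cov_tensor A 2 (perturbation g l)"
    unfolding cov_tensor_def
  proof (intro ballI)
    fix c c' p as assume *: "c \<in> A" "c' \<in> A" "p \<in> cdom c \<inter> cdom c'" "as \<in> multi_indices 2"
    have eq: "g k c' p as = (\<Sum>bs\<in>multi_indices 2. (\<Prod>k<2. jacobian c' c p (bs ! k) (as ! k)) * g k c p bs)" if "k = l \<or> k = 0" for k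
      using g * that unfolding smooth_cov_tensor_def cov_tensor_def by blast
    show "perturbation g l c' p as = (\<Sum>bs\<in>multi_indices 2. (\<Prod>k<2. jacobian c' c p (bs ! k) (as ! k)) * perturbation g l c p bs)"
      unfolding perturbation_def eq[OF disjI1[OF refl]] eq[OF disjI2[OF refl]]
      by (simp only: right_diff_distrib sum_subtractf)
  qed
  moreover have "smooth_components A 2 (perturbation g l)"
    unfolding smooth_components_def smooth_in_chart_def o_def perturbation_def
    by (intro ballI smooth_on_diff open_cran smooth_component_cov[OF g(1)] smooth_component_cov[OF g(2)])
       (simp_all add: multi_indices_def)
  ultimately show ?thesis by (simp add: smooth_cov_tensor_def)
qed

text \<open>The coordinate and the covariant derivative of \<open>h\<close> differ by terms of the order of \<open>h\<close>.\<close>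

abbreviation Dc where "Dc c l i j k x \<equiv> partial i (gc c l j k) x - partial i (gc c 0 j k) x"
abbreviation Nc where "Nc c l i j k x \<equiv> cov_deriv (g 0) (perturbation g l) c (cinv c x) [i, j, k]"

lemma cont_christoffel: "c \<in> A \<Longrightarrow> continuous_on (cran c) (\<lambda>x. christoffel (g 0) c k i j (cinv c x))"
proof -
  assume c: "c \<in> A"
  have "smooth_on (cran c) (lchr (gc c 0) (hc c 0) k i j)"
    by (intro smooth_lchr open_cran c smooth_gc smooth_hc) simp_all
  then have "continuous_on (cran c) (lchr (gc c 0) (hc c 0) k i j)" by (rule smooth_on_continuous)
  then show ?thesis by (rule continuous_on_eq) (simp add: christoffel_cinv)
qed

lemma null_D_N: assumes c: "c \<in> A" shows "null_fam (cran c) (\<lambda>l x. Dc c l i j k x - Nc c l i j k x)"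
proof -
  let ?C = "\<lambda>d i j x. christoffel (g 0) c d i j (cinv c x)" and ?h = "\<lambda>l a b x. gc c l a b x - gc c 0 a b x"
  have "null_fam (cran c) (\<lambda>l x. (\<Sum>d\<in>UNIV. ?C d i j x * ?h l d k x) + (\<Sum>d\<in>UNIV. ?C d i k x * ?h l j d x))"
    by (intro null_fam_add null_fam_sum null_fam_bdd_mult bdd_fam_const cont_christoffel null_h c)
  then show ?thesis
  proof (rule null_fam_cong[rotated])
    fix l :: real and x assume l: "l > 0" and x: "x \<in> cran c"
    have "coord_deriv c i (\<lambda>q. perturbation g l c q [j, k]) (cinv c x) = partial i (\<lambda>x. gc c l j k x - gc c 0 j k x) x"
      by (simp add: coord_deriv_cinv[OF x] perturbation_def)
    also have "\<dots> = Dc c l i j k x"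
      using l c x by (intro partial_diff smooth_on_differentiable[OF open_cran[OF c]] smooth_gc) auto
    finally show "(\<Sum>d\<in>UNIV. ?C d i j x * ?h l d k x) + (\<Sum>d\<in>UNIV. ?C d i k x * ?h l j d x) = Dc c l i j k x - Nc c l i j k x"
      by (simp add: cov_deriv_2 perturbation_def)
  qed
qed

lemma fam_D: "c \<in> A \<Longrightarrow> fam (cran c) (\<lambda>l x. Dc c l i j k x)"
  unfolding fam_def by (intro allI impI continuous_on_diff smooth_on_continuous smooth_on_partial smooth_gc) simp_all

lemma fam_N: assumes c: "c \<in> A" shows "fam (cran c) (\<lambda>l x. Nc c l i j k x)"
proof -
  have "fam (cran c) (\<lambda>l x. Dc c l i j k x - Nc c l i j k x)"
    using null_D_N[OF c, where i = i and j = j and k = k] by (simp add: null_fam_def)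
  from fam_diff[OF fam_D[OF c, where i = i and j = j and k = k] this] show ?thesis by simp
qed

lemma bdd_N: assumes c: "c \<in> A" shows "bdd_fam (cran c) (\<lambda>l x. Nc c l i j k x)"
proof (rule bdd_fam_bound[OF fam_N[OF c]])
  let ?E = "\<lambda>x. sqrt (\<Prod>m<3. e c (cinv c x) [[i, j, k] ! m, [i, j, k] ! m])"
  show "continuous_on (cran c) (\<lambda>x. ?E x * C2 (cinv c x))"
    by (intro continuous_on_mult continuous_frame continuous_function c C2)
  fix l :: real and x assume l: "l > 0" and x: "x \<in> cran c"
  have "\<bar>Nc c l i j k x\<bar> \<le> ?E x * tensor_norm e 3 (cov_deriv (g 0) (perturbation g l)) c (cinv c x)"
    by (rule component_bound[OF c x]) (simp add: multi_indices_def)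
  also have "\<dots> \<le> ?E x * C2 (cinv c x)"
    by (intro mult_left_mono grad_h_bound l c cinv_in x frame_nonneg)
  finally show "\<bar>Nc c l i j k x\<bar> \<le> ?E x * C2 (cinv c x)" .
qed

lemma bdd_D: "c \<in> A \<Longrightarrow> bdd_fam (cran c) (\<lambda>l x. Dc c l i j k x)"
  using bdd_fam_add[OF null_fam_imp_bdd[OF null_D_N[where i = i and j = j and k = k]] bdd_N[where i = i and j = j and k = k], of c] by simp

text \<open>The assumption on \<open>\<mu>\<close> concerns covariant derivatives. Exchanging the
  factors one at a time for coordinate derivatives costs a null family times a bounded one.\<close>

lemma wlim_DD:
  assumes c: "c \<in> A"
  shows "wlim (cran c) (\<lambda>l x. Dc c l i k m x * Dc c l j n r x) (\<lambda>x. \<mu> c (cinv c x) [i, j, k, m, n, r])"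
proof (rule wlim_null_cong)
  have as: "[i, j, k, m, n, r] \<in> multi_indices 6" by (simp add: multi_indices_def)
  have gp: "grad_product (g 0) (perturbation g l) c (cinv c x) [i, j, k, m, n, r] = Nc c l i k m x * Nc c l j n r x" for l x
    by (simp add: grad_product_def eval_nat_numeral)
  have "wlim (cran c) (\<lambda>l x. grad_product (g 0) (perturbation g l) c (cinv c x) [i, j, k, m, n, r]) (\<lambda>x. \<mu> c (cinv c x) [i, j, k, m, n, r])"
  proof (rule weak_limit_imp_wlim[OF \<mu>_limit _ _ c as])
    show "cov_tensor A 6 (grad_product (g 0) (perturbation g l))" if "l > 0" for l
      by (rule grad_product_tensor[OF lorentzian_smooth[OF lor] lorentzian_sym[OF lor] det_g smooth_perturbation[OF that]]) simp_all
    show "cov_tensor A 6 \<mu>" using \<mu> by (simp add: smooth_cov_tensor_def)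
    show "continuous_on (cran c) (\<lambda>x. grad_product (g 0) (perturbation g l) c (cinv c x) [i, j, k, m, n, r])" if "l > 0" for l
      unfolding gp using fam_N[OF c] that by (intro continuous_on_mult) (simp_all add: fam_def)
    show "continuous_on (cran c) (\<lambda>x. \<mu> c (cinv c x) [i, j, k, m, n, r])"
      by (intro smooth_on_continuous smooth_component_cov[OF \<mu> c]) simp
  qed
  then show "wlim (cran c) (\<lambda>l x. Nc c l i k m x * Nc c l j n r x) (\<lambda>x. \<mu> c (cinv c x) [i, j, k, m, n, r])"
    unfolding gp .
  have "null_fam (cran c) (\<lambda>l x. (Dc c l i k m x - Nc c l i k m x) * Dc c l j n r x + Nc c l i k m x * (Dc c l j n r x - Nc c l j n r x))"
    by (intro null_fam_add null_fam_mult_bdd[OF null_D_N bdd_D] null_fam_bdd_mult[OF bdd_N null_D_N] c)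
  then show "null_fam (cran c) (\<lambda>l x. Dc c l i k m x * Dc c l j n r x - Nc c l i k m x * Nc c l j n r x)"
    by (rule null_fam_cong[rotated]) (simp add: algebra_simps)
qed

lemma metric_family:
  assumes c: "c \<in> A"
  shows "metric_family (cran c) (gc c) (hc c) (\<lambda>i j k m n r x. \<mu> c (cinv c x) [i, j, k, m, n, r])"
proof
  fix l :: real and a b d :: 4 and x assume l: "l \<ge> 0" and x: "x \<in> cran c"
  show "gc c l a b x = gc c l b a x" by (rule sym_gc[OF l c x])
  show "hc c l a b x = hc c l b a x"
    by (rule inv_metric_sym[OF det_g[OF l c cinv_in[OF x]] lorentzian_sym[OF lorentzian[OF l] c cinv_in[OF x]]])
  show "(\<Sum>b\<in>UNIV. gc c l a b x * hc c l b d x) = (if a = d then 1 else 0)"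
    by (rule invertible_metric_matrix(1)[OF det_g[OF l c cinv_in[OF x]]])
qed (intro open_cran smooth_gc smooth_hc null_h bdd_D wlim_DD c; assumption)+

text \<open>The limit equation solved for the stress tensor: the equation in the theorem then holds
  by construction, and the content lies in the convergence.\<close>

definition T0 :: "real \<Rightarrow> 'm tensor" where
  "T0 \<Lambda> c p as = (einstein (g 0) c p (as ! 0) (as ! 1) + \<Lambda> * g 0 c p [as ! 0, as ! 1]) / (8 * pi)
     - effective_stress (g 0) \<mu> c p as"

lemma wlim_stress:
  assumes c: "c \<in> A"
    and einstein_eq: "\<And>l c p a b. l > 0 \<Longrightarrow> c \<in> A \<Longrightarrow> p \<in> cdom c \<Longrightarrow>
          einstein (g l) c p a b + \<Lambda> * g l c p [a, b] = 8 * pi * T l c p [a, b]"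
  shows "wlim (cran c) (\<lambda>l x. T l c (cinv c x) [a, b]) (\<lambda>x. T0 \<Lambda> c (cinv c x) [a, b])"
proof -
  interpret M: metric_family "cran c" "gc c" "hc c" "\<lambda>i j k m n r x. \<mu> c (cinv c x) [i, j, k, m, n, r]"
    by (rule metric_family[OF c])
  have wg: "wlim (cran c) (\<lambda>l x. gc c l a b x) (gc c 0 a b)"
    by (rule wlim_null_cong[OF wlim_const null_h[OF c]]) (intro smooth_on_continuous smooth_gc c, simp)
  have "wlim (cran c) (\<lambda>l x. (1 / (8 * pi)) * (M.Ein l a b x + \<Lambda> * gc c l a b x))
     (\<lambda>x. (1 / (8 * pi)) * ((M.Ein 0 a b x - M.leff a b x) + \<Lambda> * gc c 0 a b x))"
    by (intro wlim_cmult wlim_add M.wlim_Ein wg open_cran c)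
  then show ?thesis
  proof (rule wlim_cong[rotated 2])
    fix l :: real and x assume l: "l > 0" and x: "x \<in> cran c"
    show "(1 / (8 * pi)) * (M.Ein l a b x + \<Lambda> * gc c l a b x) = T l c (cinv c x) [a, b]"
      using einstein_eq[OF l c cinv_in[OF x], of a b] by (simp add: einstein_cinv[OF c x])
  next
    fix x assume x: "x \<in> cran c"
    have "M.leff a b x = 8 * pi * effective_stress (g 0) \<mu> c (cinv c x) [a, b]"
      unfolding M.leff_def effective_stress_def Let_def contract2_eq_ct2 contract3_eq_ct3 by simp
    then show "(1 / (8 * pi)) * ((M.Ein 0 a b x - M.leff a b x) + \<Lambda> * gc c 0 a b x) = T0 \<Lambda> c (cinv c x) [a, b]"
      by (simp add: T0_def einstein_cinv[OF c x] field_simps)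
  qed
qed

lemma smooth_T0: "smooth_components A 2 (T0 \<Lambda>)"
  unfolding smooth_components_def smooth_in_chart_def o_def
proof (intro ballI)
  fix c as assume c: "c \<in> A"
  have m: "smooth_on (cran c) (\<lambda>x. \<mu> c (cinv c x) [i, j, k, m, n, r])" for i j k m n r
    by (intro smooth_component_cov[OF \<mu> c]) simp
  have U: "open (cran c)" by (rule open_cran[OF c])
  have g0: "smooth_on (cran c) (gc c 0 i j)" and h0: "smooth_on (cran c) (hc c 0 i j)" for i j
    by (intro smooth_gc smooth_hc c, simp)+
  have E: "smooth_on (cran c) (\<lambda>x. einstein (g 0) c (cinv c x) i j)" for i j
    by (rule smooth_on_cong[OF U _ smooth_leinstein[OF U g0 h0]]) (simp add: einstein_cinv[OF c])
  have "smooth_on (cran c) (\<lambda>x. effective_stress (g 0) \<mu> c (cinv c x) as)"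
    unfolding effective_stress_def Let_def contract2_def contract3_def
    by (intro smooth_rules U m g0 h0)
  then show "smooth_on (cran c) (\<lambda>x. T0 \<Lambda> c (cinv c x) as)"
    unfolding T0_def divide_inverse by (intro smooth_rules U E g0)
qed

end

theorem mainTheorem3:
  fixes A :: "'m::{t2_space, second_countable_topology} chart set"
    and g T :: "real \<Rightarrow> 'm tensor"
    and e \<mu> :: "'m tensor"
    and \<Lambda> :: real
    and C1 C2 :: "'m \<Rightarrow> real"
  assumes atlas: "smooth_atlas A"
    and e: "riemannian_metric A e"
    and g: "\<And>l. l \<ge> 0 \<Longrightarrow> lorentzian_metric A (g l)"
    and T: "\<And>l. l > 0 \<Longrightarrow> cov_tensor A 2 (T l)"
    and einstein_eq: "\<And>l c p a b. l > 0 \<Longrightarrow> c \<in> A \<Longrightarrow> p \<in> cdom c \<Longrightarrow>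
          einstein (g l) c p a b + \<Lambda> * g l c p [a, b] = 8 * pi * T l c p [a, b]"
    and wec: "\<And>l. l > 0 \<Longrightarrow> weak_energy_condition A (g l) (T l)"
    and C1: "smooth_function A C1" "\<And>p. C1 p > 0"
    and h_bound: "\<And>l c p. l > 0 \<Longrightarrow> c \<in> A \<Longrightarrow> p \<in> cdom c \<Longrightarrow>
          tensor_norm e 2 (perturbation g l) c p \<le> l * C1 p"
    and C2: "smooth_function A C2" "\<And>p. C2 p > 0"
    and grad_h_bound: "\<And>l c p. l > 0 \<Longrightarrow> c \<in> A \<Longrightarrow> p \<in> cdom c \<Longrightarrow>
          tensor_norm e 3 (cov_deriv (g 0) (perturbation g l)) c p \<le> C2 p"
    and \<mu>: "smooth_cov_tensor A 6 \<mu>"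
    and \<mu>_limit: "weak_limit A (g 0) 6 (\<lambda>l. grad_product (g 0) (perturbation g l)) \<mu>"
  shows "\<exists>T0. smooth_cov_tensor A 2 T0 \<and> weak_limit A (g 0) 2 T T0 \<and>
           weak_energy_condition A (g 0) T0 \<and>
           (\<forall>c\<in>A. \<forall>p\<in>cdom c. \<forall>a b.
              einstein (g 0) c p a b + \<Lambda> * g 0 c p [a, b] =
                8 * pi * T0 c p [a, b] + 8 * pi * effective_stress (g 0) \<mu> c p [a, b])"
proof -
  interpret M: metric_sequence A g e \<mu> C1 C2
    by unfold_locales (fact atlas e g C1(1) h_bound C2(1) grad_h_bound \<mu> \<mu>_limit)+
  interpret C: chart_convergence A "g 0" T "M.T0 \<Lambda>"
    by unfold_locales (auto intro: T M.wlim_stress einstein_eq)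
  show ?thesis
  proof (intro exI conjI ballI allI)
    show "smooth_cov_tensor A 2 (M.T0 \<Lambda>)"
      using C.cov_T0 M.smooth_T0 by (simp add: smooth_cov_tensor_def)
    show "weak_limit A (g 0) 2 T (M.T0 \<Lambda>)" by (rule C.weak_limit_T0)
    show "weak_energy_condition A (g 0) (M.T0 \<Lambda>)" by (rule C.weak_energy_T0[OF wec M.null_h])
    show "einstein (g 0) c p a b + \<Lambda> * g 0 c p [a, b] =
        8 * pi * M.T0 \<Lambda> c p [a, b] + 8 * pi * effective_stress (g 0) \<mu> c p [a, b]" for c p a b
      by (simp add: M.T0_def field_simps)
  qed
qed

end
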